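(* Let $A$ be an $A_\infty$-algebra over $\boldsymbol{k}$ and let $C$ be an $A_\infty$-bimodule over $A$. Then $C$ has a homotopy inner product if and only if there exists an $A_\infty$-bimodule homomorphism $\phi: C\to C^*$ over $A$ satisfying the following two conditions. (Skew symmetry) For all $k,l\ge 0$ and all homogeneous $\vec a=(a_1,\dots,a_k)\in A^k$, $\vec b=(b_1,\dots,b_l)\in A^l$, $v,w\in C$, $$\phi_{k,l}(\vec a,v,\vec b)(w)=-(-1)^{K}\,\phi_{l,k}(\vec b,w,\vec a)(v),\qquad K=\Big(\sum_i|a_i|'+|v|'\Big)\Big(\sum_j|b_j|'+|w|'\Big).$$ (Homological non-degeneracy) For every non-zero class $[a]\in H^*(C)$, with $a\in C$, there exists a class $[b]\in H^*(C)$, with $b\in C$, such that $\phi_{0,0}(a)(b)\neq 0$.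
   Context: $\boldsymbol{k}$ is a field of characteristic $0$. For a $\mathbb{Z}$-graded space $A$, $|x|'=|x|-1$ is the degree in $A[1]$. An $A_\infty$-algebra $(A,\{m_n\}_{n\ge1})$ is a $\mathbb{Z}$-graded $\boldsymbol{k}$-vector space with multilinear maps $m_n:A[1]^{\otimes n}\to A[1]$ of degree one such that for all $k\ge 1$ $$\sum_{k_1+k_2=k+1}\sum_{i=1}^{k_1}(-1)^{|x_1|'+\cdots+|x_{i-1}|'}m_{k_1}(x_1,\dots,x_{i-1},m_{k_2}(x_i,\dots,x_{i+k_2-1}),\dots,x_k)=0$$ (no $m_0$). Put $BA=\bigoplus_{i\ge 0}A[1]^{\otimes i}$. An $A_\infty$-bimodule over $A$ is a graded space $M$ (degrees of its elements are denoted $|v|'$) with degree one maps $b_{k,l}:A[1]^{\otimes k}\otimes M\otimes A[1]^{\otimes l}\to M$, $k,l\ge0$, such that $\widehat b\circ\widehat b=0$, where $\widehat b:BA\otimes M\otimes BA\to BA\otimes M\otimes BA$ is the sum of all ways of applying some $m_n$ to consecutive $A$-factors lying on one side of the $M$-factor, or some $b_{p,q}$ to consecutive factors including the $M$-factor, with the Koszul sign $(-1)^{s}$, $s$ being the sum of degrees $|\cdot|'$ of the factors to the left of the place of application. $H^*(M)$ denotes the cohomology of $(M,b_{0,0})$. An $A_\infty$-bimodule homomorphism $f:M\to M'$ over $A$ is a family of degree zero maps $f_{k,l}:A[1]^{\otimes k}\otimes M\otimes A[1]^{\otimes l}\to M'$ with $f\circ\widehat b^M=b^{M'}\circ\widehat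 f$, where $$\widehat f(a_1\otimes\cdots\otimes a_k\otimes v\otimes b_1\otimes\cdots\otimes b_l)=\sum_{i,j}a_1\otimes\cdots\otimes a_i\otimes f_{k-i,j}(a_{i+1},\dots,a_k,v,b_1,\dots,b_j)\otimes b_{j+1}\otimes\cdots\otimes b_l.$$ Composition is defined by $g\circ \widehat f$. $f$ is a quasi-isomorphism if $f_{0,0}$ induces an isomorphism on cohomology with respect to $b_{0,0}$. Dual bimodule: fix an integer $d$. $M^*=\mathrm{Hom}(M,\boldsymbol{k})$ is graded (via a degree shift) so that $v^*$ of degree $|v^*|'$ is non-zero only on elements of degree $d-|v^*|'$; thus "degree zero" for $\phi:M\to M^*$ means that $\phi_{k,l}(\vec a,v,\vec b)(w)\ne0$ forces the sum of all degrees $|\cdot|'$ to be $d$. Its bimodule structure is $$b^*_{k,l}(x_1,\dots,x_k,v^*,x_{k+1},\dots,x_{k+l})(w)=(-1)^{\epsilon}v^*\big(b_{l,k}(x_{k+1},\dots,x_{k+l},w,x_1,\dots,x_k)\big),$$ $$\epsilon=1+|v^*|'+(|x_1|'+\cdots+|x_k|')(|v^*|'+|x_{k+1}|'+\cdots+|x_{k+l}|'+|w|').$$ For a homomorphism $f:M\to M'$, the dual $f^*:M'^*\to M^*$ is $$f^*_{k,l}(\vec x,v^*,\vec y)(w)=(-1)^{K}v^*(f_{l,k}(\vec y,w,\vec x)),\qquad K=\Big(\sum|x_i|'\Big)\Big(|v^*|'+\sum|y_j|'+|w|'\Big).$$ An $A_\infty$-bimodule $D$ over $A$ has a cyclic symmetric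 inner product if there is an $A_\infty$-bimodule homomorphism $\psi:D\to D^*$ over $A$ with $\psi_{k,l}=0$ for $(k,l)\ne(0,0)$ such that the bilinear form $\langle v,w\rangle=\psi_{0,0}(v)(w)$ is non-degenerate and skew symmetric: $\langle v,w\rangle=-(-1)^{|v|'|w|'}\langle w,v\rangle$. A homotopy inner product on $C$ is an $A_\infty$-bimodule homomorphism $\phi':C\to C^*$ for which there exist an $A_\infty$-bimodule $D$ over $A$ with a cyclic symmetric inner product $\psi:D\to D^*$ and an $A_\infty$-bimodule quasi-isomorphism $g:C\to D$ with $\phi'=g^*\circ\psi\circ g$. "$C$ has a homotopy inner product" means that such a $\phi'$ exists (it need not equal the $\phi$ of the claim).
   Formalization: Each H^n(C) is assumed finite-dimensional, and "non-degenerate" for the cyclic symmetric inner product means that ψ_{0,0} is an isomorphism of D onto the graded dual D^*; without such finiteness the equivalence is false. *)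

theory Defs
  imports Complex_Main "HOL-Library.Function_Algebras"
begin

section \<open>Graded vector spaces\<close>

text \<open>
  A graded space is a family of independent subspaces of an ambient vector space, the type
  \<open>'v\<close>; the space itself is their direct sum, which may be smaller than \<open>'v\<close>.
  All (multi)linear maps are described by their values on homogeneous elements, and values on
  other arguments are irrelevant.
\<close>

record ('k, 'v) gspace =
  scl :: "'k \<Rightarrow> 'v \<Rightarrow> 'v"
  gr :: "int \<Rightarrow> 'v set"

definition graded_space :: "('k::field, 'v::ab_group_add, 'x) gspace_scheme \<Rightarrow> bool" where
  "graded_space V \<longleftrightarrow>
     vector_space (scl V) \<and>
     (\<forall>n. module.subspace (scl V) (gr V n)) \<and>
     (\<forall>N x. finite N \<and> (\<forall>n\<in>N. x n \<in> gr V n) \<and> (\<Sum>n\<in>N. x n) = 0 \<longrightarrow> (\<forall>n\<in>N. x n = 0))"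

definition homog :: "('k, 'v, 'x) gspace_scheme \<Rightarrow> 'v set" where
  "homog V = (\<Union>n. gr V n)"

text \<open>
  The degree of a homogeneous element. It is unspecified at \<open>0\<close>, which is harmless:
  degrees occur only in signs of, and as degrees of, terms that are then \<open>0\<close>.
\<close>

definition deg :: "('k, 'v, 'x) gspace_scheme \<Rightarrow> 'v \<Rightarrow> int" where
  "deg V x = (THE n. x \<in> gr V n)"

definition degs :: "('k, 'v, 'x) gspace_scheme \<Rightarrow> 'v list \<Rightarrow> int" where
  "degs V xs = (\<Sum>x\<leftarrow>xs. deg V x)"

text \<open>The shifted space $V[1]$, so that \<open>deg (susp V) x\<close> is $|x|' = |x| - 1$.\<close>

definition susp :: "('k, 'v, 'x) gspace_scheme \<Rightarrow> ('k, 'v) gspace" where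
  "susp V = \<lparr>scl = scl V, gr = (\<lambda>n. gr V (n + 1))\<rparr>"

text \<open>\<open>ksgn s y\<close> is $(-1)^s y$.\<close>

definition ksgn :: "int \<Rightarrow> 'v::ab_group_add \<Rightarrow> 'v" where
  "ksgn s y = (if even s then y else - y)"

definition glinear ::
  "('k, 'v::ab_group_add, 'x) gspace_scheme \<Rightarrow> ('k \<Rightarrow> 'w \<Rightarrow> 'w) \<Rightarrow> ('v \<Rightarrow> 'w::ab_group_add) \<Rightarrow> bool"
  where
  "glinear V sW h \<longleftrightarrow>
     (\<forall>n. \<forall>x\<in>gr V n. \<forall>y\<in>gr V n. h (x + y) = h x + h y) \<and>
     (\<forall>c. \<forall>x\<in>homog V. h (scl V c x) = sW c (h x))"


section \<open>A-infinity algebras\<close>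

text \<open>\<open>mu A xs\<close> is $m_n(x_1,\dots,x_n)$ with \<open>n = length xs\<close>; \<open>mu A []\<close> is never used.\<close>

record ('k, 'a) ainf = "('k, 'a) gspace" +
  mu :: "'a list \<Rightarrow> 'a"

text \<open>
  Linear maps out of a tensor product are written as multilinear maps, and an operator on the
  tensor product is given by precomposition with it. Here: precomposition of \<open>F\<close> with the
  extension of all $m_n$, $n \ge 1$, to words; the block to which $m_{j-i}$ is applied
  consists of the entries $i+1,\dots,j$.
\<close>

definition mhat ::
  "('k, 'a::ab_group_add) ainf \<Rightarrow> ('a list \<Rightarrow> 'w::ab_group_add) \<Rightarrow> 'a list \<Rightarrow> 'w" where
  "mhat A F xs =
     (\<Sum>i<length xs. \<Sum>j\<in>{i<..length xs}.
        ksgn (degs (susp A) (take i xs))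
          (F (take i xs @ [mu A (take (j - i) (drop i xs))] @ drop j xs)))"

definition ainf_algebra :: "('k::field, 'a::ab_group_add) ainf \<Rightarrow> bool" where
  "ainf_algebra A \<longleftrightarrow>
     graded_space A \<and>
     (\<forall>xs\<in>lists (homog A). \<forall>ys\<in>lists (homog A). glinear A (scl A) (\<lambda>x. mu A (xs @ [x] @ ys))) \<and>
     (\<forall>xs\<in>lists (homog A). xs \<noteq> [] \<longrightarrow> mu A xs \<in> gr (susp A) (degs (susp A) xs + 1)) \<and>
     (\<forall>xs\<in>lists (homog A). xs \<noteq> [] \<longrightarrow> mhat A (mu A) xs = 0)"


section \<open>A-infinity bimodules\<close>

text \<open>
  \<open>act M as v bs\<close> is $b_{k,l}(\vec a, v, \vec b)$ with \<open>k = length as\<close> and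
  \<open>l = length bs\<close>. The grading \<open>gr M\<close> is the one by $|v|'$.
\<close>

record ('k, 'a, 'm) bimod = "('k, 'm) gspace" +
  act :: "'a list \<Rightarrow> 'm \<Rightarrow> 'a list \<Rightarrow> 'm"

definition trilinear ::
  "('k, 'a::ab_group_add) ainf \<Rightarrow> ('k, 'a, 'm::ab_group_add) bimod \<Rightarrow> ('k \<Rightarrow> 'w \<Rightarrow> 'w) \<Rightarrow>
   ('a list \<Rightarrow> 'm \<Rightarrow> 'a list \<Rightarrow> 'w::ab_group_add) \<Rightarrow> bool" where
  "trilinear A M sW F \<longleftrightarrow>
     (\<forall>as\<in>lists (homog A). \<forall>bs\<in>lists (homog A). glinear M sW (\<lambda>v. F as v bs)) \<and>
     (\<forall>xs\<in>lists (homog A). \<forall>ys\<in>lists (homog A). \<forall>bs\<in>lists (homog A). \<forall>v\<in>homog M.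
        glinear A sW (\<lambda>x. F (xs @ [x] @ ys) v bs)) \<and>
     (\<forall>as\<in>lists (homog A). \<forall>v\<in>homog M. \<forall>xs\<in>lists (homog A). \<forall>ys\<in>lists (homog A).
        glinear A sW (\<lambda>x. F as v (xs @ [x] @ ys)))"

definition has_degree ::
  "('k, 'a) ainf \<Rightarrow> ('k, 'a, 'm) bimod \<Rightarrow> ('k, 'a, 'n) bimod \<Rightarrow> int \<Rightarrow>
   ('a list \<Rightarrow> 'm \<Rightarrow> 'a list \<Rightarrow> 'n) \<Rightarrow> bool" where
  "has_degree A M N r F \<longleftrightarrow>
     (\<forall>as\<in>lists (homog A). \<forall>v\<in>homog M. \<forall>bs\<in>lists (homog A).
        F as v bs \<in> gr N (degs (susp A) as + deg M v + degs (susp A) bs + r))"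

text \<open>Precomposition of \<open>F\<close> with $\widehat b$.\<close>

definition bhat ::
  "('k, 'a::ab_group_add) ainf \<Rightarrow> ('k, 'a, 'm) bimod \<Rightarrow>
   ('a list \<Rightarrow> 'm \<Rightarrow> 'a list \<Rightarrow> 'w::ab_group_add) \<Rightarrow> 'a list \<Rightarrow> 'm \<Rightarrow> 'a list \<Rightarrow> 'w" where
  "bhat A M F as v bs =
     mhat A (\<lambda>as'. F as' v bs) as
     + (\<Sum>i\<le>length as. \<Sum>j\<le>length bs.
          ksgn (degs (susp A) (take i as))
            (F (take i as) (act M (drop i as) v (take j bs)) (drop j bs)))
     + ksgn (degs (susp A) as + deg M v) (mhat A (\<lambda>bs'. F as v bs') bs)"

text \<open>
  The last clause is $\widehat b \circ \widehat b = 0$: an element of a tensor product is zero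
  iff every multilinear form takes the value zero on it.
\<close>

definition ainf_bimodule ::
  "('k::field, 'a::ab_group_add) ainf \<Rightarrow> ('k, 'a, 'm::ab_group_add) bimod \<Rightarrow> bool" where
  "ainf_bimodule A M \<longleftrightarrow>
     graded_space M \<and>
     trilinear A M (scl M) (act M) \<and>
     has_degree A M M 1 (act M) \<and>
     (\<forall>F :: 'a list \<Rightarrow> 'm \<Rightarrow> 'a list \<Rightarrow> 'k. trilinear A M (*) F \<longrightarrow>
        (\<forall>as\<in>lists (homog A). \<forall>v\<in>homog M. \<forall>bs\<in>lists (homog A).
           bhat A M (bhat A M F) as v bs = 0))"

text \<open>
  \<open>hcomp G f\<close> is $G \circ \widehat f$; for bimodule homomorphisms it is the composition of
  \<open>G\<close> with \<open>f\<close>.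
\<close>

definition hcomp ::
  "('a list \<Rightarrow> 'n \<Rightarrow> 'a list \<Rightarrow> 'w::ab_group_add) \<Rightarrow> ('a list \<Rightarrow> 'm \<Rightarrow> 'a list \<Rightarrow> 'n) \<Rightarrow>
   'a list \<Rightarrow> 'm \<Rightarrow> 'a list \<Rightarrow> 'w" where
  "hcomp G f as v bs =
     (\<Sum>i\<le>length as. \<Sum>j\<le>length bs. G (take i as) (f (drop i as) v (take j bs)) (drop j bs))"

definition bimod_hom ::
  "('k::field, 'a::ab_group_add) ainf \<Rightarrow> ('k, 'a, 'm::ab_group_add) bimod \<Rightarrow>
   ('k, 'a, 'n::ab_group_add) bimod \<Rightarrow> ('a list \<Rightarrow> 'm \<Rightarrow> 'a list \<Rightarrow> 'n) \<Rightarrow> bool" where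
  "bimod_hom A M N f \<longleftrightarrow>
     trilinear A M (scl N) f \<and>
     has_degree A M N 0 f \<and>
     (\<forall>as\<in>lists (homog A). \<forall>v\<in>homog M. \<forall>bs\<in>lists (homog A).
        bhat A M f as v bs = hcomp (act N) f as v bs)"


section \<open>Cohomology\<close>

definition cocycles :: "('k, 'a, 'm::ab_group_add) bimod \<Rightarrow> int \<Rightarrow> 'm set" where
  "cocycles M n = {v \<in> gr M n. act M [] v [] = 0}"

definition cohom_rel :: "('k, 'a, 'm::ab_group_add) bimod \<Rightarrow> int \<Rightarrow> ('m \<times> 'm) set" where
  "cohom_rel M n =
     {(x, y). x \<in> cocycles M n \<and> y \<in> cocycles M n \<and> (\<exists>u\<in>gr M (n - 1). y - x = act M [] u [])}"

definition cohomology :: "('k, 'a, 'm::ab_group_add) bimod \<Rightarrow> int \<Rightarrow> 'm set set" where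
  "cohomology M n = cocycles M n // cohom_rel M n"

definition cohom_class :: "('k, 'a, 'm::ab_group_add) bimod \<Rightarrow> int \<Rightarrow> 'm \<Rightarrow> 'm set" where
  "cohom_class M n x = cohom_rel M n `` {x}"

text \<open>Every class of degree \<open>n\<close> has a representative in the span of a finite set of cocycles.\<close>

definition finite_dim_cohomology ::
  "('k::field, 'a, 'm::ab_group_add) bimod \<Rightarrow> int \<Rightarrow> bool" where
  "finite_dim_cohomology M n \<longleftrightarrow>
     (\<exists>S. finite S \<and> S \<subseteq> cocycles M n \<and>
        (\<forall>X\<in>cohomology M n. X \<inter> module.span (scl M) S \<noteq> {}))"

text \<open>The map induced on classes sends $[x]$ to $[f_{0,0}(x)]$; it is linear as $f_{0,0}$ is.\<close>

definition quasi_iso ::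
  "('k::field, 'a::ab_group_add) ainf \<Rightarrow> ('k, 'a, 'm::ab_group_add) bimod \<Rightarrow>
   ('k, 'a, 'n::ab_group_add) bimod \<Rightarrow> ('a list \<Rightarrow> 'm \<Rightarrow> 'a list \<Rightarrow> 'n) \<Rightarrow> bool" where
  "quasi_iso A M N f \<longleftrightarrow>
     bimod_hom A M N f \<and>
     (\<forall>n. bij_betw (\<lambda>X. \<Union>x\<in>X. cohom_class N n (f [] x [])) (cohomology M n) (cohomology N n))"


section \<open>Duals\<close>

text \<open>
  The degree \<open>n\<close> part of the dual (with respect to the integer \<open>d\<close>) is
  $\mathrm{Hom}(M_{d-n}, k)$; a functional on $M_{d-n}$ is represented by its extension by
  \<open>0\<close> to the ambient type.
\<close>

definition dual ::
  "int \<Rightarrow> ('k::field, 'a) ainf \<Rightarrow> ('k, 'a, 'm::ab_group_add) bimod \<Rightarrow> ('k, 'a, 'm \<Rightarrow> 'k) bimod"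
  where
  "dual d A M =
     (let G = (\<lambda>n. {\<phi>. glinear M (*) \<phi> \<and> (\<forall>w. w \<notin> gr M (d - n) \<longrightarrow> \<phi> w = 0)});
          V = \<lparr>scl = (\<lambda>c \<phi> w. c * \<phi> w), gr = G\<rparr>
      in \<lparr>scl = scl V, gr = gr V,
          act = (\<lambda>xs \<phi> ys w. if w \<in> homog M then
             ksgn (1 + deg V \<phi> + degs (susp A) xs * (deg V \<phi> + degs (susp A) ys + deg M w))
               (\<phi> (act M ys w xs)) else 0)\<rparr>)"

definition dual_hom ::
  "int \<Rightarrow> ('k::field, 'a) ainf \<Rightarrow> ('k, 'a, 'm::ab_group_add) bimod \<Rightarrow>
   ('k, 'a, 'n::ab_group_add) bimod \<Rightarrow> ('a list \<Rightarrow> 'm \<Rightarrow> 'a list \<Rightarrow> 'n) \<Rightarrow>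
   'a list \<Rightarrow> ('n \<Rightarrow> 'k) \<Rightarrow> 'a list \<Rightarrow> ('m \<Rightarrow> 'k)" where
  "dual_hom d A M N f xs \<phi> ys =
     (\<lambda>w. if w \<in> homog M then
        ksgn (degs (susp A) xs * (deg (dual d A N) \<phi> + degs (susp A) ys + deg M w))
          (\<phi> (f ys w xs)) else 0)"


section \<open>Inner products\<close>

text \<open>
  Non-degeneracy means that $\psi_{0,0}$ is an isomorphism of graded spaces onto the dual, not
  just that it is injective; the two agree when the graded pieces are finite-dimensional.
\<close>

definition cyclic_inner_product ::
  "int \<Rightarrow> ('k::field, 'a::ab_group_add) ainf \<Rightarrow> ('k, 'a, 'm::ab_group_add) bimod \<Rightarrow>
   ('a list \<Rightarrow> 'm \<Rightarrow> 'a list \<Rightarrow> ('m \<Rightarrow> 'k)) \<Rightarrow> bool" where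
  "cyclic_inner_product d A D \<psi> \<longleftrightarrow>
     bimod_hom A D (dual d A D) \<psi> \<and>
     (\<forall>as\<in>lists (homog A). \<forall>v\<in>homog D. \<forall>bs\<in>lists (homog A).
        (as, bs) \<noteq> ([], []) \<longrightarrow> \<psi> as v bs = 0) \<and>
     (\<forall>n. bij_betw (\<lambda>v. \<psi> [] v []) (gr D n) (gr (dual d A D) n)) \<and>
     (\<forall>v\<in>homog D. \<forall>w\<in>homog D. \<psi> [] v [] w = - ksgn (deg D v * deg D w) (\<psi> [] w [] v))"

text \<open>
  HOL cannot quantify over types, so the type argument \<open>'d\<close> is the universe in which the
  bimodule \<open>D\<close> is sought.
\<close>

definition homotopy_inner_product ::
  "'d::ab_group_add itself \<Rightarrow> int \<Rightarrow> ('k::field, 'a::ab_group_add) ainf \<Rightarrow> ('k, 'a, 'c::ab_group_add) bimod \<Rightarrow>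
   ('a list \<Rightarrow> 'c \<Rightarrow> 'a list \<Rightarrow> ('c \<Rightarrow> 'k)) \<Rightarrow> bool" where
  "homotopy_inner_product (_ :: 'd itself) d A C \<phi> \<longleftrightarrow>
     bimod_hom A C (dual d A C) \<phi> \<and>
     (\<exists>(D :: ('k, 'a, 'd) bimod) \<psi> g.
        ainf_bimodule A D \<and> cyclic_inner_product d A D \<psi> \<and> quasi_iso A C D g \<and>
        (\<forall>as\<in>lists (homog A). \<forall>v\<in>homog C. \<forall>bs\<in>lists (homog A).
           \<phi> as v bs = hcomp (dual_hom d A C D g) (hcomp \<psi> g) as v bs))"

definition skew_symmetric ::
  "('k::field, 'a) ainf \<Rightarrow> ('k, 'a, 'c) bimod \<Rightarrow> ('a list \<Rightarrow> 'c \<Rightarrow> 'a list \<Rightarrow> ('c \<Rightarrow> 'k)) \<Rightarrow> bool"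
  where
  "skew_symmetric A C \<phi> \<longleftrightarrow>
     (\<forall>as\<in>lists (homog A). \<forall>bs\<in>lists (homog A). \<forall>v\<in>homog C. \<forall>w\<in>homog C.
        \<phi> as v bs w =
          - ksgn ((degs (susp A) as + deg C v) * (degs (susp A) bs + deg C w)) (\<phi> bs w as v))"

definition homologically_nondegenerate ::
  "('k::field, 'a, 'c::ab_group_add) bimod \<Rightarrow> ('a list \<Rightarrow> 'c \<Rightarrow> 'a list \<Rightarrow> ('c \<Rightarrow> 'k)) \<Rightarrow> bool"
  where
  "homologically_nondegenerate C \<phi> \<longleftrightarrow>
     (\<forall>n. \<forall>a\<in>cocycles C n. cohom_class C n a \<noteq> cohom_class C n 0 \<longrightarrow>
        (\<exists>m. \<exists>b\<in>cocycles C m. \<phi> [] a [] b \<noteq> 0))"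

end

theory Submission
  imports Defs
begin

text \<open>
  Let \<open>C\<close> have a homotopy inner product, pulled back from a cyclic inner product \<open>\<psi>\<close> on \<open>D\<close> along a
  quasi-isomorphism \<open>g\<close>. The pulled-back form is skew because \<open>\<psi>\<close> is. A cocycle of \<open>D\<close> that is orthogonal to all
  cocycles has a pairing that factors through the differential; the resulting functional is
  represented by some \<open>u\<close>, as \<open>\<psi>\<close> maps onto the dual, and the cocycle is the differential of \<open>u\<close> up to
  sign (\<open>coboundary_if_orthogonal\<close>). So \<open>\<psi>\<close> is non-degenerate on cohomology, and since \<open>g\<close> is bijective
  there, the pullback is non-degenerate too.

  Conversely, let \<open>\<phi>\<close> be skew and homologically non-degenerate. Homological perturbation transfers
  the bimodule structure to representatives of the cohomology of \<open>C\<close>, where it has no constant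
  term (\<open>perturbation\<close>, \<open>minimal_model\<close>). The pullback \<open>\<Phi>\<close> of \<open>\<phi>\<close> to this minimal model is again skew; its
  constant part \<open>\<psi>\<close> is the pairing on cohomology, which is perfect by non-degeneracy and
  finite-dimensionality (\<open>perfect_pairing\<close>). The higher parts of \<open>\<Phi>\<close> are removed by a change of
  coordinates \<open>1 + u\<close> (\<open>straighten_skew_form\<close>). The equation for \<open>u\<close> has the form \<open>\<psi> u + u\<^sup>* \<psi> + \<Gamma> u = 0\<close>,
  where \<open>\<Gamma> u\<close> is skew for every \<open>u\<close> and contains \<open>u\<close> only in terms of higher order. Hence the equation
  \<open>\<psi> u = - \<Gamma> u / 2\<close> can be solved by iteration, and as its right-hand side is skew, the two terms \<open>\<psi> u\<close> and
  \<open>u\<^sup>* \<psi>\<close> coincide. In the new coordinates the minimal model is a bimodule on which the constant form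
  \<open>\<psi>\<close> is a homomorphism into the dual, which is a cyclic inner product. The projection of \<open>C\<close> onto
  the minimal model, followed by the inverse of \<open>1 + u\<close>, is a quasi-isomorphism to it.

  The computations take place in an algebra of families of maps indexed by a left and a right word
  (type \<open>tmap\<close>), with composition \<open>\<odot>\<close>, a derivation \<open>del\<close> that inserts products of \<open>A\<close> into the
  words, and the sign operator \<open>sgl\<close> of the left word. A structure map \<open>b\<close> satisfies
  \<open>del b + sgl A b \<odot> b = 0\<close>, and a homomorphism \<open>f\<close> satisfies \<open>del f + sgl A f \<odot> b = b' \<odot> f\<close>. Families vanish on
  irrelevant words and are linear on the whole space, which is spanned by homogeneous elements
  after enlarging the grading (\<open>spanning_enlargement\<close>); so identities on homogeneous arguments are
  identities of families. Homomorphisms into the dual are treated as bilinear forms (\<open>represent_form\<close>).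
  They have a fixed total degree \<open>d\<close>, so that their signs only depend on the degrees of words.
\<close>

section \<open>Signs and sums over splittings of a word\<close>

lemma ksgn_add [simp]: "ksgn s (x + y) = ksgn s x + ksgn s y"
  by (simp add: ksgn_def)

lemma ksgn_minus [simp]: "ksgn s (- x) = - ksgn s x"
  by (simp add: ksgn_def)

lemma ksgn_diff [simp]: "ksgn s (x - y) = ksgn s x - ksgn s y"
  by (simp add: ksgn_def)

lemma ksgn_zero [simp]: "ksgn s 0 = 0"
  by (simp add: ksgn_def)

lemma ksgn_ksgn [simp]: "ksgn s (ksgn t x) = ksgn (s + t) x"
  by (auto simp add: ksgn_def)

lemma ksgn_0 [simp]: "ksgn 0 x = x"
  by (simp add: ksgn_def)

lemma ksgn_1 [simp]: "ksgn 1 x = - x"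
  by (simp add: ksgn_def)

lemma ksgn_eq_0_iff [simp]: "ksgn s x = 0 \<longleftrightarrow> x = 0"
  by (simp add: ksgn_def)

lemma ksgn_sum: "ksgn s (sum f I) = (\<Sum>i\<in>I. ksgn s (f i))"
  by (simp add: ksgn_def sum_negf)

lemma ksgn_cong: "even (s - t) \<Longrightarrow> x = y \<Longrightarrow> ksgn s x = ksgn t y"
  by (auto simp add: ksgn_def)

lemma ksgn_opp: "odd (s - t) \<Longrightarrow> x = y \<Longrightarrow> ksgn s x = - ksgn t y"
  by (auto simp add: ksgn_def)

lemma ksgn_fun [simp]: "ksgn s (f :: 'x \<Rightarrow> 'y::ab_group_add) w = ksgn s (f w)"
  by (simp add: ksgn_def)

lemma ksgn_mult: "ksgn s x * (y :: 'k::field) = ksgn s (x * y)"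
  "y * ksgn s x = ksgn s (y * x :: 'k)"
  by (simp_all add: ksgn_def)

lemma additive_zero_minus_ksgn:
  fixes h :: "'x::ab_group_add \<Rightarrow> 'y::ab_group_add"
  assumes "\<And>x y. h (x + y) = h x + h y"
  shows additive_zero: "h 0 = 0"
    and additive_minus: "h (- x) = - h x"
    and additive_diff: "h (x - y) = h x - h y"
    and additive_ksgn: "h (ksgn s x) = ksgn s (h x)"
    and additive_sum: "h (sum f I) = (\<Sum>i\<in>I. h (f i))"
proof -
  show 0: "h 0 = 0" using assms[of 0 0] by simp
  show m: "h (- x) = - h x" for x
    using assms[of x "- x"] 0 by (simp add: eq_neg_iff_add_eq_0 add.commute)
  show "h (x - y) = h x - h y" using assms[of x "- y"] m by simp
  show "h (ksgn s x) = ksgn s (h x)" by (simp add: ksgn_def m)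
  show "h (sum f I) = (\<Sum>i\<in>I. h (f i))"
    by (induction I rule: infinite_finite_induct) (simp_all add: 0 assms)
qed

lemma degs_Nil [simp]: "degs V [] = 0"
  and degs_Cons [simp]: "degs V (x # xs) = deg V x + degs V xs"
  and degs_append [simp]: "degs V (xs @ ys) = degs V xs + degs V ys"
  by (simp_all add: degs_def)

definition spl :: "('a list \<Rightarrow> 'a list \<Rightarrow> 'w::ab_group_add) \<Rightarrow> 'a list \<Rightarrow> 'w" where
  "spl K as = (\<Sum>i\<le>length as. K (take i as) (drop i as))"

lemma spl_Nil [simp]: "spl K [] = K [] []"
  by (simp add: spl_def)

lemma spl_Cons: "spl K (a # as) = K [] (a # as) + spl (\<lambda>x. K (a # x)) as"
  by (simp add: spl_def sum.atMost_Suc_shift del: sum.atMost_Suc)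

lemma spl_cong: "(\<And>x y. x @ y = as \<Longrightarrow> K x y = K' x y) \<Longrightarrow> spl K as = spl K' as"
  unfolding spl_def by (rule sum.cong) auto

lemma spl_add: "spl (\<lambda>x y. K x y + K' x y) as = spl K as + spl K' as"
  by (simp add: spl_def sum.distrib)

lemma spl_diff: "spl (\<lambda>x y. K x y - K' x y) as = spl K as - spl K' as"
  by (simp add: spl_def sum_subtractf)

lemma spl_minus: "spl (\<lambda>x y. - K x y) as = - spl K as"
  by (simp add: spl_def sum_negf)

lemma spl_zero [simp]: "spl (\<lambda>x y. 0) as = 0"
  by (simp add: spl_def)

lemma spl_ksgn: "spl (\<lambda>x y. ksgn s (K x y)) as = ksgn s (spl K as)"
  by (simp add: spl_def ksgn_sum)

lemma spl_hom:
  assumes "\<And>x y. h (x + y) = h x + h y"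
  shows "h (spl K as) = spl (\<lambda>x y. h (K x y)) as"
  unfolding spl_def by (rule additive_sum) (rule assms)

lemma spl_fun: "spl K as w = spl (\<lambda>x y. K x y w) as"
  by (rule spl_hom[of "\<lambda>f. f w"]) simp

lemma spl_zeroI: "(\<And>x y. x @ y = as \<Longrightarrow> K x y = 0) \<Longrightarrow> spl K as = 0"
  using spl_cong[of as K "\<lambda>x y. 0"] by simp

lemma spl_swap: "spl (\<lambda>x y. spl (\<lambda>u v. K x y u v) bs) as = spl (\<lambda>u v. spl (\<lambda>x y. K x y u v) as) bs"
  unfolding spl_def by (rule sum.swap)

lemma spl_assoc: "spl (\<lambda>x z. spl (\<lambda>u v. K u v z) x) as = spl (\<lambda>u z. spl (\<lambda>v w. K u v w) z) as"
proof (induction as arbitrary: K)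
  case (Cons a as)
  show ?case
    by (simp add: spl_Cons spl_add Cons.IH[of "\<lambda>u. K (a # u)"] add.assoc)
qed simp

lemma mhat_Nil [simp]: "mhat A F [] = 0"
  by (simp add: mhat_def)

lemma mhat_Cons:
  "mhat A F (a # as) = spl (\<lambda>x y. F (mu A (a # x) # y)) as
     + ksgn (deg (susp A) a) (mhat A (\<lambda>y. F (a # y)) as)"
proof -
  let ?T = "\<lambda>i j. ksgn (degs (susp A) (take i (a # as)))
          (F (take i (a # as) @ [mu A (take (j - i) (drop i (a # as)))] @ drop j (a # as)))"
  have "mhat A F (a # as) = (\<Sum>j\<in>{0<..Suc (length as)}. ?T 0 j)
     + (\<Sum>i<length as. \<Sum>j\<in>{Suc i<..Suc (length as)}. ?T (Suc i) j)"
    unfolding mhat_def by (simp add: sum.lessThan_Suc_shift del: sum.lessThan_Suc)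
  moreover have "(\<Sum>j\<in>{0<..Suc (length as)}. ?T 0 j) = (\<Sum>j\<le>length as. ?T 0 (Suc j))"
    by (rule sum.reindex_bij_witness[of _ Suc "\<lambda>j. j - 1"]) auto
  moreover have "(\<Sum>j\<in>{Suc i<..Suc (length as)}. ?T (Suc i) j) = (\<Sum>j\<in>{i<..length as}. ?T (Suc i) (Suc j))" for i
    by (rule sum.reindex_bij_witness[of _ Suc "\<lambda>j. j - 1"]) auto
  ultimately show ?thesis
    by (simp add: mhat_def spl_def ksgn_sum)
qed

lemma mhat_cong: "(\<And>x. F x = G x) \<Longrightarrow> mhat A F as = mhat A G as"
  by presburger

lemma mhat_add: "mhat A (\<lambda>x. F x + G x) as = mhat A F as + mhat A G as"
  by (simp add: mhat_def sum.distrib)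

lemma mhat_zero [simp]: "mhat A (\<lambda>x. 0) as = 0"
  by (simp add: mhat_def)

lemma mhat_minus: "mhat A (\<lambda>x. - F x) as = - mhat A F as"
  by (simp add: mhat_def sum_negf)

lemma mhat_ksgn: "mhat A (\<lambda>x. ksgn s (F x)) as = ksgn s (mhat A F as)"
  by (simp add: ksgn_def mhat_minus)

lemma mhat_hom:
  assumes "\<And>x y. h (x + y) = h x + h y"
  shows "h (mhat A F as) = mhat A (\<lambda>x. h (F x)) as"
  unfolding mhat_def by (simp add: additive_sum[of h, OF assms] additive_ksgn[of h, OF assms])

lemma mhat_fun: "mhat A F as w = mhat A (\<lambda>x. F x w) as"
  by (rule mhat_hom[of "\<lambda>f. f w"]) simp

lemma spl_mhat_swap: "spl (\<lambda>x y. mhat A (F x y) bs) as = mhat A (\<lambda>z. spl (\<lambda>x y. F x y z) as) bs"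
  by (induction as arbitrary: F) (simp_all add: spl_Cons mhat_add)

text \<open>\<open>mhat\<close> is a signed coderivation: inserting a product into a word that is afterwards cut in
  two amounts to cutting first and inserting into one of the two pieces, because the inserted
  letter falls wholly on one side of the cut.\<close>

lemma mhat_spl:
  "mhat A (spl K) as =
     spl (\<lambda>x y. mhat A (\<lambda>z. K z y) x + ksgn (degs (susp A) x) (mhat A (K x) y)) as"
proof (induction as arbitrary: K)
  case (Cons a as)
  let ?a = "deg (susp A) a"
  have "mhat A (spl K) (a # as) =
      spl (\<lambda>x y. K [] (mu A (a # x) # y)) as
      + spl (\<lambda>x y. spl (\<lambda>u v. K (mu A (a # x) # u) v) y) as
      + ksgn ?a (mhat A (\<lambda>y. K [] (a # y)) as)
      + ksgn ?a (spl (\<lambda>x y. mhat A (\<lambda>z. K (a # z) y) x + ksgn (degs (susp A) x) (mhat A (K (a # x)) y)) as)"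
    by (simp add: mhat_Cons spl_Cons spl_add mhat_add Cons.IH[of "\<lambda>x. K (a # x)"] add.assoc)
  also have "\<dots> = spl (\<lambda>x y. mhat A (\<lambda>z. K z y) x + ksgn (degs (susp A) x) (mhat A (K x) y)) (a # as)"
    by (simp add: mhat_Cons spl_Cons spl_add spl_ksgn[symmetric] spl_assoc[symmetric] algebra_simps)
  finally show ?case .
qed simp

section \<open>Families of maps indexed by words on both sides\<close>

text \<open>Only additivity in the argument between the two words is built in: it is what makes
  composition associative and biadditive. Linearity in the words holds for homogeneous
  letters only and stays a predicate.\<close>

typedef (overloaded) ('a, 'm::ab_group_add, 'w::ab_group_add) tmap =
  "{f :: 'a list \<Rightarrow> 'm \<Rightarrow> 'a list \<Rightarrow> 'w. \<forall>as bs x y. f as (x + y) bs = f as x bs + f as y bs}"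
  morphisms app Tmap
  by (rule exI[of _ "\<lambda>as v bs. 0"]) simp

setup_lifting type_definition_tmap

lemma app_add [simp]: "app f as (x + y) bs = app f as x bs + app f as y bs"
  by transfer simp

lemma app_zero [simp]: "app f as 0 bs = 0"
  using app_add[of f as 0 0 bs] by simp

lemma app_minus [simp]: "app f as (- x) bs = - app f as x bs"
  by (rule additive_minus[of "\<lambda>x. app f as x bs"]) simp

lemma app_diff [simp]: "app f as (x - y) bs = app f as x bs - app f as y bs"
  by (rule additive_diff[of "\<lambda>x. app f as x bs"]) simp

lemma app_ksgn [simp]: "app f as (ksgn s x) bs = ksgn s (app f as x bs)"
  by (rule additive_ksgn[of "\<lambda>x. app f as x bs"]) simp

lemma app_sum: "app f as (sum x I) bs = (\<Sum>i\<in>I. app f as (x i) bs)"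
  by (rule additive_sum[of "\<lambda>x. app f as x bs"]) simp

lemma app_spl: "app f as (spl K xs) bs = spl (\<lambda>x y. app f as (K x y) bs) xs"
  by (rule spl_hom[of "\<lambda>x. app f as x bs"]) simp

lemma app_mhat: "app f as (mhat A K xs) bs = mhat A (\<lambda>x. app f as (K x) bs) xs"
  by (rule mhat_hom[of "\<lambda>x. app f as x bs"]) simp

lemma tmap_eqI: "(\<And>as v bs. app f as v bs = app g as v bs) \<Longrightarrow> f = g"
  by transfer (simp add: fun_eq_iff)

instantiation tmap :: (type, ab_group_add, ab_group_add) ab_group_add
begin

lift_definition zero_tmap :: "('a, 'b, 'c) tmap" is "\<lambda>as v bs. 0" by simp
lift_definition plus_tmap :: "('a, 'b, 'c) tmap \<Rightarrow> ('a, 'b, 'c) tmap \<Rightarrow> ('a, 'b, 'c) tmap"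
  is "\<lambda>f g as v bs. f as v bs + g as v bs" by simp
lift_definition minus_tmap :: "('a, 'b, 'c) tmap \<Rightarrow> ('a, 'b, 'c) tmap \<Rightarrow> ('a, 'b, 'c) tmap"
  is "\<lambda>f g as v bs. f as v bs - g as v bs" by simp
lift_definition uminus_tmap :: "('a, 'b, 'c) tmap \<Rightarrow> ('a, 'b, 'c) tmap"
  is "\<lambda>f as v bs. - f as v bs" by simp

instance by standard (transfer; simp add: fun_eq_iff algebra_simps)+

end

lemma app_0 [simp]: "app 0 as v bs = 0" by transfer simp
lemma app_plus [simp]: "app (f + g) as v bs = app f as v bs + app g as v bs" by transfer simp
lemma app_minus_left [simp]: "app (f - g) as v bs = app f as v bs - app g as v bs" by transfer simp
lemma app_uminus [simp]: "app (- f) as v bs = - app f as v bs" by transfer simp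
lemma app_ksgn_left [simp]: "app (ksgn s f) as v bs = ksgn s (app f as v bs)" by (simp add: ksgn_def)

lift_definition tcomp ::
  "('a, 'n::ab_group_add, 'w::ab_group_add) tmap \<Rightarrow> ('a, 'm::ab_group_add, 'n) tmap \<Rightarrow> ('a, 'm, 'w) tmap"
    (infixl "\<odot>" 70)
  is "\<lambda>G f as v bs. spl (\<lambda>x y. spl (\<lambda>u w. G x (f y v u) w) bs) as"
  by (auto simp: spl_add[symmetric] intro!: spl_cong)

lemma app_tcomp: "app (G \<odot> f) as v bs = spl (\<lambda>x y. spl (\<lambda>u w. app G x (app f y v u) w) bs) as"
  by transfer simp

lemma app_tcomp_hcomp: "app (G \<odot> f) = hcomp (app G) (app f)"
  by (simp add: fun_eq_iff hcomp_def app_tcomp spl_def)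

lemma tcomp_assoc: "(F \<odot> f) \<odot> g = F \<odot> (f \<odot> g)"
proof (rule tmap_eqI)
  fix as v bs
  have "app ((F \<odot> f) \<odot> g) as v bs =
      spl (\<lambda>x z. spl (\<lambda>u w. spl (\<lambda>x1 x2. spl (\<lambda>w1 w2. app F x1 (app f x2 (app g z v u) w1) w2) w) x) bs) as"
    by (simp add: app_tcomp)
  also have "\<dots> = spl (\<lambda>x z. spl (\<lambda>x1 x2. spl (\<lambda>u w. spl (\<lambda>w1 w2. app F x1 (app f x2 (app g z v u) w1) w2) w) bs) x) as"
    by (subst spl_swap) simp
  also have "\<dots> = spl (\<lambda>x1 z. spl (\<lambda>x2 y. spl (\<lambda>u w. spl (\<lambda>w1 w2. app F x1 (app f x2 (app g y v u) w1) w2) w) bs) z) as"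
    by (rule spl_assoc)
  also have "\<dots> = spl (\<lambda>x1 z. spl (\<lambda>x2 y. spl (\<lambda>u w. spl (\<lambda>w1 w2. app F x1 (app f x2 (app g y v w1) w2) w) u) bs) z) as"
    by (subst spl_assoc) simp
  also have "\<dots> = app (F \<odot> (f \<odot> g)) as v bs"
    by (subst spl_swap) (simp add: app_tcomp app_spl)
  finally show "app ((F \<odot> f) \<odot> g) as v bs = app (F \<odot> (f \<odot> g)) as v bs" .
qed

lemma tcomp_add_left: "(F + G) \<odot> f = F \<odot> f + G \<odot> f"
  and tcomp_diff_left: "(F - G) \<odot> f = F \<odot> f - G \<odot> f"
  and tcomp_minus_left: "(- F) \<odot> f = - (F \<odot> f)"
  and tcomp_ksgn_left: "ksgn s F \<odot> f = ksgn s (F \<odot> f)"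
  and tcomp_zero_left [simp]: "0 \<odot> f = 0"
  by (rule tmap_eqI; simp add: app_tcomp spl_add spl_diff spl_minus spl_ksgn)+

lemma tcomp_add_right: "F \<odot> (f + g) = F \<odot> f + F \<odot> g"
  and tcomp_diff_right: "F \<odot> (f - g) = F \<odot> f - F \<odot> g"
  and tcomp_minus_right: "F \<odot> (- f) = - (F \<odot> f)"
  and tcomp_ksgn_right: "F \<odot> (ksgn s f) = ksgn s (F \<odot> f)"
  and tcomp_zero_right [simp]: "F \<odot> 0 = 0"
  by (rule tmap_eqI; simp add: app_tcomp spl_add spl_diff spl_minus spl_ksgn)+

lemmas tcomp_simps = tcomp_assoc tcomp_add_left tcomp_diff_left tcomp_minus_left
  tcomp_add_right tcomp_diff_right tcomp_minus_right

subsection \<open>Maps concentrated in the empty words\<close>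

text \<open>A map that is not additive is sent to \<open>0\<close>, as it does not define a family.\<close>

lift_definition conc :: "('m::ab_group_add \<Rightarrow> 'w::ab_group_add) \<Rightarrow> ('a, 'm, 'w) tmap"
  is "\<lambda>h as v bs. if (\<forall>x y. h (x + y) = h x + h y) \<and> as = [] \<and> bs = [] then h v else 0"
  by auto

lemma app_conc: "(\<And>x y. h (x + y) = h x + h y) \<Longrightarrow> app (conc h) as v bs = (if as = [] \<and> bs = [] then h v else 0)"
  by transfer auto

lemma app_conc_nonempty [simp]: "as \<noteq> [] \<or> bs \<noteq> [] \<Longrightarrow> app (conc h) as v bs = 0"
  by transfer auto

definition tid :: "('a, 'm::ab_group_add, 'm) tmap" where "tid = conc (\<lambda>v. v)"

lemma spl_eq_first: "(\<And>x y. x @ y = as \<Longrightarrow> x \<noteq> [] \<Longrightarrow> K x y = 0) \<Longrightarrow> spl K as = K [] as"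
  by (cases as) (auto simp: spl_Cons intro!: spl_zeroI)

lemma spl_eq_last: "(\<And>x y. x @ y = as \<Longrightarrow> y \<noteq> [] \<Longrightarrow> K x y = 0) \<Longrightarrow> spl K as = K as []"
proof (induction as arbitrary: K)
  case (Cons a as)
  then show ?case using Cons.IH[of "\<lambda>x. K (a # x)"] Cons.prems[of "[]" "a # as"]
    by (simp add: spl_Cons)
qed simp

lemma app_conc_tcomp:
  "(\<And>x y. h (x + y) = h x + h y) \<Longrightarrow> app (conc h \<odot> f) as v bs = h (app f as v bs)"
proof -
  assume h: "\<And>x y. h (x + y) = h x + h y"
  have "spl (\<lambda>u w. app (conc h) [] (app f as v u) w) bs = h (app f as v bs)"
    by (subst spl_eq_last) (auto simp: app_conc[of h, OF h])
  then show ?thesis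
    by (simp add: app_tcomp spl_eq_first)
qed

lemma app_tcomp_conc:
  "(\<And>x y. h (x + y) = h x + h y) \<Longrightarrow> app (F \<odot> conc h) as v bs = app F as (h v) bs"
proof -
  assume h: "\<And>x y. h (x + y) = h x + h y"
  have "spl (\<lambda>u w. app F as (app (conc h) [] v u) w) bs = app F as (h v) bs"
    by (subst spl_eq_first) (auto simp: app_conc[of h, OF h])
  then show ?thesis
    by (simp add: app_tcomp spl_eq_last)
qed

lemma tid_left [simp]: "tid \<odot> f = f"
  by (rule tmap_eqI) (simp add: tid_def app_conc_tcomp)

lemma tid_right [simp]: "f \<odot> tid = f"
  by (rule tmap_eqI) (simp add: tid_def app_tcomp_conc)

subsection \<open>Order of vanishing and fixed points\<close>

definition vanish :: "nat \<Rightarrow> ('a, 'm::ab_group_add, 'w::ab_group_add) tmap \<Rightarrow> bool" where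
  "vanish n f \<longleftrightarrow> (\<forall>as v bs. length as + length bs < n \<longrightarrow> app f as v bs = 0)"

lemma vanish_0 [simp]: "vanish 0 f"
  by (simp add: vanish_def)

lemma vanish_mono: "vanish n f \<Longrightarrow> m \<le> n \<Longrightarrow> vanish m f"
  by (auto simp: vanish_def)

lemma vanish_zero [simp]: "vanish n 0"
  and vanish_add: "vanish n f \<Longrightarrow> vanish n g \<Longrightarrow> vanish n (f + g)"
  and vanish_diff: "vanish n f \<Longrightarrow> vanish n g \<Longrightarrow> vanish n (f - g)"
  and vanish_minus: "vanish n f \<Longrightarrow> vanish n (- f)"
  by (auto simp: vanish_def)

lemma vanish_tcomp:
  fixes F :: "('a, 'n::ab_group_add, 'w::ab_group_add) tmap" and f :: "('a, 'm::ab_group_add, 'n) tmap"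
  assumes "vanish m F" "vanish n f" shows "vanish (m + n) (F \<odot> f)"
  unfolding vanish_def
proof (intro allI impI)
  fix as :: "'a list" and v and bs :: "'a list" assume l: "length as + length bs < m + n"
  show "app (F \<odot> f) as v bs = 0"
    unfolding app_tcomp
  proof (intro spl_zeroI)
    fix x y u w assume "x @ y = as" "u @ w = bs"
    then have "length x + length w < m \<or> length y + length u < n"
      using l by auto
    then show "app F x (app f y v u) w = 0"
      using assms by (auto simp: vanish_def)
  qed
qed

lemma vanish_all_imp_0: "(\<And>n. vanish n f) \<Longrightarrow> f = 0"
  by (rule tmap_eqI) (metis app_0 lessI vanish_def)

text \<open>Every application of the equation raises the order of vanishing of \<open>z\<close>.\<close>

lemma tcomp_fix_0: assumes "vanish 1 x" and "z = x \<odot> z" shows "z = 0"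
proof (rule vanish_all_imp_0)
  show "vanish n z" for n
  proof (induction n)
    case (Suc n)
    then show ?case using vanish_tcomp[OF assms(1) Suc] assms(2) by simp
  qed simp
qed

text \<open>The iterates of a map that improves agreement by one word length stabilise on words
  of any given length, and their limit is fixed. It inherits every property that passes
  from arbitrarily good approximations to the limit.\<close>

lemma contraction_fixed_point:
  fixes T :: "('a, 'm::ab_group_add, 'w::ab_group_add) tmap \<Rightarrow> ('a, 'm, 'w) tmap"
  assumes P0: "P z" and PT: "\<And>f. P f \<Longrightarrow> P (T f)"
    and contr: "\<And>n f g. P f \<Longrightarrow> P g \<Longrightarrow> vanish n (f - g) \<Longrightarrow> vanish (Suc n) (T f - T g)"
    and closed: "\<And>f. (\<And>n. \<exists>g. P g \<and> vanish n (f - g)) \<Longrightarrow> P f"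
  shows "\<exists>f. P f \<and> T f = f"
proof -
  define it where "it n = (T ^^ n) z" for n
  have P: "P (it n)" for n by (induction n) (auto simp: it_def P0 PT)
  have step: "vanish n (it (Suc n) - it n)" for n
  proof (induction n)
    case (Suc n)
    then show ?case using contr[OF P P Suc] by (simp add: it_def)
  qed simp
  have le: "vanish n (it (n + k) - it n)" for n k
  proof (induction k)
    case (Suc k)
    have "vanish n (it (Suc (n + k)) - it (n + k))" by (rule vanish_mono[OF step]) simp
    from vanish_add[OF this Suc] show ?case by simp
  qed simp
  define f where "f = Tmap (\<lambda>as v bs. app (it (Suc (length as + length bs))) as v bs)"
  have f: "app f as v bs = app (it (Suc (length as + length bs))) as v bs" for as v bs
    unfolding f_def by (subst Tmap_inverse) auto
  have close: "vanish n (f - it n)" for n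
    unfolding vanish_def
  proof (intro allI impI)
    fix as :: "'a list" and v and bs :: "'a list" assume l: "length as + length bs < n"
    then obtain k where "n = Suc (length as + length bs) + k"
      using less_iff_Suc_add by auto
    then show "app (f - it n) as v bs = 0"
      using le[of "Suc (length as + length bs)" k] unfolding vanish_def by (auto simp: f)
  qed
  have Pf: "P f" by (rule closed) (use P close in blast)
  have "vanish n (T f - f)" for n
  proof -
    have 1: "vanish (Suc n) (T f - it (Suc n))"
      using contr[OF Pf P close] by (simp add: it_def)
    have "vanish (Suc n) ((T f - it (Suc n)) - (f - it (Suc n)))"
      by (intro vanish_diff 1 close)
    then show ?thesis by (auto intro: vanish_mono)
  qed
  then have "T f - f = 0" by (rule vanish_all_imp_0)
  with Pf show ?thesis by auto
qed

subsection \<open>Inserting products, and signs\<close>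

definition letters :: "('k, 'a::ab_group_add) ainf \<Rightarrow> 'a set" where
  "letters A = homog A - {0}"

text \<open>A word with an entry outside \<open>letters A\<close> carries no information, as this entry is \<open>0\<close> or
  not homogeneous. Making families vanish there turns equations that hold on homogeneous
  words into equations between families.\<close>

definition nrm :: "('k, 'a::ab_group_add) ainf \<Rightarrow> ('a, 'm::ab_group_add, 'w::ab_group_add) tmap \<Rightarrow> bool" where
  "nrm A f \<longleftrightarrow> (\<forall>as v bs. \<not> (as \<in> lists (letters A) \<and> bs \<in> lists (letters A)) \<longrightarrow> app f as v bs = 0)"

text \<open>The operators out of which the sign rules and the differential on families are built:
  multiplication by the sign of the left or right word, and precomposition with the
  insertion of a product into one of the words. The case distinction in the last two keeps
  normalised families normalised.\<close>

lift_definition sgl :: "('k, 'a::ab_group_add) ainf \<Rightarrow> ('a, 'm::ab_group_add, 'w::ab_group_add) tmap \<Rightarrow> ('a, 'm, 'w) tmap"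
  is "\<lambda>A f as v bs. ksgn (degs (susp A) as) (f as v bs)" by simp

lift_definition sgr :: "('k, 'a::ab_group_add) ainf \<Rightarrow> ('a, 'm::ab_group_add, 'w::ab_group_add) tmap \<Rightarrow> ('a, 'm, 'w) tmap"
  is "\<lambda>A f as v bs. ksgn (degs (susp A) bs) (f as v bs)" by simp

lift_definition insl :: "('k, 'a::ab_group_add) ainf \<Rightarrow> ('a, 'm::ab_group_add, 'w::ab_group_add) tmap \<Rightarrow> ('a, 'm, 'w) tmap"
  is "\<lambda>A f as v bs. if as \<in> lists (letters A) then mhat A (\<lambda>x. f x v bs) as else 0"
  by (auto simp: mhat_add[symmetric] intro!: mhat_cong)

lift_definition insr :: "('k, 'a::ab_group_add) ainf \<Rightarrow> ('a, 'm::ab_group_add, 'w::ab_group_add) tmap \<Rightarrow> ('a, 'm, 'w) tmap"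
  is "\<lambda>A f as v bs. if bs \<in> lists (letters A) then mhat A (\<lambda>x. f as v x) bs else 0"
  by (auto simp: mhat_add[symmetric] intro!: mhat_cong)

lemma app_sgl: "app (sgl A f) as v bs = ksgn (degs (susp A) as) (app f as v bs)"
  and app_sgr: "app (sgr A f) as v bs = ksgn (degs (susp A) bs) (app f as v bs)"
  and app_insl: "app (insl A f) as v bs = (if as \<in> lists (letters A) then mhat A (\<lambda>x. app f x v bs) as else 0)"
  and app_insr: "app (insr A f) as v bs = (if bs \<in> lists (letters A) then mhat A (\<lambda>x. app f as v x) bs else 0)"
  by (transfer; simp)+

lemmas app_ops = app_sgl app_sgr app_insl app_insr

lemma ops_add:
  "sgl A (f + g) = sgl A f + sgl A g" "sgr A (f + g) = sgr A f + sgr A g"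
  "insl A (f + g) = insl A f + insl A g" "insr A (f + g) = insr A f + insr A g"
  by (rule tmap_eqI; simp add: app_ops mhat_add)+

lemma ops_minus:
  "sgl A (- f) = - sgl A f" "sgr A (- f) = - sgr A f"
  "insl A (- f) = - insl A f" "insr A (- f) = - insr A f"
  by (rule tmap_eqI; simp add: app_ops mhat_minus)+

lemma ops_diff:
  "sgl A (f - g) = sgl A f - sgl A g" "sgr A (f - g) = sgr A f - sgr A g"
  "insl A (f - g) = insl A f - insl A g" "insr A (f - g) = insr A f - insr A g"
  using ops_add[of A f "- g"] by (simp_all add: ops_minus)

lemma ops_zero [simp]: "sgl A 0 = 0" "sgr A 0 = 0" "insl A 0 = 0" "insr A 0 = 0"
  by (rule tmap_eqI; simp add: app_ops)+

lemma sgl_sgl [simp]: "sgl A (sgl A f) = f"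
  by (rule tmap_eqI) (auto simp: app_ops intro: ksgn_cong[of _ 0, simplified])

lemma sgr_sgr [simp]: "sgr A (sgr A f) = f"
  by (rule tmap_eqI) (auto simp: app_ops intro: ksgn_cong[of _ 0, simplified])

lemma sgr_sgl: "sgr A (sgl A f) = sgl A (sgr A f)"
  by (rule tmap_eqI) (simp add: app_ops add.commute)

lemma insl_sgr: "insl A (sgr A f) = sgr A (insl A f)"
  by (rule tmap_eqI) (simp add: app_ops mhat_ksgn)

lemma insr_sgl: "insr A (sgl A f) = sgl A (insr A f)"
  by (rule tmap_eqI) (simp add: app_ops mhat_ksgn)

lemma sgl_tcomp: "sgl A (F \<odot> f) = sgl A F \<odot> sgl A f"
proof (rule tmap_eqI)
  fix as v bs
  have "app (sgl A (F \<odot> f)) as v bs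
      = spl (\<lambda>x y. spl (\<lambda>u w. ksgn (degs (susp A) as) (app F x (app f y v u) w)) bs) as"
    by (simp add: app_ops app_tcomp spl_ksgn)
  also have "\<dots> = app (sgl A F \<odot> sgl A f) as v bs"
    by (auto simp: app_ops app_tcomp add.commute intro!: spl_cong)
  finally show "app (sgl A (F \<odot> f)) as v bs = app (sgl A F \<odot> sgl A f) as v bs" .
qed

lemma sgr_tcomp: "sgr A (F \<odot> f) = sgr A F \<odot> sgr A f"
proof (rule tmap_eqI)
  fix as v bs
  have "app (sgr A (F \<odot> f)) as v bs
      = spl (\<lambda>x y. spl (\<lambda>u w. ksgn (degs (susp A) bs) (app F x (app f y v u) w)) bs) as"
    by (simp add: app_ops app_tcomp spl_ksgn)
  also have "\<dots> = app (sgr A F \<odot> sgr A f) as v bs"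
    by (auto simp: app_ops app_tcomp add.commute intro!: spl_cong)
  finally show "app (sgr A (F \<odot> f)) as v bs = app (sgr A F \<odot> sgr A f) as v bs" .
qed

lemma sgl_conc [simp]: "sgl A (conc h) = conc h"
  and sgr_conc [simp]: "sgr A (conc h) = conc h"
proof -
  show "sgl A (conc h) = conc h"
    by (rule tmap_eqI) (metis (no_types) app_conc_nonempty app_sgl degs_Nil ksgn_0 ksgn_zero)
  show "sgr A (conc h) = conc h"
    by (rule tmap_eqI) (metis (no_types) app_conc_nonempty app_sgr degs_Nil ksgn_0 ksgn_zero)
qed

lemma mhat_eq_0: "(\<And>x. x \<noteq> [] \<Longrightarrow> F x = 0) \<Longrightarrow> mhat A F as = 0"
  unfolding mhat_def by simp

lemma ins_conc [simp]: "insl A (conc h) = 0" "insr A (conc h) = 0"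
  by (rule tmap_eqI; simp add: app_ops mhat_eq_0)+

lemma nrm_insl [intro]: "nrm A f \<Longrightarrow> nrm A (insl A f)"
  and nrm_insr [intro]: "nrm A f \<Longrightarrow> nrm A (insr A f)"
  and nrm_sgl [intro]: "nrm A f \<Longrightarrow> nrm A (sgl A f)"
  and nrm_sgr [intro]: "nrm A f \<Longrightarrow> nrm A (sgr A f)"
  and nrm_add [intro]: "nrm A f \<Longrightarrow> nrm A g \<Longrightarrow> nrm A (f + g)"
  and nrm_diff [intro]: "nrm A f \<Longrightarrow> nrm A g \<Longrightarrow> nrm A (f - g)"
  and nrm_minus [intro]: "nrm A f \<Longrightarrow> nrm A (- f)"
  and nrm_0 [intro, simp]: "nrm A 0"
  by (auto simp: nrm_def app_ops mhat_zero)

lemma nrm_conc [intro, simp]: "nrm A (conc h)"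
  unfolding nrm_def by (metis app_conc_nonempty lists.Nil)

lemma nrm_tcomp [intro]: assumes "nrm A F" "nrm A f" shows "nrm A (F \<odot> f)"
  unfolding nrm_def
proof (intro allI impI)
  fix as v bs assume l: "\<not> (as \<in> lists (letters A) \<and> bs \<in> lists (letters A))"
  show "app (F \<odot> f) as v bs = 0"
    unfolding app_tcomp
  proof (intro spl_zeroI)
    fix x y u w assume "x @ y = as" "u @ w = bs"
    then have "\<not> (x \<in> lists (letters A) \<and> w \<in> lists (letters A)) \<or> \<not> (y \<in> lists (letters A) \<and> u \<in> lists (letters A))"
      using l by auto
    then show "app F x (app f y v u) w = 0"
      using assms unfolding nrm_def by (metis app_zero)
  qed
qed

text \<open>The product is inserted into the letters consumed by the outer or by the inner
  family; in the second case it passes the letters of the outer one. On the right it is the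
  other way round, since there the letters of the inner family come first.\<close>

lemma insl_tcomp:
  assumes "nrm A F" "nrm A f"
  shows "insl A (F \<odot> f) = insl A F \<odot> f + sgl A F \<odot> insl A f"
proof (rule tmap_eqI)
  fix as v bs
  show "app (insl A (F \<odot> f)) as v bs = app (insl A F \<odot> f + sgl A F \<odot> insl A f) as v bs"
  proof (cases "as \<in> lists (letters A)")
    case True
    have "app (insl A (F \<odot> f)) as v bs =
        spl (\<lambda>x y. mhat A (\<lambda>z. spl (\<lambda>u w. app F z (app f y v u) w) bs) x
          + ksgn (degs (susp A) x) (mhat A (\<lambda>z. spl (\<lambda>u w. app F x (app f z v u) w) bs) y)) as"
      using True by (simp add: app_ops app_tcomp mhat_spl)
    also have "\<dots> = spl (\<lambda>x y. spl (\<lambda>u w. app (insl A F) x (app f y v u) w) bs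
          + spl (\<lambda>u w. app (sgl A F) x (app (insl A f) y v u) w) bs) as"
    proof (intro spl_cong)
      fix x y assume "x @ y = as"
      then have xy: "x \<in> lists (letters A)" "y \<in> lists (letters A)" using True by auto
      have 1: "mhat A (\<lambda>z. spl (\<lambda>u w. app F z (app f y v u) w) bs) x
          = spl (\<lambda>u w. app (insl A F) x (app f y v u) w) bs"
        using xy by (simp add: app_insl spl_mhat_swap)
      have "app F x (app (insl A f) y v u) w = mhat A (\<lambda>z. app F x (app f z v u) w) y" for u w
        using xy by (simp add: app_insl app_mhat)
      then have 2: "ksgn (degs (susp A) x) (mhat A (\<lambda>z. spl (\<lambda>u w. app F x (app f z v u) w) bs) y)
          = spl (\<lambda>u w. app (sgl A F) x (app (insl A f) y v u) w) bs"
        by (simp add: app_sgl spl_ksgn spl_mhat_swap)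
      show "mhat A (\<lambda>z. spl (\<lambda>u w. app F z (app f y v u) w) bs) x
          + ksgn (degs (susp A) x) (mhat A (\<lambda>z. spl (\<lambda>u w. app F x (app f z v u) w) bs) y)
        = spl (\<lambda>u w. app (insl A F) x (app f y v u) w) bs
          + spl (\<lambda>u w. app (sgl A F) x (app (insl A f) y v u) w) bs"
        by (simp only: 1 2)
    qed
    also have "\<dots> = app (insl A F \<odot> f + sgl A F \<odot> insl A f) as v bs"
      by (simp add: app_tcomp spl_add)
    finally show ?thesis .
  next
    case False
    have "nrm A (insl A (F \<odot> f))" "nrm A (insl A F \<odot> f + sgl A F \<odot> insl A f)"
      using assms by blast+
    with False show ?thesis by (simp add: nrm_def)
  qed
qed

lemma insr_tcomp:
  assumes "nrm A F" "nrm A f"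
  shows "insr A (F \<odot> f) = F \<odot> insr A f + insr A F \<odot> sgr A f"
proof (rule tmap_eqI)
  fix as v bs
  show "app (insr A (F \<odot> f)) as v bs = app (F \<odot> insr A f + insr A F \<odot> sgr A f) as v bs"
  proof (cases "bs \<in> lists (letters A)")
    case True
    have "app (insr A (F \<odot> f)) as v bs =
        spl (\<lambda>x y. mhat A (spl (\<lambda>u w. app F x (app f y v u) w)) bs) as"
      using True by (auto simp: app_ops app_tcomp spl_mhat_swap intro!: mhat_cong)
    also have "\<dots> = spl (\<lambda>x y. spl (\<lambda>u w. mhat A (\<lambda>z. app F x (app f y v z) w) u
         + ksgn (degs (susp A) u) (mhat A (\<lambda>z. app F x (app f y v u) z) w)) bs) as"
      by (simp add: mhat_spl)
    also have "\<dots> = spl (\<lambda>x y. spl (\<lambda>u w. app F x (app (insr A f) y v u) w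
         + app (insr A F) x (app (sgr A f) y v u) w) bs) as"
      using True by (intro spl_cong) (auto simp: app_ops app_mhat mhat_ksgn)
    also have "\<dots> = app (F \<odot> insr A f + insr A F \<odot> sgr A f) as v bs"
      by (simp add: app_tcomp spl_add)
    finally show ?thesis .
  next
    case False
    have "nrm A (insr A (F \<odot> f))" "nrm A (F \<odot> insr A f + insr A F \<odot> sgr A f)"
      using assms by blast+
    with False show ?thesis by (simp add: nrm_def)
  qed
qed

section \<open>Graded spaces\<close>

lemma vector_space_field: "vector_space ((*) :: 'k::field \<Rightarrow> 'k \<Rightarrow> 'k)"
  by unfold_locales (simp_all add: algebra_simps)

lemma vector_space_functions: "vector_space (\<lambda>(c::'k::field) \<phi> (w::'m). c * \<phi> w :: 'k)"
  by unfold_locales (simp_all add: fun_eq_iff algebra_simps)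

text \<open>Linearity without the vector space axioms, which are always known from the context.\<close>

definition homogeneous_map :: "('k \<Rightarrow> 'v \<Rightarrow> 'v) \<Rightarrow> ('k \<Rightarrow> 'w \<Rightarrow> 'w) \<Rightarrow> ('v::ab_group_add \<Rightarrow> 'w::ab_group_add) \<Rightarrow> bool" where
  "homogeneous_map s1 s2 h \<longleftrightarrow> (\<forall>x y. h (x + y) = h x + h y) \<and> (\<forall>c x. h (s1 c x) = s2 c (h x))"

lemma homogeneous_mapD:
  assumes "homogeneous_map s1 s2 h"
  shows "h (x + y) = h x + h y" "h (s1 c x) = s2 c (h x)" "h 0 = 0" "h (- x) = - h x"
    "h (x - y) = h x - h y" "h (ksgn s x) = ksgn s (h x)"
proof -
  have a: "\<And>x y. h (x + y) = h x + h y" using assms by (auto simp: homogeneous_map_def)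
  then show "h (x + y) = h x + h y" "h 0 = 0" "h (- x) = - h x" "h (x - y) = h x - h y" "h (ksgn s x) = ksgn s (h x)"
    by (auto intro: additive_zero additive_minus additive_diff additive_ksgn)
  show "h (s1 c x) = s2 c (h x)" using assms by (auto simp: homogeneous_map_def)
qed

lemma linear_iff_homogeneous_map:
  "vector_space s1 \<Longrightarrow> vector_space s2 \<Longrightarrow> Vector_Spaces.linear s1 s2 h \<longleftrightarrow> homogeneous_map s1 s2 h"
  unfolding homogeneous_map_def Vector_Spaces.linear_def module_hom_def module_hom_axioms_def
  by (metis module_iff_vector_space)

lemma homogeneous_map_conc_apply:
  "homogeneous_map s1 s2 h \<Longrightarrow> app (conc h) as v bs = (if as = [] \<and> bs = [] then h v else 0)"
  "homogeneous_map s1 s2 h \<Longrightarrow> app (conc h \<odot> f) as u bs = h (app f as u bs)"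
  "homogeneous_map s1 s2 h \<Longrightarrow> app (F \<odot> conc h) as v bs = app F as (h v) bs"
  by (simp_all add: homogeneous_map_def app_conc app_conc_tcomp app_tcomp_conc)

locale graded =
  fixes V :: "('k::field, 'c::ab_group_add, 'x) gspace_scheme"
  assumes graded: "graded_space V"
begin

sublocale vs: vector_space "scl V"
  using graded by (simp add: graded_space_def)

lemma gr_subspace: "vs.subspace (gr V n)"
  using graded by (simp add: graded_space_def)

lemma gr_zero [simp, intro]: "0 \<in> gr V n"
  and gr_add [intro]: "x \<in> gr V n \<Longrightarrow> y \<in> gr V n \<Longrightarrow> x + y \<in> gr V n"
  and gr_scale [intro]: "x \<in> gr V n \<Longrightarrow> scl V c x \<in> gr V n"
  and gr_minus [intro]: "x \<in> gr V n \<Longrightarrow> - x \<in> gr V n"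
  and gr_diff [intro]: "x \<in> gr V n \<Longrightarrow> y \<in> gr V n \<Longrightarrow> x - y \<in> gr V n"
  using gr_subspace[of n]
  by (auto simp: vs.subspace_def intro: vs.subspace_neg[OF gr_subspace] vs.subspace_diff[OF gr_subspace])

lemma gr_ksgn [intro]: "x \<in> gr V n \<Longrightarrow> ksgn s x \<in> gr V n"
  by (auto simp: ksgn_def)

lemma gr_sum [intro]: "(\<And>i. i \<in> I \<Longrightarrow> f i \<in> gr V n) \<Longrightarrow> sum f I \<in> gr V n"
  by (rule vs.subspace_sum[OF gr_subspace])

lemma gr_spl [intro]: "(\<And>x y. x @ y = as \<Longrightarrow> K x y \<in> gr V n) \<Longrightarrow> spl K as \<in> gr V n"
  unfolding spl_def by (rule gr_sum) auto

lemma independent_sum: "finite N \<Longrightarrow> (\<And>n. n \<in> N \<Longrightarrow> x n \<in> gr V n) \<Longrightarrow> (\<Sum>n\<in>N. x n) = 0 \<Longrightarrow> n \<in> N \<Longrightarrow> x n = 0"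
  using graded unfolding graded_space_def by blast

lemma gr_disjoint: assumes "x \<in> gr V n" "x \<in> gr V m" "n \<noteq> m" shows "x = 0"
proof -
  have "(if n = n then x else - x) = 0"
    by (rule independent_sum[of "{n, m}" "\<lambda>i. if i = n then x else - x"]) (use assms in auto)
  then show ?thesis by simp
qed

lemma deg_eq: "x \<in> gr V n \<Longrightarrow> x \<noteq> 0 \<Longrightarrow> deg V x = n"
  unfolding deg_def using gr_disjoint by (intro the_equality) auto

lemma homogI [intro]: "x \<in> gr V n \<Longrightarrow> x \<in> homog V"
  by (auto simp: homog_def)

lemma homog_0 [simp, intro]: "0 \<in> homog V"
  by (rule homogI[of _ 0]) simp

lemma gr_deg: "x \<in> homog V \<Longrightarrow> x \<in> gr V (deg V x)"
  by (cases "x = 0") (auto simp: homog_def dest: deg_eq)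

lemma susp_graded: "graded_space (susp V)"
  unfolding graded_space_def susp_def
proof (simp, intro conjI allI impI)
  show "vector_space (scl V)" ..
  show "vs.subspace (gr V (n + 1))" for n by (rule gr_subspace)
  fix N x assume a: "finite N \<and> (\<forall>n\<in>N. x n \<in> gr V (n + 1)) \<and> sum x N = 0"
  have "(\<Sum>n\<in>(\<lambda>n. n + 1) ` N. x (n - 1)) = 0"
    using a by (subst sum.reindex) (auto simp: o_def)
  then have "x (n - 1) = 0" if "n \<in> (\<lambda>n. n + 1) ` N" for n
    using that a by (intro independent_sum[of "(\<lambda>n. n + 1) ` N" "\<lambda>n. x (n - 1)"]) auto
  then show "\<forall>n\<in>N. x n = 0" by force
qed

lemma glinear_zero:
  assumes "vector_space sW" "glinear V sW h" shows "h 0 = 0"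
proof -
  interpret W: vector_space sW by fact
  have "h (scl V 0 0) = sW 0 (h 0)" using assms(2) homog_0 unfolding glinear_def by blast
  then show ?thesis by simp
qed

end

text \<open>A map that is linear on homogeneous elements has a unique linear extension when these
  span the ambient space.\<close>

locale spanning = graded V for V :: "('k::field, 'c::ab_group_add, 'x) gspace_scheme" +
  assumes spanning: "module.span (scl V) (homog V) = UNIV"
begin

lemma homog_induct:
  assumes "\<And>n v. v \<in> gr V n \<Longrightarrow> P v" "\<And>x y. P x \<Longrightarrow> P y \<Longrightarrow> P (x + y)"
  shows "P v"
proof (rule vs.span_induct_alt[of v "homog V"])
  show "v \<in> vs.span (homog V)" by (simp add: spanning)
  show "P 0" using assms(1) gr_zero by blast
  show "P (scl V c x + y)" if "x \<in> homog V" "P y" for c x y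
    using that assms by (metis gr_deg gr_scale)
qed

lemma additive_eqI:
  assumes "\<And>n v. v \<in> gr V n \<Longrightarrow> f v = g v"
    "\<And>x y. f (x + y) = f x + f y" "\<And>x y. g (x + y) = g x + g y"
  shows "f v = g v"
  by (rule homog_induct[of "\<lambda>v. f v = g v"]) (simp_all add: assms)

lemma tmap_eq_on_homog:
  "(\<And>as v bs n. v \<in> gr V n \<Longrightarrow> app f as v bs = app g as v bs) \<Longrightarrow> f = g"
  by (rule tmap_eqI, rule additive_eqI) auto

lemma finite_decomposition:
  "\<exists>c. (\<forall>n. c n \<in> gr V n) \<and> finite {n. c n \<noteq> 0} \<and> v = (\<Sum>n | c n \<noteq> 0. c n)"
proof (rule homog_induct[of _ v], goal_cases)
  case (1 n v)
  then show ?case by (intro exI[of _ "\<lambda>i. if i = n then v else 0"]) auto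
next
  case (2 x y)
  then obtain c c' where c: "\<forall>n. c n \<in> gr V n" "finite {n. c n \<noteq> 0}" "x = (\<Sum>n | c n \<noteq> 0. c n)"
    and c': "\<forall>n. c' n \<in> gr V n" "finite {n. c' n \<noteq> 0}" "y = (\<Sum>n | c' n \<noteq> 0. c' n)" by blast
  let ?N = "{n. c n \<noteq> 0} \<union> {n. c' n \<noteq> 0}"
  have "x = sum c ?N" "y = sum c' ?N"
    unfolding c(3) c'(3) using c c' by (auto intro!: sum.mono_neutral_left)
  moreover have "(\<Sum>n | c n + c' n \<noteq> 0. c n + c' n) = (\<Sum>n\<in>?N. c n + c' n)"
    using c c' by (intro sum.mono_neutral_left) auto
  ultimately show ?case using c c'
    by (intro exI[of _ "\<lambda>n. c n + c' n"])
       (auto simp: sum.distrib intro: finite_subset[of _ ?N])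
qed

definition component :: "'c \<Rightarrow> int \<Rightarrow> 'c" where
  "component v = (SOME c. (\<forall>n. c n \<in> gr V n) \<and> finite {n. c n \<noteq> 0} \<and> v = (\<Sum>n | c n \<noteq> 0. c n))"

definition extend :: "('c \<Rightarrow> 'w::ab_group_add) \<Rightarrow> 'c \<Rightarrow> 'w" where
  "extend h v = (\<Sum>n | component v n \<noteq> 0. h (component v n))"

text \<open>Homogeneous components are unique because the graded pieces are independent. Hence
  choosing them is additive, and the extension can be defined componentwise.\<close>

lemma extend:
  assumes "vector_space sW" "glinear V sW h"
  shows "homogeneous_map (scl V) sW (extend h)" "v \<in> homog V \<Longrightarrow> extend h v = h v"
proof -
  interpret W: vector_space sW by fact
  note h0 = glinear_zero[OF assms]
  define c where "c = component"
  have c: "\<And>v n. c v n \<in> gr V n" "\<And>v. finite {n. c v n \<noteq> 0}" "\<And>v. v = (\<Sum>n | c v n \<noteq> 0. c v n)"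
    unfolding c_def component_def using someI_ex[OF finite_decomposition] by blast+
  have cN: "(\<Sum>n\<in>N. c v n) = v" if "finite N" "{n. c v n \<noteq> 0} \<subseteq> N" for N v
    using that by (subst (2) c(3)) (auto intro!: sum.mono_neutral_right)
  have uniq: "c v n = x n" if "finite N" "\<And>n. x n \<in> gr V n" "v = sum x N" "\<And>n. n \<notin> N \<Longrightarrow> x n = 0" for v x N n
  proof -
    let ?M = "N \<union> {n. c v n \<noteq> 0}"
    have "v = sum x ?M"
      unfolding that(3) using that(1,4) c(2) by (intro sum.mono_neutral_left) auto
    then have "(\<Sum>n\<in>?M. c v n - x n) = 0"
      using cN[of ?M v] that c by (simp add: sum_subtractf)
    then have "n \<in> ?M \<Longrightarrow> c v n - x n = 0"
      using that c by (intro independent_sum[of ?M "\<lambda>n. c v n - x n"]) auto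
    then show ?thesis using that(4)[of n] by (cases "n \<in> ?M") auto
  qed
  have cadd: "c (v + w) n = c v n + c w n" for v w n
  proof -
    let ?N = "{n. c v n \<noteq> 0} \<union> {n. c w n \<noteq> 0}"
    show ?thesis
      by (rule uniq[of ?N]) (use c cN[of ?N v] cN[of ?N w] in \<open>auto simp: sum.distrib\<close>)
  qed
  have cscale: "c (scl V k v) n = scl V k (c v n)" for k v n
    by (rule uniq[of "{n. c v n \<noteq> 0}"])
       (use c in \<open>auto simp: vs.scale_sum_right[symmetric]\<close>)
  have chom: "c v m = (if m = n then v else 0)" if "v \<in> gr V n" for v n m
    by (rule uniq[of "{n}"]) (use that in auto)
  define H where H_eq: "H = extend h"
  have H_def: "H v = (\<Sum>n | c v n \<noteq> 0. h (c v n))" for v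
    by (simp add: H_eq extend_def c_def)
  have H: "H v = (\<Sum>n\<in>N. h (c v n))" if "finite N" "{n. c v n \<noteq> 0} \<subseteq> N" for N v
    unfolding H_def using that by (intro sum.mono_neutral_left) (auto simp: h0)
  have hadd: "h (x + y) = h x + h y" if "x \<in> gr V n" "y \<in> gr V n" for x y n
    using assms(2) that by (auto simp: glinear_def)
  have hscale: "h (scl V k x) = sW k (h x)" if "x \<in> gr V n" for x k n
    using assms(2) homogI[OF that] unfolding glinear_def by blast
  have "homogeneous_map (scl V) sW H"
      unfolding homogeneous_map_def
    proof (intro conjI allI)
      fix v w
      let ?N = "{n. c v n \<noteq> 0} \<union> {n. c w n \<noteq> 0}"
      have "H (v + w) = (\<Sum>n\<in>?N. h (c (v + w) n))"
        by (rule H) (use c cadd in auto)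
      also have "\<dots> = (\<Sum>n\<in>?N. h (c v n) + h (c w n))"
        by (simp add: cadd hadd[OF c(1) c(1)])
      also have "\<dots> = H v + H w"
        using c by (simp add: sum.distrib H[of ?N v] H[of ?N w])
      finally show "H (v + w) = H v + H w" .
    next
      fix k v
      have "H (scl V k v) = (\<Sum>n | c v n \<noteq> 0. h (c (scl V k v) n))"
        by (rule H) (use c cscale in auto)
      also have "\<dots> = sW k (H v)"
        by (simp add: cscale hscale[OF c(1)] H_def W.scale_sum_right)
      finally show "H (scl V k v) = sW k (H v)" .
    qed
  then show "homogeneous_map (scl V) sW (extend h)" by (simp add: H_eq)
  assume "v \<in> homog V"
  then obtain n where "v \<in> gr V n" by (auto simp: homog_def)
  then have "H v = h v"
    by (subst H[of "{n}"]) (auto simp: chom)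
  then show "extend h v = h v" by (simp add: H_eq)
qed

lemma glinear_extension:
  assumes "vector_space sW" "glinear V sW h"
  shows "\<exists>H. homogeneous_map (scl V) sW H \<and> (\<forall>v\<in>homog V. H v = h v)"
  using extend[OF assms] by blast

end

text \<open>Enlarging the part of degree \<open>0\<close> by a complement of the direct sum makes the homogeneous
  elements span the ambient space.\<close>

lemma spanning_enlargement:
  fixes C :: "('k::field, 'c::ab_group_add, 'x) gspace_scheme"
  assumes "graded_space C"
  shows "\<exists>(V :: ('k, 'c) gspace) e. spanning V \<and> scl V = scl C \<and> homogeneous_map (scl C) (scl C) e \<and>
    (\<forall>n. gr C n \<subseteq> gr V n \<and> (\<forall>v\<in>gr V n. e v \<in> gr C n) \<and> (\<forall>v\<in>gr C n. e v = v))"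
proof -
  interpret C: graded C by unfold_locales fact
  interpret vp: vector_space_pair "scl C" "scl C" ..
  have "Vector_Spaces.linear (scl C) (scl C) (\<lambda>x. x)" by (rule C.vs.linear_ident)
  from vp.linear_exists_left_inverse_on[OF this, of "C.vs.span (homog C)"]
  obtain e where e: "range e \<subseteq> C.vs.span (homog C)" "Vector_Spaces.linear (scl C) (scl C) e"
    "\<And>v. v \<in> C.vs.span (homog C) \<Longrightarrow> e v = v" by auto
  have el: "homogeneous_map (scl C) (scl C) e"
    using e(2) by (simp add: linear_iff_homogeneous_map C.vs.vector_space_axioms)
  note el' = homogeneous_mapD[OF el]
  have e_gr: "e v = v" if "v \<in> gr C n" for v n
    using that by (intro e(3) C.vs.span_base) auto
  define V :: "('k, 'c) gspace" where
    "V = \<lparr>scl = scl C, gr = (\<lambda>n. if n = 0 then {v. e v \<in> gr C 0} else gr C n)\<rparr>"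
  have eV: "e v \<in> gr C n" if "v \<in> gr V n" for v n
    using that e_gr by (auto simp: V_def split: if_splits)
  have sub: "gr C n \<subseteq> gr V n" for n
    using e_gr by (auto simp: V_def)
  have gV: "graded_space V"
    unfolding graded_space_def
  proof (intro conjI allI impI ballI)
    show "vector_space (scl V)" by (simp add: V_def C.vs.vector_space_axioms)
    show "module.subspace (scl V) (gr V n)" for n
      by (auto simp: V_def C.vs.subspace_def el')
    fix N x n assume a: "finite N \<and> (\<forall>n\<in>N. x n \<in> gr V n) \<and> (\<Sum>n\<in>N. x n) = 0" and n: "n \<in> N"
    have "(\<Sum>n\<in>N. e (x n)) = e (\<Sum>n\<in>N. x n)" by (rule additive_sum[symmetric]) (rule el')
    then have "(\<Sum>n\<in>N. e (x n)) = 0" using a by (simp add: el')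
    then have ex: "e (x n) = 0" if "n \<in> N" for n
      using C.independent_sum[of N "\<lambda>n. e (x n)" n] a eV that by auto
    have x0: "x n = 0" if "n \<in> N" "n \<noteq> 0" for n
      using ex[OF that(1)] e_gr[of "x n" n] a that by (auto simp: V_def)
    have "(\<Sum>n\<in>N. x n) = x n" if "n = 0"
      using a n that x0 by (subst sum.remove[of N n]) (auto intro!: sum.neutral)
    then show "x n = 0" using x0[OF n] a by (cases "n = 0") auto
  qed
  interpret V: graded V by unfold_locales fact
  have "spanning V"
  proof unfold_locales
    have "v \<in> V.vs.span (homog V)" for v
    proof -
      have "homog C \<subseteq> homog V" using sub by (auto simp: homog_def)
      then have "C.vs.span (homog C) \<subseteq> C.vs.span (homog V)" by (rule C.vs.span_mono)
      moreover have "e v \<in> C.vs.span (homog C)" using e by auto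
      ultimately have 1: "e v \<in> V.vs.span (homog V)" by (auto simp: V_def)
      have "e (e v) = e v" using e by auto
      then have "v - e v \<in> gr V 0" by (simp add: V_def el')
      then have 2: "v - e v \<in> V.vs.span (homog V)" by (intro V.vs.span_base) auto
      from V.vs.span_add[OF 1 2] show ?thesis by simp
    qed
    then show "V.vs.span (homog V) = UNIV" by auto
  qed
  moreover have "scl V = scl C" by (simp add: V_def)
  ultimately show ?thesis using el sub eV e_gr by blast
qed

section \<open>Multilinearity\<close>

lemma spl_append_single:
  "spl K (xs @ [x] @ ys) = spl (\<lambda>p q. K p (q @ [x] @ ys)) xs + spl (\<lambda>p q. K (xs @ [x] @ p) q) ys"
  by (induction xs arbitrary: K) (simp_all add: spl_Cons add.assoc)

lemma glinearI:
  assumes "\<And>n x y. x \<in> gr V n \<Longrightarrow> y \<in> gr V n \<Longrightarrow> h (x + y) = h x + h y"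
    and "\<And>n c x. x \<in> gr V n \<Longrightarrow> h (scl V c x) = sW c (h x)"
  shows "glinear V sW h"
  using assms by (auto simp: glinear_def homog_def)

lemma glinearD:
  assumes "glinear V sW h" "x \<in> gr V n"
  shows "y \<in> gr V n \<Longrightarrow> h (x + y) = h x + h y" "h (scl V c x) = sW c (h x)"
  using assms by (auto simp: glinear_def homog_def)

lemma (in graded) glinear_homog_cong:
  assumes "glinear V sW h" "\<And>x. x \<in> homog V \<Longrightarrow> h' x = h x"
  shows "glinear V sW h'"
proof (rule glinearI)
  fix n x assume x: "x \<in> gr V n"
  show "h' (x + y) = h' x + h' y" if "y \<in> gr V n" for y
    using glinearD(1)[OF assms(1) x that] assms(2) homogI[OF x] homogI[OF that] homogI[OF gr_add[OF x that]] by simp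
  show "h' (scl V c x) = sW c (h' x)" for c
    using glinearD(2)[OF assms(1) x] assms(2) homogI[OF x] homogI[OF gr_scale[OF x]] by simp
qed

locale glin = V: graded V + W: vector_space sW
  for V :: "('k::field, 'v::ab_group_add, 'x) gspace_scheme" and sW :: "'k \<Rightarrow> 'w::ab_group_add \<Rightarrow> 'w"
begin

lemma glinear_0 [intro, simp]: "glinear V sW (\<lambda>x. 0)"
  by (rule glinearI) auto

lemma glinear_plus [intro]: "glinear V sW f \<Longrightarrow> glinear V sW g \<Longrightarrow> glinear V sW (\<lambda>x. f x + g x)"
  by (rule glinearI) (auto simp: glinearD W.scale_right_distrib)

lemma glinear_minus [intro]: "glinear V sW f \<Longrightarrow> glinear V sW (\<lambda>x. - f x)"
  by (rule glinearI) (auto simp: glinearD)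

lemma glinear_ksgn [intro]: "glinear V sW f \<Longrightarrow> glinear V sW (\<lambda>x. ksgn s (f x))"
  by (cases "even s") (auto simp: ksgn_def)

lemma glinear_sum [intro]: "(\<And>i. i \<in> I \<Longrightarrow> glinear V sW (f i)) \<Longrightarrow> glinear V sW (\<lambda>x. \<Sum>i\<in>I. f i x)"
  by (induction I rule: infinite_finite_induct) auto

lemma glinear_spl:
  "(\<And>p q. p @ q = as \<Longrightarrow> glinear V sW (\<lambda>x. K x p q)) \<Longrightarrow> glinear V sW (\<lambda>x. spl (K x) as)"
  unfolding spl_def by (rule glinear_sum) auto

lemma glinear_zero: "glinear V sW h \<Longrightarrow> h 0 = 0"
  using V.glinear_zero[OF W.vector_space_axioms] by blast

text \<open>The degree is constant on the nonzero elements of a graded piece, so a sign depending on it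
  does not destroy linearity.\<close>

lemma glinear_degree_sign:
  assumes h: "glinear V sW h"
  shows "glinear V sW (\<lambda>x. ksgn (s + deg V x) (h x))"
proof -
  have h0: "h 0 = 0" by (rule glinear_zero[OF h])
  have *: "ksgn (s + deg V x) (h x) = ksgn (s + n) (h x)" if "x \<in> gr V n" for x n
    using that V.deg_eq[OF that] by (cases "x = 0") (auto simp: h0)
  have g: "glinear V sW (\<lambda>x. ksgn (s + n) (h x))" for n
    using h by (rule glinear_ksgn)
  show ?thesis
  proof (rule glinearI)
    fix n x assume x: "x \<in> gr V n"
    show "ksgn (s + deg V (x + y)) (h (x + y)) = ksgn (s + deg V x) (h x) + ksgn (s + deg V y) (h y)"
      if y: "y \<in> gr V n" for y
      unfolding *[OF x] *[OF y] *[OF V.gr_add[OF x y]] by (rule glinearD(1)[OF g x y])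
    show "ksgn (s + deg V (scl V c x)) (h (scl V c x)) = sW c (ksgn (s + deg V x) (h x))" for c
      unfolding *[OF x] *[OF V.gr_scale[OF x]] by (rule glinearD(2)[OF g x])
  qed
qed

lemma glinear_homogeneous_map:
  "vector_space sU \<Longrightarrow> glinear V sU h \<Longrightarrow> homogeneous_map sU sW H \<Longrightarrow> glinear V sW (\<lambda>x. H (h x))"
  by (rule glinearI) (auto simp: glinearD homogeneous_mapD)

lemma glinear_spl_letter:
  assumes "\<And>p q. p @ q = xs \<Longrightarrow> glinear V sW (\<lambda>x. K p (q @ [x] @ ys))"
    and "\<And>p q. p @ q = ys \<Longrightarrow> glinear V sW (\<lambda>x. K (xs @ [x] @ p) q)"
  shows "glinear V sW (\<lambda>x. spl K (xs @ [x] @ ys))"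
  unfolding spl_append_single by (intro glinear_plus glinear_spl assms)

end

locale words = A: graded A + spanning V
  for A :: "('k::field, 'a::ab_group_add) ainf" and V :: "('k, 'c::ab_group_add) gspace" +
  assumes algebra: "ainf_algebra A"
begin

abbreviation "H \<equiv> lists (homog A)"
abbreviation "L \<equiv> lists (letters A)"
abbreviation "dg \<equiv> degs (susp A)"

sublocale SA: graded "susp A" by unfold_locales (rule A.susp_graded)

lemma homog_susp [simp]: "homog (susp A) = homog A"
proof -
  have "x \<in> homog (susp A)" if "x \<in> gr A n" for x n
    using that by (auto simp: homog_def susp_def intro!: exI[of _ "n - 1"])
  then show ?thesis by (auto simp: homog_def susp_def)
qed

lemma gr_susp [simp]: "gr (susp A) n = gr A (n + 1)"
  and scl_susp [simp]: "scl (susp A) = scl A"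
  by (simp_all add: susp_def)

lemma glinear_susp [simp]: "glinear (susp A) sW h \<longleftrightarrow> glinear A sW h"
proof -
  have shift: "(\<forall>n. P (n + 1)) \<longleftrightarrow> (\<forall>n. P n)" for P :: "int \<Rightarrow> bool"
    by (auto dest: spec[of _ "_ - 1"])
  show ?thesis
    unfolding glinear_def homog_susp gr_susp scl_susp
    using shift[of "\<lambda>n. \<forall>x\<in>gr A n. \<forall>y\<in>gr A n. h (x + y) = h x + h y"] by simp
qed

lemma L_sub_H: "as \<in> L \<Longrightarrow> as \<in> H"
  by (auto simp: letters_def)

lemma mu_degree: "xs \<in> H \<Longrightarrow> xs \<noteq> [] \<Longrightarrow> mu A xs \<in> gr A (dg xs + 1 + 1)"
  using algebra by (simp add: ainf_algebra_def)

lemma mu_homog [intro]: "xs \<in> H \<Longrightarrow> xs \<noteq> [] \<Longrightarrow> mu A xs \<in> homog A"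
  using mu_degree by (blast intro: A.homogI)

lemma deg_mu: "xs \<in> H \<Longrightarrow> xs \<noteq> [] \<Longrightarrow> mu A xs \<noteq> 0 \<Longrightarrow> deg (susp A) (mu A xs) = dg xs + 1"
  by (rule SA.deg_eq) (use mu_degree in auto)

lemma mu_glinear: "xs \<in> H \<Longrightarrow> ys \<in> H \<Longrightarrow> glinear A (scl A) (\<lambda>x. mu A (xs @ [x] @ ys))"
  using algebra by (simp add: ainf_algebra_def)

lemma glinear_mu_compose:
  assumes "glinear A sW h" "xs \<in> H" "ys \<in> H"
  shows "glinear A sW (\<lambda>x. h (mu A (xs @ [x] @ ys)))"
proof (rule glinearI)
  have mem: "mu A (xs @ [x] @ ys) \<in> gr A (dg xs + n + dg ys + 1)" if "x \<in> gr A n" for x n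
  proof (cases "x = 0")
    case True
    have "mu A (xs @ [x] @ ys) = 0"
      using A.glinear_zero[OF A.vs.vector_space_axioms mu_glinear[OF assms(2,3)]] True by simp
    then show ?thesis by simp
  next
    case False
    then have "deg (susp A) x = n - 1" using that by (intro SA.deg_eq) auto
    then show ?thesis
      using mu_degree[of "xs @ [x] @ ys"] that A.homogI[OF that] assms by (auto simp: algebra_simps)
  qed
  fix n x y assume x: "x \<in> gr A n"
  {
    assume y: "y \<in> gr A n"
    have "mu A (xs @ [x + y] @ ys) = mu A (xs @ [x] @ ys) + mu A (xs @ [y] @ ys)"
      by (rule glinearD(1)[OF mu_glinear[OF assms(2,3)] x y])
    then show "h (mu A (xs @ [x + y] @ ys)) = h (mu A (xs @ [x] @ ys)) + h (mu A (xs @ [y] @ ys))"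
      using glinearD(1)[OF assms(1) mem[OF x] mem[OF y]] by simp
  }
  show "h (mu A (xs @ [scl A c x] @ ys)) = sW c (h (mu A (xs @ [x] @ ys)))" for c
    using glinearD(2)[OF mu_glinear[OF assms(2,3)] x] glinearD(2)[OF assms(1) mem[OF x]] by simp
qed

definition multilinear :: "('k \<Rightarrow> 'w \<Rightarrow> 'w) \<Rightarrow> ('a list \<Rightarrow> 'w::ab_group_add) \<Rightarrow> bool" where
  "multilinear sW F \<longleftrightarrow> (\<forall>xs\<in>H. \<forall>ys\<in>H. glinear A sW (\<lambda>x. F (xs @ [x] @ ys)))"

lemma multilinearD: "multilinear sW F \<Longrightarrow> xs \<in> H \<Longrightarrow> ys \<in> H \<Longrightarrow> glinear A sW (\<lambda>x. F (xs @ [x] @ ys))"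
  by (simp add: multilinear_def)

lemma multilinear_eq_0:
  assumes "vector_space sW" "multilinear sW F" "as \<in> H" "as \<notin> L"
  shows "F as = 0"
proof -
  obtain x where "x \<in> set as" "x \<notin> letters A" using assms(4) by auto
  then have "0 \<in> set as" using assms(3) by (auto simp: letters_def)
  then obtain xs ys where "as = xs @ [0] @ ys" by (metis append.left_neutral append_Cons split_list)
  with assms(3) show ?thesis
    using A.glinear_zero[OF assms(1) multilinearD[OF assms(2), of xs ys]] by simp
qed

lemma mhat_H_cong:
  assumes "\<And>x. x \<in> H \<Longrightarrow> F x = G x" "as \<in> H"
  shows "mhat A F as = mhat A G as"
  unfolding mhat_def
proof (intro sum.cong refl arg_cong[of _ _ "ksgn _"] assms(1))
  fix i j assume "i \<in> {..<length as}" "j \<in> {i<..length as}"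
  then show "take i as @ [mu A (take (j - i) (drop i as))] @ drop j as \<in> H"
    using assms(2) by (auto dest: in_set_takeD in_set_dropD intro!: mu_homog)
qed

lemma glinear_mhat_param:
  assumes "vector_space sW" "\<And>z. z \<in> H \<Longrightarrow> glinear A sW (\<lambda>x. F x z)" "as \<in> H"
  shows "glinear A sW (\<lambda>x. mhat A (F x) as)"
proof -
  interpret glin A sW using assms by (simp add: glin_def A.graded_axioms)
  show ?thesis unfolding mhat_def
  proof (intro glinear_sum glinear_ksgn assms(2))
    fix i j assume "i \<in> {..<length as}" "j \<in> {i<..length as}"
    then show "take i as @ [mu A (take (j - i) (drop i as))] @ drop j as \<in> H"
      using assms(3) by (auto dest: in_set_takeD in_set_dropD intro!: mu_homog)
  qed
qed

text \<open>The letter that varies is either a factor of the inserted product or stays outside of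
  it. In the first case the product is linear in it, and in the second case the sign in
  front only depends on its degree, which is constant on a graded piece.\<close>

lemma multilinear_mhat:
  assumes W: "vector_space sW" and F: "multilinear sW F"
  shows "multilinear sW (mhat A F)"
proof -
  interpret glin A sW using assms by (simp add: glin_def A.graded_axioms)
  have "xs \<in> H \<Longrightarrow> ys \<in> H \<Longrightarrow> multilinear sW F \<Longrightarrow> glinear A sW (\<lambda>x. mhat A F (xs @ [x] @ ys))" for xs ys F
  proof (induction xs arbitrary: F)
    case Nil
    have "glinear A sW (\<lambda>x. F ([] @ [mu A ([] @ [x] @ p)] @ q))" if "p @ q = ys" for p q
    proof -
      have "p \<in> H" "q \<in> H" using that Nil.prems by auto
      then show ?thesis
        by (intro glinear_mu_compose[of sW "\<lambda>z. F ([] @ [z] @ q)"] multilinearD[OF Nil.prems(3)] lists.Nil)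
    qed
    moreover
    interpret SW: glin "susp A" sW by unfold_locales
    have "glinear A sW (\<lambda>x. mhat A (\<lambda>y. F ([] @ [x] @ y)) ys)"
      by (rule glinear_mhat_param[OF W]) (use Nil.prems(2) multilinearD[OF Nil.prems(3), of "[]"] in auto)
    then have "glinear (susp A) sW (\<lambda>x. ksgn (0 + deg (susp A) x) (mhat A (\<lambda>y. F ([] @ [x] @ y)) ys))"
      by (intro SW.glinear_degree_sign) simp
    ultimately show ?case
      by (auto simp: mhat_Cons intro!: glinear_plus glinear_spl)
  next
    case (Cons a xs)
    then have a: "a \<in> homog A" and xs: "xs \<in> H" by auto
    have "glinear A sW (\<lambda>x. F ([] @ [mu A ((a # xs) @ [x] @ p)] @ q))" if "p @ q = ys" for p q
    proof -
      have "p \<in> H" "q \<in> H" using that Cons.prems by auto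
      with Cons.prems(1) show ?thesis
        by (intro glinear_mu_compose[of sW "\<lambda>z. F ([] @ [z] @ q)"] multilinearD[OF Cons.prems(3)] lists.Nil)
    qed
    moreover have "glinear A sW (\<lambda>x. F ((mu A (a # p) # q) @ [x] @ ys))" if "p @ q = xs" for p q
    proof -
      have "a # p \<in> H" "q \<in> H" using that Cons.prems by auto
      moreover from this have "mu A (a # p) \<in> homog A" by (intro mu_homog) auto
      ultimately show ?thesis using Cons.prems by (intro multilinearD) auto
    qed
    moreover have "glinear A sW (\<lambda>x. mhat A (\<lambda>y. F (a # y)) (xs @ [x] @ ys))"
    proof (rule Cons.IH)
      show "multilinear sW (\<lambda>y. F (a # y))"
        unfolding multilinear_def
      proof (intro ballI)
        fix p q assume "p \<in> H" "q \<in> H"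
        then show "glinear A sW (\<lambda>x. F (a # p @ [x] @ q))"
          using multilinearD[OF Cons.prems(3), of "a # p" q] a by simp
      qed
    qed (use Cons.prems in auto)
    ultimately have "glinear A sW (\<lambda>x. spl (\<lambda>p q. F (mu A (a # p) # q)) (xs @ [x] @ ys)
        + ksgn (deg (susp A) a) (mhat A (\<lambda>y. F (a # y)) (xs @ [x] @ ys)))"
      by (intro glinear_plus glinear_ksgn glinear_spl_letter) simp_all
    then show ?case
      by (simp add: mhat_Cons)
  qed
  then show ?thesis using F by (simp add: multilinear_def)
qed

text \<open>In the middle argument linearity is required on the whole space and not only on
  homogeneous elements. When these span the space, a family is thus determined by its
  values on homogeneous arguments.\<close>

definition trilin :: "('k \<Rightarrow> 'w \<Rightarrow> 'w) \<Rightarrow> ('a, 'c, 'w::ab_group_add) tmap \<Rightarrow> bool" where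
  "trilin sW f \<longleftrightarrow> nrm A f \<and> (\<forall>as bs. homogeneous_map (scl V) sW (\<lambda>v. app f as v bs))
     \<and> (\<forall>bs\<in>H. \<forall>v. multilinear sW (\<lambda>as. app f as v bs))
     \<and> (\<forall>as\<in>H. \<forall>v. multilinear sW (\<lambda>bs. app f as v bs))"

lemma trilinD:
  assumes "trilin sW f"
  shows "nrm A f" "homogeneous_map (scl V) sW (\<lambda>v. app f as v bs)"
    "bs \<in> H \<Longrightarrow> multilinear sW (\<lambda>as. app f as v bs)"
    "as \<in> H \<Longrightarrow> multilinear sW (\<lambda>bs. app f as v bs)"
    "app f as (scl V c v) bs = sW c (app f as v bs)"
    "xs \<in> H \<Longrightarrow> ys \<in> H \<Longrightarrow> bs \<in> H \<Longrightarrow> glinear A sW (\<lambda>x. app f (xs @ [x] @ ys) v bs)"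
    "xs \<in> H \<Longrightarrow> ys \<in> H \<Longrightarrow> as \<in> H \<Longrightarrow> glinear A sW (\<lambda>x. app f as v (xs @ [x] @ ys))"
proof -
  show n: "nrm A f" and h: "homogeneous_map (scl V) sW (\<lambda>v. app f as v bs)"
    and 1: "bs \<in> H \<Longrightarrow> multilinear sW (\<lambda>as. app f as v bs)"
    and 2: "as \<in> H \<Longrightarrow> multilinear sW (\<lambda>bs. app f as v bs)"
    using assms unfolding trilin_def by blast+
  show "app f as (scl V c v) bs = sW c (app f as v bs)"
    using homogeneous_mapD(2)[OF h] .
  show "xs \<in> H \<Longrightarrow> ys \<in> H \<Longrightarrow> bs \<in> H \<Longrightarrow> glinear A sW (\<lambda>x. app f (xs @ [x] @ ys) v bs)"
    using 1 multilinearD by blast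
  show "xs \<in> H \<Longrightarrow> ys \<in> H \<Longrightarrow> as \<in> H \<Longrightarrow> glinear A sW (\<lambda>x. app f as v (xs @ [x] @ ys))"
    using 2 multilinearD by blast
qed

lemma nrmD: "nrm A f \<Longrightarrow> \<not> (as \<in> L \<and> bs \<in> L) \<Longrightarrow> app f as v bs = 0"
  by (simp add: nrm_def)

text \<open>Structure maps of bimodules have \<open>r = 1\<close>, homomorphisms \<open>r = 0\<close> and contracting
  homotopies \<open>r = - 1\<close>.\<close>

definition mor :: "int \<Rightarrow> ('a, 'c, 'c) tmap \<Rightarrow> bool" where
  "mor r f \<longleftrightarrow> trilin (scl V) f \<and>
     (\<forall>as\<in>L. \<forall>bs\<in>L. \<forall>n. \<forall>v\<in>gr V n. app f as v bs \<in> gr V (dg as + n + dg bs + r))"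

lemma mor_degree: "mor r f \<Longrightarrow> v \<in> gr V n \<Longrightarrow> app f as v bs \<in> gr V (dg as + n + dg bs + r)"
  by (cases "as \<in> L \<and> bs \<in> L") (auto simp: mor_def trilin_def nrmD)

lemma mor_trilin: "mor r f \<Longrightarrow> trilin (scl V) f"
  by (simp add: mor_def)

lemma mor_nrm: "mor r f \<Longrightarrow> nrm A f"
  by (simp add: mor_def trilin_def)

lemma trilinI:
  assumes "nrm A f" "\<And>as bs c v. app f as (scl V c v) bs = sW c (app f as v bs)"
    "\<And>xs ys bs v. xs \<in> H \<Longrightarrow> ys \<in> H \<Longrightarrow> bs \<in> H \<Longrightarrow> glinear A sW (\<lambda>x. app f (xs @ [x] @ ys) v bs)"
    "\<And>xs ys as v. xs \<in> H \<Longrightarrow> ys \<in> H \<Longrightarrow> as \<in> H \<Longrightarrow> glinear A sW (\<lambda>x. app f as v (xs @ [x] @ ys))"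
  shows "trilin sW f"
  unfolding trilin_def multilinear_def homogeneous_map_def using assms by simp

lemma trilin_conc: "vector_space sW \<Longrightarrow> homogeneous_map (scl V) sW h \<Longrightarrow> trilin sW (conc h)"
proof -
  assume W: "vector_space sW" and h: "homogeneous_map (scl V) sW h"
  interpret glin A sW using W by (simp add: glin_def A.graded_axioms)
  show ?thesis
    by (rule trilinI) (simp_all add: homogeneous_map_conc_apply(1)[OF h] homogeneous_mapD[OF h] W.scale_zero_right)
qed

lemma trilin_0: "vector_space sW \<Longrightarrow> trilin sW 0"
proof -
  assume W: "vector_space sW"
  interpret glin A sW using W by (simp add: glin_def A.graded_axioms)
  show ?thesis by (rule trilinI) auto
qed

lemma trilin_add: "vector_space sW \<Longrightarrow> trilin sW f \<Longrightarrow> trilin sW g \<Longrightarrow> trilin sW (f + g)"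
proof -
  assume W: "vector_space sW" and fg: "trilin sW f" "trilin sW g"
  interpret glin A sW using W by (simp add: glin_def A.graded_axioms)
  note f = trilinD[OF fg(1)] and g = trilinD[OF fg(2)]
  show ?thesis
  proof (rule trilinI)
    show "nrm A (f + g)" using f(1) g(1) by blast
  qed (simp_all only: app_plus f(5) g(5) W.scale_right_distrib glinear_plus[OF f(6) g(6)] glinear_plus[OF f(7) g(7)])
qed

lemma trilin_minus: "vector_space sW \<Longrightarrow> trilin sW f \<Longrightarrow> trilin sW (- f)"
proof -
  assume W: "vector_space sW" and fg: "trilin sW f"
  interpret glin A sW using W by (simp add: glin_def A.graded_axioms)
  note f = trilinD[OF fg]
  show ?thesis
  proof (rule trilinI)
    show "nrm A (- f)" using f(1) by blast
  qed (simp_all only: app_uminus f(5) W.scale_minus_right glinear_minus[OF f(6)] glinear_minus[OF f(7)])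
qed

lemma trilin_post:
  assumes "vector_space sW" "vector_space sU" "trilin sU f" "homogeneous_map sU sW h"
  shows "trilin sW (conc h \<odot> f)"
proof -
  interpret glin A sW using assms by (simp add: glin_def A.graded_axioms)
  note f = trilinD[OF assms(3)]
  show ?thesis
  proof (rule trilinI)
    show "nrm A (conc h \<odot> f)" by (rule nrm_tcomp[OF nrm_conc f(1)])
    show "app (conc h \<odot> f) as (scl V c v) bs = sW c (app (conc h \<odot> f) as v bs)" for as bs c v
      unfolding homogeneous_map_conc_apply(2)[OF assms(4)] f(5) by (rule homogeneous_mapD(2)[OF assms(4)])
    show "glinear A sW (\<lambda>x. app (conc h \<odot> f) (xs @ [x] @ ys) v bs)"
      if "xs \<in> H" "ys \<in> H" "bs \<in> H" for xs ys bs v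
      unfolding homogeneous_map_conc_apply(2)[OF assms(4)]
      by (rule glinear_homogeneous_map[OF assms(2) f(6) assms(4)]) fact+
    show "glinear A sW (\<lambda>x. app (conc h \<odot> f) as v (xs @ [x] @ ys))"
      if "xs \<in> H" "ys \<in> H" "as \<in> H" for xs ys as v
      unfolding homogeneous_map_conc_apply(2)[OF assms(4)]
      by (rule glinear_homogeneous_map[OF assms(2) f(7) assms(4)]) fact+
  qed
qed

lemma glinear_signed_word:
  assumes W: "vector_space sW" and g: "glinear A sW h"
  shows "glinear A sW (\<lambda>x. ksgn (dg (xs @ [x] @ ys)) (h x))"
proof -
  interpret SW: glin "susp A" sW using assms by (simp add: glin_def SA.graded_axioms)
  have "glinear (susp A) sW (\<lambda>x. ksgn ((dg xs + dg ys) + deg (susp A) x) (h x))"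
    by (rule SW.glinear_degree_sign) (simp add: g)
  moreover have "dg (xs @ [x] @ ys) = (dg xs + dg ys) + deg (susp A) x" for x
    by simp
  ultimately show ?thesis by (simp only: glinear_susp)
qed

lemma trilin_sgl: assumes W: "vector_space sW" and f: "trilin sW f" shows "trilin sW (sgl A f)"
proof -
  interpret glin A sW using assms by (simp add: glin_def A.graded_axioms)
  interpret W: vector_space sW by fact
  note f' = trilinD[OF f]
  show ?thesis
  proof (rule trilinI)
    show "nrm A (sgl A f)" using f'(1) by blast
    show "app (sgl A f) as (scl V c v) bs = sW c (app (sgl A f) as v bs)" for as bs c v
      by (simp add: app_ops f'(5) ksgn_def)
  qed (simp_all only: app_ops glinear_signed_word[OF W f'(6)] glinear_signed_word[OF W f'(7)]
        glinear_ksgn[OF f'(6)] glinear_ksgn[OF f'(7)])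
qed

lemma trilin_sgr: assumes W: "vector_space sW" and f: "trilin sW f" shows "trilin sW (sgr A f)"
proof -
  interpret glin A sW using assms by (simp add: glin_def A.graded_axioms)
  interpret W: vector_space sW by fact
  note f' = trilinD[OF f]
  show ?thesis
  proof (rule trilinI)
    show "nrm A (sgr A f)" using f'(1) by blast
    show "app (sgr A f) as (scl V c v) bs = sW c (app (sgr A f) as v bs)" for as bs c v
      by (simp add: app_ops f'(5) ksgn_def)
  qed (simp_all only: app_ops glinear_signed_word[OF W f'(6)] glinear_signed_word[OF W f'(7)]
        glinear_ksgn[OF f'(6)] glinear_ksgn[OF f'(7)])
qed

lemma app_insl_H:
  assumes "vector_space sW" "trilin sW f" "as \<in> H" "bs \<in> H"
  shows "app (insl A f) as v bs = mhat A (\<lambda>x. app f x v bs) as"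
  using multilinear_eq_0[OF assms(1) multilinear_mhat[OF assms(1) trilinD(3)[OF assms(2,4)]] assms(3)]
  by (auto simp: app_insl)

lemma app_insr_H:
  assumes "vector_space sW" "trilin sW f" "as \<in> H" "bs \<in> H"
  shows "app (insr A f) as v bs = mhat A (\<lambda>x. app f as v x) bs"
  using multilinear_eq_0[OF assms(1) multilinear_mhat[OF assms(1) trilinD(4)[OF assms(2,3)]] assms(4)]
  by (auto simp: app_insr)

lemma mhat_homogeneous:
  assumes "vector_space sW" "\<And>x. F (x::'a list) = sW c (G x)"
  shows "mhat A F as = sW c (mhat A G as)"
proof -
  interpret W: vector_space sW by fact
  have "F = (\<lambda>x. sW c (G x))" using assms by auto
  then show ?thesis
    using mhat_hom[of "sW c" A G as] by (simp add: W.scale_right_distrib)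
qed

lemma trilin_insl: assumes W: "vector_space sW" and f: "trilin sW f" shows "trilin sW (insl A f)"
proof (rule trilinI)
  interpret W: vector_space sW by fact
  show "nrm A (insl A f)" using trilinD(1)[OF f] by blast
  show "app (insl A f) as (scl V c v) bs = sW c (app (insl A f) as v bs)" for as c v bs
    using mhat_homogeneous[OF W, of "\<lambda>x. app f x (scl V c v) bs" c "\<lambda>x. app f x v bs"]
    by (simp add: app_insl trilinD(5)[OF f])
  fix xs ys bs :: "'a list" and v assume H: "xs \<in> H" "ys \<in> H" "bs \<in> H"
  have "glinear A sW (\<lambda>x. mhat A (\<lambda>z. app f z v bs) (xs @ [x] @ ys))"
    using multilinear_mhat[OF W trilinD(3)[OF f H(3)]] H(1,2) by (rule multilinearD)
  then show "glinear A sW (\<lambda>x. app (insl A f) (xs @ [x] @ ys) v bs)"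
    by (rule A.glinear_homog_cong) (use H in \<open>auto intro!: app_insl_H[OF W f]\<close>)
next
  fix xs ys as :: "'a list" and v assume H: "xs \<in> H" "ys \<in> H" "as \<in> H"
  have "glinear A sW (\<lambda>x. mhat A (\<lambda>z. app f z v (xs @ [x] @ ys)) as)"
    by (rule glinear_mhat_param[OF W _ H(3)]) (rule trilinD(7)[OF f H(1,2)])
  then show "glinear A sW (\<lambda>x. app (insl A f) as v (xs @ [x] @ ys))"
    by (rule A.glinear_homog_cong) (use H in \<open>auto intro!: app_insl_H[OF W f]\<close>)
qed

lemma trilin_insr: assumes W: "vector_space sW" and f: "trilin sW f" shows "trilin sW (insr A f)"
proof (rule trilinI)
  interpret W: vector_space sW by fact
  show "nrm A (insr A f)" using trilinD(1)[OF f] by blast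
  show "app (insr A f) as (scl V c v) bs = sW c (app (insr A f) as v bs)" for as c v bs
    using mhat_homogeneous[OF W, of "\<lambda>x. app f as (scl V c v) x" c "\<lambda>x. app f as v x"]
    by (simp add: app_insr trilinD(5)[OF f])
  fix xs ys bs :: "'a list" and v assume H: "xs \<in> H" "ys \<in> H" "bs \<in> H"
  have "glinear A sW (\<lambda>x. mhat A (\<lambda>z. app f (xs @ [x] @ ys) v z) bs)"
    by (rule glinear_mhat_param[OF W _ H(3)]) (rule trilinD(6)[OF f H(1,2)])
  then show "glinear A sW (\<lambda>x. app (insr A f) (xs @ [x] @ ys) v bs)"
    by (rule A.glinear_homog_cong) (use H in \<open>auto intro!: app_insr_H[OF W f]\<close>)
next
  fix xs ys as :: "'a list" and v assume H: "xs \<in> H" "ys \<in> H" "as \<in> H"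
  have "glinear A sW (\<lambda>x. mhat A (\<lambda>z. app f as v z) (xs @ [x] @ ys))"
    using multilinear_mhat[OF W trilinD(4)[OF f H(3)]] H(1,2) by (rule multilinearD)
  then show "glinear A sW (\<lambda>x. app (insr A f) as v (xs @ [x] @ ys))"
    by (rule A.glinear_homog_cong) (use H in \<open>auto intro!: app_insr_H[OF W f]\<close>)
qed

lemma trilin_tcomp:
  assumes W: "vector_space sW" and F: "trilin sW F" and f: "trilin (scl V) f"
  shows "trilin sW (F \<odot> f)"
proof (rule trilinI)
  interpret glin A sW using assms by (simp add: glin_def A.graded_axioms)
  interpret W: vector_space sW by fact
  show "nrm A (F \<odot> f)" using F f by (auto intro: trilinD(1))
  show "app (F \<odot> f) as (scl V c v) bs = sW c (app (F \<odot> f) as v bs)" for as c v bs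
    by (auto simp: app_tcomp trilinD(5)[OF F] trilinD(5)[OF f] spl_hom[of "sW c"] W.scale_right_distrib intro!: spl_cong)
  fix xs ys bs :: "'a list" and v
  have Ff: "glinear A sW (\<lambda>x. app F as (h x) bs)" if "glinear A (scl V) h" for as h bs
    by (rule glinear_homogeneous_map[OF vs.vector_space_axioms that trilinD(2)[OF F]])
  assume H: "xs \<in> H" "ys \<in> H" "bs \<in> H"
  show "glinear A sW (\<lambda>x. app (F \<odot> f) (xs @ [x] @ ys) v bs)"
    unfolding app_tcomp
  proof (rule glinear_spl_letter; rule glinear_spl)
    fix p q u w assume "p @ q = xs" "u @ w = bs"
    then have "q \<in> H" "u \<in> H" using H by auto
    then show "glinear A sW (\<lambda>x. app F p (app f (q @ [x] @ ys) v u) w)"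
      by (intro Ff trilinD(6)[OF f] H)
  next
    fix p q u w assume "p @ q = ys" "u @ w = bs"
    then have "p \<in> H" "w \<in> H" using H by auto
    then show "glinear A sW (\<lambda>x. app F (xs @ [x] @ p) (app f q v u) w)"
      by (intro trilinD(6)[OF F] H)
  qed
next
  interpret glin A sW using assms by (simp add: glin_def A.graded_axioms)
  have Ff: "glinear A sW (\<lambda>x. app F as (h x) bs)" if "glinear A (scl V) h" for as h bs
    by (rule glinear_homogeneous_map[OF vs.vector_space_axioms that trilinD(2)[OF F]])
  fix xs ys as :: "'a list" and v assume H: "xs \<in> H" "ys \<in> H" "as \<in> H"
  show "glinear A sW (\<lambda>x. app (F \<odot> f) as v (xs @ [x] @ ys))"
    unfolding app_tcomp
  proof (rule glinear_spl, rule glinear_spl_letter)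
    fix p q u w assume "p @ q = as" "u @ w = xs"
    then have "p \<in> H" "w \<in> H" using H by auto
    then show "glinear A sW (\<lambda>x. app F p (app f q v u) (w @ [x] @ ys))"
      by (intro trilinD(7)[OF F] H)
  next
    fix p q u w assume "p @ q = as" "u @ w = ys"
    then have "q \<in> H" "u \<in> H" using H by auto
    then show "glinear A sW (\<lambda>x. app F p (app f q v (xs @ [x] @ u)) w)"
      by (intro Ff trilinD(7)[OF f] H)
  qed
qed

end

context words
begin

subsection \<open>Degrees and signs of inserted products\<close>

lemmas VV = vs.vector_space_axioms

text \<open>Inserting a product raises the degree of a word by one. The resulting word may leave
  \<open>L\<close>, when the product is \<open>0\<close>, and then its degree is unspecified.\<close>

lemma insertion_degree:
  assumes "as \<in> H" "i < j" "j \<le> length as"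
  defines "z \<equiv> take i as @ [mu A (take (j - i) (drop i as))] @ drop j as"
  shows "z \<in> H" "z \<in> L \<Longrightarrow> dg z = dg as + 1"
proof -
  let ?b = "take (j - i) (drop i as)"
  have b: "?b \<in> H" "?b \<noteq> []" using assms by (auto dest!: in_set_takeD in_set_dropD)
  show "z \<in> H" using assms(1) mu_homog[OF b] by (auto simp: z_def dest: in_set_takeD in_set_dropD)
  assume "z \<in> L"
  then have "mu A ?b \<noteq> 0" by (auto simp: z_def letters_def)
  then have "deg (susp A) (mu A ?b) = dg ?b + 1" using deg_mu b by blast
  moreover have "as = take i as @ ?b @ drop j as"
    using assms(2,3) by (metis append_assoc append_take_drop_id le_add_diff_inverse less_imp_le take_add)
  then have "dg as = dg (take i as) + (dg ?b + dg (drop j as))" by (metis degs_append)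
  ultimately show "dg z = dg as + 1" by (simp add: z_def)
qed

lemma mhat_insertion_cong:
  assumes "\<And>z. z \<in> H \<Longrightarrow> (z \<in> L \<Longrightarrow> dg z = dg as + 1) \<Longrightarrow> F z = G z" and as: "as \<in> H"
  shows "mhat A F as = mhat A G as"
  unfolding mhat_def
proof (intro sum.cong refl arg_cong[of _ _ "ksgn _"])
  fix i j assume "i \<in> {..<length as}" "j \<in> {i<..length as}"
  then have ij: "i < j" "j \<le> length as" by auto
  show "F (take i as @ [mu A (take (j - i) (drop i as))] @ drop j as)
      = G (take i as @ [mu A (take (j - i) (drop i as))] @ drop j as)"
    by (rule assms(1)) (rule insertion_degree[OF as ij], assumption?)+
qed

lemma mhat_gr:
  assumes "\<And>x. x \<in> H \<Longrightarrow> dg x = dg as + 1 \<Longrightarrow> F x \<in> gr V n" "multilinear (scl V) F" "as \<in> H"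
  shows "mhat A F as \<in> gr V n"
proof -
  have *: "F z \<in> gr V n" if "z \<in> H" "z \<in> L \<Longrightarrow> dg z = dg as + 1" for z
    using that assms(1) multilinear_eq_0[OF VV assms(2)] by (cases "z \<in> L") auto
  then show ?thesis
    unfolding mhat_def
  proof (intro gr_sum gr_ksgn)
    fix i j assume "i \<in> {..<length as}" "j \<in> {i<..length as}"
    then have ij: "i < j" "j \<le> length as" by auto
    show "F (take i as @ [mu A (take (j - i) (drop i as))] @ drop j as) \<in> gr V n"
      by (rule *) (rule insertion_degree[OF assms(3) ij], assumption?)+
  qed
qed

lemma mhat_sign:
  assumes W: "vector_space sW" and F: "multilinear sW F" and as: "as \<in> L"
  shows "mhat A (\<lambda>x. ksgn (t * dg x) (F x)) as = ksgn (t * (dg as + 1)) (mhat A F as)"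
proof -
  have *: "ksgn (t * dg z) (F z) = ksgn (t * (dg as + 1)) (F z)" if "z \<in> H" "z \<in> L \<Longrightarrow> dg z = dg as + 1" for z
    using that multilinear_eq_0[OF W F] by (cases "z \<in> L") auto
  have "mhat A (\<lambda>x. ksgn (t * dg x) (F x)) as = mhat A (\<lambda>x. ksgn (t * (dg as + 1)) (F x)) as"
    by (rule mhat_insertion_cong[OF * L_sub_H[OF as]])
  then show ?thesis by (simp add: mhat_ksgn)
qed

lemma sgl_insl:
  assumes W: "vector_space sW" and f: "trilin sW f"
  shows "insl A (sgl A f) = - sgl A (insl A f)"
proof (rule tmap_eqI)
  fix as v bs
  have 0: "app (insl A (sgl A f)) as v bs = 0 \<and> app (sgl A (insl A f)) as v bs = 0"
    if "\<not> (as \<in> L \<and> bs \<in> L)"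
    using that trilinD(1)[OF f] by (metis nrmD nrm_insl nrm_sgl)
  show "app (insl A (sgl A f)) as v bs = app (- sgl A (insl A f)) as v bs"
  proof (cases "as \<in> L \<and> bs \<in> L")
    case True
    then show ?thesis
      using mhat_sign[OF W trilinD(3)[OF f], of bs as 1] L_sub_H[of bs]
      by (auto simp: app_ops intro!: ksgn_opp)
  next
    case False
    with 0 show ?thesis by simp
  qed
qed

lemma sgr_insr:
  assumes W: "vector_space sW" and f: "trilin sW f"
  shows "insr A (sgr A f) = - sgr A (insr A f)"
proof (rule tmap_eqI)
  fix as v bs
  have 0: "app (insr A (sgr A f)) as v bs = 0 \<and> app (sgr A (insr A f)) as v bs = 0"
    if "\<not> (as \<in> L \<and> bs \<in> L)"
    using that trilinD(1)[OF f] by (metis nrmD nrm_insr nrm_sgr)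
  show "app (insr A (sgr A f)) as v bs = app (- sgr A (insr A f)) as v bs"
  proof (cases "as \<in> L \<and> bs \<in> L")
    case True
    then show ?thesis
      using mhat_sign[OF W trilinD(4)[OF f], of as bs 1] L_sub_H[of as]
        mhat_cong[of "app (sgr A f) as v" "\<lambda>x. ksgn (dg x) (app f as v x)" A bs]
      by (auto simp: app_ops intro!: ksgn_opp)
  next
    case False
    with 0 show ?thesis by simp
  qed
qed

subsection \<open>Homogeneous families of endomorphisms\<close>

lemma morI:
  assumes "trilin (scl V) f"
    "\<And>as bs n v. as \<in> L \<Longrightarrow> bs \<in> L \<Longrightarrow> v \<in> gr V n \<Longrightarrow> app f as v bs \<in> gr V (dg as + n + dg bs + r)"
  shows "mor r f"
  using assms by (simp add: mor_def)

lemma mor_0 [intro, simp]: "mor r 0"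
  by (rule morI) (auto simp: trilin_0[OF VV])

lemma mor_add [intro]: "mor r f \<Longrightarrow> mor r g \<Longrightarrow> mor r (f + g)"
  by (rule morI) (auto simp: trilin_add[OF VV] mor_trilin intro!: gr_add mor_degree)

lemma mor_minus [intro]: "mor r f \<Longrightarrow> mor r (- f)"
  by (rule morI) (auto simp: trilin_minus[OF VV] mor_trilin intro!: gr_minus mor_degree)

lemma mor_diff [intro]: "mor r f \<Longrightarrow> mor r g \<Longrightarrow> mor r (f - g)"
  using mor_add[of r f "- g"] by auto

lemma mor_sgl [intro]: "mor r f \<Longrightarrow> mor r (sgl A f)"
  by (rule morI) (auto simp: trilin_sgl[OF VV] mor_trilin app_ops intro!: gr_ksgn mor_degree)

lemma mor_sgr [intro]: "mor r f \<Longrightarrow> mor r (sgr A f)"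
  by (rule morI) (auto simp: trilin_sgr[OF VV] mor_trilin app_ops intro!: gr_ksgn mor_degree)

lemma mor_tcomp [intro]:
  assumes "mor r F" "mor s f" shows "mor (r + s) (F \<odot> f)"
proof (rule morI)
  show "trilin (scl V) (F \<odot> f)" using assms by (intro trilin_tcomp VV mor_trilin)
  fix as bs n v assume v: "v \<in> gr V n"
  show "app (F \<odot> f) as v bs \<in> gr V (dg as + n + dg bs + (r + s))"
    unfolding app_tcomp
  proof (intro gr_spl)
    fix x y u w assume "x @ y = as" "u @ w = bs"
    then have "dg as + n + dg bs + (r + s) = dg x + (dg y + n + dg u + s) + dg w + r" by auto
    then show "app F x (app f y v u) w \<in> gr V (dg as + n + dg bs + (r + s))"
      using mor_degree[OF assms(1) mor_degree[OF assms(2) v]] by metis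
  qed
qed

lemma mor_tcomp_eq: "mor r F \<Longrightarrow> mor s f \<Longrightarrow> t = r + s \<Longrightarrow> mor t (F \<odot> f)"
  by (simp add: mor_tcomp)

lemma mor_insl [intro]: assumes f: "mor r f" shows "mor (r + 1) (insl A f)"
proof (rule morI)
  show "trilin (scl V) (insl A f)" using f by (intro trilin_insl VV mor_trilin)
  fix as bs n v assume a: "as \<in> L" "bs \<in> L" "v \<in> gr V n"
  have "mhat A (\<lambda>x. app f x v bs) as \<in> gr V (dg as + n + dg bs + (r + 1))"
  proof (rule mhat_gr)
    fix x assume "dg x = dg as + 1"
    then show "app f x v bs \<in> gr V (dg as + n + dg bs + (r + 1))"
      using mor_degree[OF f a(3), of x bs] by (simp add: algebra_simps)
  qed (use a in \<open>auto intro!: trilinD(3) mor_trilin[OF f] L_sub_H simp del: in_lists_conv_set\<close>)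
  then show "app (insl A f) as v bs \<in> gr V (dg as + n + dg bs + (r + 1))"
    using a by (simp add: app_ops)
qed

lemma mor_insr [intro]: assumes f: "mor r f" shows "mor (r + 1) (insr A f)"
proof (rule morI)
  show "trilin (scl V) (insr A f)" using f by (intro trilin_insr VV mor_trilin)
  fix as bs n v assume a: "as \<in> L" "bs \<in> L" "v \<in> gr V n"
  have "mhat A (\<lambda>x. app f as v x) bs \<in> gr V (dg as + n + dg bs + (r + 1))"
  proof (rule mhat_gr)
    fix x assume "dg x = dg bs + 1"
    then show "app f as v x \<in> gr V (dg as + n + dg bs + (r + 1))"
      using mor_degree[OF f a(3), of as x] by (simp add: algebra_simps)
  qed (use a in \<open>auto intro!: trilinD(4) mor_trilin[OF f] L_sub_H simp del: in_lists_conv_set\<close>)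
  then show "app (insr A f) as v bs \<in> gr V (dg as + n + dg bs + (r + 1))"
    using a by (simp add: app_ops)
qed

lemma mor_conc:
  assumes "homogeneous_map (scl V) (scl V) h" "\<And>n v. v \<in> gr V n \<Longrightarrow> h v \<in> gr V (n + r)"
  shows "mor r (conc h)"
  by (rule morI) (auto simp: trilin_conc[OF VV] assms homogeneous_map_conc_apply(1)[OF assms(1)])

lemma mor_tid [intro, simp]: "mor 0 tid"
  unfolding tid_def by (rule mor_conc) (auto simp: homogeneous_map_def)

text \<open>Being a homogeneous family only involves finitely many word lengths at a time, so it passes
  to limits.\<close>

lemma mor_limit:
  assumes "\<And>n. \<exists>g. mor r g \<and> vanish n (f - g)"
  shows "mor r f"
proof -
  obtain g where g: "\<And>n. mor r (g n)" "\<And>n. vanish n (f - g n)" using assms by metis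
  have fg: "app f as v bs = app (g n) as v bs" if "length as + length bs < n" for as v bs n
    using g(2)[of n] that by (auto simp: vanish_def)
  have fg1: "app f as v bs = app (g (Suc (length as + length bs))) as v bs" for as v bs
    by (rule fg) simp
  show ?thesis
  proof (rule morI, rule trilinI)
    show "nrm A f"
      unfolding nrm_def using fg1 mor_nrm[OF g(1)] by (metis nrmD)
    show "app f as (scl V c v) bs = scl V c (app f as v bs)" for as c v bs
      unfolding fg1 by (rule trilinD(5)[OF mor_trilin[OF g(1)]])
    show "app f as v bs \<in> gr V (dg as + n + dg bs + r)" if "v \<in> gr V n" for as v bs n
      unfolding fg1 by (rule mor_degree[OF g(1) that])
    fix xs ys zs :: "'a list" and v assume a: "xs \<in> H" "ys \<in> H" "zs \<in> H"
    let ?n = "Suc (length (xs @ [undefined] @ ys) + length zs)"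
    have "app f (xs @ [x] @ ys) v zs = app (g ?n) (xs @ [x] @ ys) v zs" for x
      by (rule fg) simp
    then show "glinear A (scl V) (\<lambda>x. app f (xs @ [x] @ ys) v zs)"
      using trilinD(6)[OF mor_trilin[OF g(1)] a] by presburger
    have "app f zs v (xs @ [x] @ ys) = app (g ?n) zs v (xs @ [x] @ ys)" for x
      by (rule fg) simp
    then show "glinear A (scl V) (\<lambda>x. app f zs v (xs @ [x] @ ys))"
      using trilinD(7)[OF mor_trilin[OF g(1)] a] by presburger
  qed
qed

subsection \<open>The parity operator and the differential on families\<close>

text \<open>The linear extension of \<open>v \<mapsto> ksgn (deg V v) v\<close> from homogeneous elements.\<close>

definition par :: "'c \<Rightarrow> 'c" where
  "par = (SOME h. homogeneous_map (scl V) (scl V) h \<and> (\<forall>n. \<forall>v\<in>gr V n. h v = ksgn n v))"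

lemma par: "homogeneous_map (scl V) (scl V) par" "v \<in> gr V n \<Longrightarrow> par v = ksgn n v"
proof -
  have "glinear V (scl V) (\<lambda>v. ksgn (0 + deg V v) v)"
  proof -
    interpret glin V "scl V" by unfold_locales
    show ?thesis by (rule glinear_degree_sign) (auto intro: glinearI)
  qed
  from glinear_extension[OF VV this] obtain h
    where h: "homogeneous_map (scl V) (scl V) h" "\<forall>v\<in>homog V. h v = ksgn (0 + deg V v) v" by blast
  have "h v = ksgn n v" if "v \<in> gr V n" for n v
    using h(2) that deg_eq[OF that] homogI[OF that] by (cases "v = 0") (auto simp: homogeneous_mapD(3)[OF h(1)])
  with h(1) have "\<exists>h. homogeneous_map (scl V) (scl V) h \<and> (\<forall>n. \<forall>v\<in>gr V n. h v = ksgn n v)" by blast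
  from someI_ex[OF this]
  show "homogeneous_map (scl V) (scl V) par" "v \<in> gr V n \<Longrightarrow> par v = ksgn n v"
    unfolding par_def by auto
qed

abbreviation eps :: "('a, 'c, 'c) tmap" where "eps \<equiv> conc par"

lemmas app_eps = homogeneous_map_conc_apply(2,3)[OF par(1)]

lemma par_par [simp]: "par (par v) = v"
proof (rule additive_eqI)
  fix n v assume "v \<in> gr V n"
  then show "par (par v) = v"
    by (simp add: par(2) homogeneous_mapD(6)[OF par(1)]) (simp add: ksgn_def)
qed (simp_all add: homogeneous_mapD[OF par(1)])

lemma eps_eps [simp]: "eps \<odot> eps = tid" "eps \<odot> (eps \<odot> f) = f"
proof -
  show 1: "eps \<odot> eps = tid"
    by (rule tmap_eqI)
      (simp add: app_eps tid_def app_conc homogeneous_map_conc_apply(1)[OF par(1)] homogeneous_mapD(3)[OF par(1)])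
  show "eps \<odot> (eps \<odot> f) = f"
    by (simp add: tcomp_assoc[symmetric] 1)
qed

lemma mor_eps [intro, simp]: "mor 0 eps"
  by (rule mor_conc) (auto simp: par)

text \<open>A family of degree \<open>r\<close> changes the degree of the middle argument by \<open>r\<close> and the degrees
  of the two words, so the parity operator passes it at the expense of these signs.\<close>

lemma commute_eps:
  assumes f: "mor r f"
  shows "f \<odot> eps = ksgn r (eps \<odot> sgl A (sgr A f))"
proof (rule tmap_eq_on_homog)
  fix as v bs n assume v: "v \<in> gr V n"
  show "app (f \<odot> eps) as v bs = app (ksgn r (eps \<odot> sgl A (sgr A f))) as v bs"
    by (auto simp: app_eps app_ops par(2)[OF v] par(2)[OF gr_ksgn[OF mor_degree[OF f v]]] intro!: ksgn_cong)
qed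

lemma eps_commute:
  assumes f: "mor r f"
  shows "sgr A (sgl A f) \<odot> eps = ksgn r (eps \<odot> f)"
proof -
  have "mor r (sgl A (sgr A f))" using f by auto
  from commute_eps[OF this] show ?thesis by (simp add: sgr_sgl)
qed

text \<open>Precomposition with the insertion of a product into either of the two words. On the
  right the product has passed the left word and the middle argument, whose signs are
  supplied by \<open>sgl\<close> and \<open>eps\<close>. The full \<open>bhat\<close> of a bimodule with structure \<open>b\<close> sends \<open>F\<close> to
  \<open>del F + sgl A F \<odot> b\<close>.\<close>

definition del :: "('a, 'c, 'w::ab_group_add) tmap \<Rightarrow> ('a, 'c, 'w) tmap" where
  "del x = insl A x + insr A (sgl A x) \<odot> eps"

lemma del_add: "del (x + y) = del x + del y"
  and del_minus: "del (- x) = - del x"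
  and del_diff: "del (x - y) = del x - del y"
  and del_0 [simp]: "del 0 = 0"
  and del_conc [simp]: "del (conc h) = 0"
  by (simp_all add: del_def ops_add ops_minus ops_diff tcomp_simps)

lemma del_tid [simp]: "del tid = 0" "sgl A tid = tid" "sgr A tid = tid"
  by (simp_all add: tid_def)

lemma mor_del [intro]: "mor r f \<Longrightarrow> mor (r + 1) (del f)"
  unfolding del_def by (intro mor_add mor_insl mor_tcomp_eq[OF mor_insr mor_eps] mor_sgl) auto

lemma trilin_eps: "vector_space sW \<Longrightarrow> trilin sW F \<Longrightarrow> trilin sW (F \<odot> eps)"
  by (rule trilin_tcomp) (auto simp: mor_trilin[OF mor_eps])

lemma trilin_del: "vector_space sW \<Longrightarrow> trilin sW F \<Longrightarrow> trilin sW (del F)"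
  unfolding del_def by (intro trilin_add trilin_insl trilin_eps trilin_insr trilin_sgl)

lemma del_tcomp:
  assumes F: "nrm A F" and f: "mor r f"
  shows "del (F \<odot> f) = insl A F \<odot> f + sgl A F \<odot> del f + ksgn r (insr A (sgl A F) \<odot> eps \<odot> f)"
proof -
  have f': "nrm A f" using f by (rule mor_nrm)
  have "sgr A (sgl A f) \<odot> eps = ksgn r (eps \<odot> f)" by (rule eps_commute[OF f])
  then show ?thesis
    by (simp add: del_def insl_tcomp[OF F f'] sgl_tcomp insr_tcomp[OF nrm_sgl[OF F] nrm_sgl[OF f']]
        tcomp_simps tcomp_ksgn_right)
qed

text \<open>The differential is a derivation; passing an odd factor costs a sign, and so does passing
  \<open>sgl\<close>.\<close>

lemma del_even:
  assumes F: "nrm A F" and f: "mor r f" "even r"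
  shows "del (F \<odot> f) = del F \<odot> f + sgl A F \<odot> del f"
  using f(2) unfolding del_tcomp[OF F f(1)] del_def[of F]
  by (simp add: ksgn_def tcomp_simps)

lemma del_odd:
  assumes W: "vector_space sW" and F: "trilin sW F" and f: "mor r f" "odd r"
  shows "del (sgl A F \<odot> f) = F \<odot> del f - sgl A (del F) \<odot> f"
proof -
  have "nrm A (sgl A F)" using F by (auto intro: trilinD(1))
  from del_tcomp[OF this f(1)] f(2) show ?thesis
    by (simp add: ksgn_def tcomp_simps del_def[of F] ops_add sgl_insl[OF W F] sgl_tcomp insr_sgl)
qed

end

section \<open>Bilinear forms\<close>

text \<open>Precomposition with \<open>x\<close> in the second argument of a bilinear form: the words
  surrounding this argument are, read cyclically, \<open>bs\<close> on its left and \<open>as\<close> on its right.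
  Moving the part \<open>a1\<close> past everything else gives the sign \<open>|a1| (d - |a1|)\<close> when \<open>F\<close> has total
  degree \<open>d\<close> and \<open>x\<close> has degree \<open>0\<close>, which has the parity of \<open>(d + 1) |a1|\<close>. In this form the sign
  depends on the words only, and \<open>costar\<close> is a contravariant action.\<close>

lift_definition costar :: "int \<Rightarrow> ('k, 'a::ab_group_add) ainf \<Rightarrow> ('a, 'c::ab_group_add, 'c) tmap \<Rightarrow>
    ('a, 'c, 'c \<Rightarrow> 'k::field) tmap \<Rightarrow> ('a, 'c, 'c \<Rightarrow> 'k) tmap"
  is "\<lambda>d A x F as v bs w. spl (\<lambda>a1 a2. spl (\<lambda>b1 b2.
        ksgn ((d + 1) * degs (susp A) a1) (F a2 v b1 (x b2 w a1))) bs) as"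
  by (auto simp: fun_eq_iff spl_add[symmetric] intro!: spl_cong)

lemma app_costar: "app (costar d A x F) as v bs w = spl (\<lambda>a1 a2. spl (\<lambda>b1 b2.
        ksgn ((d + 1) * degs (susp A) a1) (app F a2 v b1 (app x b2 w a1))) bs) as"
  by transfer simp

abbreviation fscale :: "'k::field \<Rightarrow> ('c \<Rightarrow> 'k) \<Rightarrow> 'c \<Rightarrow> 'k" where
  "fscale \<equiv> \<lambda>c \<phi> w. c * \<phi> w"

lemmas FV = vector_space_functions

lemma form_eqI:
  fixes F G :: "('a, 'c::ab_group_add, 'c \<Rightarrow> 'k::ab_group_add) tmap"
  shows "(\<And>as v bs w. app F as v bs w = app G as v bs w) \<Longrightarrow> F = G"
  by (rule tmap_eqI) (simp add: fun_eq_iff)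

lemma costar_add_right: "costar d A x (F + G) = costar d A x F + costar d A x G"
  and costar_diff_right: "costar d A x (F - G) = costar d A x F - costar d A x G"
  and costar_minus_right: "costar d A x (- F) = - costar d A x F"
  and costar_zero_right [simp]: "costar d A x 0 = 0"
  by (rule form_eqI; simp add: app_costar spl_add spl_diff spl_minus)+

lemma costar_ksgn_right: "costar d A x (ksgn s F) = ksgn s (costar d A x F)"
  by (simp add: ksgn_def costar_minus_right)

lemma costar_comp: "costar d A x (F \<odot> y) = costar d A x F \<odot> y"
proof (rule form_eqI)
  fix as v bs w
  let ?T = "\<lambda>a1 a2 a3 b1 b2 b3. ksgn ((d + 1) * degs (susp A) a1) (app F a2 (app y a3 v b1) b2 (app x b3 w a1))"
  have "app (costar d A x (F \<odot> y)) as v bs w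
      = spl (\<lambda>a1 z. spl (\<lambda>u b3. spl (\<lambda>a2 a3. spl (\<lambda>b1 b2. ?T a1 a2 a3 b1 b2 b3) u) z) bs) as"
    by (simp add: app_costar app_tcomp spl_fun[where as = _ and w = "app x _ _ _"] spl_ksgn)
  also have "\<dots> = spl (\<lambda>a1 z. spl (\<lambda>a2 a3. spl (\<lambda>u b3. spl (\<lambda>b1 b2. ?T a1 a2 a3 b1 b2 b3) u) bs) z) as"
    by (subst spl_swap) simp
  also have "\<dots> = spl (\<lambda>a1 z. spl (\<lambda>a2 a3. spl (\<lambda>b1 u. spl (\<lambda>b2 b3. ?T a1 a2 a3 b1 b2 b3) u) bs) z) as"
    by (subst spl_assoc) simp
  also have "\<dots> = spl (\<lambda>z a3. spl (\<lambda>a1 a2. spl (\<lambda>b1 u. spl (\<lambda>b2 b3. ?T a1 a2 a3 b1 b2 b3) u) bs) z) as"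
    by (rule spl_assoc[symmetric])
  also have "\<dots> = spl (\<lambda>z a3. spl (\<lambda>b1 u. spl (\<lambda>a1 a2. spl (\<lambda>b2 b3. ?T a1 a2 a3 b1 b2 b3) u) z) bs) as"
    by (subst spl_swap) simp
  also have "\<dots> = app (costar d A x F \<odot> y) as v bs w"
    by (simp add: app_costar app_tcomp spl_fun[where w = w])
  finally show "app (costar d A x (F \<odot> y)) as v bs w = app (costar d A x F \<odot> y) as v bs w" .
qed

lemma sgl_costar: "sgl A (costar d A x F) = costar d A (sgr A x) (sgl A F)"
  if F: "\<And>as v bs x y. app F as v bs (x + y) = app F as v bs x + app F as v bs y"
proof (rule form_eqI)
  fix as v bs w
  have k: "app F as v bs (ksgn s z) = ksgn s (app F as v bs z)" for as v bs s z
    by (rule additive_ksgn[of "app F as v bs"]) (rule F)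
  show "app (sgl A (costar d A x F)) as v bs w = app (costar d A (sgr A x) (sgl A F)) as v bs w"
    by (auto simp: app_costar app_ops spl_ksgn[symmetric] k algebra_simps intro!: spl_cong)
qed

context words
begin

text \<open>A homomorphism of degree \<open>0\<close> into the dual is a bilinear form that is non-zero only in
  total degree \<open>d\<close>. The shift \<open>e\<close> allows for compositions with families of non-zero degree.\<close>

definition frm :: "int \<Rightarrow> ('a, 'c, 'c \<Rightarrow> 'k) tmap \<Rightarrow> bool" where
  "frm e F \<longleftrightarrow> trilin fscale F \<and> (\<forall>as v bs. homogeneous_map (scl V) (*) (app F as v bs)) \<and>
     (\<forall>as v bs w m n. v \<in> gr V m \<longrightarrow> w \<in> gr V n \<longrightarrow> dg as + m + dg bs + n \<noteq> e \<longrightarrow> app F as v bs w = 0)"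

lemma frm_trilin: "frm e F \<Longrightarrow> trilin fscale F"
  and frm_nrm: "frm e F \<Longrightarrow> nrm A F"
  and frm_linear: "frm e F \<Longrightarrow> homogeneous_map (scl V) (*) (app F as v bs)"
  and frm_degree: "frm e F \<Longrightarrow> v \<in> gr V m \<Longrightarrow> w \<in> gr V n \<Longrightarrow> dg as + m + dg bs + n \<noteq> e \<Longrightarrow> app F as v bs w = 0"
  using trilinD(1) unfolding frm_def by blast+

lemma frm_add_right:
  assumes "frm e F"
  shows "app F as v bs (x + y) = app F as v bs x + app F as v bs y"
    "app F as v bs 0 = 0"
    "app F as v bs (ksgn s x) = ksgn s (app F as v bs x)"
    "app F as v bs (spl K cs) = spl (\<lambda>p q. app F as v bs (K p q)) cs"
    "app F as v bs (mhat A k cs) = mhat A (\<lambda>p. app F as v bs (k p)) cs"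
    "app F as v bs (scl V c x) = c * app F as v bs x"
    "app F as v bs (- x) = - app F as v bs x"
    "app F as v bs (x - y) = app F as v bs x - app F as v bs y"
proof -
  note h = homogeneous_mapD[OF frm_linear[OF assms]]
  show "app F as v bs (x + y) = app F as v bs x + app F as v bs y"
    "app F as v bs 0 = 0"
    "app F as v bs (ksgn s x) = ksgn s (app F as v bs x)"
    "app F as v bs (scl V c x) = c * app F as v bs x"
    "app F as v bs (- x) = - app F as v bs x"
    "app F as v bs (x - y) = app F as v bs x - app F as v bs y" by (rule h)+
  show "app F as v bs (spl K cs) = spl (\<lambda>p q. app F as v bs (K p q)) cs"
    by (rule spl_hom) (rule h)
  show "app F as v bs (mhat A k cs) = mhat A (\<lambda>p. app F as v bs (k p)) cs"
    by (rule mhat_hom) (rule h)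
qed

lemma frmI:
  assumes "trilin fscale F"
    "\<And>as v bs x y. app F as v bs (x + y) = app F as v bs x + app F as v bs y"
    "\<And>as v bs c x. app F as v bs (scl V c x) = c * app F as v bs x"
    "\<And>as v bs w m n. v \<in> gr V m \<Longrightarrow> w \<in> gr V n \<Longrightarrow> dg as + m + dg bs + n \<noteq> e \<Longrightarrow> app F as v bs w = 0"
  shows "frm e F"
  using assms unfolding frm_def homogeneous_map_def by blast

lemma frm_zero [intro, simp]: "frm e 0"
  by (rule frmI) (auto simp: trilin_0[OF FV])

lemma frm_add [intro]: "frm e F \<Longrightarrow> frm e G \<Longrightarrow> frm e (F + G)"
  by (rule frmI) (auto simp: trilin_add[OF FV] frm_trilin frm_add_right frm_degree algebra_simps)

lemma frm_minus [intro]: "frm e F \<Longrightarrow> frm e (- F)"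
  by (rule frmI) (auto simp: trilin_minus[OF FV] frm_trilin frm_add_right frm_degree algebra_simps)

lemma frm_diff [intro]: "frm e F \<Longrightarrow> frm e G \<Longrightarrow> frm e (F - G)"
  using frm_add[of e F "- G"] by auto

lemma frm_comp:
  assumes F: "frm e F" and f: "mor r f" and e': "e' = e - r"
  shows "frm e' (F \<odot> f)"
proof (rule frmI)
  show "trilin fscale (F \<odot> f)" by (intro trilin_tcomp FV frm_trilin[OF F] mor_trilin[OF f])
  have a: "app (F \<odot> f) as v bs w = spl (\<lambda>x y. spl (\<lambda>u z. app F x (app f y v u) z w) bs) as" for as v bs w
    by (simp add: app_tcomp spl_fun[where w = w])
  show "app (F \<odot> f) as v bs (x + y) = app (F \<odot> f) as v bs x + app (F \<odot> f) as v bs y" for as v bs x y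
    by (simp add: a frm_add_right[OF F] spl_add)
  show "app (F \<odot> f) as v bs (scl V c x) = c * app (F \<odot> f) as v bs x" for as v bs c x
    by (simp add: a frm_add_right[OF F] spl_hom[of "\<lambda>x. c * x"] algebra_simps)
  fix as v bs w m n assume v: "v \<in> gr V m" and w: "w \<in> gr V n" and ne: "dg as + m + dg bs + n \<noteq> e'"
  show "app (F \<odot> f) as v bs w = 0"
    unfolding a
  proof (intro spl_zeroI)
    fix x y u z assume "x @ y = as" "u @ z = bs"
    then show "app F x (app f y v u) z w = 0"
      using ne by (intro frm_degree[OF F mor_degree[OF f v] w]) (auto simp: e')
  qed
qed

lemma glinear_signed_word_mult:
  assumes W: "vector_space sW" and g: "glinear A sW h"
  shows "glinear A sW (\<lambda>x. ksgn (t * dg (xs @ [x] @ ys)) (h x))"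
proof (cases "even t")
  case True
  then show ?thesis using g by (simp add: ksgn_def)
next
  case False
  then have "ksgn (t * dg (xs @ [x] @ ys)) (h x) = ksgn (dg (xs @ [x] @ ys)) (h x)" for x
    by (intro ksgn_cong) auto
  then show ?thesis using glinear_signed_word[OF W g, of xs ys] by presburger
qed

lemma glinear_functions: "(\<And>w. glinear A (*) (\<lambda>x. g x w)) \<Longrightarrow> glinear A fscale g"
  unfolding glinear_def by (auto simp: fun_eq_iff)

lemma frm_glinear:
  assumes "frm e F"
  shows "xs \<in> H \<Longrightarrow> ys \<in> H \<Longrightarrow> bs \<in> H \<Longrightarrow> glinear A (*) (\<lambda>x. app F (xs @ [x] @ ys) v bs w)"
    "xs \<in> H \<Longrightarrow> ys \<in> H \<Longrightarrow> as \<in> H \<Longrightarrow> glinear A (*) (\<lambda>x. app F as v (xs @ [x] @ ys) w)"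
  using trilinD(6,7)[OF frm_trilin[OF assms]] unfolding glinear_def by (auto simp: fun_eq_iff)

lemma frm_costar:
  assumes F: "frm e F" and f: "mor r f" and e': "e' = e - r"
  shows "frm e' (costar d A f F)"
proof (rule frmI)
  note f' = mor_trilin[OF f] and F' = frm_trilin[OF F]
  interpret W: glin A "(*) :: 'k \<Rightarrow> 'k \<Rightarrow> 'k" using vector_space_field by (simp add: glin_def A.graded_axioms)
  show "app (costar d A f F) as v bs (x + y) = app (costar d A f F) as v bs x + app (costar d A f F) as v bs y" for as v bs x y
    by (simp add: app_costar frm_add_right[OF F] spl_add)
  show "app (costar d A f F) as v bs (scl V c x) = c * app (costar d A f F) as v bs x" for as v bs c x
    by (simp add: app_costar frm_add_right[OF F] trilinD(5)[OF f'] spl_hom[of "\<lambda>x. c * x"] ksgn_mult distrib_left)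
  show "app (costar d A f F) as v bs w = 0"
    if v: "v \<in> gr V m" and w: "w \<in> gr V n" and ne: "dg as + m + dg bs + n \<noteq> e'" for as v bs w m n
    unfolding app_costar
  proof (intro spl_zeroI)
    fix x y u z assume "x @ y = as" "u @ z = bs"
    then have "app F y v u (app f z w x) = 0"
      using ne by (intro frm_degree[OF F v mor_degree[OF f w]]) (auto simp: e')
    then show "ksgn ((d + 1) * dg x) (app F y v u (app f z w x)) = 0" by simp
  qed
  show "trilin fscale (costar d A f F)"
  proof (rule trilinI)
    show "nrm A (costar d A f F)"
      unfolding nrm_def
    proof (intro allI impI ext)
      fix as v bs w assume l: "\<not> (as \<in> L \<and> bs \<in> L)"
      show "app (costar d A f F) as v bs w = 0 w"
        unfolding app_costar zero_fun_apply
      proof (intro spl_zeroI)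
        fix x y u z assume "x @ y = as" "u @ z = bs"
        then have "\<not> (y \<in> L \<and> u \<in> L) \<or> \<not> (z \<in> L \<and> x \<in> L)" using l by auto
        then show "ksgn ((d + 1) * dg x) (app F y v u (app f z w x)) = 0"
          using nrmD[OF frm_nrm[OF F]] nrmD[OF mor_nrm[OF f]] frm_add_right(2)[OF F]
          by (metis ksgn_zero zero_fun_apply)
      qed
    qed
    show "app (costar d A f F) as (scl V c v) bs = fscale c (app (costar d A f F) as v bs)" for as c v bs
      by (simp add: fun_eq_iff app_costar trilinD(5)[OF F'] spl_hom[of "\<lambda>x. c * x"] ksgn_mult distrib_left)
    have Ff: "glinear A (*) (\<lambda>x. app F as v bs (h x))" if "glinear A (scl V) h" for as v bs h
      by (rule W.glinear_homogeneous_map[OF VV that frm_linear[OF F]])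
    fix xs ys zs :: "'a list" and v assume H: "xs \<in> H" "ys \<in> H" "zs \<in> H"
    show "glinear A fscale (\<lambda>x. app (costar d A f F) (xs @ [x] @ ys) v zs)"
    proof (rule glinear_functions)
      fix w
      show "glinear A (*) (\<lambda>x. app (costar d A f F) (xs @ [x] @ ys) v zs w)"
        unfolding app_costar
      proof (rule W.glinear_spl_letter; rule W.glinear_spl)
        fix p q p' q' assume "p @ q = xs" "p' @ q' = zs"
        then have "q \<in> H" "p' \<in> H" using H by auto
        then show "glinear A (*) (\<lambda>x. ksgn ((d + 1) * dg p) (app F (q @ [x] @ ys) v p' (app f q' w p)))"
          by (intro W.glinear_ksgn frm_glinear[OF F] H)
      next
        fix p q p' q' assume "p @ q = ys" "p' @ q' = zs"
        then have "p \<in> H" "q' \<in> H" using H by auto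
        then show "glinear A (*) (\<lambda>x. ksgn ((d + 1) * dg (xs @ [x] @ p)) (app F q v p' (app f q' w (xs @ [x] @ p))))"
          by (intro glinear_signed_word_mult vector_space_field Ff trilinD(7)[OF f'] H)
      qed
    qed
    show "glinear A fscale (\<lambda>x. app (costar d A f F) zs v (xs @ [x] @ ys))"
    proof (rule glinear_functions)
      fix w
      show "glinear A (*) (\<lambda>x. app (costar d A f F) zs v (xs @ [x] @ ys) w)"
        unfolding app_costar
      proof (rule W.glinear_spl, rule W.glinear_spl_letter)
        fix p q p' q' assume "p @ q = zs" "p' @ q' = xs"
        then have "p \<in> H" "q' \<in> H" using H by auto
        then show "glinear A (*) (\<lambda>x. ksgn ((d + 1) * dg p) (app F q v p' (app f (q' @ [x] @ ys) w p)))"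
          by (intro W.glinear_ksgn Ff trilinD(6)[OF f'] H)
      next
        fix p q p' q' assume "p @ q = zs" "p' @ q' = ys"
        then have "q \<in> H" "p' \<in> H" using H by auto
        then show "glinear A (*) (\<lambda>x. ksgn ((d + 1) * dg p) (app F q v (xs @ [x] @ p') (app f q' w p)))"
          by (intro W.glinear_ksgn frm_glinear[OF F] H)
      qed
    qed
  qed
qed

lemma costar_add_left: "frm e F \<Longrightarrow> costar d A (x + y) F = costar d A x F + costar d A y F"
  and costar_minus_left: "frm e F \<Longrightarrow> costar d A (- x) F = - costar d A x F"
  and costar_diff_left: "frm e F \<Longrightarrow> costar d A (x - y) F = costar d A x F - costar d A y F"
  by (rule form_eqI; simp add: app_costar frm_add_right spl_add spl_minus spl_diff)+

lemma costar_tcomp: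
  assumes F: "frm e F"
  shows "costar d A (x \<odot> y) F = costar d A y (costar d A x F)"
proof (rule form_eqI)
  fix as v bs w
  let ?T = "\<lambda>a1 a2 a3 b1 b2 b3. ksgn ((d + 1) * dg (a1 @ a2))
      (app F a3 v b1 (app x b2 (app y b3 w a1) a2))"
  have "app (costar d A (x \<odot> y) F) as v bs w
      = spl (\<lambda>z a3. spl (\<lambda>b1 u. spl (\<lambda>b2 b3. spl (\<lambda>a1 a2. ksgn ((d + 1) * dg z) (app F a3 v b1 (app x b2 (app y b3 w a1) a2))) z) u) bs) as"
    by (simp add: app_costar app_tcomp frm_add_right[OF F] spl_ksgn)
  also have "\<dots> = spl (\<lambda>z a3. spl (\<lambda>b1 u. spl (\<lambda>b2 b3. spl (\<lambda>a1 a2. ?T a1 a2 a3 b1 b2 b3) z) u) bs) as"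
    by (auto intro!: spl_cong)
  also have "\<dots> = spl (\<lambda>z a3. spl (\<lambda>b1 u. spl (\<lambda>a1 a2. spl (\<lambda>b2 b3. ?T a1 a2 a3 b1 b2 b3) u) z) bs) as"
    by (subst spl_swap) simp
  also have "\<dots> = spl (\<lambda>z a3. spl (\<lambda>a1 a2. spl (\<lambda>b1 u. spl (\<lambda>b2 b3. ?T a1 a2 a3 b1 b2 b3) u) bs) z) as"
    by (subst (2) spl_swap) simp
  also have "\<dots> = spl (\<lambda>a1 z. spl (\<lambda>a2 a3. spl (\<lambda>b1 u. spl (\<lambda>b2 b3. ?T a1 a2 a3 b1 b2 b3) u) bs) z) as"
    by (rule spl_assoc)
  also have "\<dots> = spl (\<lambda>a1 z. spl (\<lambda>a2 a3. spl (\<lambda>u b3. spl (\<lambda>b1 b2. ?T a1 a2 a3 b1 b2 b3) u) bs) z) as"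
    by (simp only: spl_assoc)
  also have "\<dots> = spl (\<lambda>a1 z. spl (\<lambda>u b3. spl (\<lambda>a2 a3. spl (\<lambda>b1 b2. ?T a1 a2 a3 b1 b2 b3) u) z) bs) as"
    by (subst (2) spl_swap) simp
  also have "\<dots> = app (costar d A y (costar d A x F)) as v bs w"
    by (simp add: app_costar spl_ksgn[symmetric] algebra_simps)
  finally show "app (costar d A (x \<odot> y) F) as v bs w = app (costar d A y (costar d A x F)) as v bs w" .
qed

text \<open>The left word of \<open>costar d A f F\<close> is cut into a right word of \<open>f\<close> and a left word of \<open>F\<close>;
  its right word is cut into a right word of \<open>F\<close> and a left word of \<open>f\<close>. Inserting a product
  into the left word therefore means inserting it into one of its two parts.\<close>

lemma insl_costar:
  assumes F: "frm e F" and f: "mor r f"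
  shows "insl A (costar d A f F) = costar d A (sgr A f) (insl A F) + ksgn (d + 1) (costar d A (insr A f) F)"
    (is "?l = ?r")
proof (rule form_eqI)
  fix as v bs w
  have n: "nrm A ?l" "nrm A ?r"
  proof -
    show "nrm A ?l" by (rule nrm_insl[OF frm_nrm[OF frm_costar[OF F f refl]]])
    have "nrm A (ksgn (d + 1) (costar d A (insr A f) F))"
      using frm_nrm[OF frm_costar[OF F mor_insr[OF f] refl]] by (auto simp: ksgn_def)
    moreover have "nrm A (costar d A (sgr A f) (insl A F))"
      unfolding nrm_def
    proof (intro allI impI ext)
      fix as v bs w assume l: "\<not> (as \<in> L \<and> bs \<in> L)"
      show "app (costar d A (sgr A f) (insl A F)) as v bs w = 0 w"
        unfolding app_costar zero_fun_apply
      proof (intro spl_zeroI)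
        fix x y u z assume "x @ y = as" "u @ z = bs"
        then have "\<not> (y \<in> L \<and> u \<in> L) \<or> \<not> (z \<in> L \<and> x \<in> L)" using l by auto
        moreover have "app (insl A F) y v u 0 = 0"
          by (auto simp: app_insl mhat_fun frm_add_right[OF F])
        ultimately show "ksgn ((d + 1) * dg x) (app (insl A F) y v u (app (sgr A f) z w x)) = 0"
          using nrmD[OF nrm_insl[OF frm_nrm[OF F]]] nrmD[OF nrm_sgr[OF mor_nrm[OF f]]]
          by (metis ksgn_zero zero_fun_apply)
      qed
    qed
    ultimately show "nrm A ?r" by blast
  qed
  show "app ?l as v bs w = app ?r as v bs w"
  proof (cases "as \<in> L \<and> bs \<in> L")
    case False
    show ?thesis by (simp only: nrmD[OF n(1) False] nrmD[OF n(2) False])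
  next
    case True
    let ?K = "\<lambda>a1 a2. spl (\<lambda>b1 b2. ksgn ((d + 1) * dg a1) (app F a2 v b1 (app f b2 w a1))) bs"
    have "app ?l as v bs w = mhat A (spl ?K) as"
      using True by (auto simp: app_insl mhat_fun[where w = w] app_costar intro!: mhat_cong)
    also have "\<dots> = spl (\<lambda>x y. mhat A (\<lambda>z. ?K z y) x + ksgn (dg x) (mhat A (?K x) y)) as"
      by (rule mhat_spl)
    also have "\<dots> = spl (\<lambda>x y. spl (\<lambda>b1 b2. ksgn (d + 1) (ksgn ((d + 1) * dg x) (app F y v b1 (app (insr A f) b2 w x)))) bs
        + spl (\<lambda>b1 b2. ksgn ((d + 1) * dg x) (app (insl A F) y v b1 (app (sgr A f) b2 w x))) bs) as"
    proof (rule spl_cong)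
      fix x y assume "x @ y = as"
      then have xy: "x \<in> L" "y \<in> L" using True by auto
      have 1: "mhat A (\<lambda>z. ?K z y) x
          = spl (\<lambda>b1 b2. ksgn (d + 1) (ksgn ((d + 1) * dg x) (app F y v b1 (app (insr A f) b2 w x)))) bs"
        unfolding spl_mhat_swap[symmetric]
      proof (rule spl_cong)
        fix b1 b2 assume "b1 @ b2 = bs"
        then have b: "b2 \<in> H" using True by (intro L_sub_H) auto
        have m: "multilinear (*) (\<lambda>x. app F y v b1 (app f b2 w x))"
          unfolding multilinear_def
        proof (intro ballI)
          interpret W: glin A "(*) :: 'k \<Rightarrow> 'k \<Rightarrow> 'k" using vector_space_field by (simp add: glin_def A.graded_axioms)
          fix xs ys :: "'a list" assume "xs \<in> H" "ys \<in> H"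
          then show "glinear A (*) (\<lambda>x. app F y v b1 (app f b2 w (xs @ [x] @ ys)))"
            by (intro W.glinear_homogeneous_map[OF VV _ frm_linear[OF F]] trilinD(7)[OF mor_trilin[OF f]] b)
        qed
        show "mhat A (\<lambda>z. ksgn ((d + 1) * dg z) (app F y v b1 (app f b2 w z))) x =
            ksgn (d + 1) (ksgn ((d + 1) * dg x) (app F y v b1 (app (insr A f) b2 w x)))"
          using xy unfolding mhat_sign[OF vector_space_field m xy(1)]
          by (simp add: app_insr frm_add_right[OF F] algebra_simps)
      qed
      have 2: "ksgn (dg x) (mhat A (?K x) y)
          = spl (\<lambda>b1 b2. ksgn ((d + 1) * dg x) (app (insl A F) y v b1 (app (sgr A f) b2 w x))) bs"
        using xy by (simp add: spl_mhat_swap[symmetric] spl_ksgn[symmetric] app_ops mhat_fun frm_add_right[OF F] mhat_ksgn algebra_simps)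
      show "mhat A (\<lambda>z. ?K z y) x + ksgn (dg x) (mhat A (?K x) y) =
          spl (\<lambda>b1 b2. ksgn (d + 1) (ksgn ((d + 1) * dg x) (app F y v b1 (app (insr A f) b2 w x)))) bs
        + spl (\<lambda>b1 b2. ksgn ((d + 1) * dg x) (app (insl A F) y v b1 (app (sgr A f) b2 w x))) bs"
        by (simp only: 1 2)
    qed
    also have "\<dots> = app ?r as v bs w"
      by (simp add: app_costar spl_add spl_ksgn[symmetric])
    finally show ?thesis .
  qed
qed

lemma insr_costar:
  assumes F: "frm e F" and f: "mor r f"
  shows "insr A (costar d A f F) = costar d A f (insr A F) + costar d A (insl A f) (sgr A F)"
    (is "?l = ?r")
proof (rule form_eqI)
  fix as v bs w
  have F0: "app (insr A F) y v u 0 = 0" "app (sgr A F) y v u 0 = 0" for y v u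
    by (auto simp: app_ops mhat_fun frm_add_right[OF F])
  have cn: "nrm A (costar d A x G)" if x: "nrm A x" and G: "nrm A G" "\<And>y v u. app G y v u 0 = 0" for x G
    unfolding nrm_def
  proof (intro allI impI ext)
    fix as v bs w assume l: "\<not> (as \<in> L \<and> bs \<in> L)"
    show "app (costar d A x G) as v bs w = 0 w"
      unfolding app_costar zero_fun_apply
    proof (intro spl_zeroI)
      fix a y u z assume "a @ y = as" "u @ z = bs"
      then have "\<not> (y \<in> L \<and> u \<in> L) \<or> \<not> (z \<in> L \<and> a \<in> L)" using l by auto
      then show "ksgn ((d + 1) * dg a) (app G y v u (app x z w a)) = 0"
        using nrmD[OF x] nrmD[OF G(1)] G(2) by (metis ksgn_zero zero_fun_apply)
    qed
  qed
  have n: "nrm A ?l" "nrm A ?r"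
    using frm_nrm[OF F] mor_nrm[OF f] F0 frm_add_right(2)[OF F]
    by (auto intro!: cn nrm_insr nrm_insl nrm_sgr nrm_add)
  show "app ?l as v bs w = app ?r as v bs w"
  proof (cases "as \<in> L \<and> bs \<in> L")
    case False
    show ?thesis by (simp only: nrmD[OF n(1) False] nrmD[OF n(2) False])
  next
    case True
    let ?K = "\<lambda>a1 a2 b1 b2. ksgn ((d + 1) * dg a1) (app F a2 v b1 (app f b2 w a1))"
    have "app ?l as v bs w = mhat A (\<lambda>z. spl (\<lambda>a1 a2. spl (?K a1 a2) z) as) bs"
      using True by (auto simp: app_insr mhat_fun[where w = w] app_costar intro!: mhat_cong)
    also have "\<dots> = spl (\<lambda>a1 a2. spl (\<lambda>x y. mhat A (\<lambda>z. ?K a1 a2 z y) x + ksgn (dg x) (mhat A (?K a1 a2 x) y)) bs) as"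
      by (simp add: spl_mhat_swap[symmetric] mhat_spl)
    also have "\<dots> = spl (\<lambda>a1 a2. spl (\<lambda>x y. ksgn ((d + 1) * dg a1) (app (insr A F) a2 v x (app f y w a1))
         + ksgn ((d + 1) * dg a1) (app (sgr A F) a2 v x (app (insl A f) y w a1))) bs) as"
      using True
      by (intro spl_cong) (auto simp: app_ops mhat_fun mhat_ksgn frm_add_right[OF F] algebra_simps)
    also have "\<dots> = app ?r as v bs w"
      by (simp add: app_costar spl_add)
    finally show ?thesis .
  qed
qed

text \<open>Where \<open>G\<close> is non-zero, all degrees add up to \<open>e\<close>. The sign of the first argument and of
  the words is thus the sign of the second argument, up to \<open>(-1)^e\<close>.\<close>

lemma eps_form:
  assumes G: "frm e G"
  shows "sgr A (sgl A G) \<odot> eps = ksgn e (costar d A eps G)"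
proof (rule tmap_eq_on_homog)
  fix as v bs n assume v: "v \<in> gr V n"
  have "app (costar d A eps G) as v bs w = app G as v bs (par w)" for w
  proof -
    have "app (costar d A eps G) as v bs w =
        spl (\<lambda>b1 b2. ksgn ((d + 1) * dg []) (app G as v b1 (app eps b2 w []))) bs"
      unfolding app_costar by (rule spl_eq_first) (simp add: frm_add_right[OF G])
    also have "\<dots> = app G as v bs (app eps [] w [])"
      by (subst spl_eq_last) (auto simp: frm_add_right[OF G])
    also have "app eps [] w [] = par w"
      by (simp add: homogeneous_map_conc_apply(1)[OF par(1)])
    finally show ?thesis .
  qed
  moreover have "ksgn (n + (dg bs + dg as)) (app G as v bs w) = ksgn e (app G as v bs (par w))" for w
  proof (rule additive_eqI[of "\<lambda>w. ksgn (n + (dg bs + dg as)) (app G as v bs w)" "\<lambda>w. ksgn e (app G as v bs (par w))"])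
    fix m w assume w: "w \<in> gr V m"
    show "ksgn (n + (dg bs + dg as)) (app G as v bs w) = ksgn e (app G as v bs (par w))"
    proof (cases "dg as + n + dg bs + m = e")
      case True
      then show ?thesis
        by (auto simp: par(2)[OF w] frm_add_right[OF G] intro!: ksgn_cong)
    next
      case False
      then show ?thesis using frm_degree[OF G v w] by (simp add: par(2)[OF w] frm_add_right[OF G])
    qed
  qed (simp_all add: frm_add_right[OF G] homogeneous_mapD[OF par(1)])
  ultimately show "app (sgr A (sgl A G) \<odot> eps) as v bs = app (ksgn e (costar d A eps G)) as v bs"
    by (auto simp: fun_eq_iff app_eps app_ops par(2)[OF v])
qed

lemma frm_sgl: "frm e F \<Longrightarrow> frm e (sgl A F)"
  by (rule frmI) (auto simp: trilin_sgl[OF FV] frm_trilin app_ops frm_add_right frm_degree ksgn_mult)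

text \<open>The failure of a form \<open>F\<close> to be a homomorphism into the dual: a product is inserted
  into one of the two words, or the structure map \<open>b\<close> is applied around either of the two
  module arguments.\<close>

definition variation :: "int \<Rightarrow> ('a, 'c, 'c) tmap \<Rightarrow> ('a, 'c, 'c \<Rightarrow> 'k) tmap \<Rightarrow> ('a, 'c, 'c \<Rightarrow> 'k) tmap" where
  "variation d b F = del F + sgl A F \<odot> b + ksgn d (costar d A (eps \<odot> sgr A b) F)"

text \<open>Moving \<open>f\<close> out of both arguments of \<open>\<phi>\<close> produces the terms by which \<open>f\<close> fails to commute
  with the insertion of products, and the homomorphism equation turns them into
  applications of the structure maps.\<close>

lemma variation_pullback:
  assumes \<phi>: "frm d \<phi>" and f: "mor 0 f" and b: "mor 1 b" "mor 1 b'"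
    and hom: "del f + sgl A f \<odot> b = b' \<odot> f"
  shows "variation d b (costar d A f (\<phi> \<odot> f)) = costar d A (sgr A f) (variation d b' \<phi> \<odot> f)"
proof -
  define G where "G = \<phi> \<odot> f"
  have G: "frm d G" unfolding G_def by (rule frm_comp[OF \<phi> f]) simp
  have sG: "frm d (sgl A G)" by (rule frm_sgl[OF G])
  have s\<phi>: "frm d (sgl A \<phi>)" by (rule frm_sgl[OF \<phi>])
  note addG = frm_add_right(1)[OF G]
  have sgr_f: "mor 0 (sgr A f)" using f by blast
  have 1: "insl A (costar d A f G) = costar d A (sgr A f) (insl A G) - ksgn d (costar d A (insr A f) G)"
    by (simp add: insl_costar[OF G f] ksgn_def)
  have 2: "insr A (sgl A (costar d A f G)) \<odot> eps
      = costar d A (sgr A f) (insr A (sgl A G) \<odot> eps) + ksgn d (costar d A (eps \<odot> insl A (sgr A f)) G)"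
  proof -
    have "insr A (sgl A (costar d A f G)) = costar d A (sgr A f) (insr A (sgl A G)) + costar d A (insl A (sgr A f)) (sgr A (sgl A G))"
      using sgl_costar[OF addG] insr_costar[OF sG sgr_f] by metis
    then show ?thesis
      by (simp add: tcomp_add_left costar_comp[symmetric] eps_form[OF G, of d] costar_ksgn_right costar_tcomp[OF G])
  qed
  have 3: "eps \<odot> sgr A (del f) = eps \<odot> insl A (sgr A f) - insr A f"
  proof -
    have "mor (0 + 1) (insr A (sgl A f))" using f by blast
    from commute_eps[OF this]
    have "insr A (sgl A f) \<odot> eps = - (eps \<odot> sgl A (sgr A (insr A (sgl A f))))" by simp
    also have "sgl A (sgr A (insr A (sgl A f))) = sgr A (insr A f)"
      by (simp add: insr_sgl sgr_sgl)
    also have "\<dots> = - insr A (sgr A f)"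
      using sgr_insr[OF VV mor_trilin[OF f]] by simp
    finally have "del f = insl A f + eps \<odot> insr A (sgr A f)"
      by (simp add: del_def tcomp_simps)
    then have "sgr A (del f) = insl A (sgr A f) + eps \<odot> sgr A (insr A (sgr A f))"
      by (simp add: ops_add sgr_tcomp insl_sgr)
    also have "sgr A (insr A (sgr A f)) = - insr A f"
      using sgr_insr[OF VV mor_trilin[OF sgr_f]] by simp
    finally show ?thesis by (simp add: tcomp_simps)
  qed
  have delF: "del (costar d A f G) = costar d A (sgr A f) (del G) + ksgn d (costar d A (eps \<odot> sgr A (del f)) G)"
    unfolding del_def[of "costar d A f G"] del_def[of G] 1 2 3
    by (simp add: costar_add_right costar_diff_left[OF G])
  have delG: "del G = del \<phi> \<odot> f + sgl A \<phi> \<odot> del f"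
    unfolding G_def by (rule del_even[OF frm_nrm[OF \<phi>] f]) simp
  have 4: "sgl A (costar d A f G) \<odot> b = costar d A (sgr A f) (sgl A \<phi> \<odot> (sgl A f \<odot> b))"
    unfolding sgl_costar[OF addG] costar_comp[symmetric] by (simp add: G_def sgl_tcomp tcomp_assoc)
  have 5: "costar d A (eps \<odot> sgr A b) (costar d A f G) = costar d A (eps \<odot> sgr A (sgl A f \<odot> b)) G"
  proof -
    have "costar d A (eps \<odot> sgr A b) (costar d A f G) = costar d A ((f \<odot> eps) \<odot> sgr A b) G"
      by (simp add: costar_tcomp[OF G] tcomp_assoc)
    also have "f \<odot> eps = eps \<odot> sgr A (sgl A f)"
      using commute_eps[OF f] by (simp add: sgr_sgl)
    finally show ?thesis by (simp add: tcomp_assoc sgr_tcomp)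
  qed
  have "variation d b (costar d A f G) =
      costar d A (sgr A f) (del \<phi> \<odot> f + sgl A \<phi> \<odot> (del f + sgl A f \<odot> b))
      + ksgn d (costar d A (eps \<odot> sgr A (del f + sgl A f \<odot> b)) G)"
    unfolding variation_def delF delG 4 5
    by (simp add: costar_add_right costar_add_left[OF G] ops_add tcomp_add_right algebra_simps)
  also have "\<dots> = costar d A (sgr A f) (del \<phi> \<odot> f + sgl A \<phi> \<odot> (b' \<odot> f))
      + ksgn d (costar d A (eps \<odot> sgr A (b' \<odot> f)) G)"
    by (simp only: hom)
  also have "costar d A (eps \<odot> sgr A (b' \<odot> f)) G = costar d A (sgr A f) (costar d A (eps \<odot> sgr A b') \<phi> \<odot> f)"
    by (simp add: sgr_tcomp tcomp_assoc[symmetric] costar_tcomp[OF G] costar_tcomp[OF \<phi>] costar_comp G_def)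
  finally show ?thesis
    by (simp add: G_def variation_def costar_add_right costar_ksgn_right tcomp_simps tcomp_ksgn_left)
qed

end

section \<open>Homological perturbation\<close>

lemma tcomp_ext: "a \<odot> b = c \<Longrightarrow> a \<odot> (b \<odot> x) = c \<odot> x"
  by (simp add: tcomp_assoc[symmetric])

lemma tcomp_ext3: "a \<odot> (b \<odot> c) = e \<Longrightarrow> a \<odot> (b \<odot> (c \<odot> x)) = e \<odot> x"
  by (simp add: tcomp_assoc[symmetric])

lemma vanish_sgl: "vanish n f \<Longrightarrow> vanish n (sgl A f)"
  by (auto simp: vanish_def app_ops)

lemma vanish_tcomp_left: "vanish n F \<Longrightarrow> vanish n (F \<odot> f)"
  and vanish_tcomp_right: "vanish n f \<Longrightarrow> vanish n (F \<odot> f)"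
  using vanish_tcomp[of n F 0 f] vanish_tcomp[of 0 F n f] by auto

lemma (in spanning) degreewise_map:
  assumes W: "vector_space sW" and \<phi>: "\<And>n. homogeneous_map (scl V) sW (\<phi> n)"
  shows "\<exists>\<Phi>. homogeneous_map (scl V) sW \<Phi> \<and> (\<forall>n. \<forall>v\<in>gr V n. \<Phi> v = \<phi> n v)"
proof -
  have eq: "\<phi> (deg V v) v = \<phi> n v" if "v \<in> gr V n" for v n
    using deg_eq[OF that] by (cases "v = 0") (auto simp: homogeneous_mapD(3)[OF \<phi>])
  have "glinear V sW (\<lambda>v. \<phi> (deg V v) v)"
  proof (rule glinearI)
    fix n x assume x: "x \<in> gr V n"
    show "\<phi> (deg V (x + y)) (x + y) = \<phi> (deg V x) x + \<phi> (deg V y) y" if y: "y \<in> gr V n" for y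
      unfolding eq[OF x] eq[OF y] eq[OF gr_add[OF x y]] by (rule homogeneous_mapD(1)[OF \<phi>])
    show "\<phi> (deg V (scl V c x)) (scl V c x) = sW c (\<phi> (deg V x) x)" for c
      unfolding eq[OF x] eq[OF gr_scale[OF x]] by (rule homogeneous_mapD(2)[OF \<phi>])
  qed
  from glinear_extension[OF W this] obtain \<Phi>
    where \<Phi>: "homogeneous_map (scl V) sW \<Phi>" "\<forall>v\<in>homog V. \<Phi> v = \<phi> (deg V v) v" by blast
  have "\<Phi> v = \<phi> n v" if "v \<in> gr V n" for v n
    using \<Phi>(2) homogI[OF that] eq[OF that] by simp
  with \<Phi>(1) show ?thesis by blast
qed

context words
begin

text \<open>The fixed point \<open>R\<close> of \<open>R \<mapsto> 1 - x R\<close> is a right inverse of \<open>1 + x\<close>. The difference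
  \<open>z = R (1 + x) - 1\<close> satisfies \<open>z = - x z\<close>, so that \<open>R\<close> is a left inverse too.\<close>

lemma neumann_inverse:
  assumes x: "mor 0 x" "vanish 1 x"
  shows "\<exists>R. mor 0 R \<and> (tid + x) \<odot> R = tid \<and> R \<odot> (tid + x) = tid"
proof -
  have "\<exists>R. mor 0 R \<and> tid - x \<odot> R = R"
  proof (rule contraction_fixed_point)
    show "mor 0 (0 :: ('a, 'c, 'c) tmap)" by simp
    show "mor 0 (tid - x \<odot> f)" if "mor 0 f" for f
      by (intro mor_diff mor_tid mor_tcomp_eq[OF x(1) that]) simp
    show "vanish (Suc n) ((tid - x \<odot> f) - (tid - x \<odot> g))" if "vanish n (f - g)" for f g n
      using vanish_minus[OF vanish_tcomp[OF x(2) that]] by (simp add: tcomp_diff_right)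
    show "mor 0 f" if "\<And>n. \<exists>g. mor 0 g \<and> vanish n (f - g)" for f
      using that by (rule mor_limit)
  qed
  then obtain R where R: "mor 0 R" "tid - x \<odot> R = R" by blast
  have r: "(tid + x) \<odot> R = tid"
    using R(2) by (simp add: tcomp_add_left algebra_simps)
  have "R \<odot> (tid + x) - tid = 0"
  proof (rule tcomp_fix_0)
    show "vanish 1 (- x)" using x(2) by (rule vanish_minus)
    let ?z = "R \<odot> (tid + x) - tid"
    have "(tid + x) \<odot> ?z = 0"
      using r by (simp add: tcomp_diff_right tcomp_assoc[symmetric])
    then show "?z = - x \<odot> ?z"
      by (simp add: tcomp_add_left tcomp_minus_left eq_neg_iff_add_eq_0)
  qed
  with R(1) r show ?thesis by auto
qed

text \<open>The perturbation lemma. Splitting off the constant term \<open>D\<close> of the structure map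
  \<open>b = D + \<beta>\<close> and using a contraction \<open>h\<close> of \<open>D\<close> onto the image of \<open>P\<close>, the two homomorphisms are
  \<open>(1 + h \<beta>)\<^sup>-\<^sup>1 P\<close> and, up to the sign operator on \<open>\<beta>\<close>, \<open>P (1 + \<beta> h)\<^sup>-\<^sup>1\<close>. The products of \<open>A\<close>
  enter only through the derivation \<open>del\<close>, which commutes with \<open>h\<close> up to sign; they take no
  part in the perturbation.\<close>

lemma perturbation:
  fixes D h P :: "'c \<Rightarrow> 'c"
  defines "D' \<equiv> conc D" and "h' \<equiv> conc h" and "P' \<equiv> conc P"
  assumes b: "mor 1 b" and MC: "del b + sgl A b \<odot> b = 0"
    and \<beta>: "vanish 1 (b - D')" and mor: "mor 1 D'" "mor (-1) h'" "mor 0 P'"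
    and DD: "D' \<odot> D' = 0" and hh: "h' \<odot> h' = 0" and hP: "h' \<odot> P' = 0" and Ph: "P' \<odot> h' = 0"
    and DP: "D' \<odot> P' = 0" and PD: "P' \<odot> D' = 0" and PP: "P' \<odot> P' = P'"
    and contr_left: "h' \<odot> (D' \<odot> (b - D')) = (b - D') - P' \<odot> (b - D') - D' \<odot> (h' \<odot> (b - D'))"
    and contr_right: "(b - D') \<odot> (D' \<odot> h') = (b - D') - (b - D') \<odot> P' - (b - D') \<odot> (h' \<odot> D')"
  shows "\<exists>i q bH. mor 0 i \<and> mor 0 q \<and> mor 1 bH \<and> i \<odot> P' = i \<and> P' \<odot> q = q \<and> q \<odot> i = P'
    \<and> P' \<odot> bH = bH \<and> bH \<odot> P' = bH \<and> vanish 1 (i - P') \<and> vanish 1 (q - P') \<and> vanish 1 bH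
    \<and> del i + sgl A i \<odot> bH = b \<odot> i \<and> del q + sgl A q \<odot> b = bH \<odot> q"
proof -
  define \<beta> where "\<beta> = b - D'"
  have b_eq: "b = D' + \<beta>" by (simp add: \<beta>_def)
  have c [simp]: "sgl A D' = D'" "sgl A h' = h'" "sgl A P' = P'" "del D' = 0" "del h' = 0" "del P' = 0"
    by (simp_all add: D'_def h'_def P'_def)
  have m\<beta>: "mor 1 \<beta>" unfolding \<beta>_def using b mor by blast
  have v\<beta>: "vanish 1 \<beta>" using \<beta> by (simp add: \<beta>_def)
  define \<sigma>\<beta> where "\<sigma>\<beta> = sgl A \<beta>"
  have sb [simp]: "sgl A \<beta> = \<sigma>\<beta>" "sgl A \<sigma>\<beta> = \<beta>" by (simp_all add: \<sigma>\<beta>_def)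
  have m\<sigma>\<beta>: "mor 1 \<sigma>\<beta>" unfolding \<sigma>\<beta>_def using m\<beta> by blast
  have v\<sigma>\<beta>: "vanish 1 \<sigma>\<beta>" unfolding \<sigma>\<beta>_def using v\<beta> by (rule vanish_sgl)
  have d\<beta>: "del \<beta> = - (D' \<odot> \<beta>) - \<sigma>\<beta> \<odot> D' - \<sigma>\<beta> \<odot> \<beta>"
  proof -
    have "del \<beta> + (D' \<odot> \<beta> + \<sigma>\<beta> \<odot> D' + \<sigma>\<beta> \<odot> \<beta>) = 0"
      using MC unfolding b_eq by (simp add: del_add ops_add tcomp_simps DD algebra_simps)
    then show ?thesis by (simp add: add_eq_0_iff algebra_simps)
  qed
  have mh\<beta>: "mor 0 (h' \<odot> \<beta>)" by (rule mor_tcomp_eq[OF mor(2) m\<beta>]) simp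
  obtain R where R: "mor 0 R" "(tid + h' \<odot> \<beta>) \<odot> R = tid" "R \<odot> (tid + h' \<odot> \<beta>) = tid"
    using neumann_inverse[OF mh\<beta> vanish_tcomp_right[OF v\<beta>]] by blast
  define S where "S = sgl A R"
  have sR [simp]: "sgl A R = S" "sgl A S = R" by (simp_all add: S_def)
  have mS: "mor 0 S" unfolding S_def using R by blast
  have hR: "h' \<odot> (\<beta> \<odot> R) = tid - R" and Rh: "R \<odot> (h' \<odot> \<beta>) = tid - R"
    using R(2,3) by (simp_all add: tcomp_simps algebra_simps)
  have hS: "h' \<odot> (\<sigma>\<beta> \<odot> S) = tid - S" and Sh: "S \<odot> (h' \<odot> \<sigma>\<beta>) = tid - S"
    using arg_cong[OF hR, of "sgl A"] arg_cong[OF Rh, of "sgl A"] by (simp_all add: sgl_tcomp ops_diff)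
  note rules = hR Rh hS Sh tcomp_ext3[OF hR] tcomp_ext3[OF Rh] tcomp_ext3[OF hS] tcomp_ext3[OF Sh]
    DD DP PD PP hh hP Ph tcomp_ext[OF DD] tcomp_ext[OF DP] tcomp_ext[OF PD] tcomp_ext[OF PP]
    tcomp_ext[OF hh] tcomp_ext[OF hP] tcomp_ext[OF Ph]
  \<comment> \<open>\<open>h D = e - p - D h\<close>, applied to the output of \<open>\<beta>\<close>, which is fixed by \<open>e\<close>; similarly \<open>cr\<close> below\<close>
  have cl: "h' \<odot> (D' \<odot> (\<beta> \<odot> x)) = \<beta> \<odot> x - P' \<odot> (\<beta> \<odot> x) - D' \<odot> (h' \<odot> (\<beta> \<odot> x))" for x
    using tcomp_ext3[OF contr_left[folded \<beta>_def], of x] by (simp add: tcomp_simps)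
  note cr = contr_right[folded \<beta>_def]
  have dhb: "del (h' \<odot> \<beta>) = h' \<odot> del \<beta>"
    using del_odd[OF VV mor_trilin[OF mor(2)] m\<beta>] by simp
  have dR: "del R = b \<odot> R - S \<odot> (P' \<odot> (\<beta> \<odot> R)) - S \<odot> D'"
  proof -
    have "nrm A (tid + h' \<odot> \<beta>)" by (rule mor_nrm[OF mor_add[OF mor_tid mh\<beta>]])
    from del_even[OF this R(1)] have "h' \<odot> (del \<beta> \<odot> R) + (tid + h' \<odot> \<sigma>\<beta>) \<odot> del R = 0"
      unfolding R(2) by (simp add: del_add dhb ops_add sgl_tcomp tcomp_assoc)
    from arg_cong[OF this, of "\<lambda>x. S \<odot> x"]
    have "del R = - (S \<odot> (h' \<odot> (del \<beta> \<odot> R)))"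
      by (simp add: tcomp_simps rules eq_neg_iff_add_eq_0 add.commute)
    also have "\<dots> = b \<odot> R - S \<odot> (P' \<odot> (\<beta> \<odot> R)) - S \<odot> D'"
      unfolding d\<beta> b_eq by (simp add: tcomp_simps cl rules algebra_simps)
    finally show ?thesis .
  qed
  define bH where "bH = P' \<odot> (\<beta> \<odot> (R \<odot> P'))"
  define i where "i = R \<odot> P'"
  \<comment> \<open>the inverse of \<open>1 + \<sigma>\<beta> h\<close>, in terms of that of \<open>1 + h \<sigma>\<beta>\<close>\<close>
  define L where "L = tid - \<sigma>\<beta> \<odot> (S \<odot> h')"
  define q where "q = P' \<odot> L"
  have mbH: "mor 1 bH"
    unfolding bH_def by (intro mor_tcomp_eq[OF mor(3)] mor_tcomp_eq[OF m\<beta>] mor_tcomp_eq[OF R(1) mor(3)]) auto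
  have mi: "mor 0 i" unfolding i_def by (rule mor_tcomp_eq[OF R(1) mor(3)]) simp
  have mL: "mor 0 L" unfolding L_def
    by (intro mor_diff mor_tid mor_tcomp_eq[OF m\<sigma>\<beta>] mor_tcomp_eq[OF mS mor(2)]) auto
  have mq: "mor 0 q" unfolding q_def by (rule mor_tcomp_eq[OF mor(3) mL]) simp
  have di: "del i + sgl A i \<odot> bH = b \<odot> i"
  proof -
    have "del i = del R \<odot> P'"
      unfolding i_def using del_even[OF mor_nrm[OF R(1)] mor(3)] by simp
    then show ?thesis
      unfolding dR by (simp add: i_def bH_def sgl_tcomp tcomp_simps rules)
  qed
  have dL: "del L + sgl A L \<odot> b = D' \<odot> L + \<beta> \<odot> (R \<odot> (P' \<odot> L))"
  proof -
    have "del (\<beta> \<odot> R) = del \<beta> \<odot> R + \<sigma>\<beta> \<odot> del R"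
      using del_even[OF mor_nrm[OF m\<beta>] R(1)] by simp
    also have "\<dots> = - (D' \<odot> (\<beta> \<odot> R)) - \<sigma>\<beta> \<odot> (S \<odot> (P' \<odot> (\<beta> \<odot> R))) - \<sigma>\<beta> \<odot> (S \<odot> D')"
      unfolding d\<beta> dR b_eq by (simp add: tcomp_simps)
    finally have dbR: "sgl A (del (\<beta> \<odot> R)) = - (D' \<odot> (\<sigma>\<beta> \<odot> S)) - \<beta> \<odot> (R \<odot> (P' \<odot> (\<sigma>\<beta> \<odot> S))) - \<beta> \<odot> (R \<odot> D')"
      by (simp add: ops_diff ops_minus sgl_tcomp)
    have "mor 1 (\<beta> \<odot> R)" by (rule mor_tcomp_eq[OF m\<beta> R(1)]) simp
    from del_odd[OF VV mor_trilin[OF this] mor(2)]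
    have "del L = sgl A (del (\<beta> \<odot> R)) \<odot> h'"
      by (simp add: L_def del_diff sgl_tcomp tcomp_assoc)
    then have dL1: "del L = - (D' \<odot> (\<sigma>\<beta> \<odot> (S \<odot> h'))) - \<beta> \<odot> (R \<odot> (P' \<odot> (\<sigma>\<beta> \<odot> (S \<odot> h')))) - \<beta> \<odot> (R \<odot> (D' \<odot> h'))"
      unfolding dbR by (simp add: tcomp_simps)
    have "R \<odot> (D' \<odot> h') = (tid - R \<odot> (h' \<odot> \<beta>)) \<odot> (D' \<odot> h')" by (simp add: Rh)
    also have "\<dots> = D' \<odot> h' - R \<odot> (h' \<odot> (\<beta> - \<beta> \<odot> P' - \<beta> \<odot> (h' \<odot> D')))"
      by (simp only: tcomp_simps tid_left cr)
    also have "\<dots> = D' \<odot> h' - (tid - R) + (P' - R \<odot> P') + (h' \<odot> D' - R \<odot> (h' \<odot> D'))"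
      by (simp add: tcomp_simps rules)
    finally have "\<beta> \<odot> (R \<odot> (D' \<odot> h')) = \<beta> \<odot> (R - R \<odot> P' - R \<odot> (h' \<odot> D'))"
      by (simp add: tcomp_simps cr)
    then have bRDh: "\<beta> \<odot> (R \<odot> (D' \<odot> h')) = \<beta> \<odot> R - \<beta> \<odot> (R \<odot> P') - \<beta> \<odot> (R \<odot> (h' \<odot> D'))"
      by (simp add: tcomp_simps)
    show ?thesis
      unfolding dL1 bRDh by (simp add: L_def b_eq ops_diff sgl_tcomp tcomp_simps rules algebra_simps)
  qed
  have dq: "del q + sgl A q \<odot> b = bH \<odot> q"
  proof -
    have "del q = P' \<odot> del L"
      unfolding q_def using del_even[OF mor_nrm[OF mor(3)] mL] by simp
    then have "del q + sgl A q \<odot> b = P' \<odot> (del L + sgl A L \<odot> b)"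
      by (simp add: q_def sgl_tcomp tcomp_simps)
    then show ?thesis
      unfolding dL by (simp add: bH_def q_def tcomp_simps rules)
  qed
  have hRP: "h' \<odot> (R \<odot> P') = 0"
  proof -
    have "h' \<odot> (h' \<odot> (\<beta> \<odot> R)) = 0" by (simp add: tcomp_ext[OF hh])
    then have "h' \<odot> (tid - R) = 0" by (simp only: hR)
    then have "h' \<odot> R = h'" by (simp add: tcomp_diff_right)
    then show ?thesis using tcomp_ext[of h' R h' P'] by (simp add: rules)
  qed
  have qi: "q \<odot> i = P'"
  proof -
    have "P' \<odot> (h' \<odot> (\<beta> \<odot> R)) = 0" by (simp add: tcomp_ext[OF Ph])
    then have "P' \<odot> (tid - R) = 0" by (simp only: hR)
    then have "P' \<odot> R = P'" by (simp add: tcomp_diff_right)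
    then have "P' \<odot> (R \<odot> P') = P'" by (simp add: tcomp_assoc[symmetric] PP)
    then show ?thesis by (simp add: q_def i_def L_def tcomp_simps rules hRP)
  qed
  have vi: "vanish 1 (i - P')"
  proof -
    have "vanish 1 (- (h' \<odot> (\<beta> \<odot> R)) \<odot> P')"
      using v\<beta> by (intro vanish_tcomp_left vanish_minus vanish_tcomp_right)
    then show ?thesis by (simp add: hR i_def tcomp_simps)
  qed
  have vq: "vanish 1 (q - P')"
  proof -
    have "vanish 1 (- (P' \<odot> (\<sigma>\<beta> \<odot> (S \<odot> h'))))"
      by (rule vanish_minus, rule vanish_tcomp_right, rule vanish_tcomp_left[OF v\<sigma>\<beta>])
    then show ?thesis by (simp add: q_def L_def tcomp_simps)
  qed
  have vb: "vanish 1 bH"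
    unfolding bH_def by (rule vanish_tcomp_right, rule vanish_tcomp_left[OF v\<beta>])
  show ?thesis
    by (rule exI[of _ i], rule exI[of _ q], rule exI[of _ bH], intro conjI mi mq mbH qi vi vq vb di dq)
       (simp_all add: i_def q_def bH_def tcomp_simps rules)
qed

end

section \<open>Contracting a complex onto its cohomology\<close>

lemma (in vector_space) linear_self_iff: "Vector_Spaces.linear scale scale f \<longleftrightarrow> homogeneous_map scale scale f"
  by (rule linear_iff_homogeneous_map) (rule vector_space_axioms)+

lemma (in vector_space) projection_onto:
  assumes "subspace S"
  shows "\<exists>g. homogeneous_map scale scale g \<and> range g \<subseteq> S \<and> (\<forall>v\<in>S. g v = v)"
proof -
  interpret vp: vector_space_pair scale scale ..
  show ?thesis
    using vp.linear_exists_left_inverse_on[OF linear_ident assms] by (auto simp: linear_self_iff)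
qed

lemma (in vector_space) section_on:
  assumes "subspace S" "homogeneous_map scale scale f"
  shows "\<exists>g. homogeneous_map scale scale g \<and> range g \<subseteq> S \<and> (\<forall>v\<in>f ` S. f (g v) = v)"
proof -
  interpret vp: vector_space_pair scale scale ..
  show ?thesis
    using vp.linear_exists_right_inverse_on[OF assms(2)[folded linear_self_iff] assms(1)] by (auto simp: linear_self_iff)
qed

lemma homogeneous_map_compose:
  "homogeneous_map s1 s2 f \<Longrightarrow> homogeneous_map s2 s3 g \<Longrightarrow> homogeneous_map s1 s3 (\<lambda>x. g (f x))"
  by (simp add: homogeneous_map_def)

lemma homogeneous_map_diff:
  assumes "vector_space s2" "homogeneous_map s1 s2 f" "homogeneous_map s1 s2 g"
  shows "homogeneous_map s1 s2 (\<lambda>x. f x - g x)"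
proof -
  interpret vector_space s2 by fact
  show ?thesis using assms(2,3) by (simp add: homogeneous_map_def scale_right_diff_distrib)
qed

text \<open>Over a field every complex splits. In each degree, sections \<open>g\<close> of \<open>D\<close> over its image and
  projections \<open>\<pi>\<close> onto the image give the projection \<open>\<zeta> = e - g D e\<close> onto cocycles, the
  contraction \<open>h = g \<pi> \<zeta>\<close> and the projection \<open>p = \<zeta> - \<pi> \<zeta>\<close> onto representatives of the
  cohomology. The complex itself is the graded subspace with pieces \<open>G n\<close>, onto which \<open>e\<close>
  projects.\<close>

lemma (in spanning) contraction_exists:
  assumes e: "homogeneous_map (scl V) (scl V) e" "\<And>n v. v \<in> gr V n \<Longrightarrow> e v \<in> G n" "\<And>n v. v \<in> G n \<Longrightarrow> e v = v"
    and G: "\<And>n. vs.subspace (G n)" "\<And>n. G n \<subseteq> gr V n"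
    and D: "homogeneous_map (scl V) (scl V) D" "\<And>n v. v \<in> G n \<Longrightarrow> D v \<in> G (n + 1)" "\<And>n v. v \<in> G n \<Longrightarrow> D (D v) = 0"
  shows "\<exists>h p. homogeneous_map (scl V) (scl V) h \<and> homogeneous_map (scl V) (scl V) p
    \<and> (\<forall>n. \<forall>v\<in>gr V n. h v \<in> G (n - 1) \<and> p v \<in> G n \<and> D (p v) = 0 \<and> p (D (e v)) = 0
         \<and> p (p v) = p v \<and> h (h v) = 0 \<and> h (p v) = 0 \<and> p (h v) = 0 \<and> p (e v) = p v \<and> h (e v) = h v
         \<and> h (D (e v)) + D (h v) = e v - p v)"
proof -
  note De = homogeneous_mapD[OF D(1)] and e' = homogeneous_mapD[OF e(1)]
  have ee: "e (e v) = e v" if "v \<in> gr V n" for v n using e(3)[OF e(2)[OF that]] .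
  have "\<exists>g. homogeneous_map (scl V) (scl V) g \<and> range g \<subseteq> G n \<and> (\<forall>v\<in>D ` G n. D (g v) = v)" for n
    by (rule vs.section_on[OF G(1) D(1)])
  then obtain g where g: "\<And>n. homogeneous_map (scl V) (scl V) (g n)" "\<And>n. range (g n) \<subseteq> G n"
    "\<And>n v. v \<in> D ` G n \<Longrightarrow> D (g n v) = v" by metis
  interpret Dl: module_hom "scl V" "scl V" D
    using D(1) vs.linear_self_iff[of D] by (simp add: Vector_Spaces.linear_def)
  have "\<exists>\<pi>. homogeneous_map (scl V) (scl V) \<pi> \<and> range \<pi> \<subseteq> D ` G (n - 1) \<and> (\<forall>v\<in>D ` G (n - 1). \<pi> v = v)" for n
    by (rule vs.projection_onto[OF Dl.subspace_image[OF G(1)]])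
  then obtain \<pi> where \<pi>: "\<And>n. homogeneous_map (scl V) (scl V) (\<pi> n)" "\<And>n. range (\<pi> n) \<subseteq> D ` G (n - 1)"
    "\<And>n v. v \<in> D ` G (n - 1) \<Longrightarrow> \<pi> n v = v" by metis
  note g' = homogeneous_mapD[OF g(1)] and \<pi>' = homogeneous_mapD[OF \<pi>(1)]
  \<comment> \<open>the projection onto cocycles along the image of \<open>g\<close>\<close>
  define \<zeta> where "\<zeta> n v = e v - g n (D (e v))" for n v
  have \<zeta>h: "homogeneous_map (scl V) (scl V) (\<zeta> n)" for n
    unfolding \<zeta>_def
    by (intro homogeneous_map_diff vs.vector_space_axioms e(1) homogeneous_map_compose[OF _ g(1)]
        homogeneous_map_compose[OF e(1) D(1)])
  have gG: "g n v \<in> G n" for n v using g(2) by blast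
  have Gsub: "x - y \<in> G n" if "x \<in> G n" "y \<in> G n" for x y n using vs.subspace_diff[OF G(1) that] .
  have G0: "0 \<in> G n" for n using vs.subspace_0[OF G(1)] .
  have \<pi>B: "\<pi> n v \<in> D ` G (n - 1)" for n v using \<pi>(2) by blast
  have \<pi>G: "\<pi> n v \<in> G n" for n v
  proof -
    obtain u where "u \<in> G (n - 1)" "\<pi> n v = D u" using \<pi>B[of n v] by blast
    then show ?thesis using D(2)[of u "n - 1"] by simp
  qed
  have D\<pi>: "D (\<pi> n v) = 0" for n v using \<pi>B[of n v] D(3) by auto
  have \<zeta>G: "\<zeta> n v \<in> G n" if "v \<in> gr V n" for v n
    unfolding \<zeta>_def by (intro Gsub e(2)[OF that] gG)
  have D\<zeta>: "D (\<zeta> n v) = 0" if "v \<in> gr V n" for v n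
  proof -
    have "D (g n (D (e v))) = D (e v)" using e(2)[OF that] by (intro g(3)) auto
    then show ?thesis by (simp add: \<zeta>_def De)
  qed
  have \<zeta>Z: "\<zeta> n v = v" if "v \<in> G n" "D v = 0" for v n
    using that by (simp add: \<zeta>_def e(3) g')
  have \<zeta>g: "\<zeta> n (g n w) = 0" if "w \<in> D ` G n" for w n
    using g(3)[OF that] by (simp add: \<zeta>_def e(3)[OF gG])
  obtain h where h: "homogeneous_map (scl V) (scl V) h" "\<And>n v. v \<in> gr V n \<Longrightarrow> h v = g (n - 1) (\<pi> n (\<zeta> n v))"
    using degreewise_map[OF vs.vector_space_axioms, of "\<lambda>n v. g (n - 1) (\<pi> n (\<zeta> n v))"]
      homogeneous_map_compose[OF homogeneous_map_compose[OF \<zeta>h \<pi>(1)] g(1)] by blast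
  obtain p where p: "homogeneous_map (scl V) (scl V) p" "\<And>n v. v \<in> gr V n \<Longrightarrow> p v = \<zeta> n v - \<pi> n (\<zeta> n v)"
    using degreewise_map[OF vs.vector_space_axioms, of "\<lambda>n v. \<zeta> n v - \<pi> n (\<zeta> n v)"]
      homogeneous_map_diff[OF vs.vector_space_axioms \<zeta>h homogeneous_map_compose[OF \<zeta>h \<pi>(1)]] by blast
  have GV: "v \<in> gr V n" if "v \<in> G n" for v n using G(2) that by blast
  show ?thesis
  proof (rule exI[of _ h], rule exI[of _ p], intro conjI h(1) p(1) allI ballI)
    fix n v assume v: "v \<in> gr V n"
    note ev = e(2)[OF v]
    have hv: "h v \<in> G (n - 1)" by (simp add: h(2)[OF v] gG)
    then show "h v \<in> G (n - 1)" .
    have pv: "p v \<in> G n" by (simp add: p(2)[OF v] Gsub \<zeta>G[OF v] \<pi>G)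
    then show "p v \<in> G n" .
    show Dp: "D (p v) = 0" by (simp add: p(2)[OF v] De D\<zeta>[OF v] D\<pi>)
    have DB: "D (e v) \<in> D ` G (n + 1 - 1)" using ev by simp
    have Dev: "D (e v) \<in> G (n + 1)" by (rule D(2)[OF ev])
    have \<zeta>D: "\<zeta> (n + 1) (D (e v)) = D (e v)" using ev by (intro \<zeta>Z Dev D(3))
    show "p (D (e v)) = 0"
      by (simp only: p(2)[OF GV[OF Dev]] \<zeta>D \<pi>(3)[OF DB]) simp
    have \<zeta>p: "\<zeta> n (p v) = p v" by (rule \<zeta>Z[OF pv Dp])
    have \<pi>p: "\<pi> n (p v) = 0" by (simp add: p(2)[OF v] \<pi>' \<pi>(3)[OF \<pi>B])
    show "p (p v) = p v" by (simp add: p(2)[OF GV[OF pv]] \<zeta>p \<pi>p)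
    show "h (p v) = 0" by (simp add: h(2)[OF GV[OF pv]] \<zeta>p \<pi>p g')
    have \<zeta>hv: "\<zeta> (n - 1) (h v) = 0" unfolding h(2)[OF v] by (rule \<zeta>g[OF \<pi>B])
    show "h (h v) = 0" by (simp add: h(2)[OF GV[OF hv]] \<zeta>hv g' \<pi>')
    show "p (h v) = 0" by (simp add: p(2)[OF GV[OF hv]] \<zeta>hv \<pi>')
    have \<zeta>e: "\<zeta> n (e v) = \<zeta> n v" by (simp add: \<zeta>_def ee[OF v])
    show "p (e v) = p v" "h (e v) = h v"
      by (simp_all add: p(2)[OF v] p(2)[OF GV[OF ev]] h(2)[OF v] h(2)[OF GV[OF ev]] \<zeta>e)
    have "h (D (e v)) = g n (D (e v))"
      by (simp only: h(2)[OF GV[OF Dev]] \<zeta>D \<pi>(3)[OF DB]) simp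
    moreover have "D (h v) = \<pi> n (\<zeta> n v)"
      unfolding h(2)[OF v] by (rule g(3)[OF \<pi>B])
    ultimately show "h (D (e v)) + D (h v) = e v - p v"
      by (simp add: p(2)[OF v] \<zeta>_def)
  qed
qed

section \<open>Bimodules as normalised families\<close>

lemma (in vector_space) functionals_separate:
  assumes "\<And>\<xi>. homogeneous_map scale (*) \<xi> \<Longrightarrow> \<xi> x = 0" shows "x = 0"
proof (rule ccontr)
  assume x: "x \<noteq> 0"
  interpret F: vector_space "(*) :: 'a \<Rightarrow> 'a \<Rightarrow> 'a" by (rule vector_space_field)
  interpret vp: vector_space_pair scale "(*) :: 'a \<Rightarrow> 'a \<Rightarrow> 'a" ..
  have "independent {x}" using x by simp
  from vp.linear_independent_extend[OF this, of "\<lambda>x. 1"] obtain g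
    where "Vector_Spaces.linear scale (*) g" "g x = 1" by auto
  then have "homogeneous_map scale (*) g" "g x = 1"
    by (simp_all add: linear_iff_homogeneous_map[OF vector_space_axioms F.vector_space_axioms])
  with assms[of g] show False by simp
qed

lemma trilinearI:
  assumes "\<And>as bs n x y. as \<in> lists (homog A) \<Longrightarrow> bs \<in> lists (homog A) \<Longrightarrow> x \<in> gr M n \<Longrightarrow> y \<in> gr M n \<Longrightarrow> F as (x + y) bs = F as x bs + F as y bs"
    "\<And>as bs n x c. as \<in> lists (homog A) \<Longrightarrow> bs \<in> lists (homog A) \<Longrightarrow> x \<in> gr M n \<Longrightarrow> F as (scl M c x) bs = sW c (F as x bs)"
    "\<And>xs ys bs v. xs \<in> lists (homog A) \<Longrightarrow> ys \<in> lists (homog A) \<Longrightarrow> bs \<in> lists (homog A) \<Longrightarrow> v \<in> homog M \<Longrightarrow> glinear A sW (\<lambda>x. F (xs @ [x] @ ys) v bs)"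
    "\<And>xs ys as v. xs \<in> lists (homog A) \<Longrightarrow> ys \<in> lists (homog A) \<Longrightarrow> as \<in> lists (homog A) \<Longrightarrow> v \<in> homog M \<Longrightarrow> glinear A sW (\<lambda>x. F as v (xs @ [x] @ ys))"
  shows "trilinear A M sW F"
  unfolding trilinear_def
proof (intro conjI ballI)
  show "glinear M sW (\<lambda>v. F as v bs)" if "as \<in> lists (homog A)" "bs \<in> lists (homog A)" for as bs
    by (rule glinearI; rule assms(1,2)[OF that])
qed (rule assms(3,4); assumption)+

lemma trilinearD:
  assumes "trilinear A M sW F"
  shows "as \<in> lists (homog A) \<Longrightarrow> bs \<in> lists (homog A) \<Longrightarrow> glinear M sW (\<lambda>v. F as v bs)"
    "xs \<in> lists (homog A) \<Longrightarrow> ys \<in> lists (homog A) \<Longrightarrow> bs \<in> lists (homog A) \<Longrightarrow> v \<in> homog M \<Longrightarrow> glinear A sW (\<lambda>x. F (xs @ [x] @ ys) v bs)"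
    "xs \<in> lists (homog A) \<Longrightarrow> ys \<in> lists (homog A) \<Longrightarrow> as \<in> lists (homog A) \<Longrightarrow> v \<in> homog M \<Longrightarrow> glinear A sW (\<lambda>x. F as v (xs @ [x] @ ys))"
  using assms unfolding trilinear_def by blast+

text \<open>The projection \<open>e\<close> serves to extend maps that are only defined on the homogeneous
  elements of \<open>M\<close>.\<close>

locale submodule = words A V
  for A :: "('k::field, 'a::ab_group_add) ainf" and V :: "('k, 'c::ab_group_add) gspace" +
  fixes M :: "('k, 'a, 'c) bimod" and e :: "'c \<Rightarrow> 'c"
  assumes M: "graded_space M" and scl_M: "scl M = scl V"
    and e: "homogeneous_map (scl V) (scl V) e"
    and gr_M: "gr M n \<subseteq> gr V n"
    and e_gr: "v \<in> gr V n \<Longrightarrow> e v \<in> gr M n"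
    and e_id: "v \<in> gr M n \<Longrightarrow> e v = v"
begin

sublocale M: graded M by unfold_locales (rule M)

lemmas e' = homogeneous_mapD[OF e]

lemma e_e: "e (e v) = e v"
proof (rule additive_eqI[of "\<lambda>v. e (e v)" e])
  show "e (e v) = e v" if "v \<in> gr V n" for v n using e_id[OF e_gr[OF that]] .
qed (simp_all add: e')

lemma deg_M: "v \<in> gr M n \<Longrightarrow> v \<noteq> 0 \<Longrightarrow> deg M v = n"
  by (rule M.deg_eq)

lemma homog_M: "v \<in> homog M \<Longrightarrow> e v = v"
  using e_id by (auto simp: homog_def)

lemma homog_e: "v \<in> gr V n \<Longrightarrow> e v \<in> homog M"
  using e_gr by blast

lemma mor_e [intro, simp]: "mor 0 (conc e)"
  by (rule mor_conc[OF e]) (use e_gr gr_M in auto)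

lemma trilinear_restrict: "trilin sW F \<Longrightarrow> trilinear A M sW (app F)"
  by (rule trilinearI) (auto simp: scl_M trilinD(5) intro: trilinD(6,7) simp del: append.simps)

text \<open>The representative is \<open>f as (e v) bs\<close>, extended linearly in \<open>v\<close> and set to \<open>0\<close> off
  normalised words, where multilinearity forces this value anyway or \<open>f\<close> is irrelevant.\<close>

lemma represent:
  assumes W: "vector_space sW" and f: "trilinear A M sW f"
  shows "\<exists>F. trilin sW F \<and> F \<odot> conc e = F \<and> (\<forall>as\<in>H. \<forall>bs\<in>H. \<forall>v\<in>homog M. app F as v bs = f as v bs)"
proof -
  interpret W: glin A sW using W by (simp add: glin_def A.graded_axioms)
  define \<Phi> where "\<Phi> as bs = extend (\<lambda>v. f as (e v) bs)" for as bs
  have g: "glinear V sW (\<lambda>v. f as (e v) bs)" if "as \<in> H" "bs \<in> H" for as bs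
  proof (rule glinearI)
    note t = trilinearD(1)[OF f that]
    fix n x assume x: "x \<in> gr V n"
    show "f as (e (x + y)) bs = f as (e x) bs + f as (e y) bs" if y: "y \<in> gr V n" for y
      unfolding e'(1) by (rule glinearD(1)[OF t e_gr[OF x] e_gr[OF y]])
    show "f as (e (scl V c x)) bs = sW c (f as (e x) bs)" for c
      unfolding e'(2) using glinearD(2)[OF t e_gr[OF x]] by (simp add: scl_M)
  qed
  have \<Phi>: "homogeneous_map (scl V) sW (\<Phi> as bs)" "\<And>v. v \<in> homog V \<Longrightarrow> \<Phi> as bs v = f as (e v) bs"
    if "as \<in> H" "bs \<in> H" for as bs
    unfolding \<Phi>_def using extend[OF W g[OF that]] by auto
  define F where "F = Tmap (\<lambda>as v bs. if as \<in> L \<and> bs \<in> L then \<Phi> as bs v else 0)"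
  have F: "app F as v bs = (if as \<in> L \<and> bs \<in> L then \<Phi> as bs v else 0)" for as v bs
    unfolding F_def
    by (subst Tmap_inverse) (auto simp: homogeneous_mapD[OF \<Phi>(1)[OF L_sub_H L_sub_H]] simp del: in_lists_conv_set)
  have ml: "multilinear sW (\<lambda>as. f as v bs)" "multilinear sW (\<lambda>as. f bs v as)" if "bs \<in> H" "v \<in> homog M" for v bs
    unfolding multilinear_def using trilinearD(2,3)[OF f] that by blast+
  have agree: "app F as v bs = f as (e v) bs" if "as \<in> H" "bs \<in> H" "v \<in> homog V" for as bs v
  proof (cases "as \<in> L \<and> bs \<in> L")
    case True
    then show ?thesis using \<Phi>(2)[OF that] by (simp add: F)
  next
    case False
    have ev: "e v \<in> homog M" using that(3) homog_e by (auto simp: homog_def[of V])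
    have "f as (e v) bs = 0"
      using False multilinear_eq_0[OF W ml(1)[OF that(2) ev] that(1)] multilinear_eq_0[OF W ml(2)[OF that(1) ev] that(2)] by blast
    with False show ?thesis by (auto simp: F simp del: in_lists_conv_set)
  qed
  have tri: "trilin sW F"
  proof (rule trilinI)
    show "nrm A F" by (auto simp: nrm_def F simp del: in_lists_conv_set)
    show "app F as (scl V c v) bs = sW c (app F as v bs)" for as c v bs
      by (auto simp: F homogeneous_mapD[OF \<Phi>(1)[OF L_sub_H L_sub_H]] simp del: in_lists_conv_set)
    fix xs ys bs :: "'a list" and v assume H: "xs \<in> H" "ys \<in> H" "bs \<in> H"
    show "glinear A sW (\<lambda>x. app F (xs @ [x] @ ys) v bs)"
    proof (rule homog_induct[of "\<lambda>v. glinear A sW (\<lambda>x. app F (xs @ [x] @ ys) v bs)"])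
      fix n v assume v: "v \<in> gr V n"
      show "glinear A sW (\<lambda>x. app F (xs @ [x] @ ys) v bs)"
        by (rule A.glinear_homog_cong[OF trilinearD(2)[OF f H homog_e[OF v]]]) (use H v in \<open>auto intro!: agree\<close>)
    qed (auto intro: W.glinear_plus)
    show "glinear A sW (\<lambda>x. app F bs v (xs @ [x] @ ys))"
    proof (rule homog_induct[of "\<lambda>v. glinear A sW (\<lambda>x. app F bs v (xs @ [x] @ ys))"])
      fix n v assume v: "v \<in> gr V n"
      show "glinear A sW (\<lambda>x. app F bs v (xs @ [x] @ ys))"
        by (rule A.glinear_homog_cong[OF trilinearD(3)[OF f H homog_e[OF v]]]) (use H v in \<open>auto intro!: agree\<close>)
    qed (auto intro: W.glinear_plus)
  qed
  have agree_L: "app F as (e v) bs = app F as v bs" if "v \<in> gr V n" for as v bs n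
  proof (cases "as \<in> L \<and> bs \<in> L")
    case True
    then have H: "as \<in> H" "bs \<in> H" using L_sub_H by blast+
    have "e v \<in> homog V" using that e_gr gr_M by blast
    then show ?thesis using agree[OF H] that by (simp add: e_e homogI)
  qed (auto simp: F)
  have "F \<odot> conc e = F"
    by (rule tmap_eq_on_homog) (simp add: homogeneous_map_conc_apply(3)[OF e] agree_L)
  moreover have "app F as v bs = f as v bs" if "as \<in> H" "bs \<in> H" "v \<in> homog M" for as bs v
  proof -
    have "v \<in> homog V" using that(3) gr_M by (auto simp: homog_def)
    then show ?thesis using agree[OF that(1,2)] homog_M[OF that(3)] by simp
  qed
  ultimately show ?thesis using tri by blast
qed

lemma represent_mor:
  assumes f: "trilinear A M (scl V) f" "has_degree A M M r f"
  shows "\<exists>F. mor r F \<and> F \<odot> conc e = F \<and> conc e \<odot> F = F \<and> (\<forall>as\<in>H. \<forall>bs\<in>H. \<forall>v\<in>homog M. app F as v bs = f as v bs)"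
proof -
  obtain F where F: "trilin (scl V) F" "F \<odot> conc e = F" "\<And>as bs v. as \<in> H \<Longrightarrow> bs \<in> H \<Longrightarrow> v \<in> homog M \<Longrightarrow> app F as v bs = f as v bs"
    using represent[OF VV f(1)] by blast
  have Fe: "app F as (e v) bs = app F as v bs" for as v bs
    using arg_cong[OF F(2), of "\<lambda>F. app F as v bs"] by (simp add: homogeneous_map_conc_apply(3)[OF e])
  have deg: "app F as v bs \<in> gr M (dg as + n + dg bs + r)" if "v \<in> gr V n" for as v bs n
  proof (cases "as \<in> L \<and> bs \<in> L \<and> e v \<noteq> 0")
    case True
    then have H: "as \<in> H" "bs \<in> H" using L_sub_H by blast+
    have "deg M (e v) = n" using True deg_M[OF e_gr[OF that]] by blast
    then have "f as (e v) bs \<in> gr M (dg as + n + dg bs + r)"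
      using f(2) H homog_e[OF that] unfolding has_degree_def by blast
    then show ?thesis using F(3)[OF H homog_e[OF that]] by (simp add: Fe)
  next
    case False
    then have "app F as (e v) bs = 0"
      by (cases "e v = 0") (simp, blast intro: nrmD[OF trilinD(1)[OF F(1)]])
    then show ?thesis by (simp add: Fe)
  qed
  have "mor r F" by (rule morI[OF F(1)]) (use deg gr_M in blast)
  moreover have "conc e \<odot> F = F"
    by (rule tmap_eq_on_homog) (simp add: homogeneous_map_conc_apply(2)[OF e] e_id[OF deg])
  ultimately show ?thesis using F by blast
qed

end

locale represented = submodule A V M e
  for A :: "('k::field, 'a::ab_group_add) ainf" and V :: "('k, 'c::ab_group_add) gspace"
    and M :: "('k, 'a, 'c) bimod" and e :: "'c \<Rightarrow> 'c" +
  fixes b :: "('a, 'c, 'c) tmap"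
  assumes b: "mor 1 b" and be: "b \<odot> conc e = b" and eb: "conc e \<odot> b = b"
    and act: "as \<in> H \<Longrightarrow> bs \<in> H \<Longrightarrow> v \<in> homog M \<Longrightarrow> act M as v bs = app b as v bs"
begin

lemma act_homog: "as \<in> H \<Longrightarrow> bs \<in> H \<Longrightarrow> v \<in> gr M n \<Longrightarrow> act M as v bs \<in> gr M (dg as + n + dg bs + 1)"
proof -
  assume a: "as \<in> H" "bs \<in> H" and v: "v \<in> gr M n"
  have "app b as v bs \<in> gr V (dg as + n + dg bs + 1)"
    using mor_degree[OF b] v gr_M by blast
  then have "e (app b as v bs) \<in> gr M (dg as + n + dg bs + 1)" by (rule e_gr)
  moreover have "e (app b as v bs) = app b as v bs"
    using arg_cong[OF eb, of "\<lambda>F. app F as v bs"] by (simp add: homogeneous_map_conc_apply(2)[OF e])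
  ultimately show ?thesis by (simp add: act[OF a M.homogI[OF v]])
qed

lemma act_trilinear: "trilinear A M (scl M) (act M)"
proof -
  have t: "trilin (scl V) b" using b by (rule mor_trilin)
  have H1: "xs @ [x] @ ys \<in> H" if "xs \<in> H" "ys \<in> H" "x \<in> homog A" for xs ys x
    using that by auto
  show ?thesis
  proof (rule trilinearI)
    fix as bs :: "'a list" and n x y assume H: "as \<in> H" "bs \<in> H" and x: "x \<in> gr M n"
    { assume y: "y \<in> gr M n"
      show "act M as (x + y) bs = act M as x bs + act M as y bs"
        using act[OF H] M.homogI[OF x] M.homogI[OF y] M.homogI[OF M.gr_add[OF x y]] by simp }
    show "act M as (scl M c x) bs = scl M c (act M as x bs)" for c
      using act[OF H M.homogI[OF x]] act[OF H M.homogI[OF M.gr_scale[OF x]]] by (simp add: scl_M trilinD(5)[OF t])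
  next
    fix xs ys bs :: "'a list" and v assume H: "xs \<in> H" "ys \<in> H" "bs \<in> H" "v \<in> homog M"
    show "glinear A (scl M) (\<lambda>x. act M (xs @ [x] @ ys) v bs)"
      unfolding scl_M by (rule A.glinear_homog_cong[OF trilinD(6)[OF t H(1-3), of v]]) (simp only: act[OF H1 H(3,4)] H)
    show "glinear A (scl M) (\<lambda>x. act M bs v (xs @ [x] @ ys))"
      unfolding scl_M by (rule A.glinear_homog_cong[OF trilinD(7)[OF t H(1-3), of v]]) (simp only: act[OF H(3) H1 H(4)] H)
  qed
qed

lemma act_degree: "has_degree A M M 1 (act M)"
  unfolding has_degree_def using act_homog M.gr_deg by blast

text \<open>This identity turns the equations of bimodules and homomorphisms into identities in
  an algebra of families with a derivation.\<close>

lemma bhat_eq: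
  assumes W: "vector_space sW" and F: "trilin sW F"
    and agree: "\<And>as bs v. as \<in> H \<Longrightarrow> bs \<in> H \<Longrightarrow> v \<in> homog M \<Longrightarrow> F' as v bs = app F as v bs"
    and H: "as \<in> H" "bs \<in> H" and v: "v \<in> homog M"
  shows "bhat A M F' as v bs = app (del F + sgl A F \<odot> b) as v bs"
proof -
  have 1: "mhat A (\<lambda>as'. F' as' v bs) as = app (insl A F) as v bs"
    unfolding app_insl_H[OF W F H] by (rule mhat_H_cong[OF agree[OF _ H(2) v] H(1)])
  have 2: "(\<Sum>i\<le>length as. \<Sum>j\<le>length bs.
      ksgn (dg (take i as)) (F' (take i as) (act M (drop i as) v (take j bs)) (drop j bs)))
      = app (sgl A F \<odot> b) as v bs"
  proof -
    have "ksgn (dg (take i as)) (F' (take i as) (act M (drop i as) v (take j bs)) (drop j bs))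
        = app (sgl A F) (take i as) (app b (drop i as) v (take j bs)) (drop j bs)" for i j
    proof -
      have "take i as \<in> H" "drop i as \<in> H" "take j bs \<in> H" "drop j bs \<in> H"
        using H by (auto dest: in_set_takeD in_set_dropD)
      moreover from this have "act M (drop i as) v (take j bs) \<in> homog M"
        using act_homog M.gr_deg[OF v] by blast
      ultimately show ?thesis by (simp add: agree act[OF _ _ v] app_sgl)
    qed
    then show ?thesis by (simp add: app_tcomp spl_def)
  qed
  obtain n where n: "v \<in> gr M n" using v by (auto simp: homog_def)
  have 3: "ksgn (dg as + deg M v) (mhat A (\<lambda>bs'. F' as v bs') bs) = app (insr A (sgl A F) \<odot> eps) as v bs"
  proof -
    have m: "mhat A (\<lambda>bs'. F' as v bs') bs = mhat A (\<lambda>bs'. app F as v bs') bs"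
      by (rule mhat_H_cong[OF agree[OF H(1) _ v] H(2)])
    have "app (insr A (sgl A F)) as (par v) bs = ksgn n (app (insr A (sgl A F)) as v bs)"
      using par(2)[of v n] n gr_M by (metis app_ksgn subsetD)
    also have "app (insr A (sgl A F)) as v bs = mhat A (\<lambda>x. app (sgl A F) as v x) bs"
      by (rule app_insr_H[OF W trilin_sgl[OF W F] H])
    also have "\<dots> = ksgn (dg as) (mhat A (\<lambda>bs'. app F as v bs') bs)"
      unfolding app_sgl mhat_ksgn ..
    finally have a: "app (insr A (sgl A F)) as (par v) bs = ksgn (dg as + n) (mhat A (\<lambda>bs'. app F as v bs') bs)"
      by (simp add: add.commute)
    show ?thesis
    proof (cases "v = 0")
      case True
      then show ?thesis unfolding m by (simp add: mhat_eq_0)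
    next
      case False
      then show ?thesis unfolding m app_eps a using deg_M[OF n] by simp
    qed
  qed
  show ?thesis unfolding bhat_def 1 2 3 by (simp add: del_def algebra_simps)
qed

lemma bhat_bhat_eq:
  assumes W: "vector_space sW" and F: "trilin sW F"
    and agree: "\<And>as bs v. as \<in> H \<Longrightarrow> bs \<in> H \<Longrightarrow> v \<in> homog M \<Longrightarrow> F' as v bs = app F as v bs"
    and H: "as \<in> H" "bs \<in> H" and v: "v \<in> homog M"
  shows "bhat A M (bhat A M F') as v bs = app (del (del F) + F \<odot> (del b + sgl A b \<odot> b)) as v bs"
proof -
  have t: "trilin sW (sgl A F)" "trilin sW (del F)" by (intro trilin_sgl trilin_del W F)+
  have tb: "trilin sW (del F + sgl A F \<odot> b)"
    by (intro trilin_add W t trilin_tcomp mor_trilin[OF b])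
  have "bhat A M (bhat A M F') as v bs = app (del (del F + sgl A F \<odot> b) + sgl A (del F + sgl A F \<odot> b) \<odot> b) as v bs"
    by (rule bhat_eq[OF W tb _ H v]) (rule bhat_eq[OF W F agree])
  also have "del (del F + sgl A F \<odot> b) + sgl A (del F + sgl A F \<odot> b) \<odot> b = del (del F) + F \<odot> (del b + sgl A b \<odot> b)"
    using del_odd[OF W F b] by (simp add: del_add ops_add sgl_tcomp tcomp_simps)
  finally show ?thesis .
qed

text \<open>The defining equation, tested on forms \<open>F\<close>, mixes the relations of \<open>A\<close> and those of \<open>M\<close>.
  Forms concentrated in the empty words are killed by \<open>del\<close> and separate points, so they isolate
  the relation for \<open>b\<close>; what remains for general \<open>F\<close> is \<open>del (del F) = 0\<close>.\<close>

lemma bimodule_equations: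
  assumes "ainf_bimodule A M"
  shows "del b + sgl A b \<odot> b = 0"
    and "\<And>F. trilin (*) F \<Longrightarrow> F \<odot> conc e = F \<Longrightarrow> del (del F) = 0"
proof -
  let ?m = "del b + sgl A b \<odot> b"
  have zero: "app (del (del F) + F \<odot> ?m) as v bs = 0"
    if F: "trilin (*) F" and H: "as \<in> H" "bs \<in> H" and v: "v \<in> homog M" for F as bs v
  proof -
    have "bhat A M (bhat A M (app F)) as v bs = 0"
      using assms trilinear_restrict[OF F] H v unfolding ainf_bimodule_def by blast
    then show ?thesis using bhat_bhat_eq[OF vector_space_field F refl H v] by simp
  qed
  have ext0: "F = 0" if n: "nrm A F" and Fe: "F \<odot> conc e = F"
    and z: "\<And>as bs v. as \<in> H \<Longrightarrow> bs \<in> H \<Longrightarrow> v \<in> homog M \<Longrightarrow> app F as v bs = 0"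
    for F :: "('a, 'c, 'w::ab_group_add) tmap"
  proof (rule tmap_eq_on_homog)
    fix as v bs k assume v: "v \<in> gr V k"
    have "app F as v bs = app F as (e v) bs"
      using arg_cong[OF Fe, of "\<lambda>F. app F as v bs"] by (simp add: homogeneous_map_conc_apply(3)[OF e])
    also have "\<dots> = 0"
      using z[OF _ _ homog_e[OF v]] L_sub_H nrmD[OF n] by (cases "as \<in> L \<and> bs \<in> L") auto
    finally show "app F as v bs = app 0 as v bs" by simp
  qed
  have de: "del F \<odot> conc e = del F" if "nrm A F" "F \<odot> conc e = F" for F :: "('a, 'c, 'w::ab_group_add) tmap"
    using del_even[OF that(1) mor_e] that(2) by simp
  show MC: "?m = 0"
  proof (rule ext0)
    have "mor 2 (del b)" using mor_del[OF b] by simp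
    moreover have "mor 2 (sgl A b \<odot> b)" using mor_tcomp[OF mor_sgl[OF b] b] by simp
    ultimately show "nrm A ?m" by (auto dest: mor_nrm)
    show "?m \<odot> conc e = ?m"
      using de[OF mor_nrm[OF b] be] be by (simp add: tcomp_simps)
    fix as bs :: "'a list" and v assume a: "as \<in> H" "bs \<in> H" "v \<in> homog M"
    show "app ?m as v bs = 0"
    proof (rule vs.functionals_separate)
      fix \<xi> assume l: "homogeneous_map (scl V) (*) \<xi>"
      from zero[OF trilin_conc[OF vector_space_field l] a] show "\<xi> (app ?m as v bs) = 0"
        by (simp add: homogeneous_map_conc_apply(2)[OF l])
    qed
  qed
  show "del (del F) = 0" if F: "trilin (*) F" and Fe: "F \<odot> conc e = F" for F
  proof (rule ext0)
    note n = trilinD(1)[OF F]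
    have n': "nrm A (del F)" using trilinD(1)[OF trilin_del[OF vector_space_field F]] .
    show "nrm A (del (del F))"
      using trilinD(1)[OF trilin_del[OF vector_space_field trilin_del[OF vector_space_field F]]] .
    show "del (del F) \<odot> conc e = del (del F)" by (rule de[OF n' de[OF n Fe]])
    show "app (del (del F)) as v bs = 0" if "as \<in> H" "bs \<in> H" "v \<in> homog M" for as bs v
      using zero[OF F that] by (simp add: MC)
  qed
qed

lemma bimoduleI:
  assumes "del b + sgl A b \<odot> b = 0" "\<And>F. trilin (*) F \<Longrightarrow> F \<odot> conc e = F \<Longrightarrow> del (del F) = 0"
  shows "ainf_bimodule A M"
  unfolding ainf_bimodule_def
proof (intro conjI allI impI ballI M act_trilinear act_degree)
  fix F :: "'a list \<Rightarrow> 'c \<Rightarrow> 'a list \<Rightarrow> 'k" and as bs v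
  assume F: "trilinear A M (*) F" and a: "as \<in> H" "v \<in> homog M" "bs \<in> H"
  obtain G where G: "trilin (*) G" "G \<odot> conc e = G" "\<forall>as\<in>H. \<forall>bs\<in>H. \<forall>v\<in>homog M. app G as v bs = F as v bs"
    using represent[OF vector_space_field F] by blast
  have "bhat A M (bhat A M F) as v bs = app (del (del G) + G \<odot> (del b + sgl A b \<odot> b)) as v bs"
    by (rule bhat_bhat_eq[OF vector_space_field G(1) _ a(1,3,2)]) (use G(3) in auto)
  then show "bhat A M (bhat A M F) as v bs = 0" using assms G by simp
qed

end

context words
begin

lemma del_conc_tcomp:
  assumes h: "homogeneous_map (scl V) sW h" and x: "mor r x"
  shows "del (conc h \<odot> x) = conc h \<odot> del x"
  using del_tcomp[OF nrm_conc x, of h] by (simp add: ksgn_def)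

text \<open>Composing with linear functionals on the target reduces this to scalar-valued
  families.\<close>

lemma del_del_mor:
  assumes dd: "\<And>F. trilin (*) F \<Longrightarrow> F \<odot> conc e = F \<Longrightarrow> del (del F) = (0 :: ('a, 'c, 'k) tmap)"
    and x: "mor r x" "x \<odot> conc e = x"
  shows "del (del x) = 0"
proof (rule tmap_eqI)
  fix as v bs
  have "app (del (del x)) as v bs = 0"
  proof (rule vs.functionals_separate)
    fix \<xi> assume l: "homogeneous_map (scl V) (*) \<xi>"
    have "trilin (*) (conc \<xi> \<odot> x)" by (rule trilin_post[OF vector_space_field VV mor_trilin[OF x(1)] l])
    then have "del (del (conc \<xi> \<odot> x)) = 0" by (rule dd) (simp add: tcomp_assoc x)
    then have "conc \<xi> \<odot> del (del x) = 0"
      using del_conc_tcomp[OF l x(1)] del_conc_tcomp[OF l mor_del[OF x(1)]] by simp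
    from arg_cong[OF this, of "\<lambda>F. app F as v bs"] show "\<xi> (app (del (del x)) as v bs) = 0"
      by (simp add: homogeneous_map_conc_apply(2)[OF l])
  qed
  then show "app (del (del x)) as v bs = app 0 as v bs" by simp
qed

lemma bimod_homI:
  assumes M: "represented A V M e b" and N: "represented A V N e' b'"
    and f: "mor 0 f" "conc e' \<odot> f = f" and hom: "del f + sgl A f \<odot> b = b' \<odot> f"
  shows "bimod_hom A M N (app f)"
proof -
  interpret M: represented A V M e b by fact
  interpret N: represented A V N e' b' by fact
  have ef: "e' (app f as v bs) = app f as v bs" for as v bs
    using arg_cong[OF f(2), of "\<lambda>F. app F as v bs"] by (simp add: homogeneous_map_conc_apply(2)[OF N.e])
  have fgr: "app f as v bs \<in> gr N (dg as + n + dg bs)" if "v \<in> gr M n" for as v bs n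
    using N.e_gr[OF mor_degree[OF f(1), of v n as bs]] that M.gr_M by (auto simp: ef)
  show ?thesis
    unfolding bimod_hom_def
  proof (intro conjI ballI)
    show "trilinear A M (scl N) (app f)"
      using M.trilinear_restrict[OF mor_trilin[OF f(1)]] by (simp add: N.scl_M)
    show "has_degree A M N 0 (app f)"
      unfolding has_degree_def using fgr M.M.gr_deg by auto
    fix as v bs assume a: "as \<in> H" "v \<in> homog M" "bs \<in> H"
    have "bhat A M (app f) as v bs = app (b' \<odot> f) as v bs"
      using M.bhat_eq[OF VV mor_trilin[OF f(1)] refl a(1,3,2)] by (simp add: hom)
    also have "\<dots> = hcomp (act N) (app f) as v bs"
      unfolding app_tcomp_hcomp hcomp_def
    proof (intro sum.cong refl)
      fix i j
      have "take i as \<in> H" "drop j bs \<in> H"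
        using a by (auto dest: in_set_takeD in_set_dropD)
      moreover have "app f (drop i as) v (take j bs) \<in> homog N"
        using fgr M.M.gr_deg[OF a(2)] by blast
      ultimately show "app b' (take i as) (app f (drop i as) v (take j bs)) (drop j bs)
          = act N (take i as) (app f (drop i as) v (take j bs)) (drop j bs)"
        by (simp add: N.act)
    qed
    finally show "bhat A M (app f) as v bs = hcomp (act N) (app f) as v bs" .
  qed
qed

end

section \<open>Homomorphisms into the dual as forms\<close>

lemma scl_dual [simp]: "scl (dual d A M) = fscale"
  and gr_dual: "gr (dual d A M) n = {\<phi>. glinear M (*) \<phi> \<and> (\<forall>w. w \<notin> gr M (d - n) \<longrightarrow> \<phi> w = 0)}"
  by (simp_all add: dual_def Let_def)

lemma act_dual:
  "act (dual d A M) xs \<phi> ys w = (if w \<in> homog M then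
     ksgn (1 + deg (dual d A M) \<phi> + degs (susp A) xs * (deg (dual d A M) \<phi> + degs (susp A) ys + deg M w))
       (\<phi> (act M ys w xs)) else 0)"
  by (simp add: dual_def Let_def deg_def)

lemma sum_fun: "sum (f :: 'i \<Rightarrow> 'x \<Rightarrow> 'y::ab_group_add) I w = (\<Sum>i\<in>I. f i w)"
  using additive_sum[where h = "\<lambda>f. f w" and f = f and I = I] by simp

lemma bhat_eval: "bhat A M \<phi> as v bs w = bhat A M (\<lambda>as v bs. \<phi> as v bs w) as v bs"
  by (simp add: bhat_def mhat_fun sum_fun)

lemma ops_conc_tcomp:
  assumes F: "nrm A F"
  shows "insl A (conc h \<odot> F) = conc h \<odot> insl A F" "insr A (conc h \<odot> F) = conc h \<odot> insr A F"
    "sgl A (conc h \<odot> F) = conc h \<odot> sgl A F" "sgr A (conc h \<odot> F) = conc h \<odot> sgr A F"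
  by (simp_all add: insl_tcomp[OF nrm_conc F] insr_tcomp[OF nrm_conc F] sgl_tcomp sgr_tcomp)

context words
begin

lemma del_conc_post: "nrm A F \<Longrightarrow> del (conc h \<odot> F) = conc h \<odot> del F"
  by (simp add: del_def ops_conc_tcomp[OF nrm_sgl] ops_conc_tcomp tcomp_simps)

text \<open>The transpose of \<open>h\<close>.\<close>

definition arg :: "('c \<Rightarrow> 'c) \<Rightarrow> ('c \<Rightarrow> 'k) \<Rightarrow> 'c \<Rightarrow> 'k" where
  "arg h \<xi> w = \<xi> (h w)"

lemma arg_additive: "arg h (\<xi> + \<eta>) = arg h \<xi> + arg h \<eta>"
  by (simp add: fun_eq_iff arg_def)

lemma app_arg [simp]: "app (conc (arg h) \<odot> F) as v bs w = app F as v bs (h w)"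
  by (simp add: app_conc_tcomp[of "arg h", OF arg_additive] arg_def)

lemma costar_tcomp_conc:
  assumes "homogeneous_map (scl V) (scl V) h"
  shows "costar d A (x \<odot> conc h) F = conc (arg h) \<odot> costar d A x F"
  by (rule form_eqI) (simp add: app_costar homogeneous_map_conc_apply(3)[OF assms])

lemma costar_conc:
  assumes h: "homogeneous_map (scl V) (scl V) h" and G: "frm e G"
  shows "costar d A (conc h) G = conc (arg h) \<odot> G"
proof (rule form_eqI)
  fix as v bs w
  have "app (costar d A (conc h) G) as v bs w =
      spl (\<lambda>b1 b2. ksgn ((d + 1) * dg []) (app G as v b1 (app (conc h) b2 w []))) bs"
    unfolding app_costar by (rule spl_eq_first) (simp add: frm_add_right[OF G])
  also have "\<dots> = app G as v bs (h w)"
    by (subst spl_eq_last) (auto simp: frm_add_right[OF G] homogeneous_map_conc_apply(1)[OF h])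
  finally show "app (costar d A (conc h) G) as v bs w = app (conc (arg h) \<odot> G) as v bs w" by simp
qed

lemma trilin_evaluation:
  assumes F: "frm d F"
  shows "trilin (*) (conc (\<lambda>\<xi>. \<xi> w) \<odot> F)"
    "app (conc (\<lambda>\<xi>. \<xi> w) \<odot> F) as v bs = app F as v bs w"
proof -
  have h: "homogeneous_map fscale (*) (\<lambda>\<xi>. \<xi> w)" by (simp add: homogeneous_map_def)
  show "trilin (*) (conc (\<lambda>\<xi>. \<xi> w) \<odot> F)"
    by (rule trilin_post[OF vector_space_field FV frm_trilin[OF F] h])
  show "app (conc (\<lambda>\<xi>. \<xi> w) \<odot> F) as v bs = app F as v bs w"
    by (simp add: homogeneous_map_conc_apply(2)[OF h])
qed

end

context submodule
begin

lemma dual_degree: "\<phi> \<in> gr (dual d A M) n \<Longrightarrow> \<phi> \<noteq> 0 \<Longrightarrow> deg (dual d A M) \<phi> = n"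
proof -
  assume \<phi>: "\<phi> \<in> gr (dual d A M) n" and "\<phi> \<noteq> 0"
  then obtain w where w: "\<phi> w \<noteq> 0" by (auto simp: fun_eq_iff)
  have "m = n" if "\<phi> \<in> gr (dual d A M) m" for m
  proof (rule ccontr)
    assume "m \<noteq> n"
    moreover have "w \<in> gr M (d - n)" "w \<in> gr M (d - m)" using w \<phi> that unfolding gr_dual by blast+
    ultimately have "w = 0" using M.gr_disjoint[of w "d - n" "d - m"] by simp
    moreover have "\<phi> 0 = 0" using \<phi> M.glinear_zero[OF vector_space_field, of \<phi>] by (simp add: gr_dual)
    ultimately show False using w by simp
  qed
  with \<phi> show ?thesis unfolding deg_def by (rule the_equality)
qed

end

context represented
begin

text \<open>A form has a fixed total degree. This replaces the degrees of the functional and of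
  its argument in the sign of the dual action by those of the words.\<close>

lemma dual_action:
  assumes F: "frm d F"
    and deg: "\<And>as bs n v. as \<in> H \<Longrightarrow> bs \<in> H \<Longrightarrow> v \<in> gr M n \<Longrightarrow> \<phi> as v bs \<in> gr (dual d A M) (dg as + n + dg bs)"
    and agree: "\<And>as bs v w. as \<in> H \<Longrightarrow> bs \<in> H \<Longrightarrow> v \<in> homog M \<Longrightarrow> w \<in> homog M \<Longrightarrow> \<phi> as v bs w = app F as v bs w"
    and H: "as \<in> H" "bs \<in> H" and v: "v \<in> homog M" and w: "w \<in> homog M"
  shows "hcomp (act (dual d A M)) \<phi> as v bs w = - ksgn d (app (costar d A (eps \<odot> sgr A b) F) as v bs w)"
proof -
  obtain n m where n: "v \<in> gr M n" and m: "w \<in> gr M m" using v w by (auto simp: homog_def)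
  have "act (dual d A M) x (\<phi> y v p) q w
      = - ksgn d (ksgn ((d + 1) * dg x) (app F y v p (app (eps \<odot> sgr A b) q w x)))"
    if xy: "x @ y = as" and pq: "p @ q = bs" for x y p q
  proof -
    have h: "x \<in> H" "y \<in> H" "p \<in> H" "q \<in> H" using H xy pq by auto
    define z where "z = act M q w x"
    define N where "N = dg q + m + dg x + 1"
    have z: "z \<in> gr M N" unfolding z_def N_def by (rule act_homog[OF h(4,1) m])
    have zb: "app b q w x = z" unfolding z_def using act[OF h(4,1) w] by simp
    have "app (eps \<odot> sgr A b) q w x = ksgn (N + dg x) z"
    proof -
      have "par z = ksgn N z" by (rule par(2)) (use z gr_M in blast)
      then show ?thesis by (simp add: app_eps app_ops zb homogeneous_mapD(6)[OF par(1)] add.commute)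
    qed
    then have r: "app F y v p (app (eps \<odot> sgr A b) q w x) = ksgn (N + dg x) (app F y v p z)"
      by (simp add: frm_add_right[OF F])
    have \<xi>z: "\<phi> y v p z = app F y v p z" using agree[OF h(2,3) v] z by blast
    show ?thesis
    proof (cases "app F y v p z = 0")
      case True
      then show ?thesis unfolding r by (simp add: act_dual \<xi>z z_def[symmetric])
    next
      case False
      then have "\<phi> y v p \<noteq> 0" using \<xi>z by auto
      then have d1: "deg (dual d A M) (\<phi> y v p) = dg y + n + dg p"
        using dual_degree[OF deg[OF h(2,3) n]] by simp
      have "w \<noteq> 0"
      proof
        assume "w = 0"
        then have "z = 0" using zb by simp
        then show False using False by (simp add: frm_add_right[OF F])
      qed
      then have d2: "deg M w = m" using deg_M[OF m] by simp
      have "dg y + n + dg p + N = d"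
        using frm_degree[OF F, of v n z N y p] False n z gr_M by blast
      then have d: "d = dg y + n + dg p + dg q + m + dg x + 1" by (simp add: N_def)
      show ?thesis
      proof -
        let ?\<delta> = "dg y + n + dg p"
        have "odd ((1 + ?\<delta> + dg x * (?\<delta> + dg q + m)) - (d + (d + 1) * dg x + (N + dg x)))"
          unfolding d N_def by (cases "even (dg x)"; cases "even (dg y)"; cases "even n"; cases "even (dg p)"; cases "even (dg q)"; simp)
        then have "ksgn (1 + ?\<delta> + dg x * (?\<delta> + dg q + m)) (app F y v p z)
            = - ksgn (d + (d + 1) * dg x + (N + dg x)) (app F y v p z)"
          by (rule ksgn_opp) simp
        then show ?thesis
          using w by (simp only: r act_dual d1 d2 \<xi>z z_def[symmetric] if_True ksgn_ksgn add.assoc)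
      qed
    qed
  qed
  then have "hcomp (act (dual d A M)) \<phi> as v bs w
      = spl (\<lambda>x y. spl (\<lambda>p q. - ksgn d (ksgn ((d + 1) * dg x) (app F y v p (app (eps \<odot> sgr A b) q w x)))) bs) as"
    by (simp add: hcomp_def sum_fun spl_def)
  then show ?thesis by (simp add: app_costar spl_minus spl_ksgn del: ksgn_ksgn)
qed

lemma bhat_form:
  assumes F: "frm d F"
    and agree: "\<And>as bs v w. as \<in> H \<Longrightarrow> bs \<in> H \<Longrightarrow> v \<in> homog M \<Longrightarrow> w \<in> homog M \<Longrightarrow> \<phi> as v bs w = app F as v bs w"
    and H: "as \<in> H" "bs \<in> H" and v: "v \<in> homog M" and w: "w \<in> homog M"
  shows "bhat A M \<phi> as v bs w = app (del F + sgl A F \<odot> b) as v bs w"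
proof -
  let ?h = "\<lambda>\<xi> :: 'c \<Rightarrow> 'k. \<xi> w"
  note t = trilin_evaluation[OF F, of w]
  have "bhat A M \<phi> as v bs w = app (del (conc ?h \<odot> F) + sgl A (conc ?h \<odot> F) \<odot> b) as v bs"
    unfolding bhat_eval by (rule bhat_eq[OF vector_space_field t(1) _ H v]) (simp add: t(2) agree w)
  also have "\<dots> = app (conc ?h \<odot> (del F + sgl A F \<odot> b)) as v bs"
    by (simp add: del_conc_post[OF frm_nrm[OF F]] ops_conc_tcomp[OF frm_nrm[OF F]] tcomp_simps)
  also have "\<dots> = app (del F + sgl A F \<odot> b) as v bs w"
    by (rule app_conc_tcomp) simp
  finally show ?thesis .
qed

lemma form_hom:
  assumes F: "frm d F" and var: "variation d b F = 0"
  shows "bimod_hom A M (dual d A M) (\<lambda>as v bs w. if w \<in> homog M then app F as v bs w else 0)"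
proof -
  let ?\<phi> = "\<lambda>as v bs w. if w \<in> homog M then app F as v bs w else 0"
  have deg: "?\<phi> as v bs \<in> gr (dual d A M) (dg as + n + dg bs)" if "as \<in> H" "bs \<in> H" "v \<in> gr M n" for as bs v n
    unfolding gr_dual
  proof (intro CollectI conjI allI impI)
    show "glinear M (*) (?\<phi> as v bs)"
      by (rule glinearI) (auto simp: frm_add_right[OF F] scl_M dest: M.gr_scale[unfolded scl_M])
    show "?\<phi> as v bs w = 0" if w: "w \<notin> gr M (d - (dg as + n + dg bs))" for w
    proof (cases "w \<in> homog M")
      case True
      then obtain m where m: "w \<in> gr M m" by (auto simp: homog_def)
      with w have "dg as + n + dg bs + m \<noteq> d" by auto
      then show ?thesis using frm_degree[OF F, of v n w m as bs] \<open>v \<in> gr M n\<close> m gr_M by auto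
    qed simp
  qed
  show ?thesis
    unfolding bimod_hom_def
  proof (intro conjI ballI)
    show "trilinear A M (scl (dual d A M)) ?\<phi>"
    proof (rule trilinearI)
      fix xs ys bs :: "'a list" and v assume H: "xs \<in> H" "ys \<in> H" "bs \<in> H"
      interpret W: glin A "(*) :: 'k \<Rightarrow> 'k \<Rightarrow> 'k" using vector_space_field by (simp add: glin_def A.graded_axioms)
      show "glinear A (scl (dual d A M)) (\<lambda>x. ?\<phi> (xs @ [x] @ ys) v bs)"
        unfolding scl_dual
      proof (rule glinear_functions)
        show "glinear A (*) (\<lambda>x. ?\<phi> (xs @ [x] @ ys) v bs w)" for w
          using frm_glinear(1)[OF F H] by (cases "w \<in> homog M") auto
      qed
      show "glinear A (scl (dual d A M)) (\<lambda>x. ?\<phi> bs v (xs @ [x] @ ys))"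
        unfolding scl_dual
      proof (rule glinear_functions)
        show "glinear A (*) (\<lambda>x. ?\<phi> bs v (xs @ [x] @ ys) w)" for w
          using frm_glinear(2)[OF F H] by (cases "w \<in> homog M") auto
      qed
    qed (auto simp: fun_eq_iff scl_M trilinD(5)[OF frm_trilin[OF F]])
    show "has_degree A M (dual d A M) 0 ?\<phi>"
      unfolding has_degree_def using deg M.gr_deg by auto
    fix as v bs assume a: "as \<in> H" "v \<in> homog M" "bs \<in> H"
    show "bhat A M ?\<phi> as v bs = hcomp (act (dual d A M)) ?\<phi> as v bs"
    proof (rule ext)
      fix w
      show "bhat A M ?\<phi> as v bs w = hcomp (act (dual d A M)) ?\<phi> as v bs w"
      proof (cases "w \<in> homog M")
        case True
        have "hcomp (act (dual d A M)) ?\<phi> as v bs w = - ksgn d (app (costar d A (eps \<odot> sgr A b) F) as v bs w)"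
          by (rule dual_action[OF F deg _ a(1,3,2) True]) auto
        moreover have "bhat A M ?\<phi> as v bs w = app (del F + sgl A F \<odot> b) as v bs w"
          by (rule bhat_form[OF F _ a(1,3,2) True]) auto
        moreover have "app (variation d b F) as v bs w = 0" by (simp add: var)
        ultimately show ?thesis by (simp add: variation_def add_eq_0_iff2)
      next
        case False
        then have "bhat A M ?\<phi> as v bs w = 0" unfolding bhat_eval by (simp add: bhat_def)
        moreover have "hcomp (act (dual d A M)) ?\<phi> as v bs w = 0"
          using False by (simp add: hcomp_def sum_fun act_dual)
        ultimately show ?thesis by simp
      qed
    qed
  qed
qed

text \<open>The values \<open>\<phi> as v bs\<close> are linear on homogeneous elements of \<open>M\<close> only, so they have to be
  extended in the second argument too. Since \<open>F\<close> factors through \<open>e\<close> in both arguments, so does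
  its variation, and it is enough to evaluate the latter on \<open>M\<close>.\<close>

lemma represent_form:
  assumes \<phi>: "bimod_hom A M (dual d A M) \<phi>"
  shows "\<exists>F. frm d F \<and> variation d b F = 0 \<and> F \<odot> conc e = F \<and> conc (arg e) \<odot> F = F
    \<and> (\<forall>as\<in>H. \<forall>bs\<in>H. \<forall>v\<in>homog M. \<forall>w\<in>homog M. app F as v bs w = \<phi> as v bs w)"
proof -
  have tri: "trilinear A M fscale \<phi>" and "has_degree A M (dual d A M) 0 \<phi>"
    and eq: "\<And>as bs v. as \<in> H \<Longrightarrow> v \<in> homog M \<Longrightarrow> bs \<in> H \<Longrightarrow> bhat A M \<phi> as v bs = hcomp (act (dual d A M)) \<phi> as v bs"
    using \<phi> by (auto simp: bimod_hom_def)
  then have deg0: "\<phi> as v bs \<in> gr (dual d A M) (dg as + deg M v + dg bs)"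
    if "as \<in> H" "bs \<in> H" "v \<in> homog M" for as bs v
    using that by (simp add: has_degree_def)
  have phi0: "\<phi> as 0 bs = 0" if "as \<in> H" "bs \<in> H" for as bs
    using M.glinear_zero[OF FV trilinearD(1)[OF tri that]] .
  have deg: "\<phi> as v bs \<in> gr (dual d A M) (dg as + n + dg bs)"
    if "as \<in> H" "bs \<in> H" "v \<in> gr M n" for as bs v n
  proof (cases "v = 0")
    case True
    then show ?thesis using phi0[OF that(1,2)] by (auto simp: gr_dual intro!: glinearI)
  next
    case False
    then show ?thesis using deg0[OF that(1,2)] deg_M[OF that(3)] that(3) by auto
  qed
  obtain F0 where F0: "trilin fscale F0" "F0 \<odot> conc e = F0"
    "\<And>as bs v. as \<in> H \<Longrightarrow> bs \<in> H \<Longrightarrow> v \<in> homog M \<Longrightarrow> app F0 as v bs = \<phi> as v bs"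
    using represent[OF FV tri] by blast
  have F0e: "app F0 as v bs = app F0 as (e v) bs" for as v bs
    using arg_cong[OF F0(2), of "\<lambda>F. app F as v bs"] by (simp add: homogeneous_map_conc_apply(3)[OF e])
  have F0_gr: "app F0 as v bs = 0 \<or> as \<in> H \<and> bs \<in> H \<and> app F0 as v bs = \<phi> as (e v) bs" if "v \<in> gr V n" for as v bs n
    using F0(3)[OF _ _ homog_e[OF that]] F0e[of as v bs] nrmD[OF trilinD(1)[OF F0(1)]] L_sub_H by metis
  have F0_lin: "glinear M (*) (app F0 as v bs)" for as v bs
  proof (rule homog_induct[of "\<lambda>v. glinear M (*) (app F0 as v bs)"])
    fix n v assume v: "v \<in> gr V n"
    show "glinear M (*) (app F0 as v bs)"
    proof (cases "app F0 as v bs = 0")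
      case True
      then show ?thesis by (auto intro!: glinearI)
    next
      case False
      then have "as \<in> H" "bs \<in> H" "app F0 as v bs = \<phi> as (e v) bs" using F0_gr[OF v, of as bs] by blast+
      then show ?thesis using deg[OF _ _ e_gr[OF v], of as bs] unfolding gr_dual by auto
    qed
  next
    show "glinear M (*) (app F0 as (x + y) bs)"
      if "glinear M (*) (app F0 as x bs)" "glinear M (*) (app F0 as y bs)" for x y
      by (rule glinearI) (auto simp: glinearD[OF that(1)] glinearD[OF that(2)] algebra_simps)
  qed
  \<comment> \<open>The functionals are only linear on homogeneous arguments of \<open>M\<close>; \<open>E\<close> extends them.\<close>
  define E where "E \<xi> = extend (\<lambda>w. \<xi> (e w))" for \<xi> :: "'c \<Rightarrow> 'k"
  have E: "homogeneous_map fscale fscale E"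
    unfolding homogeneous_map_def E_def extend_def by (simp add: fun_eq_iff sum.distrib sum_distrib_left)
  have E_lin: "homogeneous_map (scl V) (*) (E \<xi>)" "w \<in> homog V \<Longrightarrow> E \<xi> w = \<xi> (e w)" if "glinear M (*) \<xi>" for \<xi> w
  proof -
    have "glinear V (*) (\<lambda>w. \<xi> (e w))"
    proof (rule glinearI)
      fix n x assume x: "x \<in> gr V n"
      show "\<xi> (e (x + y)) = \<xi> (e x) + \<xi> (e y)" if y: "y \<in> gr V n" for y
        unfolding e'(1) by (rule glinearD(1)[OF \<open>glinear M (*) \<xi>\<close> e_gr[OF x] e_gr[OF y]])
      show "\<xi> (e (scl V c x)) = c * \<xi> (e x)" for c
        unfolding e'(2) using glinearD(2)[OF \<open>glinear M (*) \<xi>\<close> e_gr[OF x]] by (simp add: scl_M)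
    qed
    from extend[OF vector_space_field this]
    show "homogeneous_map (scl V) (*) (E \<xi>)" "w \<in> homog V \<Longrightarrow> E \<xi> w = \<xi> (e w)" by (auto simp: E_def)
  qed
  define F where "F = conc E \<odot> F0"
  have F: "app F as v bs = E (app F0 as v bs)" for as v bs
    by (simp add: F_def homogeneous_map_conc_apply(2)[OF E])
  note Fl = homogeneous_mapD[OF E_lin(1)[OF F0_lin]]
  have agree: "app F as v bs w = \<phi> as v bs w" if "as \<in> H" "bs \<in> H" "v \<in> homog M" "w \<in> homog M" for as bs v w
  proof -
    have "w \<in> homog V" using that(4) gr_M by (auto simp: homog_def)
    then show ?thesis using E_lin(2)[OF F0_lin, of w as v bs] by (simp add: F homog_M that F0(3))
  qed
  have frm: "frm d F"
  proof (rule frmI)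
    show "trilin fscale F" unfolding F_def by (rule trilin_post[OF FV FV F0(1) E])
    show "app F as v bs w = 0" if v: "v \<in> gr V m" and w: "w \<in> gr V n" and ne: "dg as + m + dg bs + n \<noteq> d" for as v bs w m n
    proof -
      have *: "app F as v bs w = app F0 as v bs (e w)"
        unfolding F by (rule E_lin(2)[OF F0_lin homogI[OF w]])
      show ?thesis
      proof (cases "app F0 as v bs = 0")
        case False
        then have h: "as \<in> H" "bs \<in> H" "app F0 as v bs = \<phi> as (e v) bs" using F0_gr[OF v, of as bs] by blast+
        have g: "\<phi> as (e v) bs \<in> gr (dual d A M) (dg as + m + dg bs)" by (rule deg[OF h(1,2) e_gr[OF v]])
        show ?thesis
        proof (cases "e w \<in> gr M (d - (dg as + m + dg bs))")
          case True
          then have "e w = 0" using M.gr_disjoint[OF True e_gr[OF w]] ne by auto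
          then show ?thesis using M.glinear_zero[OF vector_space_field F0_lin] by (simp add: *)
        qed (use g in \<open>auto simp: * h gr_dual\<close>)
      qed (simp add: *)
    qed
  qed (auto simp: F Fl)
  have Fe: "F \<odot> conc e = F" by (simp add: F_def tcomp_assoc F0)
  have aF: "conc (arg e) \<odot> F = F"
  proof (rule form_eqI)
    fix as v bs w
    have "app F as v bs (e w) = app F as v bs w"
    proof (rule additive_eqI[of "\<lambda>w. app F as v bs (e w)" "app F as v bs"])
      fix n w assume w: "w \<in> gr V n"
      have "e w \<in> homog V" using e_gr[OF w] gr_M by blast
      with w show "app F as v bs (e w) = app F as v bs w"
        by (simp add: F e_e homogI E_lin(2)[OF F0_lin])
    qed (simp_all add: F Fl e')
    then show "app (conc (arg e) \<odot> F) as v bs w = app F as v bs w" by simp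
  qed
  let ?X = "variation d b F"
  have "?X = 0"
  proof (rule tmap_eq_on_homog)
    fix as v bs n assume v: "v \<in> gr V n"
    have m: "mor 1 (eps \<odot> sgr A b)" by (rule mor_tcomp_eq[OF mor_eps mor_sgr[OF b]]) simp
    have be': "sgr A b \<odot> conc e = sgr A b" using arg_cong[OF be, of "sgr A"] by (simp add: sgr_tcomp)
    have Xe: "?X \<odot> conc e = ?X"
      using del_even[OF frm_nrm[OF frm] mor_e] Fe
      by (simp add: variation_def tcomp_simps be tcomp_ksgn_left costar_comp[symmetric])
    have aX: "conc (arg e) \<odot> ?X = ?X"
      using del_conc_post[OF frm_nrm[OF frm], of "arg e"] ops_conc_tcomp(3)[OF frm_nrm[OF frm], of "arg e"]
        costar_tcomp_conc[OF e, of d "eps \<odot> sgr A b" F]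
      by (simp add: variation_def tcomp_simps aF be' tcomp_ksgn_right) (simp add: tcomp_assoc[symmetric])
    have n: "nrm A ?X"
    proof -
      have "nrm A (del F)" using trilinD(1)[OF trilin_del[OF FV frm_trilin[OF frm]]] .
      moreover have "nrm A (sgl A F \<odot> b)" by (rule nrm_tcomp[OF nrm_sgl[OF frm_nrm[OF frm]] mor_nrm[OF b]])
      moreover have "nrm A (ksgn d (costar d A (eps \<odot> sgr A b) F))"
        using frm_nrm[OF frm_costar[OF frm m refl]] by (auto simp: ksgn_def)
      ultimately show ?thesis unfolding variation_def by blast
    qed
    show "app ?X as v bs = app 0 as v bs"
    proof (cases "as \<in> L \<and> bs \<in> L")
      case False
      then show ?thesis using nrmD[OF n] by auto
    next
      case True
      then have H: "as \<in> H" "bs \<in> H" using L_sub_H by blast+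
      have zero: "app ?X as v bs w = 0" if v: "v \<in> homog M" and w: "w \<in> homog M" for v w
      proof -
        have "hcomp (act (dual d A M)) \<phi> as v bs w = - ksgn d (app (costar d A (eps \<odot> sgr A b) F) as v bs w)"
          by (rule dual_action[OF frm deg agree[symmetric] H v w])
        moreover have "bhat A M \<phi> as v bs w = app (del F + sgl A F \<odot> b) as v bs w"
          by (rule bhat_form[OF frm agree[symmetric] H v w])
        ultimately have "app (del F + sgl A F \<odot> b) as v bs w = - ksgn d (app (costar d A (eps \<odot> sgr A b) F) as v bs w)"
          using eq[OF H(1) v H(2)] by metis
        then show ?thesis by (simp add: variation_def eq_neg_iff_add_eq_0)
      qed
      show ?thesis
      proof (rule ext)
        fix w
        have l: "homogeneous_map (scl V) (*) (app ?X as v bs)" for v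
        proof -
          have "frm d F \<Longrightarrow> homogeneous_map (scl V) (*) (app (del F) as v bs)"
            unfolding homogeneous_map_def del_def using frm_add_right[OF frm]
            by (auto simp: app_eps app_ops mhat_fun mhat_add mhat_hom[of "\<lambda>x. _ * x"] distrib_left ksgn_mult
                mhat_ksgn)
          moreover have "homogeneous_map (scl V) (*) (app (sgl A F \<odot> b) as v bs)"
            by (rule frm_linear[OF frm_comp[OF frm_sgl[OF frm] b refl]])
          moreover have "homogeneous_map (scl V) (*) (app (costar d A (eps \<odot> sgr A b) F) as v bs)"
            by (rule frm_linear[OF frm_costar[OF frm m refl]])
          ultimately show ?thesis using frm
            by (auto simp: variation_def homogeneous_map_def ksgn_mult distrib_left)
        qed
        have "app ?X as v bs w = app ?X as (e v) bs (e w)"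
          using arg_cong[OF aX, of "\<lambda>F. app F as v bs w"] arg_cong[OF Xe, of "\<lambda>F. app F as v bs (e w)"]
          by (simp add: homogeneous_map_conc_apply(3)[OF e])
        also have "\<dots> = 0"
        proof (rule additive_eqI[of "\<lambda>w. app ?X as (e v) bs (e w)" "\<lambda>w. 0"])
          show "app ?X as (e v) bs (e w) = 0" if "w \<in> gr V k" for w k
            by (rule zero[OF homog_e[OF v] homog_e[OF that]])
          show "app ?X as (e v) bs (e (x + y)) = app ?X as (e v) bs (e x) + app ?X as (e v) bs (e y)" for x y
            unfolding e'(1) by (rule homogeneous_mapD(1)[OF l])
        qed simp
        finally show "app ?X as v bs w = app 0 as v bs w" by simp
      qed
    qed
  qed
  with frm Fe aF agree show ?thesis by blast
qed

end

section \<open>Straightening a skew form\<close>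

lemma vanish_costar: "vanish m f \<Longrightarrow> vanish n F \<Longrightarrow> (\<And>as v bs. app F as v bs 0 = 0) \<Longrightarrow> vanish (m + n) (costar d A f F)"
  for f :: "('a::ab_group_add, 'c::ab_group_add, 'c) tmap" and F :: "('a, 'c, 'c \<Rightarrow> 'k::field) tmap"
  unfolding vanish_def
proof (intro allI impI ext)
  fix as bs :: "'a list" and v w assume a: "\<forall>as v bs. length as + length bs < m \<longrightarrow> app f as v bs = 0"
    "\<forall>as v bs. length as + length bs < n \<longrightarrow> app F as v bs = 0" "\<And>as v bs. app F as v bs 0 = 0"
    and l: "length as + length bs < m + n"
  show "app (costar d A f F) as v bs w = 0 w"
    unfolding app_costar zero_fun_apply
  proof (intro spl_zeroI)
    fix x y p q assume "x @ y = as" "p @ q = bs"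
    then have "length q + length x < m \<or> length y + length p < n" using l by auto
    then show "ksgn ((d + 1) * degs (susp A) x) (app F y v p (app f q w x)) = 0"
      using a by auto
  qed
qed

lemma (in graded) glinear_degree_dependent:
  assumes W: "vector_space sW" and h: "\<And>k. glinear V sW (h k)"
  shows "glinear V sW (\<lambda>x. h (deg V x) x)"
proof -
  have eq: "h (deg V x) x = h n x" if "x \<in> gr V n" for x n
    using deg_eq[OF that] glinear_zero[OF W h] by (cases "x = 0") auto
  show ?thesis
  proof (rule glinearI)
    fix n x assume x: "x \<in> gr V n"
    show "h (deg V (x + y)) (x + y) = h (deg V x) x + h (deg V y) y" if y: "y \<in> gr V n" for y
      unfolding eq[OF x] eq[OF y] eq[OF gr_add[OF x y]] by (rule glinearD(1)[OF h x y])
    show "h (deg V (scl V c x)) (scl V c x) = sW c (h (deg V x) x)" for c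
      unfolding eq[OF x] eq[OF gr_scale[OF x]] by (rule glinearD(2)[OF h x])
  qed
qed

context words
begin

text \<open>The form \<open>F'\<close> is the transpose of \<open>F\<close>. The signs refer to homogeneous arguments, hence a
  relation instead of an operation.\<close>

definition flip :: "('a, 'c, 'c \<Rightarrow> 'k) tmap \<Rightarrow> ('a, 'c, 'c \<Rightarrow> 'k) tmap \<Rightarrow> bool" where
  "flip F F' \<longleftrightarrow> (\<forall>as v bs w m n. v \<in> gr V m \<longrightarrow> w \<in> gr V n \<longrightarrow>
     app F' as v bs w = ksgn ((dg as + m) * (dg bs + n)) (app F bs w as v))"

lemma flipD: "flip F F' \<Longrightarrow> v \<in> gr V m \<Longrightarrow> w \<in> gr V n \<Longrightarrow>
    app F' as v bs w = ksgn ((dg as + m) * (dg bs + n)) (app F bs w as v)"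
  by (simp add: flip_def)

lemma flip_sym: assumes "flip F F'" shows "flip F' F"
  unfolding flip_def
proof (intro allI impI)
  fix as v bs w m n assume a: "v \<in> gr V m" "w \<in> gr V n"
  show "app F as v bs w = ksgn ((dg as + m) * (dg bs + n)) (app F' bs w as v)"
    unfolding flipD[OF assms a(2,1)] by (simp add: ksgn_def)
qed

lemma flip_add: "flip F F' \<Longrightarrow> flip G G' \<Longrightarrow> flip (F + G) (F' + G')"
  by (simp add: flip_def)

lemma flip_minus: "flip F F' \<Longrightarrow> flip (- F) (- F')"
  by (simp add: flip_def)

lemma flip_unique:
  assumes "flip F G" "flip F G'" and G: "frm e G" "frm e' G'"
  shows "G = G'"
proof (rule tmap_eq_on_homog, rule ext)
  fix as v bs n w assume v: "v \<in> gr V n"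
  show "app G as v bs w = app G' as v bs w"
  proof (rule additive_eqI[of "app G as v bs" "app G' as v bs"])
    show "app G as v bs w = app G' as v bs w" if "w \<in> gr V m" for w m
      using flipD[OF assms(1) v that] flipD[OF assms(2) v that] by simp
  qed (simp_all add: frm_add_right[OF G(1)] frm_add_right[OF G(2)])
qed

text \<open>Transposition exchanges the two arguments of a form, and with them the two ways of
  applying a family to it.\<close>

lemma flip_costar:
  assumes fl: "flip F F'" and F: "frm d F" and F': "frm d F'" and x: "mor 0 x"
  shows "flip (costar d A x F) (F' \<odot> x)"
  unfolding flip_def
proof (intro allI impI)
  fix as v bs w m n assume v: "v \<in> gr V m" and w: "w \<in> gr V n"
  have "app (F' \<odot> x) as v bs w = spl (\<lambda>a1 a2. spl (\<lambda>b1 b2. app F' a1 (app x a2 v b1) b2 w) bs) as"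
    by (simp add: app_tcomp spl_fun[where w = w])
  also have "\<dots> = spl (\<lambda>a1 a2. spl (\<lambda>b1 b2. ksgn ((dg as + m) * (dg bs + n))
      (ksgn ((d + 1) * dg b1) (app F b2 w a1 (app x a2 v b1)))) bs) as"
  proof (intro spl_cong)
    fix a1 a2 b1 b2 assume ab: "a1 @ a2 = as" "b1 @ b2 = bs"
    have z: "app x a2 v b1 \<in> gr V (dg a2 + m + dg b1)" using mor_degree[OF x v, of a2 b1] by simp
    show "app F' a1 (app x a2 v b1) b2 w = ksgn ((dg as + m) * (dg bs + n))
      (ksgn ((d + 1) * dg b1) (app F b2 w a1 (app x a2 v b1)))"
    proof (cases "app F b2 w a1 (app x a2 v b1) = 0")
      case True
      then show ?thesis using flipD[OF fl z w, of a1 b2] by simp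
    next
      case False
      then have "dg b2 + n + dg a1 + (dg a2 + m + dg b1) = d"
        using frm_degree[OF F w z] by blast
      then have d: "d = dg b2 + n + dg a1 + dg a2 + m + dg b1" by simp
      have "even ((dg a1 + (dg a2 + m + dg b1)) * (dg b2 + n) - ((dg as + m) * (dg bs + n) + (d + 1) * dg b1))"
        unfolding d ab[symmetric] degs_append
        by (cases "even (dg a1)"; cases "even (dg a2)"; cases "even m"; cases "even (dg b1)"; cases "even (dg b2)"; simp)
      then show ?thesis
        unfolding flipD[OF fl z w] ksgn_ksgn by (rule ksgn_cong) simp
    qed
  qed
  also have "\<dots> = spl (\<lambda>b1 b2. spl (\<lambda>a1 a2. ksgn ((dg as + m) * (dg bs + n))
      (ksgn ((d + 1) * dg b1) (app F b2 w a1 (app x a2 v b1)))) as) bs"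
    by (rule spl_swap)
  also have "\<dots> = ksgn ((dg as + m) * (dg bs + n)) (app (costar d A x F) bs w as v)"
    by (simp add: app_costar spl_ksgn del: ksgn_ksgn)
  finally show "app (F' \<odot> x) as v bs w = ksgn ((dg as + m) * (dg bs + n)) (app (costar d A x F) bs w as v)" .
qed

definition skew :: "('a, 'c, 'c \<Rightarrow> 'k) tmap \<Rightarrow> bool" where
  "skew F \<longleftrightarrow> flip F (- F)"

lemma skew_add: "skew F \<Longrightarrow> skew G \<Longrightarrow> skew (F + G)"
  unfolding skew_def using flip_add[of F "- F" G "- G"] by simp

lemma skew_minus: "skew F \<Longrightarrow> skew (- F)"
  unfolding skew_def using flip_minus[of F "- F"] by simp

lemma skew_flip:
  assumes "skew F" "frm d F" "mor 0 x" shows "flip (costar d A x F) (- (F \<odot> x))"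
  using flip_costar[OF assms(1)[unfolded skew_def] assms(2) frm_minus[OF assms(2)] assms(3)]
  by (simp add: tcomp_minus_left)

text \<open>Both here and in the next lemma, transposition exchanges the two arguments to which \<open>x\<close>
  is applied.\<close>

lemma skew_sum:
  assumes "skew F" "frm d F" "mor 0 x" shows "skew (costar d A x F + F \<odot> x)"
proof -
  have 1: "flip (costar d A x F) (- (F \<odot> x))" by (rule skew_flip[OF assms])
  have "flip (F \<odot> x) (- costar d A x F)" using flip_minus[OF flip_sym[OF 1]] by simp
  from flip_add[OF 1 this] show ?thesis by (simp add: skew_def add.commute)
qed

lemma skew_pullback:
  assumes "skew F" "frm d F" "mor 0 x" shows "skew (costar d A x (F \<odot> x))"
proof -
  have 1: "flip (costar d A x F) (- (F \<odot> x))" by (rule skew_flip[OF assms])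
  have f: "frm d (F \<odot> x)" "frm d (costar d A x F)"
    using frm_comp[OF assms(2,3)] frm_costar[OF assms(2,3)] by auto
  have "flip (F \<odot> x) (- costar d A x F)" using flip_minus[OF flip_sym[OF 1]] by simp
  from flip_costar[OF this f(1) frm_minus[OF f(2)] assms(3)] show ?thesis
    by (simp add: skew_def tcomp_minus_left costar_comp)
qed

definition smul :: "'k \<Rightarrow> ('a, 'c, 'c \<Rightarrow> 'k) tmap \<Rightarrow> ('a, 'c, 'c \<Rightarrow> 'k) tmap" where
  "smul c F = conc (fscale c) \<odot> F"

lemma app_smul [simp]: "app (smul c F) as v bs w = c * app F as v bs w"
  unfolding smul_def by (subst app_conc_tcomp) (auto simp: fun_eq_iff distrib_left)

lemma smul_diff: "smul c F - smul c G = smul c (F - G)"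
  by (rule form_eqI) (simp add: algebra_simps)

lemma frm_smul: "frm e F \<Longrightarrow> frm e (smul c F)"
proof (rule frmI)
  assume F: "frm e F"
  show "trilin fscale (smul c F)"
    unfolding smul_def
    by (rule trilin_post[OF FV FV frm_trilin[OF F]]) (simp add: homogeneous_map_def fun_eq_iff algebra_simps)
qed (auto simp: frm_add_right frm_degree algebra_simps)

lemma skew_smul: "skew F \<Longrightarrow> skew (smul c F)"
  unfolding skew_def flip_def[of "smul c F"]
proof (intro allI impI)
  fix as v bs w m n assume fl: "flip F (- F)" and v: "v \<in> gr V m" and w: "w \<in> gr V n"
  have "- app F as v bs w = ksgn ((dg as + m) * (dg bs + n)) (app F bs w as v)"
    using flipD[OF fl v w] by simp
  then have "c * (- app F as v bs w) = ksgn ((dg as + m) * (dg bs + n)) (c * app F bs w as v)"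
    by (simp only: ksgn_mult)
  then show "app (- smul c F) as v bs w = ksgn ((dg as + m) * (dg bs + n)) (app (smul c F) bs w as v)"
    by simp
qed

lemma vanish_smul: "vanish n F \<Longrightarrow> vanish n (smul c F)"
  by (auto simp: vanish_def fun_eq_iff)

text \<open>A change of coordinates \<open>1 + u\<close> removes the higher parts \<open>\<Upsilon> = \<Phi> - \<psi>\<close> of a skew form whose
  constant part \<open>\<psi>\<close> is perfect on the image of \<open>p\<close>. Expanding the pullback gives
  \<open>\<psi> + (\<psi> u + u\<^sup>* \<psi>) + \<Gamma> u\<close>, where \<open>\<Gamma> u\<close> consists of \<open>\<Upsilon>\<close>, of terms linear in \<open>u\<close> with a factor \<open>\<Upsilon>\<close>,
  and of terms quadratic in \<open>u\<close>. Since \<open>\<Gamma> u\<close> is skew for every \<open>u\<close>, a solution of \<open>\<psi> u = - \<Gamma> u / 2\<close>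
  has a skew \<open>\<psi> u\<close>; then \<open>u\<^sup>* \<psi> = \<psi> u\<close>, and the pullback is \<open>\<psi>\<close>. The equation is solved for \<open>u\<close> by
  iteration, because \<open>\<psi>\<close> is invertible and \<open>\<Gamma>\<close> improves agreement by one word length.\<close>

lemma straighten_skew_form:
  fixes p :: "'c \<Rightarrow> 'c" and \<Phi> :: "('a, 'c, 'c \<Rightarrow> 'k) tmap"
  defines "\<psi>0 \<equiv> \<lambda>v. app \<Phi> [] v []"
  assumes two: "(2 :: 'k) \<noteq> 0"
    and p: "homogeneous_map (scl V) (scl V) p" "\<And>n v. v \<in> gr V n \<Longrightarrow> p v \<in> gr V n"
    and pp: "\<And>v. p (p v) = p v"
    and \<Phi>: "frm d \<Phi>" "skew \<Phi>" "\<Phi> \<odot> conc p = \<Phi>" "conc (arg p) \<odot> \<Phi> = \<Phi>"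
    and inj: "\<And>n z. z \<in> gr V n \<Longrightarrow> p z = z \<Longrightarrow> \<psi>0 z = 0 \<Longrightarrow> z = 0"
    and surj: "\<And>n \<xi>. homogeneous_map (scl V) (*) \<xi> \<Longrightarrow> arg p \<xi> = \<xi> \<Longrightarrow> (\<And>m w. m \<noteq> d - n \<Longrightarrow> w \<in> gr V m \<Longrightarrow> \<xi> w = 0)
        \<Longrightarrow> \<exists>z\<in>gr V n. p z = z \<and> \<psi>0 z = \<xi>"
  shows "\<exists>u. mor 0 u \<and> vanish 1 u \<and> conc p \<odot> u = u \<and> u \<odot> conc p = u
    \<and> costar d A (tid + u) (\<Phi> \<odot> (tid + u)) = conc \<psi>0"
proof -
  note p' = homogeneous_mapD[OF p(1)]
  let ?P = "conc p :: ('a, 'c, 'c) tmap"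
  have PP: "?P \<odot> ?P = ?P" by (rule tmap_eqI) (simp add: homogeneous_map_conc_apply(1,2)[OF p(1)] p' pp)
  have mP: "mor 0 ?P" by (rule mor_conc[OF p(1)]) (simp add: p(2))
  have \<psi>0: "homogeneous_map (scl V) fscale \<psi>0"
    unfolding \<psi>0_def by (rule trilinD(2)[OF frm_trilin[OF \<Phi>(1)]])
  note \<psi>0' = homogeneous_mapD[OF \<psi>0]
  define \<psi> where "\<psi> = (conc \<psi>0 :: ('a, 'c, 'c \<Rightarrow> 'k) tmap)"
  have app_\<psi>: "app \<psi> as v bs = (if as = [] \<and> bs = [] then app \<Phi> [] v [] else 0)" for as v bs
    unfolding \<psi>_def homogeneous_map_conc_apply(1)[OF \<psi>0] by (simp add: \<psi>0_def)
  have app_\<psi>': "app (\<psi> \<odot> f) as v bs = \<psi>0 (app f as v bs)" for f as v bs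
    unfolding \<psi>_def by (rule homogeneous_map_conc_apply(2)[OF \<psi>0])
  have f\<psi>: "frm d \<psi>"
  proof (rule frmI)
    show "trilin fscale \<psi>" unfolding \<psi>_def by (rule trilin_conc[OF FV \<psi>0])
    show "app \<psi> as v bs w = 0" if "v \<in> gr V m" "w \<in> gr V n" "dg as + m + dg bs + n \<noteq> d" for as v bs w m n
      using frm_degree[OF \<Phi>(1) that(1,2), of "[]" "[]"] that(3) by (auto simp: app_\<psi>)
  qed (auto simp: app_\<psi> frm_add_right[OF \<Phi>(1)])
  have sk\<psi>: "skew \<psi>"
    unfolding skew_def flip_def
  proof (intro allI impI)
    fix as v bs w m n assume v: "v \<in> gr V m" and w: "w \<in> gr V n"
    show "app (- \<psi>) as v bs w = ksgn ((dg as + m) * (dg bs + n)) (app \<psi> bs w as v)"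
      using flipD[OF \<Phi>(2)[unfolded skew_def] v w, of "[]" "[]"] by (auto simp: app_\<psi>)
  qed
  define \<Upsilon> where "\<Upsilon> = \<Phi> - \<psi>"
  have f\<Upsilon>: "frm d \<Upsilon>" unfolding \<Upsilon>_def by (intro frm_diff \<Phi> f\<psi>)
  have sk\<Upsilon>: "skew \<Upsilon>" using skew_add[OF \<Phi>(2) skew_minus[OF sk\<psi>]] by (simp add: \<Upsilon>_def)
  have v\<Upsilon>: "vanish 1 \<Upsilon>" by (auto simp: vanish_def \<Upsilon>_def app_\<psi>)
  have app\<Phi>P: "app \<Phi> as (p v) bs = app \<Phi> as v bs" for as v bs
    using arg_cong[OF \<Phi>(3), of "\<lambda>F. app F as v bs"] by (simp add: homogeneous_map_conc_apply(3)[OF p(1)])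
  have app\<Phi>P': "app \<Phi> as v bs (p w) = app \<Phi> as v bs w" for as v bs w
    using arg_cong[OF \<Phi>(4), of "\<lambda>F. app F as v bs w"] by simp
  have \<psi>P: "\<psi> \<odot> ?P = \<psi>" by (rule tmap_eqI) (simp add: homogeneous_map_conc_apply(3)[OF p(1)] app_\<psi> app\<Phi>P)
  have \<psi>P': "conc (arg p) \<odot> \<psi> = \<psi>" by (rule form_eqI) (simp add: app_\<psi> app\<Phi>P')
  have \<Upsilon>P: "\<Upsilon> \<odot> ?P = \<Upsilon>" "conc (arg p) \<odot> \<Upsilon> = \<Upsilon>"
    unfolding \<Upsilon>_def by (simp_all add: tcomp_simps \<psi>P \<psi>P' \<Phi>)
  \<comment> \<open>a linear right inverse of \<open>\<psi>0\<close> in every degree\<close>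
  have "\<exists>g. homogeneous_map fscale (scl V) g \<and> (\<forall>\<xi>. g \<xi> \<in> gr V n \<and> p (g \<xi>) = g \<xi>)
      \<and> (\<forall>z\<in>gr V n. p z = z \<longrightarrow> \<psi>0 (g (\<psi>0 z)) = \<psi>0 z)" for n
  proof -
    interpret FF: vector_space "fscale :: 'k \<Rightarrow> ('c \<Rightarrow> 'k) \<Rightarrow> 'c \<Rightarrow> 'k" by (rule FV)
    interpret vp: vector_space_pair "scl V" "fscale :: 'k \<Rightarrow> ('c \<Rightarrow> 'k) \<Rightarrow> 'c \<Rightarrow> 'k" ..
    have sub: "vs.subspace {z \<in> gr V n. p z = z}"
      by (rule vs.subspaceI) (auto simp: p')
    have "Vector_Spaces.linear (scl V) fscale \<psi>0"
      using \<psi>0 by (simp add: linear_iff_homogeneous_map[OF VV FV])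
    from vp.linear_exists_right_inverse_on[OF this sub] obtain g
      where g: "range g \<subseteq> {z \<in> gr V n. p z = z}" "Vector_Spaces.linear fscale (scl V) g"
        "\<forall>v\<in>\<psi>0 ` {z \<in> gr V n. p z = z}. \<psi>0 (g v) = v" by auto
    then show ?thesis
      by (intro exI[of _ g]) (auto simp: linear_iff_homogeneous_map[OF FV VV])
  qed
  then obtain sh where sh: "\<And>n. homogeneous_map fscale (scl V) (sh n)" "\<And>n \<xi>. sh n \<xi> \<in> gr V n"
    "\<And>n \<xi>. p (sh n \<xi>) = sh n \<xi>" "\<And>n z. z \<in> gr V n \<Longrightarrow> p z = z \<Longrightarrow> \<psi>0 (sh n (\<psi>0 z)) = \<psi>0 z" by metis
  note sh' = homogeneous_mapD[OF sh(1)]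
  \<comment> \<open>perfectness solves \<open>\<psi> x = G\<close> for \<open>x\<close>, in each degree through \<open>sh\<close>\<close>
  have sharp: "\<exists>x. mor 0 x \<and> ?P \<odot> x = x \<and> x \<odot> ?P = x \<and> \<psi> \<odot> x = G"
    if G: "frm d G" "G \<odot> ?P = G" "conc (arg p) \<odot> G = G" for G
  proof -
    have GP: "app G as (p v) bs = app G as v bs" for as v bs
      using arg_cong[OF G(2), of "\<lambda>F. app F as v bs"] by (simp add: homogeneous_map_conc_apply(3)[OF p(1)])
    have GP': "app G as v bs (p w) = app G as v bs w" for as v bs w
      using arg_cong[OF G(3), of "\<lambda>F. app F as v bs w"] by simp
    have "\<exists>X. homogeneous_map (scl V) (scl V) X \<and> (\<forall>n. \<forall>v\<in>gr V n. X v = sh (dg as + n + dg bs) (app G as v bs))" for as bs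
      by (rule degreewise_map[OF VV]) (rule homogeneous_map_compose[OF trilinD(2)[OF frm_trilin[OF G(1)]] sh(1)])
    then obtain X where X: "\<And>as bs. homogeneous_map (scl V) (scl V) (X as bs)"
      "\<And>as bs n v. v \<in> gr V n \<Longrightarrow> X as bs v = sh (dg as + n + dg bs) (app G as v bs)" by metis
    define x where "x = Tmap (\<lambda>as v bs. X as bs v)"
    have x: "app x as v bs = X as bs v" for as v bs
      unfolding x_def by (subst Tmap_inverse) (auto simp: homogeneous_mapD(1)[OF X(1)])
    have xh: "app x as v bs = sh (dg as + n + dg bs) (app G as v bs)" if "v \<in> gr V n" for as v bs n
      using X(2)[OF that] by (simp add: x)
    interpret W: glin A "scl V" using VV by (simp add: glin_def A.graded_axioms)
    have "mor 0 x"
    proof (rule morI, rule trilinI)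
      show "nrm A x"
        unfolding nrm_def
      proof (intro allI impI)
        fix as v bs assume l: "\<not> (as \<in> L \<and> bs \<in> L)"
        show "app x as v bs = 0"
          by (rule additive_eqI[of "\<lambda>v. app x as v bs" "\<lambda>v. 0"]) (auto simp: xh nrmD[OF frm_nrm[OF G(1)] l] sh')
      qed
      show "app x as (scl V c v) bs = scl V c (app x as v bs)" for as c v bs
        by (simp add: x homogeneous_mapD(2)[OF X(1)])
      show "app x as v bs \<in> gr V (dg as + n + dg bs + 0)" if "v \<in> gr V n" for as v bs n
        by (simp add: xh[OF that] sh(2))
      fix xs ys zs :: "'a list" and v assume H: "xs \<in> H" "ys \<in> H" "zs \<in> H"
      show "glinear A (scl V) (\<lambda>y. app x (xs @ [y] @ ys) v zs)"
      proof (rule homog_induct[of "\<lambda>v. glinear A (scl V) (\<lambda>y. app x (xs @ [y] @ ys) v zs)"])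
        fix n v assume v: "v \<in> gr V n"
        have "glinear A (scl V) (\<lambda>y. sh k (app G (xs @ [y] @ ys) v zs))" for k
          by (rule W.glinear_homogeneous_map[OF FV trilinD(6)[OF frm_trilin[OF G(1)] H] sh(1)])
        then have "glinear (susp A) (scl V) (\<lambda>y. sh (dg xs + deg (susp A) y + dg ys + n + dg zs) (app G (xs @ [y] @ ys) v zs))"
          by (intro SA.glinear_degree_dependent[where h = "\<lambda>k y. sh (dg xs + k + dg ys + n + dg zs) (app G (xs @ [y] @ ys) v zs)"] VV) simp
        then show "glinear A (scl V) (\<lambda>y. app x (xs @ [y] @ ys) v zs)"
          unfolding glinear_susp xh[OF v] by (simp add: add.assoc)
      qed (auto intro: W.glinear_plus)
      show "glinear A (scl V) (\<lambda>y. app x zs v (xs @ [y] @ ys))"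
      proof (rule homog_induct[of "\<lambda>v. glinear A (scl V) (\<lambda>y. app x zs v (xs @ [y] @ ys))"])
        fix n v assume v: "v \<in> gr V n"
        have "glinear A (scl V) (\<lambda>y. sh k (app G zs v (xs @ [y] @ ys)))" for k
          by (rule W.glinear_homogeneous_map[OF FV trilinD(7)[OF frm_trilin[OF G(1)] H] sh(1)])
        then have "glinear (susp A) (scl V) (\<lambda>y. sh (dg zs + n + (dg xs + (deg (susp A) y + dg ys))) (app G zs v (xs @ [y] @ ys)))"
          by (intro SA.glinear_degree_dependent[where h = "\<lambda>k y. sh (dg zs + n + (dg xs + (k + dg ys))) (app G zs v (xs @ [y] @ ys))"] VV) simp
        then show "glinear A (scl V) (\<lambda>y. app x zs v (xs @ [y] @ ys))"
          unfolding glinear_susp xh[OF v] by simp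
      qed (auto intro: W.glinear_plus)
    qed
    moreover have "?P \<odot> x = x"
      by (rule tmap_eq_on_homog) (simp add: homogeneous_map_conc_apply(2)[OF p(1)] xh sh(3))
    moreover have "x \<odot> ?P = x"
    proof (rule tmap_eq_on_homog)
      show "app (x \<odot> ?P) as v bs = app x as v bs" if "v \<in> gr V n" for as v bs n
        unfolding homogeneous_map_conc_apply(3)[OF p(1)] xh[OF that] xh[OF p(2)[OF that]] GP ..
    qed
    moreover have "\<psi> \<odot> x = G"
    proof (rule tmap_eq_on_homog)
      fix as v bs n assume v: "v \<in> gr V n"
      have "\<exists>z\<in>gr V (dg as + n + dg bs). p z = z \<and> \<psi>0 z = app G as v bs"
      proof (rule surj)
        show "homogeneous_map (scl V) (*) (app G as v bs)" by (rule frm_linear[OF G(1)])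
        show "arg p (app G as v bs) = app G as v bs" by (simp add: fun_eq_iff arg_def GP')
        show "app G as v bs w = 0" if "m \<noteq> d - (dg as + n + dg bs)" "w \<in> gr V m" for m w
          using that by (intro frm_degree[OF G(1) v that(2)]) auto
      qed
      then obtain z where "z \<in> gr V (dg as + n + dg bs)" "p z = z" "\<psi>0 z = app G as v bs" by blast
      then show "app (\<psi> \<odot> x) as v bs = app G as v bs"
        using sh(4)[of z "dg as + n + dg bs"] by (simp add: app_\<psi>' xh[OF v])
    qed
    ultimately show ?thesis by blast
  qed
  have sharp_vanish: "vanish k x" if x: "mor 0 x" "?P \<odot> x = x" and v: "vanish k (\<psi> \<odot> x)" for x k
    unfolding vanish_def
  proof (intro allI impI)
    fix as :: "'a list" and v and bs :: "'a list" assume l: "length as + length bs < k"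
    show "app x as v bs = 0"
    proof (rule additive_eqI[of "\<lambda>v. app x as v bs" "\<lambda>v. 0"])
      fix n v assume n: "v \<in> gr V n"
      show "app x as v bs = 0"
      proof (rule inj)
        show "app x as v bs \<in> gr V (dg as + n + dg bs + 0)" by (rule mor_degree[OF x(1) n])
        show "p (app x as v bs) = app x as v bs"
          using arg_cong[OF x(2), of "\<lambda>F. app F as v bs"] by (simp add: homogeneous_map_conc_apply(2)[OF p(1)])
        show "\<psi>0 (app x as v bs) = 0"
          using that(3) l by (simp add: vanish_def app_\<psi>')
      qed
    qed simp_all
  qed
  define \<Gamma> where "\<Gamma> u = \<Upsilon> + (costar d A u \<Upsilon> + \<Upsilon> \<odot> u) + costar d A u (\<psi> \<odot> u) + costar d A u (\<Upsilon> \<odot> u)" for u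
  \<comment> \<open>the solution sought is a fixed point of \<open>S\<close>, where \<open>\<psi> (S u) = T u\<close>\<close>
  define T where "T u = smul (- inverse 2) (\<Gamma> u)" for u
  define ok where "ok u \<longleftrightarrow> mor 0 u \<and> ?P \<odot> u = u \<and> u \<odot> ?P = u \<and> vanish 1 u" for u
  have comp: "frm d (F \<odot> u)" "frm d (costar d A u F)" if "frm d F" "mor 0 u" for F u
    using frm_comp[OF that] frm_costar[OF that] by auto
  have fG: "frm d (\<Gamma> u)" if "mor 0 u" for u
    unfolding \<Gamma>_def by (intro frm_add comp f\<Upsilon> f\<psi> that)
  have fT: "frm d (T u)" if "mor 0 u" for u unfolding T_def by (rule frm_smul[OF fG[OF that]])
  have skT: "skew (T u)" if "mor 0 u" for u
    unfolding T_def \<Gamma>_def by (intro skew_smul skew_add skew_sum skew_pullback sk\<Upsilon> sk\<psi> f\<Upsilon> f\<psi> that)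
  have zero: "app F as v bs 0 = 0" if "frm d F" for F as v bs by (rule frm_add_right(2)[OF that])
  have TP: "T u \<odot> ?P = T u" "conc (arg p) \<odot> T u = T u" if u: "ok u" for u
  proof -
    have u': "mor 0 u" "?P \<odot> u = u" "u \<odot> ?P = u" using u by (auto simp: ok_def)
    have G1: "\<Gamma> u \<odot> ?P = \<Gamma> u"
      by (simp add: \<Gamma>_def tcomp_simps costar_comp[symmetric] \<Upsilon>P u')
    have G2: "conc (arg p) \<odot> \<Gamma> u = \<Gamma> u"
      using costar_tcomp_conc[OF p(1), of d u] tcomp_ext[OF \<Upsilon>P(2), of u]
      by (simp add: \<Gamma>_def tcomp_simps \<Upsilon>P u')
    show "T u \<odot> ?P = T u" by (simp add: T_def smul_def tcomp_assoc G1)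
    show "conc (arg p) \<odot> T u = T u"
      using arg_cong[OF G2, of "\<lambda>F. app F _ _ _ _"] by (intro form_eqI) (simp add: T_def)
  qed
  define S where "S u = (SOME x. mor 0 x \<and> ?P \<odot> x = x \<and> x \<odot> ?P = x \<and> \<psi> \<odot> x = T u)" for u
  have S: "mor 0 (S u)" "?P \<odot> S u = S u" "S u \<odot> ?P = S u" "\<psi> \<odot> S u = T u" if "ok u" for u
  proof -
    have "mor 0 u" using that by (simp add: ok_def)
    from someI_ex[OF sharp[OF fT[OF this] TP[OF that]]]
    show "mor 0 (S u)" "?P \<odot> S u = S u" "S u \<odot> ?P = S u" "\<psi> \<odot> S u = T u"
      unfolding S_def by blast+
  qed
  have "\<exists>u. ok u \<and> S u = u"
  proof (rule contraction_fixed_point)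
    show "ok 0" by (simp add: ok_def)
    show "ok (S u)" if u: "ok u" for u
    proof -
      have u': "mor 0 u" "vanish 1 u" using u by (auto simp: ok_def)
      have 1: "vanish 1 (costar d A u \<Upsilon>)" "vanish 1 (\<Upsilon> \<odot> u)"
        using vanish_costar[OF u'(2) vanish_0 zero[OF f\<Upsilon>], of d A] vanish_tcomp_left[OF v\<Upsilon>] by auto
      have 2: "vanish 1 (costar d A u (\<psi> \<odot> u))" "vanish 1 (costar d A u (\<Upsilon> \<odot> u))"
        using vanish_costar[OF u'(2) vanish_0 zero[OF comp(1)[OF f\<psi> u'(1)]], of d A]
          vanish_costar[OF u'(2) vanish_0 zero[OF comp(1)[OF f\<Upsilon> u'(1)]], of d A] by auto
      have "vanish 1 (T u)"
        unfolding T_def \<Gamma>_def by (intro vanish_smul vanish_add v\<Upsilon> 1 2)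
      then have "vanish 1 (S u)" by (intro sharp_vanish[OF S(1,2)[OF u]]) (simp add: S[OF u])
      then show ?thesis using S[OF u] by (simp add: ok_def)
    qed
    show "vanish (Suc n) (S u - S w)" if u: "ok u" and w: "ok w" and vn: "vanish n (u - w)" for n u w
    proof -
      have u': "mor 0 u" "vanish 1 u" and w': "mor 0 w" "vanish 1 w" using u w by (auto simp: ok_def)
      have uw: "mor 0 (u - w)" using u' w' by blast
      have quad: "costar d A u (F \<odot> u) - costar d A w (F \<odot> w) = costar d A (u - w) (F \<odot> u) + costar d A w (F \<odot> (u - w))"
        if "frm d F" for F
        by (simp add: costar_diff_left[OF comp(1)[OF that u'(1)]] tcomp_diff_right costar_diff_right)
      have "vanish (Suc n) (costar d A (u - w) (F \<odot> u) + costar d A w (F \<odot> (u - w)))" if F: "frm d F" for F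
      proof (rule vanish_add)
        have "vanish (n + 1) (costar d A (u - w) (F \<odot> u))"
          by (rule vanish_costar[OF vn vanish_tcomp_right[OF u'(2)] zero[OF comp(1)[OF F u'(1)]]])
        then show "vanish (Suc n) (costar d A (u - w) (F \<odot> u))" by simp
        have "vanish (1 + n) (costar d A w (F \<odot> (u - w)))"
          by (rule vanish_costar[OF w'(2) vanish_tcomp_right[OF vn] zero[OF comp(1)[OF F uw]]])
        then show "vanish (Suc n) (costar d A w (F \<odot> (u - w)))" by simp
      qed
      note q = this[OF f\<psi>, folded quad[OF f\<psi>]] this[OF f\<Upsilon>, folded quad[OF f\<Upsilon>]]
      have l: "vanish (Suc n) (costar d A (u - w) \<Upsilon>)" "vanish (Suc n) (\<Upsilon> \<odot> (u - w))"
        using vanish_costar[OF vn v\<Upsilon> zero[OF f\<Upsilon>], of d A] vanish_tcomp[OF v\<Upsilon> vn] by simp_all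
      have "\<Gamma> u - \<Gamma> w = (costar d A (u - w) \<Upsilon> + \<Upsilon> \<odot> (u - w))
          + (costar d A u (\<psi> \<odot> u) - costar d A w (\<psi> \<odot> w)) + (costar d A u (\<Upsilon> \<odot> u) - costar d A w (\<Upsilon> \<odot> w))"
        by (simp add: \<Gamma>_def costar_diff_left[OF f\<Upsilon>] tcomp_diff_right)
      then have "vanish (Suc n) (\<Gamma> u - \<Gamma> w)" using l q by (simp only: vanish_add)
      then have "vanish (Suc n) (\<psi> \<odot> (S u - S w))"
        by (simp add: tcomp_diff_right S[OF u] S[OF w] T_def smul_diff vanish_smul)
      then show ?thesis
        using S(1,2)[OF u] S(1,2)[OF w] by (intro sharp_vanish mor_diff) (simp_all add: tcomp_diff_right)
    qed
    show "ok f" if lim: "\<And>k. \<exists>g. ok g \<and> vanish k (f - g)" for f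
    proof -
      have "mor 0 f" by (rule mor_limit) (use lim in \<open>auto simp: ok_def\<close>)
      moreover have "?P \<odot> f - f = 0"
      proof (rule vanish_all_imp_0)
        fix n
        obtain g where g: "?P \<odot> g = g" "vanish n (f - g)" using lim[of n] by (auto simp: ok_def)
        have "vanish n (?P \<odot> (f - g) - (f - g))" by (intro vanish_diff vanish_tcomp_right g(2))
        then show "vanish n (?P \<odot> f - f)" by (simp add: tcomp_diff_right g(1))
      qed
      moreover have "f \<odot> ?P - f = 0"
      proof (rule vanish_all_imp_0)
        fix n
        obtain g where g: "g \<odot> ?P = g" "vanish n (f - g)" using lim[of n] by (auto simp: ok_def)
        have "vanish n ((f - g) \<odot> ?P - (f - g))" by (intro vanish_diff vanish_tcomp_left g(2))
        then show "vanish n (f \<odot> ?P - f)" by (simp add: tcomp_diff_left g(1))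
      qed
      moreover have "vanish 1 f"
      proof -
        obtain g where g: "vanish 1 g" "vanish 1 (f - g)" using lim[of 1] by (auto simp: ok_def)
        from vanish_add[OF this] show ?thesis by simp
      qed
      ultimately show ?thesis by (simp add: ok_def)
    qed
  qed
  then obtain u where u: "ok u" "S u = u" by blast
  then have u': "mor 0 u" "vanish 1 u" "?P \<odot> u = u" "u \<odot> ?P = u" by (auto simp: ok_def)
  have \<psi>u: "\<psi> \<odot> u = T u" using S(4)[OF u(1)] u(2) by simp
  \<comment> \<open>both sides are transposes of \<open>- \<psi> u\<close>, the second because \<open>\<psi> u = T u\<close> is skew\<close>
  have sym: "costar d A u \<psi> = \<psi> \<odot> u"
  proof (rule flip_unique)
    show "flip (- (\<psi> \<odot> u)) (costar d A u \<psi>)" by (rule flip_sym[OF skew_flip[OF sk\<psi> f\<psi> u'(1)]])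
    show "flip (- (\<psi> \<odot> u)) (\<psi> \<odot> u)"
      using flip_sym[OF skT[OF u'(1), unfolded skew_def]] by (simp add: \<psi>u)
  qed (rule comp[OF f\<psi> u'(1)])+
  have T2: "T u + T u = - \<Gamma> u"
    by (rule form_eqI) (use two in \<open>simp add: T_def field_simps\<close>)
  have "costar d A (tid + u) (\<Phi> \<odot> (tid + u)) = \<psi> + (\<psi> \<odot> u + costar d A u \<psi>) + \<Gamma> u"
  proof -
    have f: "frm d (\<Phi> \<odot> (tid + u))" using u'(1) by (intro comp \<Phi>) auto
    have ct: "costar d A tid F = F" if "frm d F" for F
      using costar_conc[of "\<lambda>v. v", OF _ that, of d]
      by (simp add: tid_def[symmetric] homogeneous_map_def) (rule form_eqI, simp)
    have \<Phi>_eq: "\<Phi> = \<psi> + \<Upsilon>" by (simp add: \<Upsilon>_def)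
    show ?thesis
      unfolding costar_add_left[OF f] ct[OF f]
      by (simp add: \<Phi>_eq \<Gamma>_def tcomp_simps costar_add_right algebra_simps)
  qed
  also have "\<dots> = \<psi>" by (simp add: sym \<psi>u T2)
  finally show ?thesis using u' by (auto simp: \<psi>_def)
qed

end

section \<open>The minimal model and its inner product\<close>

text \<open>By induction on the number of functionals: on the kernel of one of them the others
  suffice, and a vector on which it is \<open>1\<close> determines its coefficient.\<close>

lemma (in vector_space) functional_combination:
  assumes "finite I" "subspace X"
    and f: "\<And>i. i \<in> I \<Longrightarrow> homogeneous_map scale (*) (f i)" and g: "homogeneous_map scale (*) g"
    and ker: "\<And>x. x \<in> X \<Longrightarrow> (\<And>i. i \<in> I \<Longrightarrow> f i x = 0) \<Longrightarrow> g x = 0"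
  shows "\<exists>c. \<forall>x\<in>X. g x = (\<Sum>i\<in>I. c i * f i x)"
  using assms
proof (induction I arbitrary: X)
  case empty
  then show ?case by auto
next
  case (insert i I)
  note fi = homogeneous_mapD[OF insert.prems(2)[of i, simplified]] and g' = homogeneous_mapD[OF g]
  let ?Y = "{x \<in> X. f i x = 0}"
  have Y: "subspace ?Y" using insert.prems(1) by (auto simp: subspace_def fi)
  have "\<exists>c. \<forall>x\<in>?Y. g x = (\<Sum>i\<in>I. c i * f i x)"
    by (rule insert.IH[OF Y _ g]) (use insert.prems in auto)
  then obtain c where c: "\<And>x. x \<in> ?Y \<Longrightarrow> g x = (\<Sum>i\<in>I. c i * f i x)" by blast
  show ?case
  proof (cases "?Y = X")
    case True
    then have "f i x = 0" if "x \<in> X" for x using that by blast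
    with True c have "\<forall>x\<in>X. g x = (\<Sum>j\<in>insert i I. c j * f j x)"
      using insert.hyps by auto
    then show ?thesis by blast
  next
    case False
    then obtain y where y: "y \<in> X" "f i y \<noteq> 0" by blast
    define y0 where "y0 = scale (inverse (f i y)) y"
    have y0: "y0 \<in> X" "f i y0 = 1" using y insert.prems(1) by (auto simp: y0_def fi subspace_scale)
    define S where "S = (\<Sum>k\<in>I. c k * f k y0)"
    define c' where "c' j = (if j = i then g y0 - S else c j)" for j
    have "g x = (\<Sum>j\<in>insert i I. c' j * f j x)" if x: "x \<in> X" for x
    proof -
      let ?z = "x - scale (f i x) y0"
      have z: "?z \<in> ?Y" using x y0 insert.prems(1) by (auto simp: fi subspace_diff subspace_scale)
      have "f k ?z = f k x - f i x * f k y0" if "k \<in> I" for k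
        using homogeneous_mapD[OF insert.prems(2)[of k]] that by simp
      then have "(\<Sum>k\<in>I. c k * f k ?z) = (\<Sum>k\<in>I. c k * (f k x - f i x * f k y0))"
        by (intro sum.cong) auto
      also have "\<dots> = (\<Sum>k\<in>I. c k * f k x) - f i x * (\<Sum>k\<in>I. c k * f k y0)"
        by (simp add: right_diff_distrib sum_subtractf sum_distrib_left mult.left_commute)
      finally have 1: "(\<Sum>k\<in>I. c k * f k ?z) = (\<Sum>k\<in>I. c k * f k x) - f i x * S" by (simp only: S_def)
      have "g ?z = g x - f i x * g y0" by (simp add: g')
      then have 2: "g x = g ?z + f i x * g y0" by simp
      have 3: "(\<Sum>k\<in>I. c' k * f k x) = (\<Sum>k\<in>I. c k * f k x)"
        using insert.hyps by (intro sum.cong) (auto simp: c'_def)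
      have "(\<Sum>j\<in>insert i I. c' j * f j x) = (g y0 - S) * f i x + (\<Sum>k\<in>I. c k * f k x)"
        using insert.hyps 3 by (simp add: c'_def)
      also have "\<dots> = ((\<Sum>k\<in>I. c k * f k x) - f i x * S) + f i x * g y0"
        by (simp add: algebra_simps)
      also have "\<dots> = g x"
        by (simp only: 1[symmetric] c[OF z, symmetric] 2[symmetric])
      finally show ?thesis by simp
    qed
    then show ?thesis by blast
  qed
qed

context words
begin

lemma app_del_empty [simp]: "app (del x) [] v [] = 0"
  by (simp add: del_def app_eps app_ops)

lemma vanish_del: "vanish 1 (del x)"
  by (auto simp: vanish_def)

end

context represented
begin

definition D :: "'c \<Rightarrow> 'c" where "D v = app b [] v []"

lemma D_lin: "homogeneous_map (scl V) (scl V) D"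
  unfolding D_def by (rule trilinD(2)[OF mor_trilin[OF b]])

lemma D_e [simp]: "D (e v) = D v" and e_D [simp]: "e (D v) = D v"
  using arg_cong[OF be, of "\<lambda>F. app F [] v []"] arg_cong[OF eb, of "\<lambda>F. app F [] v []"]
  by (simp_all add: D_def homogeneous_map_conc_apply(2,3)[OF e])

lemma act_D: "v \<in> homog M \<Longrightarrow> act M [] v [] = D v"
  by (simp add: D_def act)

lemma D_gr: "v \<in> gr M n \<Longrightarrow> D v \<in> gr M (n + 1)"
  using act_homog[of "[]" "[]" v n] act_D[OF M.homogI, of v n] by simp

lemma D_gr_V: "v \<in> gr V n \<Longrightarrow> D v \<in> gr V (n + 1)"
  using mor_degree[OF b, of v n "[]" "[]"] by (simp add: D_def)

lemma D_D: assumes "del b + sgl A b \<odot> b = 0" shows "D (D v) = 0"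
  using arg_cong[OF assms, of "\<lambda>F. app F [] v []"] by (simp add: app_tcomp app_ops D_def)

text \<open>Splitting off an acyclic part: \<open>p\<close> projects onto representatives of the cohomology,
  which carries a transferred structure \<open>bH\<close> and homomorphisms \<open>i\<close> and \<open>q\<close> from and to \<open>M\<close>.\<close>

lemma minimal_model:
  assumes MC: "del b + sgl A b \<odot> b = 0"
  obtains h p i q bH where
    "homogeneous_map (scl V) (scl V) h" "homogeneous_map (scl V) (scl V) p"
    "\<And>n v. v \<in> gr V n \<Longrightarrow> h v \<in> gr M (n - 1)" "\<And>n v. v \<in> gr V n \<Longrightarrow> p v \<in> gr M n"
    "\<And>v. D (p v) = 0" "\<And>v. p (D v) = 0" "\<And>v. p (p v) = p v" "\<And>v. p (e v) = p v"
    "\<And>v. h (D v) + D (h v) = e v - p v"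
    "mor 0 i" "mor 0 q" "mor 1 bH" "i \<odot> conc p = i" "conc p \<odot> q = q" "q \<odot> i = conc p"
    "conc p \<odot> bH = bH" "bH \<odot> conc p = bH"
    "vanish 1 (i - conc p)" "vanish 1 (q - conc p)" "vanish 1 bH"
    "del i + sgl A i \<odot> bH = b \<odot> i" "del q + sgl A q \<odot> b = bH \<odot> q"
proof -
  note D' = homogeneous_mapD[OF D_lin]
  have sub: "vs.subspace (gr M n)" for n using M.gr_subspace[of n] by (simp add: scl_M)
  have "\<exists>h p. homogeneous_map (scl V) (scl V) h \<and> homogeneous_map (scl V) (scl V) p
    \<and> (\<forall>n. \<forall>v\<in>gr V n. h v \<in> gr M (n - 1) \<and> p v \<in> gr M n \<and> D (p v) = 0 \<and> p (D (e v)) = 0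
         \<and> p (p v) = p v \<and> h (h v) = 0 \<and> h (p v) = 0 \<and> p (h v) = 0 \<and> p (e v) = p v \<and> h (e v) = h v
         \<and> h (D (e v)) + D (h v) = e v - p v)"
    by (rule contraction_exists[OF e _ _ sub gr_M D_lin]) (use e_gr e_id D_gr D_D[OF MC] in auto)
  then obtain h p where h: "homogeneous_map (scl V) (scl V) h" and p: "homogeneous_map (scl V) (scl V) p"
    and hp: "\<And>n v. v \<in> gr V n \<Longrightarrow> h v \<in> gr M (n - 1) \<and> p v \<in> gr M n \<and> D (p v) = 0 \<and> p (D (e v)) = 0
         \<and> p (p v) = p v \<and> h (h v) = 0 \<and> h (p v) = 0 \<and> p (h v) = 0 \<and> p (e v) = p v \<and> h (e v) = h v
         \<and> h (D (e v)) + D (h v) = e v - p v"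
    by blast
  note h' = homogeneous_mapD[OF h] and p' = homogeneous_mapD[OF p]
  have lift: "f v = g v" if "\<And>n v. v \<in> gr V n \<Longrightarrow> f v = g v" "\<And>x y. f (x + y) = f x + f y" "\<And>x y. g (x + y) = g x + g y"
    for f g :: "'c \<Rightarrow> 'c" and v
    using additive_eqI[of f g v] that by blast
  have Dp: "D (p v) = 0" for v by (rule lift[of "\<lambda>v. D (p v)" "\<lambda>v. 0"]) (use hp in \<open>auto simp: D' p'\<close>)
  have pD: "p (D v) = 0" for v by (rule lift[of "\<lambda>v. p (D v)" "\<lambda>v. 0"]) (use hp in \<open>auto simp: D' p'\<close>)
  have pp: "p (p v) = p v" for v by (rule lift[of "\<lambda>v. p (p v)" p]) (use hp in \<open>auto simp: p'\<close>)
  have hh: "h (h v) = 0" for v by (rule lift[of "\<lambda>v. h (h v)" "\<lambda>v. 0"]) (use hp in \<open>auto simp: h'\<close>)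
  have hp0: "h (p v) = 0" for v by (rule lift[of "\<lambda>v. h (p v)" "\<lambda>v. 0"]) (use hp in \<open>auto simp: h' p'\<close>)
  have ph0: "p (h v) = 0" for v by (rule lift[of "\<lambda>v. p (h v)" "\<lambda>v. 0"]) (use hp in \<open>auto simp: h' p'\<close>)
  have pe: "p (e v) = p v" for v by (rule lift[of "\<lambda>v. p (e v)" p]) (use hp in \<open>auto simp: p' e'\<close>)
  have hD: "h (D v) + D (h v) = e v - p v" for v
    by (rule lift[of "\<lambda>v. h (D v) + D (h v)" "\<lambda>v. e v - p v"]) (use hp in \<open>auto simp: p' e' h' D'\<close>)
  have hgr: "h v \<in> gr M (n - 1)" "p v \<in> gr M n" if "v \<in> gr V n" for v n using hp[OF that] by auto
  note c1 = homogeneous_map_conc_apply(1)[OF D_lin] homogeneous_map_conc_apply(1)[OF h] homogeneous_map_conc_apply(1)[OF p]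
  note c2 = homogeneous_map_conc_apply(2)[OF D_lin] homogeneous_map_conc_apply(2)[OF h] homogeneous_map_conc_apply(2)[OF p]
  note c3 = homogeneous_map_conc_apply(3)[OF D_lin] homogeneous_map_conc_apply(3)[OF h] homogeneous_map_conc_apply(3)[OF p]
  have eb': "e (app (b - conc D) as v bs) = app (b - conc D) as v bs" for as v bs
    using arg_cong[OF eb, of "\<lambda>F. app F as v bs"]
    by (simp add: homogeneous_map_conc_apply(2)[OF e] c1 e')
  have be': "app (b - conc D) as (e v) bs = app (b - conc D) as v bs" for as v bs
    using arg_cong[OF be, of "\<lambda>F. app F as v bs"]
    by (simp add: homogeneous_map_conc_apply(3)[OF e] c1)
  have "\<exists>i q bH. mor 0 i \<and> mor 0 q \<and> mor 1 bH \<and> i \<odot> conc p = i \<and> conc p \<odot> q = q \<and> q \<odot> i = conc p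
    \<and> conc p \<odot> bH = bH \<and> bH \<odot> conc p = bH \<and> vanish 1 (i - conc p) \<and> vanish 1 (q - conc p) \<and> vanish 1 bH
    \<and> del i + sgl A i \<odot> bH = b \<odot> i \<and> del q + sgl A q \<odot> b = bH \<odot> q"
  proof (rule perturbation[OF b MC])
    show "vanish 1 (b - conc D)" by (auto simp: vanish_def c1 D_def)
    show "mor 1 (conc D)" by (rule mor_conc[OF D_lin D_gr_V])
    show "mor (- 1) (conc h)" by (rule mor_conc[OF h]) (use hgr gr_M in \<open>auto simp: subset_iff\<close>)
    show "mor 0 (conc p)" by (rule mor_conc[OF p]) (use hgr gr_M in \<open>auto simp: subset_iff\<close>)
    show "conc D \<odot> conc D = 0" "conc h \<odot> conc h = 0" "conc h \<odot> conc p = 0" "conc p \<odot> conc h = 0"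
      "conc D \<odot> conc p = 0" "conc p \<odot> conc D = 0" "conc p \<odot> conc p = conc p"
      by (rule tmap_eqI; simp add: c1 c2 D_D[OF MC] hh hp0 ph0 Dp pD pp D' h' p')+
    show "conc h \<odot> (conc D \<odot> (b - conc D)) = b - conc D - conc p \<odot> (b - conc D) - conc D \<odot> (conc h \<odot> (b - conc D))"
    proof (rule tmap_eqI)
      fix as v bs
      show "app (conc h \<odot> (conc D \<odot> (b - conc D))) as v bs =
          app (b - conc D - conc p \<odot> (b - conc D) - conc D \<odot> (conc h \<odot> (b - conc D))) as v bs"
        using hD[of "app (b - conc D) as v bs"] unfolding eb' app_minus_left[of _ "_ \<odot> _"] c2
        by (simp add: algebra_simps)
    qed
    show "(b - conc D) \<odot> (conc D \<odot> conc h) = b - conc D - (b - conc D) \<odot> conc p - (b - conc D) \<odot> (conc h \<odot> conc D)"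
    proof (rule tmap_eqI)
      fix as v bs
      have "D (h v) = e v - p v - h (D v)" using hD[of v] by (simp add: algebra_simps)
      then have "app (b - conc D) as (D (h v)) bs = app (b - conc D) as v bs - app (b - conc D) as (p v) bs - app (b - conc D) as (h (D v)) bs"
        by (simp only: app_diff be')
      then show "app ((b - conc D) \<odot> (conc D \<odot> conc h)) as v bs =
          app (b - conc D - (b - conc D) \<odot> conc p - (b - conc D) \<odot> (conc h \<odot> conc D)) as v bs"
        by (simp only: tcomp_assoc[symmetric] c3 app_minus_left[of _ "_ \<odot> _"])
    qed
  qed
  then obtain i q bH where "mor 0 i" "mor 0 q" "mor 1 bH" "i \<odot> conc p = i" "conc p \<odot> q = q" "q \<odot> i = conc p"
    "conc p \<odot> bH = bH" "bH \<odot> conc p = bH"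
    "vanish 1 (i - conc p)" "vanish 1 (q - conc p)" "vanish 1 bH"
    "del i + sgl A i \<odot> bH = b \<odot> i" "del q + sgl A q \<odot> b = bH \<odot> q" by blast
  from that[OF h p hgr Dp pD pp pe hD this] show thesis .
qed

end

definition image_bimod :: "('k::field, 'c::ab_group_add) gspace \<Rightarrow> ('c \<Rightarrow> 'c) \<Rightarrow> ('a, 'c, 'c) tmap \<Rightarrow> ('k, 'a, 'c) bimod" where
  "image_bimod V p b = \<lparr>scl = scl V, gr = (\<lambda>n. {v \<in> gr V n. p v = v}), act = app b\<rparr>"

lemma image_bimod_simps [simp]:
  "scl (image_bimod V p b) = scl V" "gr (image_bimod V p b) n = {v \<in> gr V n. p v = v}"
  "act (image_bimod V p b) = app b"
  by (simp_all add: image_bimod_def)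

context words
begin

lemma represented_image:
  assumes p: "homogeneous_map (scl V) (scl V) p" "\<And>n v. v \<in> gr V n \<Longrightarrow> p v \<in> gr V n" "\<And>v. p (p v) = p v"
    and b: "mor 1 b" "b \<odot> conc p = b" "conc p \<odot> b = b"
  shows "represented A V (image_bimod V p b) p b"
proof unfold_locales
  note p' = homogeneous_mapD[OF p(1)]
  show "graded_space (image_bimod V p b)"
    unfolding graded_space_def
  proof (intro conjI allI impI ballI)
    show "vector_space (scl (image_bimod V p b))" by (simp add: VV)
    show "module.subspace (scl (image_bimod V p b)) (gr (image_bimod V p b) n)" for n
      by (simp, rule vs.subspaceI) (auto simp: p')
    show "x n = 0" if "finite N \<and> (\<forall>n\<in>N. x n \<in> gr (image_bimod V p b) n) \<and> sum x N = 0" "n \<in> N" for N x n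
      using that by (intro independent_sum[of N x]) auto
  qed
qed (use assms in auto)

end

context represented
begin

text \<open>Without a constant term in \<open>b'\<close> every element of the image of \<open>p\<close> is a cohomology class
  of its own, and two cocycles of \<open>M\<close> are cohomologous iff they have the same image under \<open>p\<close>,
  by means of the contraction \<open>h\<close>.\<close>

lemma quasi_iso_image:
  assumes h: "\<And>n v. v \<in> gr V n \<Longrightarrow> h v \<in> gr M (n - 1)"
    and p: "homogeneous_map (scl V) (scl V) p" "\<And>n v. v \<in> gr V n \<Longrightarrow> p v \<in> gr M n"
    and Dp: "\<And>v. D (p v) = 0" and pD: "\<And>v. p (D v) = 0" and pp: "\<And>v. p (p v) = p v"
    and hD: "\<And>v. h (D v) + D (h v) = e v - p v" and h0: "h 0 = 0"
    and b': "\<And>v. app b' [] v [] = 0"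
    and g: "bimod_hom A M (image_bimod V p b') g" "\<And>v. g [] v [] = p v"
  shows "quasi_iso A M (image_bimod V p b') g"
  unfolding quasi_iso_def
proof (intro conjI allI g(1))
  fix n
  let ?N = "image_bimod V p b'"
  note p' = homogeneous_mapD[OF p(1)] and D' = homogeneous_mapD[OF D_lin]
  have V: "v \<in> gr V n" if "v \<in> gr M n" for v n using that gr_M by blast
  have cocN: "cocycles ?N n = gr ?N n" by (auto simp: cocycles_def b')
  have relN: "cohom_rel ?N n = {(x, x) | x. x \<in> gr ?N n}"
  proof -
    have "0 \<in> gr ?N (n - 1)" by (simp add: p')
    then have "(\<exists>u\<in>gr ?N (n - 1). y - x = act ?N [] u []) \<longleftrightarrow> x = y" for x y
      unfolding image_bimod_simps(3) b' by auto
    then show ?thesis unfolding cohom_rel_def cocN by auto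
  qed
  have clN: "cohom_class ?N n x = {x}" if "x \<in> gr ?N n" for x
    using that by (auto simp: cohom_class_def relN)
  have H: "cohomology ?N n = (\<lambda>x. {x}) ` gr ?N n"
    unfolding cohomology_def quotient_def cocN relN by auto
  have coc: "x \<in> cocycles M n \<longleftrightarrow> x \<in> gr M n \<and> D x = 0" for x
    using act_D[OF M.homogI] by (auto simp: cocycles_def)
  have rel: "(x, y) \<in> cohom_rel M n \<longleftrightarrow> x \<in> cocycles M n \<and> y \<in> cocycles M n \<and> p x = p y" for x y
  proof -
    have "(\<exists>u\<in>gr M (n - 1). y - x = act M [] u []) \<longleftrightarrow> p x = p y" if "x \<in> cocycles M n" "y \<in> cocycles M n"
    proof
      assume "\<exists>u\<in>gr M (n - 1). y - x = act M [] u []"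
      then obtain u where "u \<in> gr M (n - 1)" "y - x = D u" using act_D[OF M.homogI] by metis
      then have "p (y - x) = 0" by (simp add: pD)
      then show "p x = p y" by (simp add: p')
    next
      assume pxy: "p x = p y"
      have yx: "y - x \<in> gr M n" "D (y - x) = 0" using that by (auto simp: coc D')
      then have "y - x = D (h (y - x))" using hD[of "y - x"] pxy by (simp add: h0 e_id p')
      moreover have "h (y - x) \<in> gr M (n - 1)" by (rule h[OF V[OF yx(1)]])
      ultimately show "\<exists>u\<in>gr M (n - 1). y - x = act M [] u []" using act_D[OF M.homogI] by metis
    qed
    then show ?thesis by (auto simp: cohom_rel_def)
  qed
  have cl: "cohom_class M n x = {y \<in> cocycles M n. p y = p x}" if "x \<in> cocycles M n" for x
    using that by (auto simp: cohom_class_def rel)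
  have HM: "cohomology M n = (\<lambda>x. {y \<in> cocycles M n. p y = p x}) ` cocycles M n"
    unfolding cohomology_def quotient_def using cl by (auto simp: cohom_class_def)
  have px: "p x \<in> gr ?N n" if "x \<in> cocycles M n" for x
    using that p(2)[OF V, of x n] V pp by (auto simp: coc)
  have img: "(\<Union>y\<in>{y \<in> cocycles M n. p y = p x}. cohom_class ?N n (g [] y [])) = {p x}" if "x \<in> cocycles M n" for x
    using that clN[OF px[OF that]] by (auto simp: g(2))
  show "bij_betw (\<lambda>X. \<Union>x\<in>X. cohom_class ?N n (g [] x [])) (cohomology M n) (cohomology ?N n)"
    unfolding bij_betw_def
  proof
    show "inj_on (\<lambda>X. \<Union>x\<in>X. cohom_class ?N n (g [] x [])) (cohomology M n)"
      unfolding HM by (rule inj_onI) (auto simp: img)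
    show "(\<lambda>X. \<Union>x\<in>X. cohom_class ?N n (g [] x [])) ` cohomology M n = cohomology ?N n"
      unfolding HM H image_image
    proof
      show "(\<lambda>x. \<Union>y\<in>{y \<in> cocycles M n. p y = p x}. cohom_class ?N n (g [] y [])) ` cocycles M n \<subseteq> (\<lambda>x. {x}) ` gr ?N n"
        using img px by auto
      show "(\<lambda>x. {x}) ` gr ?N n \<subseteq> (\<lambda>x. \<Union>y\<in>{y \<in> cocycles M n. p y = p x}. cohom_class ?N n (g [] y [])) ` cocycles M n"
      proof
        fix Z assume "Z \<in> (\<lambda>x. {x}) ` gr ?N n"
        then obtain z where z: "Z = {z}" "z \<in> gr V n" "p z = z" by auto
        have "z \<in> cocycles M n" using p(2)[OF z(2)] Dp[of z] z(3) by (simp add: coc)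
        from img[OF this] this z show "Z \<in> (\<lambda>x. \<Union>y\<in>{y \<in> cocycles M n. p y = p x}. cohom_class ?N n (g [] y [])) ` cocycles M n"
          by (intro image_eqI[of _ _ z]) auto
      qed
    qed
  qed
qed

end

context represented
begin

lemma represented_form_skew:
  assumes F: "frm d F" "F \<odot> conc e = F" "conc (arg e) \<odot> F = F"
    and agree: "\<And>as bs v w. as \<in> H \<Longrightarrow> bs \<in> H \<Longrightarrow> v \<in> homog M \<Longrightarrow> w \<in> homog M \<Longrightarrow> app F as v bs w = \<phi> as v bs w"
    and sk: "skew_symmetric A M \<phi>"
  shows "skew F"
  unfolding skew_def flip_def
proof (intro allI impI)
  fix as v bs w m n assume v: "v \<in> gr V m" and w: "w \<in> gr V n"
  have Fe: "app F as v bs w = app F as (e v) bs (e w)" for as v bs w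
    using arg_cong[OF F(3), of "\<lambda>F. app F as v bs w"] arg_cong[OF F(2), of "\<lambda>F. app F as v bs (e w)"]
    by (simp add: homogeneous_map_conc_apply(3)[OF e])
  show "app (- F) as v bs w = ksgn ((dg as + m) * (dg bs + n)) (app F bs w as v)"
  proof (cases "as \<in> L \<and> bs \<in> L \<and> e v \<noteq> 0 \<and> e w \<noteq> 0")
    case True
    then have H: "as \<in> H" "bs \<in> H" using L_sub_H by blast+
    note hv = homog_e[OF v] and hw = homog_e[OF w]
    have dv: "deg M (e v) = m" "deg M (e w) = n" using True deg_M[OF e_gr[OF v]] deg_M[OF e_gr[OF w]] by auto
    have "\<phi> as (e v) bs (e w) = - ksgn ((dg as + deg M (e v)) * (dg bs + deg M (e w))) (\<phi> bs (e w) as (e v))"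
      using sk H hv hw unfolding skew_symmetric_def by blast
    then show ?thesis
      using Fe[of as v bs w] Fe[of bs w as v] agree[OF H hv hw] agree[OF H(2,1) hw hv] by (simp add: dv)
  next
    case False
    have "app F as v bs w = 0 \<and> app F bs w as v = 0"
    proof (cases "as \<in> L \<and> bs \<in> L")
      case False
      then have "app F as v bs = 0" "app F bs w as = 0" using nrmD[OF frm_nrm[OF F(1)]] by blast+
      then show ?thesis by simp
    next
      case True
      with False have "e v = 0 \<or> e w = 0" by blast
      then show ?thesis using Fe[of as v bs w] Fe[of bs w as v] frm_add_right(2)[OF F(1)] by auto
    qed
    then show ?thesis by simp
  qed
qed

text \<open>The constant term of the variation says that \<open>D\<close> is self-adjoint up to sign.\<close>

lemma form_of_coboundary:
  assumes F: "frm d F" "variation d b F = 0" and z: "D z = 0"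
  shows "app F [] z [] (D y) = 0"
proof -
  have "app F [] z [] (par (D y)) = 0" for y
    using arg_cong[OF F(2), of "\<lambda>F. app F [] z [] y"] z
    by (simp add: variation_def app_tcomp app_ops app_costar app_eps homogeneous_map_conc_apply(1)[OF par(1)] D_def)
  moreover have "D y = par (D (par (- y)))"
  proof -
    have "D (par v) = - par (D v)" for v
    proof (rule additive_eqI[of "\<lambda>v. D (par v)" "\<lambda>v. - par (D v)"])
      fix n v assume v: "v \<in> gr V n"
      show "D (par v) = - par (D v)"
        by (simp add: par(2)[OF v] par(2)[OF D_gr_V[OF v]] homogeneous_mapD[OF D_lin] ksgn_def)
    qed (simp_all add: homogeneous_mapD[OF D_lin] homogeneous_mapD[OF par(1)])
    then show ?thesis by (simp add: homogeneous_mapD[OF D_lin] homogeneous_mapD[OF par(1)])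
  qed
  ultimately show ?thesis by metis
qed

text \<open>On representatives of the cohomology, homological non-degeneracy says that the pairing has
  no kernel; in finite dimensions it is then perfect.\<close>

lemma perfect_pairing:
  assumes h: "\<And>n v. v \<in> gr V n \<Longrightarrow> h v \<in> gr M (n - 1)"
    and p: "homogeneous_map (scl V) (scl V) p" "\<And>n v. v \<in> gr V n \<Longrightarrow> p v \<in> gr M n"
    and Dp: "\<And>v. D (p v) = 0" and pD: "\<And>v. p (D v) = 0" and pp: "\<And>v. p (p v) = p v"
    and hD: "\<And>v. h (D v) + D (h v) = e v - p v" and h0: "h 0 = 0"
    and F: "frm d F" "variation d b F = 0"
    and agree: "\<And>v w. v \<in> homog M \<Longrightarrow> w \<in> homog M \<Longrightarrow> app F [] v [] w = \<phi> [] v [] w"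
    and nd: "homologically_nondegenerate M \<phi>" and fin: "\<And>n. finite_dim_cohomology M n"
    and \<Psi>: "frm d \<Psi>" "skew \<Psi>" "\<And>v w. app \<Psi> [] v [] w = app F [] (p v) [] (p w)"
  shows "\<And>n z. z \<in> gr V n \<Longrightarrow> p z = z \<Longrightarrow> app \<Psi> [] z [] = 0 \<Longrightarrow> z = 0"
    and "\<And>n \<xi>. homogeneous_map (scl V) (*) \<xi> \<Longrightarrow> arg p \<xi> = \<xi> \<Longrightarrow> (\<And>m w. m \<noteq> d - n \<Longrightarrow> w \<in> gr V m \<Longrightarrow> \<xi> w = 0)
        \<Longrightarrow> \<exists>z\<in>gr V n. p z = z \<and> app \<Psi> [] z [] = \<xi>"
proof -
  note p' = homogeneous_mapD[OF p(1)]
  have V: "v \<in> gr V n" if "v \<in> gr M n" for v n using that gr_M by blast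
  have coc: "x \<in> cocycles M n \<longleftrightarrow> x \<in> gr M n \<and> D x = 0" for x n
    using act_D[OF M.homogI] by (auto simp: cocycles_def)
  show inj: "z = 0" if z: "z \<in> gr V n" "p z = z" "app \<Psi> [] z [] = 0" for n z
  proof (rule ccontr)
    assume "z \<noteq> 0"
    have zM: "z \<in> gr M n" using p(2)[OF z(1)] z(2) by simp
    have Dz: "D z = 0" using Dp[of z] z(2) by simp
    have zc: "z \<in> cocycles M n" using zM Dz by (simp add: coc)
    have "cohom_class M n z \<noteq> cohom_class M n 0"
    proof
      assume eq: "cohom_class M n z = cohom_class M n 0"
      have "act M [] 0 [] = 0" using act_D[OF M.homogI[OF M.gr_zero]] homogeneous_mapD(3)[OF D_lin] by simp
      then have "z \<in> cohom_class M n z"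
        using zc by (auto simp: cohom_class_def cohom_rel_def intro!: bexI[of _ 0])
      then have "z \<in> cohom_class M n 0" using eq by simp
      then obtain u where "u \<in> gr M (n - 1)" "z - 0 = act M [] u []"
        unfolding cohom_class_def cohom_rel_def by blast
      then have "z = D u" using act_D[OF M.homogI] by simp
      then have "p z = 0" by (simp add: pD)
      then show False using z(2) \<open>z \<noteq> 0\<close> by simp
    qed
    then obtain m y where y: "y \<in> cocycles M m" "\<phi> [] z [] y \<noteq> 0"
      using nd zc unfolding homologically_nondegenerate_def by blast
    have yM: "y \<in> gr M m" "D y = 0" using y(1) by (auto simp: coc)
    have y_eq: "p y + D (h y) = y" using hD[of y] e_id[OF yM(1)] by (simp add: yM(2) h0)
    have "app F [] z [] y = app F [] z [] (p y) + app F [] z [] (D (h y))"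
      unfolding frm_add_right(1)[OF F(1), symmetric] y_eq ..
    also have "\<dots> = app \<Psi> [] z [] y"
      using form_of_coboundary[OF F Dz] by (simp add: \<Psi>(3) z(2))
    finally have "\<phi> [] z [] y = 0"
      using agree[OF M.homogI[OF zM] M.homogI[OF yM(1)]] z(3) by simp
    with y(2) show False by simp
  qed
  \<comment> \<open>Finite-dimensionality: the vectors \<open>p s\<close> with \<open>s\<close> in a finite set \<open>S\<close> span the image of \<open>p\<close> in degree \<open>n\<close>, and the functionals they represent have no common zero other than \<open>0\<close> in degree \<open>d - n\<close>.\<close>
  fix n \<xi> assume \<xi>: "homogeneous_map (scl V) (*) \<xi>" "arg p \<xi> = \<xi>" "\<And>m w. m \<noteq> d - n \<Longrightarrow> w \<in> gr V m \<Longrightarrow> \<xi> w = 0"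
  have \<xi>p: "\<xi> (p w) = \<xi> w" for w using fun_cong[OF \<xi>(2), of w] by (simp add: arg_def)
  from fin[of n] obtain S where S': "finite S \<and> S \<subseteq> cocycles M n \<and>
      (\<forall>X\<in>cohomology M n. X \<inter> module.span (scl M) S \<noteq> {})"
    unfolding finite_dim_cohomology_def by (rule exE)
  then have S: "finite S" "S \<subseteq> cocycles M n"
    "\<And>X. X \<in> cohomology M n \<Longrightarrow> X \<inter> module.span (scl M) S \<noteq> {}" by simp_all
  have SV: "s \<in> gr V n" if "s \<in> S" for s
  proof -
    have "s \<in> cocycles M n" using S(2) that ..
    then show ?thesis using V coc by simp
  qed
  have span: "z \<in> vs.span (p ` S)" if z: "z \<in> gr V n" "p z = z" for z
  proof -
    have zc: "z \<in> cocycles M n" using p(2)[OF z(1)] Dp[of z] z(2) by (simp add: coc)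
    then have "cohom_class M n z \<in> cohomology M n"
      unfolding cohomology_def cohom_class_def by (rule quotientI)
    from S(3)[OF this] obtain x where x: "x \<in> cohom_class M n z" "x \<in> vs.span S"
      unfolding scl_M by (auto simp only: ex_in_conv[symmetric] Int_iff)
    then obtain u where "u \<in> gr M (n - 1)" "x - z = act M [] u []"
      unfolding cohom_class_def cohom_rel_def by blast
    then have "x - z = D u" using act_D[OF M.homogI] by simp
    then have "p (x - z) = 0" by (simp add: pD)
    then have "p x = z" using z(2) by (simp add: p')
    interpret pm: module_hom "scl V" "scl V" p
      using p(1) vs.linear_self_iff[of p] by (simp add: Vector_Spaces.linear_def)
    have "p x \<in> vs.span (p ` S)" using x(2) unfolding pm.span_image by (rule imageI)
    then show ?thesis by (simp only: \<open>p x = z\<close>)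
  qed
  let ?X = "{w \<in> gr V (d - n). p w = w}"
  have X: "vs.subspace ?X" by (rule vs.subspaceI) (auto simp: p')
  have "\<exists>c. \<forall>x\<in>?X. \<xi> x = (\<Sum>s\<in>S. c s * app \<Psi> [] (p s) [] x)"
  proof (rule vs.functional_combination[OF S(1) X _ \<xi>(1)])
    show "homogeneous_map (scl V) (*) (app \<Psi> [] (p s) [])" for s by (rule frm_linear[OF \<Psi>(1)])
    fix w assume w: "w \<in> ?X" "\<And>s. s \<in> S \<Longrightarrow> app \<Psi> [] (p s) [] w = 0"
    have H0: "app \<Psi> [] z [] w = 0" if z: "z \<in> gr V n" "p z = z" for z
      using span[OF z]
    proof (induction rule: vs.span_induct_alt)
      case (step c x y)
      then show ?case using w(2) by (auto simp: trilinD(5)[OF frm_trilin[OF \<Psi>(1)]])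
    qed simp
    have "app \<Psi> [] w [] = 0"
    proof
      fix y
      have "app \<Psi> [] w [] y = 0"
      proof (rule additive_eqI[of "app \<Psi> [] w []" "\<lambda>y. 0"])
        fix k y assume y: "y \<in> gr V k"
        show "app \<Psi> [] w [] y = 0"
        proof (cases "k = n")
          case False
          then show ?thesis using frm_degree[OF \<Psi>(1), of w "d - n" y k "[]" "[]"] w(1) y by auto
        next
          case True
          have "app \<Psi> [] w [] y = app \<Psi> [] w [] (p y)" by (simp only: \<Psi>(3) pp)
          moreover have py: "p y \<in> gr V n" using p(2)[OF y] True V by blast
          moreover have "app (- \<Psi>) [] w [] (p y) = ksgn ((dg [] + (d - n)) * (dg [] + n)) (app \<Psi> [] (p y) [] w)"
            using flipD[OF \<Psi>(2)[unfolded skew_def], of w "d - n" "p y" n "[]" "[]"] w(1) py by blast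
          ultimately show ?thesis using H0[OF py pp] by simp
        qed
      qed (simp_all add: frm_add_right[OF \<Psi>(1)])
      then show "app \<Psi> [] w [] y = 0 y" by simp
    qed
    then have "w = 0" using inj[of w "d - n"] w(1) by blast
    then show "\<xi> w = 0" using homogeneous_mapD(3)[OF \<xi>(1)] by simp
  qed
  then obtain c where c: "\<And>x. x \<in> ?X \<Longrightarrow> \<xi> x = (\<Sum>s\<in>S. c s * app \<Psi> [] (p s) [] x)" by blast
  define z where "z = (\<Sum>s\<in>S. scl V (c s) (p s))"
  have pS: "p s \<in> gr V n" if "s \<in> S" for s using p(2)[OF SV[OF that]] V by blast
  have zV: "z \<in> gr V n" unfolding z_def using pS by (intro gr_sum gr_scale)
  have pz: "p z = z"
    unfolding z_def by (simp add: additive_sum[of p, OF p'(1)] p' pp)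
  have "app \<Psi> [] z [] = \<xi>"
  proof
    fix w
    show "app \<Psi> [] z [] w = \<xi> w"
    proof (rule additive_eqI[of "app \<Psi> [] z []" \<xi>])
      fix m w assume w: "w \<in> gr V m"
      show "app \<Psi> [] z [] w = \<xi> w"
      proof (cases "m = d - n")
        case False
        then show ?thesis using frm_degree[OF \<Psi>(1) zV w, of "[]" "[]"] \<xi>(3)[OF False w] by auto
      next
        case True
        then have pw: "p w \<in> ?X" using p(2)[OF w] V pp by blast
        have "app \<Psi> [] z [] w = app \<Psi> [] z [] (p w)" by (simp only: \<Psi>(3) pp)
        also have "\<dots> = (\<Sum>s\<in>S. c s * app \<Psi> [] (p s) [] (p w))"
          by (simp add: z_def app_sum sum_fun trilinD(5)[OF frm_trilin[OF \<Psi>(1)]])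
        also have "\<dots> = \<xi> (p w)" using c[OF pw] by simp
        finally show ?thesis by (simp add: \<xi>p)
      qed
    qed (simp_all add: frm_add_right[OF \<Psi>(1)] homogeneous_mapD[OF \<xi>(1)])
  qed
  with zV pz show "\<exists>z\<in>gr V n. p z = z \<and> app \<Psi> [] z [] = \<xi>" by blast
qed

end

context words
begin

lemma cyclic_image:
  assumes N: "represented A V (image_bimod V p b) p b" and p: "homogeneous_map (scl V) (scl V) p" "\<And>n v. v \<in> gr V n \<Longrightarrow> p v \<in> gr V n"
      "\<And>v. p (p v) = p v"
    and \<psi>: "homogeneous_map (scl V) fscale \<psi>0" "frm d (conc \<psi>0)" "skew (conc \<psi>0)" "variation d b (conc \<psi>0) = 0"
    and \<psi>p: "\<And>v w. \<psi>0 v (p w) = \<psi>0 v w"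
    and inj: "\<And>n z. z \<in> gr V n \<Longrightarrow> p z = z \<Longrightarrow> \<psi>0 z = 0 \<Longrightarrow> z = 0"
    and surj: "\<And>n \<xi>. homogeneous_map (scl V) (*) \<xi> \<Longrightarrow> arg p \<xi> = \<xi> \<Longrightarrow> (\<And>m w. m \<noteq> d - n \<Longrightarrow> w \<in> gr V m \<Longrightarrow> \<xi> w = 0)
        \<Longrightarrow> \<exists>z\<in>gr V n. p z = z \<and> \<psi>0 z = \<xi>"
  shows "cyclic_inner_product d A (image_bimod V p b)
    (\<lambda>as v bs w. if w \<in> homog (image_bimod V p b) then app (conc \<psi>0) as v bs w else 0)"
proof -
  let ?N = "image_bimod V p b"
  interpret N: represented A V ?N p b by (rule N)
  let ?\<psi> = "\<lambda>as v bs w. if w \<in> homog ?N then app (conc \<psi>0 :: ('a, 'c, 'c \<Rightarrow> 'k) tmap) as v bs w else 0"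
  note c = homogeneous_map_conc_apply(1)[OF \<psi>(1)]
  note \<psi>' = homogeneous_mapD[OF \<psi>(1)]
  have c0: "app (conc \<psi>0 :: ('a, 'c, 'c \<Rightarrow> 'k) tmap) [] v [] = \<psi>0 v" for v by (simp add: c)
  have hom: "bimod_hom A ?N (dual d A ?N) ?\<psi>" by (rule N.form_hom[OF \<psi>(2,4)])
  have lin: "homogeneous_map (scl V) (*) (\<psi>0 v)" for v
    using frm_linear[OF \<psi>(2), of "[]" v "[]"] by (simp add: c0)
  note lin' = homogeneous_mapD[OF lin]
  show ?thesis
    unfolding cyclic_inner_product_def
  proof (intro conjI allI ballI impI hom)
    show "?\<psi> as v bs = 0" if "(as, bs) \<noteq> ([], [])" for as v bs
      using that by (auto simp: c fun_eq_iff)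
    show "bij_betw (\<lambda>v. ?\<psi> [] v []) (gr ?N n) (gr (dual d A ?N) n)" for n
      unfolding bij_betw_def
    proof
      show "inj_on (\<lambda>v. ?\<psi> [] v []) (gr ?N n)"
      proof (rule inj_onI)
        fix x y assume x: "x \<in> gr ?N n" and y: "y \<in> gr ?N n" and eq: "?\<psi> [] x [] = ?\<psi> [] y []"
        have "\<psi>0 (x - y) = 0"
        proof
          fix w
          show "\<psi>0 (x - y) w = 0 w"
          proof (rule additive_eqI[of "\<psi>0 (x - y)" 0])
            fix m w assume "w \<in> gr V m"
            then have "p w \<in> gr ?N m" using p by simp
            then have "p w \<in> homog ?N" by blast
            then have "\<psi>0 x (p w) = \<psi>0 y (p w)" using fun_cong[OF eq, of "p w"] by (simp add: c0)
            then show "\<psi>0 (x - y) w = 0 w" by (simp add: \<psi>p \<psi>')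
          qed (simp_all add: lin')
        qed
        moreover have "x - y \<in> gr V n" "p (x - y) = x - y" using x y by (auto simp: homogeneous_mapD[OF p(1)])
        ultimately have "x - y = 0" by (intro inj[of "x - y" n])
        then show "x = y" by simp
      qed
      show "(\<lambda>v. ?\<psi> [] v []) ` gr ?N n = gr (dual d A ?N) n"
      proof
        show "(\<lambda>v. ?\<psi> [] v []) ` gr ?N n \<subseteq> gr (dual d A ?N) n"
        proof
          fix \<xi> assume "\<xi> \<in> (\<lambda>v. ?\<psi> [] v []) ` gr ?N n"
          then obtain v where v: "v \<in> gr ?N n" "\<xi> = ?\<psi> [] v []" by blast
          show "\<xi> \<in> gr (dual d A ?N) n"
          proof (cases "v = 0")
            case True
            then have "\<xi> = 0" unfolding v(2) by (simp add: fun_eq_iff)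
            then show ?thesis by (auto simp: gr_dual intro!: glinearI)
          next
            case False
            then have dv: "deg ?N v = n" by (rule N.deg_M[OF v(1)])
            have "has_degree A ?N (dual d A ?N) 0 ?\<psi>" using hom by (simp only: bimod_hom_def)
            note this[unfolded has_degree_def, THEN bspec, OF lists.Nil, THEN bspec, OF N.M.homogI[OF v(1)], THEN bspec, OF lists.Nil]
            then show ?thesis by (simp only: v(2) dv degs_Nil add_0 add_0_right)
          qed
        qed
        show "gr (dual d A ?N) n \<subseteq> (\<lambda>v. ?\<psi> [] v []) ` gr ?N n"
        proof
          fix \<xi> assume "\<xi> \<in> gr (dual d A ?N) n"
          then have \<xi>: "glinear ?N (*) \<xi>" "\<And>w. w \<notin> gr ?N (d - n) \<Longrightarrow> \<xi> w = 0" unfolding gr_dual by blast+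
          have pN: "p x \<in> gr ?N k" if "x \<in> gr V k" for x k using that p by simp
          have "glinear V (*) (\<lambda>w. \<xi> (p w))"
          proof (rule glinearI)
            fix k x assume x: "x \<in> gr V k"
            show "\<xi> (p (x + y)) = \<xi> (p x) + \<xi> (p y)" if y: "y \<in> gr V k" for y
              unfolding homogeneous_mapD(1)[OF p(1)] by (rule glinearD(1)[OF \<xi>(1) pN[OF x] pN[OF y]])
            show "\<xi> (p (scl V a x)) = a * \<xi> (p x)" for a
              unfolding homogeneous_mapD(2)[OF p(1)] using glinearD(2)[OF \<xi>(1) pN[OF x]] by simp
          qed
          note ext = extend[OF vector_space_field this]
          define \<xi>' where "\<xi>' = extend (\<lambda>w. \<xi> (p w))"
          have \<xi>': "homogeneous_map (scl V) (*) \<xi>'" "\<And>w k. w \<in> gr V k \<Longrightarrow> \<xi>' w = \<xi> (p w)"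
            unfolding \<xi>'_def using ext by blast+
          have "\<exists>z\<in>gr V n. p z = z \<and> \<psi>0 z = \<xi>'"
          proof (rule surj[OF \<xi>'(1)])
            show "arg p \<xi>' = \<xi>'"
            proof
              fix w
              show "arg p \<xi>' w = \<xi>' w"
                by (rule additive_eqI[of "arg p \<xi>'" \<xi>'])
                   (simp_all add: arg_def \<xi>'(2)[OF p(2)] \<xi>'(2) p(3) homogeneous_mapD[OF \<xi>'(1)] homogeneous_mapD[OF p(1)])
            qed
            show "\<xi>' w = 0" if "m \<noteq> d - n" "w \<in> gr V m" for m w
            proof (cases "p w \<in> gr ?N (d - n)")
              case True
              then have "p w = 0" using N.M.gr_disjoint[OF True pN[OF that(2)]] that(1) by simp
              then show ?thesis using N.M.glinear_zero[OF vector_space_field \<xi>(1)] by (simp add: \<xi>'(2)[OF that(2)])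
            qed (simp add: \<xi>'(2)[OF that(2)] \<xi>(2))
          qed
          then obtain z where z: "z \<in> gr V n" "p z = z" "\<psi>0 z = \<xi>'" by blast
          have "?\<psi> [] z [] = \<xi>"
          proof
            fix w
            show "?\<psi> [] z [] w = \<xi> w"
            proof (cases "w \<in> homog ?N")
              case True
              then obtain k where "w \<in> gr V k" "p w = w" by (auto simp: homog_def)
              then show ?thesis using True \<xi>'(2)[of w k] by (simp add: c0 z(3))
            next
              case False
              then have "w \<notin> gr ?N (d - n)" by blast
              then show ?thesis using False \<xi>(2) by simp
            qed
          qed
          then show "\<xi> \<in> (\<lambda>v. ?\<psi> [] v []) ` gr ?N n" using z by (intro image_eqI[of _ _ z]) auto
        qed
      qed
    qed
    fix v w assume v: "v \<in> homog ?N" and w: "w \<in> homog ?N"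
    obtain m n where m: "v \<in> gr ?N m" and n: "w \<in> gr ?N n" using v w by (auto simp: homog_def)
    have "- \<psi>0 v w = ksgn (m * n) (\<psi>0 w v)"
      using flipD[OF \<psi>(3)[unfolded skew_def], of v m w n "[]" "[]"] m n by (simp add: c0)
    then have "\<psi>0 v w = - ksgn (m * n) (\<psi>0 w v)" by (metis minus_minus)
    moreover have "ksgn (m * n) (\<psi>0 w v) = ksgn (deg ?N v * deg ?N w) (\<psi>0 w v)"
      using N.deg_M[OF m] N.deg_M[OF n] lin'(3) \<psi>'(3) by (cases "v = 0"; cases "w = 0") auto
    ultimately show "?\<psi> [] v [] w = - ksgn (deg ?N v * deg ?N w) (?\<psi> [] w [] v)"
      using v w by (simp add: c0)
  qed
qed

end

context represented
begin

text \<open>As \<open>\<psi>0\<close> is constant, each word is cut only once. The degree of the functional in the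
  sign of the dual homomorphism is determined by the total degree \<open>d\<close>, which leaves the sign
  in \<open>costar\<close>.\<close>

lemma pulled_back_form:
  assumes N: "represented A V N p b'" and Q: "mor 0 Q" "conc p \<odot> Q = Q"
    and \<psi>: "homogeneous_map (scl V) fscale \<psi>0" "frm d (conc \<psi>0)"
    and H: "as \<in> H" "bs \<in> H" and v: "v \<in> homog M"
  shows "(\<lambda>w. if w \<in> homog M then app (costar d A Q (conc \<psi>0 \<odot> Q)) as v bs w else 0)
    = hcomp (dual_hom d A M N (app Q))
        (hcomp (\<lambda>as v bs w. if w \<in> homog N then app (conc \<psi>0) as v bs w else 0) (app Q)) as v bs"
proof
  fix w
  interpret N: represented A V N p b' by (rule N)
  let ?\<psi> = "\<lambda>as v bs w. if w \<in> homog N then app (conc \<psi>0 :: ('a, 'c, 'c \<Rightarrow> 'k) tmap) as v bs w else 0"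
  note c = homogeneous_map_conc_apply(1)[OF \<psi>(1)]
  have c0: "app (conc \<psi>0 :: ('a, 'c, 'c \<Rightarrow> 'k) tmap) [] v [] = \<psi>0 v" for v by (simp add: c)
  have Qgr: "app Q x u y \<in> gr N (dg x + n + dg y)" if "u \<in> gr V n" for x u y n
    using N.e_gr[OF mor_degree[OF Q(1) that, of x y]] arg_cong[OF Q(2), of "\<lambda>F. app F x u y"]
    by (simp add: homogeneous_map_conc_apply(2)[OF N.e])
  obtain n where n: "v \<in> gr V n" using v gr_M by (auto simp: homog_def)
  have inner: "hcomp ?\<psi> (app Q) y v u = ?\<psi> [] (app Q y v u) []" for y u
  proof -
    have 0: "?\<psi> x z q = 0" if "x \<noteq> [] \<or> q \<noteq> []" for x z q using that by (auto simp: fun_eq_iff)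
    have "hcomp ?\<psi> (app Q) y v u = spl (\<lambda>x1 x2. spl (\<lambda>u1 u2. ?\<psi> x1 (app Q x2 v u1) u2) u) y"
      by (simp add: hcomp_def spl_def)
    also have "\<dots> = spl (\<lambda>u1 u2. ?\<psi> [] (app Q y v u1) u2) u"
      by (rule spl_eq_first) (auto intro!: spl_zeroI 0)
    also have "\<dots> = ?\<psi> [] (app Q y v u) []"
      by (rule spl_eq_last) (auto intro!: 0)
    finally show ?thesis .
  qed
  show "(if w \<in> homog M then app (costar d A Q (conc \<psi>0 \<odot> Q)) as v bs w else 0)
    = hcomp (dual_hom d A M N (app Q)) (hcomp ?\<psi> (app Q)) as v bs w"
  proof (cases "w \<in> homog M")
    case False
    then show ?thesis by (simp add: hcomp_def sum_fun dual_hom_def)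
  next
    case True
    then obtain m where m: "w \<in> gr M m" by (auto simp: homog_def)
    then have mV: "w \<in> gr V m" using gr_M by blast
    have "dual_hom d A M N (app Q) x (?\<psi> [] (app Q y v u) []) q w
        = ksgn ((d + 1) * dg x) (\<psi>0 (app Q y v u) (app Q q w x))" for x y u q
    proof -
      define \<xi> where "\<xi> = ?\<psi> [] (app Q y v u) []"
      have "app Q q w x \<in> homog N" using Qgr[OF mV] by blast
      then have \<xi>w: "\<xi> (app Q q w x) = \<psi>0 (app Q y v u) (app Q q w x)" by (simp add: \<xi>_def c0)
      show ?thesis
      proof (cases "\<psi>0 (app Q y v u) (app Q q w x) = 0")
        case True
        then show ?thesis using \<xi>w \<open>w \<in> homog M\<close> by (simp add: dual_hom_def \<xi>_def)
      next
        case False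
        then have ne: "\<xi> \<noteq> 0" using \<xi>w by auto
        let ?\<delta> = "dg y + n + dg u"
        have "\<xi> \<in> gr (dual d A N) ?\<delta>"
          unfolding gr_dual
        proof (intro CollectI conjI allI impI)
          show "glinear N (*) \<xi>"
            unfolding \<xi>_def c0
            using frm_add_right[OF \<psi>(2), of "[]" "app Q y v u" "[]"]
            by (intro glinearI) (auto simp: c0 N.scl_M dest: N.M.gr_scale[unfolded N.scl_M])
          show "\<xi> z = 0" if z: "z \<notin> gr N (d - ?\<delta>)" for z
          proof (cases "z \<in> homog N")
            case True
            then obtain k where k: "z \<in> gr N k" by (auto simp: homog_def)
            have "app Q y v u \<in> gr V ?\<delta>" using Qgr[OF n] N.gr_M by blast
            moreover have "?\<delta> + k \<noteq> d" using k z by auto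
            moreover have "z \<in> gr V k" using k N.gr_M by blast
            ultimately show ?thesis
              using frm_degree[OF \<psi>(2), of "app Q y v u" ?\<delta> z k "[]" "[]"] True by (simp add: \<xi>_def c0)
          qed (simp add: \<xi>_def)
        qed
        then have d1: "deg (dual d A N) \<xi> = ?\<delta>" using ne by (rule N.dual_degree)
        have "w \<noteq> 0" using False frm_add_right(2)[OF \<psi>(2), of "[]" "app Q y v u" "[]"] by (auto simp: c0)
        then have d2: "deg M w = m" by (rule deg_M[OF m])
        have "app Q y v u \<in> gr V ?\<delta>" "app Q q w x \<in> gr V (dg q + m + dg x)"
          using Qgr[OF n] Qgr[OF mV] N.gr_M by blast+
        then have "?\<delta> + (dg q + m + dg x) = d"
          using frm_degree[OF \<psi>(2), of "app Q y v u" ?\<delta> "app Q q w x" "dg q + m + dg x" "[]" "[]"] False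
          by (auto simp: c0)
        then have d: "d = ?\<delta> + dg q + m + dg x" by simp
        have "even (dg x * (?\<delta> + dg q + m) - (d + 1) * dg x)"
          unfolding d by (cases "even (dg x)"; cases "even (dg y)"; cases "even n"; cases "even (dg u)"; cases "even (dg q)"; simp)
        then have "ksgn (dg x * (?\<delta> + dg q + m)) (\<xi> (app Q q w x)) = ksgn ((d + 1) * dg x) (\<xi> (app Q q w x))"
          by (rule ksgn_cong) simp
        then show ?thesis
          using \<open>w \<in> homog M\<close> by (simp add: dual_hom_def \<xi>_def[symmetric] d1 d2 \<xi>w)
      qed
    qed
    then have "hcomp (dual_hom d A M N (app Q)) (hcomp ?\<psi> (app Q)) as v bs w
        = spl (\<lambda>x y. spl (\<lambda>u q. ksgn ((d + 1) * dg x) (\<psi>0 (app Q y v u) (app Q q w x))) bs) as"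
      unfolding hcomp_def[of "dual_hom d A M N (app Q)"] inner by (simp add: sum_fun spl_def)
    then show ?thesis
      using True by (simp add: app_costar homogeneous_map_conc_apply(2)[OF \<psi>(1)])
  qed
qed

text \<open>The form is pulled back to the minimal model along \<open>i\<close> and straightened by \<open>s = 1 + u\<close>.
  Requiring \<open>s\<close> to be a homomorphism determines the structure \<open>bD\<close> on the target of \<open>t = s\<^sup>-\<^sup>1\<close>;
  then \<open>k = i s\<close> and \<open>Q = t q\<close> are homomorphisms to and from \<open>M\<close> with \<open>Q k = p\<close>, and the inner
  product is the pullback of the given form along \<open>k\<close>. The resulting homotopy inner product
  is its pullback along \<open>Q\<close>.\<close>

theorem homotopy_inner_product_from_skew_form:
  assumes two: "(2 :: 'k) \<noteq> 0" and bim: "ainf_bimodule A M" and fin: "\<And>n. finite_dim_cohomology M n"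
    and \<phi>: "bimod_hom A M (dual d A M) \<phi>" and sk: "skew_symmetric A M \<phi>" and nd: "homologically_nondegenerate M \<phi>"
  shows "\<exists>\<phi>' N \<psi> g. scl N = scl M \<and> bimod_hom A M (dual d A M) \<phi>' \<and>
    ainf_bimodule A (N :: ('k, 'a, 'c) bimod) \<and> cyclic_inner_product d A N \<psi> \<and> quasi_iso A M N g \<and>
    (\<forall>as\<in>H. \<forall>v\<in>homog M. \<forall>bs\<in>H. \<phi>' as v bs = hcomp (dual_hom d A M N g) (hcomp \<psi> g) as v bs)"
proof -
  note MC = bimodule_equations(1)[OF bim] and dd = bimodule_equations(2)[OF bim]
  obtain F where F: "frm d F" "variation d b F = 0" "F \<odot> conc e = F" "conc (arg e) \<odot> F = F"
    and agree: "\<forall>as\<in>H. \<forall>bs\<in>H. \<forall>v\<in>homog M. \<forall>w\<in>homog M. app F as v bs w = \<phi> as v bs w"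
    using represent_form[OF \<phi>] by blast
  have skF: "skew F" by (rule represented_form_skew[OF F(1,3,4) _ sk]) (use agree in blast)
  obtain h p i q bH where h: "homogeneous_map (scl V) (scl V) h" and p: "homogeneous_map (scl V) (scl V) p"
    and hgr: "\<And>n v. v \<in> gr V n \<Longrightarrow> h v \<in> gr M (n - 1)" and pgr: "\<And>n v. v \<in> gr V n \<Longrightarrow> p v \<in> gr M n"
    and Dp: "\<And>v. D (p v) = 0" and pD: "\<And>v. p (D v) = 0" and pp: "\<And>v. p (p v) = p v" and pe: "\<And>v. p (e v) = p v"
    and hD: "\<And>v. h (D v) + D (h v) = e v - p v"
    and mor: "mor 0 i" "mor 0 q" "mor 1 bH" and ip: "i \<odot> conc p = i" and pq: "conc p \<odot> q = q" and qi: "q \<odot> i = conc p"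
    and bH: "conc p \<odot> bH = bH" "bH \<odot> conc p = bH"
    and van: "vanish 1 (i - conc p)" "vanish 1 (q - conc p)" "vanish 1 bH"
    and di: "del i + sgl A i \<odot> bH = b \<odot> i" and dq: "del q + sgl A q \<odot> b = bH \<odot> q"
    by (rule minimal_model[OF MC]; rule that; assumption)
  let ?P = "conc p :: ('a, 'c, 'c) tmap"
  have pgrV: "p v \<in> gr V n" if "v \<in> gr V n" for v n using pgr[OF that] gr_M by blast
  have mP: "mor 0 ?P" by (rule mor_conc[OF p]) (simp add: pgrV)
  \<comment> \<open>the form transferred to the minimal model\<close>
  define \<Phi> where "\<Phi> = costar d A i (F \<odot> i)"
  have Fi: "frm d (F \<odot> i)" using frm_comp[OF F(1) mor(1)] by simp
  have f\<Phi>: "frm d \<Phi>" unfolding \<Phi>_def using frm_costar[OF Fi mor(1)] by simp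
  have sk\<Phi>: "skew \<Phi>" unfolding \<Phi>_def by (rule skew_pullback[OF skF F(1) mor(1)])
  have \<Phi>p: "\<Phi> \<odot> ?P = \<Phi>" by (simp add: \<Phi>_def costar_comp[symmetric] tcomp_assoc ip)
  have \<Phi>p': "conc (arg p) \<odot> \<Phi> = \<Phi>" by (simp add: \<Phi>_def costar_tcomp_conc[OF p, symmetric] ip)
  have app_conc_p: "app ?P [] v [] = p v" for v by (simp add: homogeneous_map_conc_apply(1)[OF p])
  have i0: "app i [] v [] = p v" for v
  proof -
    have "app (i - ?P) [] v [] = 0" using van(1) by (simp only: vanish_def) simp
    then show ?thesis by (simp add: app_conc_p)
  qed
  have q0: "app q [] v [] = p v" for v
  proof -
    have "app (q - ?P) [] v [] = 0" using van(2) by (simp only: vanish_def) simp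
    then show ?thesis by (simp add: app_conc_p)
  qed
  have \<Phi>0: "app \<Phi> [] v [] w = app F [] (p v) [] (p w)" for v w
    by (simp add: \<Phi>_def app_costar app_tcomp i0)
  define \<psi>0 where "\<psi>0 = (\<lambda>v. app \<Phi> [] v [])"
  have agree0: "app F [] v [] w = \<phi> [] v [] w" if "v \<in> homog M" "w \<in> homog M" for v w
    using agree that by simp
  note pairing = perfect_pairing[OF hgr p pgr Dp pD pp hD homogeneous_mapD(3)[OF h] F(1,2) agree0 nd fin f\<Phi> sk\<Phi> \<Phi>0]
  have inj: "z = 0" if "z \<in> gr V n" "p z = z" "\<psi>0 z = 0" for n z
    by (rule pairing(1)) (use that in \<open>auto simp: \<psi>0_def\<close>)
  have surj: "\<exists>z\<in>gr V n. p z = z \<and> \<psi>0 z = \<xi>"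
    if "homogeneous_map (scl V) (*) \<xi>" "arg p \<xi> = \<xi>" "\<And>m w. m \<noteq> d - n \<Longrightarrow> w \<in> gr V m \<Longrightarrow> \<xi> w = 0" for n \<xi>
    unfolding \<psi>0_def by (rule pairing(2); (rule that | assumption)?)
  have "\<exists>u. mor 0 u \<and> vanish 1 u \<and> ?P \<odot> u = u \<and> u \<odot> ?P = u
    \<and> costar d A (tid + u) (\<Phi> \<odot> (tid + u)) = conc \<psi>0"
    unfolding \<psi>0_def
    by (rule straighten_skew_form[OF two p pgrV pp f\<Phi> sk\<Phi> \<Phi>p \<Phi>p']) (use inj surj in \<open>auto simp: \<psi>0_def\<close>)
  then obtain u where u: "mor 0 u" "vanish 1 u" "?P \<odot> u = u" "u \<odot> ?P = u"
    and straight: "costar d A (tid + u) (\<Phi> \<odot> (tid + u)) = conc \<psi>0" by blast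
  define s where "s = tid + u"
  have s: "mor 0 s" unfolding s_def using u(1) by blast
  have sP: "s \<odot> ?P = ?P \<odot> s" by (simp add: s_def tcomp_simps u)
  obtain t where t: "mor 0 t" "s \<odot> t = tid" "t \<odot> s = tid"
    using neumann_inverse[OF u(1,2)] by (auto simp: s_def)
  have tP: "t \<odot> ?P = ?P \<odot> t"
  proof -
    have "t \<odot> ?P = t \<odot> (?P \<odot> (s \<odot> t))" by (simp add: t)
    also have "\<dots> = t \<odot> ((s \<odot> ?P) \<odot> t)" by (simp add: sP tcomp_assoc)
    also have "\<dots> = ?P \<odot> t" by (simp add: tcomp_assoc tcomp_ext[OF t(3)])
    finally show ?thesis .
  qed
  have t0: "app t [] v [] = v" for v
  proof -
    have "app (s \<odot> t) [] v [] = v" by (simp add: t(2) tid_def app_conc)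
    moreover have "app u [] x [] = 0" for x using u(2) by (simp add: vanish_def)
    ultimately show ?thesis by (simp add: s_def tcomp_simps app_tcomp)
  qed
  note tcs = tcomp_ext[OF t(2)] tcomp_ext[OF t(3)] t(2,3)
  have \<sigma>st: "sgl A s \<odot> sgl A t = tid" "sgl A t \<odot> sgl A s = tid"
    using arg_cong[OF t(2), of "sgl A"] arg_cong[OF t(3), of "sgl A"] by (simp_all add: sgl_tcomp)
  have Ps: "sgl A ?P = ?P" "del ?P = 0" by simp_all
  \<comment> \<open>the structure on the minimal model in the new coordinates\<close>
  define bD where "bD = sgl A t \<odot> (bH \<odot> s - del s)"
  have ds: "del s = del u" by (simp add: s_def del_add)
  have mbD: "mor 1 bD"
    unfolding bD_def using mor_del[OF s] by (intro mor_tcomp_eq[OF mor_sgl[OF t(1)]] mor_diff mor_tcomp_eq[OF mor(3) s]) auto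
  have Pdu: "?P \<odot> del u = del u"
    using del_conc_tcomp[OF p u(1)] by (simp add: u)
  have duP: "del u \<odot> ?P = del u"
    using del_even[OF mor_nrm[OF u(1)] mP] by (simp add: u)
  have \<sigma>tP: "sgl A t \<odot> ?P = ?P \<odot> sgl A t"
    using arg_cong[OF tP, of "sgl A"] by (simp add: sgl_tcomp)
  have bDP: "bD \<odot> ?P = bD"
    by (simp add: bD_def tcomp_simps sP ds duP) (simp add: tcomp_assoc[symmetric] bH)
  have PbD: "?P \<odot> bD = bD"
  proof -
    have "?P \<odot> bD = sgl A t \<odot> (?P \<odot> (bH \<odot> s - del s))"
      by (simp add: bD_def tcomp_assoc[symmetric] \<sigma>tP)
    also have "?P \<odot> (bH \<odot> s - del s) = bH \<odot> s - del s"
      by (simp add: tcomp_diff_right tcomp_ext[OF bH(1)] ds Pdu)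
    finally show ?thesis by (simp add: bD_def)
  qed
  have bD0: "app bD [] v [] = 0" for v
  proof -
    have "vanish 1 bD"
      unfolding bD_def by (intro vanish_tcomp_right vanish_diff vanish_tcomp_left van(3) vanish_del)
    then show ?thesis by (simp add: vanish_def)
  qed
  define N where "N = image_bimod V p bD"
  have rN: "represented A V N p bD"
    unfolding N_def by (rule represented_image[OF p pgrV pp mbD bDP PbD])
  interpret N: represented A V N p bD by (rule rN)
  define k where "k = i \<odot> s"
  define Q where "Q = t \<odot> q"
  have mk: "mor 0 k" unfolding k_def by (rule mor_tcomp_eq[OF mor(1) s]) simp
  have mQ: "mor 0 Q" unfolding Q_def by (rule mor_tcomp_eq[OF t(1) mor(2)]) simp
  have kP: "k \<odot> ?P = k" by (simp add: k_def tcomp_assoc sP) (simp add: tcomp_assoc[symmetric] ip)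
  have PQ: "?P \<odot> Q = Q" by (simp add: Q_def tcomp_assoc[symmetric] tP[symmetric]) (simp add: tcomp_assoc pq)
  have Qk: "Q \<odot> k = ?P"
  proof -
    have "Q \<odot> k = t \<odot> ((q \<odot> i) \<odot> s)" by (simp add: Q_def k_def tcomp_assoc)
    also have "\<dots> = t \<odot> (s \<odot> ?P)" by (simp add: qi sP)
    finally show ?thesis by (simp add: tcs)
  qed
  have hom_k: "del k + sgl A k \<odot> bD = b \<odot> k"
  proof -
    have "del k = del i \<odot> s + sgl A i \<odot> del s"
      unfolding k_def by (rule del_even[OF mor_nrm[OF mor(1)] s]) simp
    moreover have "sgl A k \<odot> bD = sgl A i \<odot> (bH \<odot> s - del s)"
      unfolding k_def bD_def sgl_tcomp tcomp_assoc by (simp add: tcomp_ext[OF \<sigma>st(1)])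
    ultimately have "del k + sgl A k \<odot> bD = (del i + sgl A i \<odot> bH) \<odot> s"
      by (simp add: tcomp_simps)
    then show ?thesis by (simp add: di k_def tcomp_assoc)
  qed
  have hom_Q: "del Q + sgl A Q \<odot> b = bD \<odot> Q"
  proof -
    have "del (t \<odot> s) = del t \<odot> s + sgl A t \<odot> del s"
      by (rule del_even[OF mor_nrm[OF t(1)] s]) simp
    then have "(del t \<odot> s + sgl A t \<odot> del s) \<odot> t = 0" by (simp add: t)
    then have dt: "del t = - (sgl A t \<odot> (del s \<odot> t))"
      by (simp add: tcomp_simps tcs eq_neg_iff_add_eq_0)
    have "del Q = del t \<odot> q + sgl A t \<odot> del q"
      unfolding Q_def by (rule del_even[OF mor_nrm[OF t(1)] mor(2)]) simp
    then have "del Q + sgl A Q \<odot> b = del t \<odot> q + sgl A t \<odot> (del q + sgl A q \<odot> b)"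
      by (simp add: Q_def sgl_tcomp tcomp_simps)
    then show ?thesis
      unfolding dq dt by (simp add: bD_def Q_def tcomp_simps tcs)
  qed
  \<comment> \<open>The structure equation of \<open>bD\<close> follows from that of \<open>b\<close>, because \<open>Q\<close> is a left inverse of \<open>k\<close> on the image of \<open>p\<close>.\<close>
  have MC_D: "del bD + sgl A bD \<odot> bD = 0"
  proof -
    have ke: "k \<odot> conc e = k"
    proof -
      have "?P \<odot> conc e = ?P"
        by (rule tmap_eqI) (simp add: homogeneous_map_conc_apply(3)[OF e] homogeneous_map_conc_apply(1)[OF p] pe)
      then have "k \<odot> conc e = k \<odot> ?P" using kP by (metis tcomp_assoc)
      then show ?thesis by (simp add: kP)
    qed
    have ddk: "del (del k) = 0" by (rule del_del_mor[OF dd mk ke])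
    have d1: "del (sgl A k \<odot> bD) = k \<odot> del bD - sgl A (del k) \<odot> bD"
      by (rule del_odd[OF VV mor_trilin[OF mk] mbD]) simp
    have d2: "del (b \<odot> k) = del b \<odot> k + sgl A b \<odot> del k"
      by (rule del_even[OF mor_nrm[OF b] mk]) simp
    have db: "del b = - (sgl A b \<odot> b)" using MC by (simp add: add_eq_0_iff2)
    have dk: "del k = b \<odot> k - sgl A k \<odot> bD" using hom_k by (simp add: algebra_simps)
    have sdk: "sgl A (del k) = sgl A b \<odot> sgl A k - k \<odot> sgl A bD"
      unfolding dk by (simp add: ops_diff sgl_tcomp)
    have "del (del k) + del (sgl A k \<odot> bD) = del (b \<odot> k)"
      using hom_k by (simp only: del_add[symmetric])
    then have "k \<odot> del bD = del (b \<odot> k) + sgl A (del k) \<odot> bD"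
      by (simp add: ddk d1 algebra_simps)
    also have "\<dots> = - (k \<odot> (sgl A bD \<odot> bD))"
      unfolding d2 db sdk by (simp add: dk tcomp_simps)
    finally have "k \<odot> (del bD + sgl A bD \<odot> bD) = 0"
      by (simp add: tcomp_add_right)
    then have "?P \<odot> (del bD + sgl A bD \<odot> bD) = 0"
      unfolding Qk[symmetric] by (simp add: tcomp_assoc)
    moreover have "?P \<odot> del bD = del bD"
      using del_conc_tcomp[OF p mbD] by (simp add: PbD)
    moreover have "?P \<odot> sgl A bD = sgl A bD"
      using arg_cong[OF PbD, of "sgl A"] by (simp add: sgl_tcomp)
    ultimately show ?thesis by (simp add: tcomp_simps tcomp_ext)
  qed
  have bimN: "ainf_bimodule A N"
  proof (rule N.bimoduleI[OF MC_D])
    fix G :: "('a, 'c, 'k) tmap" assume G: "trilin (*) G" "G \<odot> conc p = G"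
    have "?P \<odot> conc e = ?P"
      by (rule tmap_eqI) (simp add: homogeneous_map_conc_apply(3)[OF e] homogeneous_map_conc_apply(1)[OF p] pe)
    then have "G \<odot> conc e = G" using G(2) by (metis tcomp_assoc)
    with G(1) show "del (del G) = 0" by (rule dd)
  qed
  have rM: "represented A V M e b" by unfold_locales
  have Qhom: "bimod_hom A M N (app Q)" by (rule bimod_homI[OF rM rN mQ PQ hom_Q])
  have Q0: "app Q [] v [] = p v" for v by (simp add: Q_def app_tcomp t0 q0)
  have qiso: "quasi_iso A M N (app Q)"
    unfolding N_def
    by (rule quasi_iso_image[OF hgr p pgr Dp pD pp hD homogeneous_mapD(3)[OF h] bD0 Qhom[unfolded N_def] Q0])
  \<comment> \<open>the inner product\<close>
  have \<psi>_eq: "conc \<psi>0 = costar d A k (F \<odot> k)"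
    unfolding straight[symmetric] s_def[symmetric]
    by (simp add: \<Phi>_def k_def costar_comp[symmetric] costar_tcomp[OF frm_comp[OF F(1) mor_tcomp_eq[OF mor(1) s refl] refl]] tcomp_assoc)
  have \<psi>lin: "homogeneous_map (scl V) fscale \<psi>0"
    unfolding \<psi>0_def by (rule trilinD(2)[OF frm_trilin[OF f\<Phi>]])
  have Fk: "frm d (F \<odot> k)" using frm_comp[OF F(1) mk] by simp
  have f\<psi>: "frm d (conc \<psi>0)" unfolding \<psi>_eq using frm_costar[OF Fk mk] by simp
  have sk\<psi>: "skew (conc \<psi>0)" unfolding \<psi>_eq by (rule skew_pullback[OF skF F(1) mk])
  have var\<psi>: "variation d bD (conc \<psi>0) = 0"
    unfolding \<psi>_eq variation_pullback[OF F(1) mk mbD b hom_k] F(2) by simp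
  have \<psi>p: "\<psi>0 v (p w) = \<psi>0 v w" for v w by (simp add: \<psi>0_def \<Phi>0 pp)
  have cyc: "cyclic_inner_product d A N (\<lambda>as v bs w. if w \<in> homog N then app (conc \<psi>0) as v bs w else 0)"
    unfolding N_def
    by (rule cyclic_image[OF rN[unfolded N_def] p pgrV pp \<psi>lin f\<psi> sk\<psi> var\<psi> \<psi>p inj surj])
  define \<phi>' where "\<phi>' = (\<lambda>as v bs w. if w \<in> homog M then app (costar d A Q (conc \<psi>0 \<odot> Q)) as v bs w else 0)"
  have "frm d (costar d A Q (conc \<psi>0 \<odot> Q))"
    using frm_costar[OF frm_comp[OF f\<psi> mQ refl] mQ] by simp
  moreover have "variation d b (costar d A Q (conc \<psi>0 \<odot> Q)) = 0"
    unfolding variation_pullback[OF f\<psi> mQ b mbD hom_Q] var\<psi> by simp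
  ultimately have hom': "bimod_hom A M (dual d A M) \<phi>'"
    unfolding \<phi>'_def by (rule form_hom)
  let ?\<psi> = "\<lambda>as v bs w. if w \<in> homog N then app (conc \<psi>0) as v bs w else 0"
  have eq: "\<phi>' as v bs = hcomp (dual_hom d A M N (app Q)) (hcomp ?\<psi> (app Q)) as v bs"
    if "as \<in> H" "v \<in> homog M" "bs \<in> H" for as v bs
    unfolding \<phi>'_def by (rule pulled_back_form[OF rN mQ PQ \<psi>lin f\<psi> that(1,3,2)])
  have sclN: "scl N = scl M" by (simp add: N_def scl_M)
  show ?thesis
    by (rule exI[of _ \<phi>'], rule exI[of _ N], rule exI[of _ ?\<psi>], rule exI[of _ "app Q"],
        rule conjI[OF sclN], rule conjI[OF hom'], rule conjI[OF bimN], rule conjI[OF cyc], rule conjI[OF qiso],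
        intro ballI, rule eq)
qed

end

section \<open>Transport along an embedding\<close>

lemma UN_singleton_image: "(\<Union>x\<in>A. {f x}) = f ` A"
  by (rule UNION_singleton_eq_range)

lemma bhat_hom:
  assumes "\<And>x y. h (x + y) = h x + h y"
  shows "h (bhat A M F as v bs) = bhat A M (\<lambda>as v bs. h (F as v bs)) as v bs"
proof -
  note h = additive_ksgn[of h, OF assms] additive_sum[of h, OF assms]
  show ?thesis
    unfolding bhat_def assms h mhat_hom[of h, OF assms] ..
qed

lemma hcomp_hom:
  assumes "\<And>x y. h (x + y) = h x + h y"
  shows "h (hcomp G f as v bs) = hcomp (\<lambda>as v bs. h (G as v bs)) f as v bs"
  unfolding hcomp_def by (simp add: additive_sum[of h, OF assms])

locale embedding = N: graded N
  for N :: "('k::field, 'a::ab_group_add, 'c::ab_group_add) bimod"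
    and A :: "('k, 'a) ainf" and sU :: "'k \<Rightarrow> 'd::ab_group_add \<Rightarrow> 'd" and j :: "'c \<Rightarrow> 'd" +
  assumes sU: "vector_space sU" and j: "homogeneous_map (scl N) sU j" and inj: "inj j"
begin

abbreviation (input) "r \<equiv> inv j"

lemma r_j [simp]: "r (j x) = x"
  using inj by simp

lemmas j' = homogeneous_mapD[OF j]

definition N' :: "('k, 'a, 'd) bimod" where
  "N' = \<lparr>scl = sU, gr = (\<lambda>n. j ` gr N n), act = (\<lambda>as u bs. j (act N as (r u) bs))\<rparr>"

lemma N'_simps [simp]: "scl N' = sU" "gr N' n = j ` gr N n" "act N' as u bs = j (act N as (r u) bs)"
  by (simp_all add: N'_def)

lemma homog_N' [simp]: "homog N' = j ` homog N"
  by (auto simp: homog_def)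

lemma j_mem [simp]: "j v \<in> j ` S \<longleftrightarrow> v \<in> S"
  using inj by (simp add: inj_image_mem_iff)

lemma deg_N' [simp]: "deg N' (j v) = deg N v"
  by (simp add: deg_def)

lemma graded_N': "graded_space N'"
  unfolding graded_space_def
proof (intro conjI allI impI ballI)
  interpret U: vector_space sU by (rule sU)
  show "vector_space (scl N')" using sU by simp
  show "module.subspace (scl N') (gr N' n)" for n
  proof (simp, rule U.subspaceI)
    show "0 \<in> j ` gr N n" using j_mem[of 0] by (simp add: j')
    show "x + y \<in> j ` gr N n" if "x \<in> j ` gr N n" "y \<in> j ` gr N n" for x y
      using that by (auto simp: j'(1)[symmetric])
    show "sU c x \<in> j ` gr N n" if "x \<in> j ` gr N n" for c x
      using that by (auto simp: j'(2)[symmetric])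
  qed
  fix I x n assume a: "finite I \<and> (\<forall>n\<in>I. x n \<in> gr N' n) \<and> sum x I = 0" and n: "n \<in> I"
  have x: "x m = j (r (x m))" "r (x m) \<in> gr N m" if "m \<in> I" for m using a that by auto
  have "j (\<Sum>m\<in>I. r (x m)) = (\<Sum>m\<in>I. j (r (x m)))" by (rule additive_sum) (rule j')
  also have "\<dots> = sum x I" by (rule sum.cong) (auto simp: x(1)[symmetric])
  also have "\<dots> = j 0" using a by (simp add: j')
  finally have "(\<Sum>m\<in>I. r (x m)) = 0" using inj by (simp add: inj_eq)
  then have "r (x n) = 0" using N.independent_sum[of I "\<lambda>m. r (x m)" n] a n x by blast
  then show "x n = 0" using x(1)[OF n] by (simp add: j')
qed

sublocale N': graded N' by unfold_locales (rule graded_N')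

lemma bhat_N': "bhat A N' F as (j v) bs = bhat A N (\<lambda>as v bs. F as (j v) bs) as v bs"
  by (simp add: bhat_def)

lemma glinear_N': "glinear N' sW h \<longleftrightarrow> glinear N sW (\<lambda>v. h (j v))"
  unfolding glinear_def by (auto simp: j'(1,2)[symmetric])

lemma trilinear_N': "trilinear A N' sW F \<longleftrightarrow> trilinear A N sW (\<lambda>as v bs. F as (j v) bs)"
  unfolding trilinear_def glinear_N' by auto

lemma glinear_post:
  "glinear W (scl N) f \<Longrightarrow> glinear W sU (\<lambda>x. j (f x))"
  by (auto simp: glinear_def j')

lemma trilinear_post:
  "trilinear A M (scl N) F \<Longrightarrow> trilinear A M sU (\<lambda>as v bs. j (F as v bs))"
  unfolding trilinear_def by (simp add: glinear_post)

lemma bimodule_N': assumes "ainf_bimodule A N" shows "ainf_bimodule A N'"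
  unfolding ainf_bimodule_def
proof (intro conjI allI impI ballI graded_N')
  show "trilinear A N' (scl N') (act N')"
    using assms trilinear_post[of N "act N"] by (simp add: trilinear_N' ainf_bimodule_def)
  show "has_degree A N' N' 1 (act N')"
    using assms by (auto simp: has_degree_def ainf_bimodule_def)
  fix F :: "'a list \<Rightarrow> 'd \<Rightarrow> 'a list \<Rightarrow> 'k" and as v bs
  assume F: "trilinear A N' (*) F" and a: "as \<in> lists (homog A)" "v \<in> homog N'" "bs \<in> lists (homog A)"
  obtain x where x: "v = j x" "x \<in> homog N" using a(2) by auto
  show "bhat A N' (bhat A N' F) as v bs = 0"
    using assms F a x(2) unfolding x(1) bhat_N' ainf_bimodule_def trilinear_N' by blast
qed

text \<open>Extension by zero off the range of \<open>j\<close>, matching the representation of functionals in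
  \<open>dual\<close>.\<close>

definition J :: "('c \<Rightarrow> 'k) \<Rightarrow> 'd \<Rightarrow> 'k" where
  "J \<xi> w = (if w \<in> range j then \<xi> (r w) else 0)"

lemma J_j [simp]: "J \<xi> (j w) = \<xi> w"
  by (simp add: J_def)

lemma J_add: "J (\<xi> + \<eta>) = J \<xi> + J \<eta>"
  by (simp add: fun_eq_iff J_def)

lemma J_gr [simp]: "J \<xi> \<in> gr (dual d A N') n \<longleftrightarrow> \<xi> \<in> gr (dual d A N) n"
proof -
  have "(\<forall>w. w \<notin> j ` gr N (d - n) \<longrightarrow> J \<xi> w = 0) \<longleftrightarrow> (\<forall>w. w \<notin> gr N (d - n) \<longrightarrow> \<xi> w = 0)"
  proof
    assume "\<forall>w. w \<notin> j ` gr N (d - n) \<longrightarrow> J \<xi> w = 0"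
    then show "\<forall>w. w \<notin> gr N (d - n) \<longrightarrow> \<xi> w = 0" using J_j j_mem by metis
  next
    assume a: "\<forall>w. w \<notin> gr N (d - n) \<longrightarrow> \<xi> w = 0"
    show "\<forall>w. w \<notin> j ` gr N (d - n) \<longrightarrow> J \<xi> w = 0"
    proof (intro allI impI)
      fix w assume "w \<notin> j ` gr N (d - n)"
      then show "J \<xi> w = 0" using a by (cases "w \<in> range j") (auto simp: J_def)
    qed
  qed
  then show ?thesis by (simp add: gr_dual glinear_N')
qed

lemma J_deg [simp]: "deg (dual d A N') (J \<xi>) = deg (dual d A N) \<xi>"
  by (simp add: deg_def)

lemma J_surj: "\<eta> \<in> gr (dual d A N') n \<Longrightarrow> \<eta> = J (\<lambda>w. \<eta> (j w))"
  by (auto simp: fun_eq_iff gr_dual J_def)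

lemma J_inj: "J \<xi> = J \<eta> \<Longrightarrow> \<xi> = \<eta>"
  using J_j by (metis ext)

lemma act_dual_N': "act (dual d A N') xs (J \<xi>) ys = J (act (dual d A N) xs \<xi> ys)"
  by (auto simp: fun_eq_iff act_dual J_def)

lemma cyclic_N':
  assumes "cyclic_inner_product d A N \<psi>"
  shows "cyclic_inner_product d A N' (\<lambda>as u bs. J (\<psi> as (r u) bs))"
proof -
  let ?\<psi> = "\<lambda>as u bs. J (\<psi> as (r u) bs)"
  note c = assms[unfolded cyclic_inner_product_def]
  note cyc = c[THEN conjunct1] c[THEN conjunct2, THEN conjunct1, rule_format]
    c[THEN conjunct2, THEN conjunct2, THEN conjunct1, rule_format]
    c[THEN conjunct2, THEN conjunct2, THEN conjunct2, rule_format]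
  have tri: "trilinear A N (\<lambda>c \<phi> w. c * \<phi> w) \<psi>" and deg: "has_degree A N (dual d A N) 0 \<psi>"
    and eq: "\<And>as v bs. as \<in> lists (homog A) \<Longrightarrow> v \<in> homog N \<Longrightarrow> bs \<in> lists (homog A) \<Longrightarrow>
      bhat A N \<psi> as v bs = hcomp (act (dual d A N)) \<psi> as v bs"
    using cyc(1) by (auto simp: bimod_hom_def)
  have post: "glinear W (\<lambda>c \<phi> w. c * \<phi> w) f \<Longrightarrow> glinear W (\<lambda>c \<phi> w. c * \<phi> w) (\<lambda>x. J (f x))" for W f
    unfolding glinear_def by (auto simp: fun_eq_iff J_def)
  show ?thesis
    unfolding cyclic_inner_product_def
  proof (intro conjI allI ballI impI)
    show "bimod_hom A N' (dual d A N') ?\<psi>"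
      unfolding bimod_hom_def
    proof (intro conjI ballI)
      show "trilinear A N' (scl (dual d A N')) ?\<psi>"
        using tri unfolding scl_dual trilinear_N' unfolding trilinear_def by (simp add: post)
      show "has_degree A N' (dual d A N') 0 ?\<psi>"
        using deg by (auto simp: has_degree_def)
      fix as v bs assume a: "as \<in> lists (homog A)" "v \<in> homog N'" "bs \<in> lists (homog A)"
      obtain x where x: "v = j x" "x \<in> homog N" using a(2) by auto
      have "bhat A N' ?\<psi> as v bs = J (bhat A N \<psi> as x bs)"
        unfolding x(1) bhat_N' bhat_hom[of J, OF J_add] by simp
      also have "\<dots> = J (hcomp (act (dual d A N)) \<psi> as x bs)" using eq[OF a(1) x(2) a(3)] by simp
      also have "\<dots> = hcomp (act (dual d A N')) ?\<psi> as v bs"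
        unfolding hcomp_hom[of J, OF J_add] by (simp add: hcomp_def act_dual_N' x(1))
      finally show "bhat A N' ?\<psi> as v bs = hcomp (act (dual d A N')) ?\<psi> as v bs" .
    qed
    show "?\<psi> as v bs = 0" if "as \<in> lists (homog A)" "v \<in> homog N'" "bs \<in> lists (homog A)" "(as, bs) \<noteq> ([], [])" for as v bs
    proof -
      have "r v \<in> homog N" using that(2) by auto
      then have "\<psi> as (r v) bs = 0" using cyc(2) that(1,3,4) by simp
      then show ?thesis by (simp add: fun_eq_iff J_def)
    qed
    show "bij_betw (\<lambda>v. ?\<psi> [] v []) (gr N' n) (gr (dual d A N') n)" for n
    proof -
      have b: "bij_betw (\<lambda>v. \<psi> [] v []) (gr N n) (gr (dual d A N) n)"
        by (rule cyc(3))
      have 1: "bij_betw r (gr N' n) (gr N n)"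
        by (rule bij_betw_byWitness[where f' = j]) auto
      have 2: "bij_betw J (gr (dual d A N) n) (gr (dual d A N') n)"
        unfolding bij_betw_def
      proof
        show "inj_on J (gr (dual d A N) n)" by (rule inj_onI) (rule J_inj)
        show "J ` gr (dual d A N) n = gr (dual d A N') n"
        proof
          show "gr (dual d A N') n \<subseteq> J ` gr (dual d A N) n"
          proof
            fix \<eta> assume \<eta>: "\<eta> \<in> gr (dual d A N') n"
            from J_surj[OF this] \<eta> show "\<eta> \<in> J ` gr (dual d A N) n" by (metis J_gr image_eqI)
          qed
        qed auto
      qed
      show ?thesis using bij_betw_trans[OF bij_betw_trans[OF 1 b] 2] by (simp add: comp_def)
    qed
    fix v w assume "v \<in> homog N'" "w \<in> homog N'"
    then obtain x y where "v = j x" "w = j y" "x \<in> homog N" "y \<in> homog N" by auto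
    then show "?\<psi> [] v [] w = - ksgn (deg N' v * deg N' w) (?\<psi> [] w [] v)"
      using cyc(4)[of x y] by simp
  qed
qed

lemma quasi_iso_N':
  assumes "quasi_iso A M N g"
  shows "quasi_iso A M N' (\<lambda>as v bs. j (g as v bs))"
proof -
  let ?g = "\<lambda>as v bs. j (g as v bs)"
  have hom: "bimod_hom A M N g" using assms by (simp add: quasi_iso_def)
  have "bimod_hom A M N' ?g"
    unfolding bimod_hom_def
  proof (intro conjI ballI)
    show "trilinear A M (scl N') ?g" using hom trilinear_post[of M g] by (simp add: bimod_hom_def)
    show "has_degree A M N' 0 ?g" using hom by (simp add: bimod_hom_def has_degree_def)
    fix as v bs assume a: "as \<in> lists (homog A)" "v \<in> homog M" "bs \<in> lists (homog A)"
    have "bhat A M ?g as v bs = j (bhat A M g as v bs)" by (rule bhat_hom[symmetric]) (rule j')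
    also have "\<dots> = j (hcomp (act N) g as v bs)" using hom a by (simp add: bimod_hom_def)
    also have "\<dots> = hcomp (act N') ?g as v bs"
      unfolding hcomp_hom[of j, OF j'(1)] by (simp add: hcomp_def)
    finally show "bhat A M ?g as v bs = hcomp (act N') ?g as v bs" .
  qed
  moreover have "bij_betw (\<lambda>X. \<Union>x\<in>X. cohom_class N' n (?g [] x [])) (cohomology M n) (cohomology N' n)" for n
  proof -
    have coc: "cocycles N' n = j ` cocycles N n"
    proof -
      have j0: "j x = 0 \<longleftrightarrow> x = 0" for x using inj_eq[OF inj, of x 0] by (simp only: j'(3))
      have mem: "j x \<in> cocycles N' n \<longleftrightarrow> x \<in> cocycles N n" for x
        by (simp add: cocycles_def j0)
      have "v \<in> j ` cocycles N n" if v: "v \<in> cocycles N' n" for v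
      proof -
        have "v \<in> j ` gr N n" using v by (simp add: cocycles_def)
        then obtain x where "v = j x" by (rule imageE)
        then show ?thesis using v mem by simp
      qed
      then show ?thesis using mem by (intro equalityI subsetI) auto
    qed
    have rel: "(j x, j y) \<in> cohom_rel N' n \<longleftrightarrow> (x, y) \<in> cohom_rel N n" for x y
      by (simp add: cohom_rel_def coc j'(5)[symmetric] inj_eq[OF inj])
    have ran: "v \<in> range j" if "(u, v) \<in> cohom_rel N' n" for u v
    proof -
      have "v \<in> cocycles N' n" using that unfolding cohom_rel_def by simp
      then obtain y where "v = j y" unfolding coc by (rule imageE)
      then show ?thesis by simp
    qed
    have cl: "cohom_class N' n (j x) = j ` cohom_class N n x" for x
    proof (rule equalityI; rule subsetI)
      fix v assume v: "v \<in> cohom_class N' n (j x)"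
      then have v': "(j x, v) \<in> cohom_rel N' n" by (simp add: cohom_class_def)
      from ran[OF v'] obtain y where y: "v = j y" by (rule rangeE)
      then have "y \<in> cohom_class N n x" using v' rel by (simp add: cohom_class_def)
      then show "v \<in> j ` cohom_class N n x" unfolding y by (rule imageI)
    next
      fix v assume "v \<in> j ` cohom_class N n x"
      then obtain y where y: "v = j y" "y \<in> cohom_class N n x" by (rule imageE)
      then show "v \<in> cohom_class N' n (j x)" using rel by (simp add: cohom_class_def)
    qed
    have coh: "cohomology X n = cohom_class X n ` cocycles X n" for X :: "('k, 'y, 'x::ab_group_add) bimod"
      unfolding cohomology_def quotient_def cohom_class_def by (rule UN_singleton_image)
    have H: "cohomology N' n = (`) j ` cohomology N n"
      unfolding coh coc image_image cl ..
    have 1: "bij_betw (\<lambda>X. \<Union>x\<in>X. cohom_class N n (g [] x [])) (cohomology M n) (cohomology N n)"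
      using assms by (simp add: quasi_iso_def)
    have 2: "bij_betw ((`) j) (cohomology N n) (cohomology N' n)"
      unfolding H using inj by (intro inj_on_imp_bij_betw inj_onI) (simp add: inj_image_eq_iff)
    show ?thesis using bij_betw_trans[OF 1 2] by (simp add: comp_def image_UN cl)
  qed
  ultimately show ?thesis unfolding quasi_iso_def by blast
qed

lemma pullback_N':
  "hcomp (dual_hom d A M N' (\<lambda>as v bs. j (g as v bs))) (hcomp (\<lambda>as u bs. J (\<psi> as (r u) bs)) (\<lambda>as v bs. j (g as v bs))) as v bs
   = hcomp (dual_hom d A M N g) (hcomp \<psi> g) as v bs"
proof -
  have 1: "hcomp (\<lambda>as u bs. J (\<psi> as (r u) bs)) (\<lambda>as v bs. j (g as v bs)) as v bs = J (hcomp \<psi> g as v bs)" for as v bs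
    unfolding hcomp_hom[of J, OF J_add] by (simp add: hcomp_def)
  have 2: "dual_hom d A M N' (\<lambda>as v bs. j (g as v bs)) xs (J \<xi>) ys = dual_hom d A M N g xs \<xi> ys" for xs \<xi> ys
    by (auto simp: dual_hom_def fun_eq_iff)
  show ?thesis unfolding hcomp_def[of "dual_hom _ _ _ _ _"] 1 2 ..
qed

lemma homotopy_inner_product_N':
  assumes "bimod_hom A M (dual d A M) \<phi>" "ainf_bimodule A N" "cyclic_inner_product d A N \<psi>" "quasi_iso A M N g"
    and "\<forall>as\<in>lists (homog A). \<forall>v\<in>homog M. \<forall>bs\<in>lists (homog A). \<phi> as v bs = hcomp (dual_hom d A M N g) (hcomp \<psi> g) as v bs"
  shows "homotopy_inner_product TYPE('d) d A M \<phi>"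
  unfolding homotopy_inner_product_def
  by (rule conjI[OF assms(1)], rule exI[of _ N'], rule exI[of _ "\<lambda>as u bs. J (\<psi> as (r u) bs)"],
      rule exI[of _ "\<lambda>as v bs. j (g as v bs)"], rule conjI[OF bimodule_N'[OF assms(2)]],
      rule conjI[OF cyclic_N'[OF assms(3)]], rule conjI[OF quasi_iso_N'[OF assms(4)]])
    (use assms(5) in \<open>simp only: pullback_N'\<close>)

end

section \<open>Homotopy inner products are skew and non-degenerate\<close>

lemma bimoduleD:
  assumes "ainf_bimodule A M"
  shows "graded_space M" "trilinear A M (scl M) (act M)" "has_degree A M M 1 (act M)"
proof -
  note M = assms[unfolded ainf_bimodule_def]
  show "graded_space M" by (rule M[THEN conjunct1])
  show "trilinear A M (scl M) (act M)" by (rule M[THEN conjunct2, THEN conjunct1])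
  show "has_degree A M M 1 (act M)" by (rule M[THEN conjunct2, THEN conjunct2, THEN conjunct1])
qed

lemma bimod_homD:
  assumes "bimod_hom A M N f"
  shows "trilinear A M (scl N) f" "has_degree A M N 0 f"
    "as \<in> lists (homog A) \<Longrightarrow> v \<in> homog M \<Longrightarrow> bs \<in> lists (homog A) \<Longrightarrow> bhat A M f as v bs = hcomp (act N) f as v bs"
proof -
  note f = assms[unfolded bimod_hom_def]
  show "trilinear A M (scl N) f" by (rule f[THEN conjunct1])
  show "has_degree A M N 0 f" by (rule f[THEN conjunct2, THEN conjunct1])
  show "as \<in> lists (homog A) \<Longrightarrow> v \<in> homog M \<Longrightarrow> bs \<in> lists (homog A) \<Longrightarrow> bhat A M f as v bs = hcomp (act N) f as v bs"
    by (rule f[THEN conjunct2, THEN conjunct2, rule_format])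
qed

lemma hom_constant_part:
  assumes "bimod_hom A M N f" "v \<in> homog M"
  shows "f [] (act M [] v []) [] = act N [] (f [] v []) []"
  using bimod_homD(3)[OF assms(1) _ assms(2), of "[]" "[]"] by (simp add: bhat_def hcomp_def)

locale bimodule = graded M
  for A :: "('k::field, 'a::ab_group_add) ainf" and M :: "('k, 'a, 'm::ab_group_add) bimod" +
  assumes bimodule: "ainf_bimodule A M"
begin

definition df :: "'m \<Rightarrow> 'm" where "df v = act M [] v []"

lemma df_glinear: "glinear M (scl M) df"
  unfolding df_def using trilinearD(1)[OF bimoduleD(2)[OF bimodule], of "[]" "[]"] by simp

lemma df_0 [simp]: "df 0 = 0"
  by (rule glinear_zero[OF vs.vector_space_axioms df_glinear])

lemma df_add: "v \<in> gr M n \<Longrightarrow> w \<in> gr M n \<Longrightarrow> df (v + w) = df v + df w"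
  and df_scale: "v \<in> gr M n \<Longrightarrow> df (scl M c v) = scl M c (df v)"
  using glinearD[OF df_glinear] by blast+

lemma df_minus: "v \<in> gr M n \<Longrightarrow> df (- v) = - df v"
  using df_add[of v n "- v"] gr_minus[of v n] by (simp add: eq_neg_iff_add_eq_0 add.commute)

lemma df_diff: "v \<in> gr M n \<Longrightarrow> w \<in> gr M n \<Longrightarrow> df (v - w) = df v - df w"
  using df_add[of v n "- w"] df_minus[of w n] gr_minus[of w n] by simp

lemma df_ksgn: "v \<in> gr M n \<Longrightarrow> df (ksgn s v) = ksgn s (df v)"
  by (simp add: ksgn_def df_minus)

lemma df_gr: "v \<in> gr M n \<Longrightarrow> df v \<in> gr M (n + 1)"
proof (cases "v = 0")
  case False
  assume v: "v \<in> gr M n"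
  have "act M [] v [] \<in> gr M (degs (susp A) [] + deg M v + degs (susp A) [] + 1)"
    by (rule bimoduleD(3)[OF bimodule, unfolded has_degree_def, rule_format]) (simp_all add: homogI[OF v])
  then show ?thesis using deg_eq[OF v False] by (simp add: df_def)
qed simp

lemma cocycles_iff: "v \<in> cocycles M n \<longleftrightarrow> v \<in> gr M n \<and> df v = 0"
  by (simp add: cocycles_def df_def)

lemma cohom_rel_iff: "(x, y) \<in> cohom_rel M n \<longleftrightarrow> x \<in> cocycles M n \<and> y \<in> cocycles M n \<and> (\<exists>u\<in>gr M (n - 1). y - x = df u)"
  by (simp add: cohom_rel_def df_def)

lemma cohom_rel_refl: "x \<in> cocycles M n \<Longrightarrow> (x, x) \<in> cohom_rel M n"
  unfolding cohom_rel_iff by (auto intro: bexI[of _ 0])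

lemma cohom_rel_sym: "(x, y) \<in> cohom_rel M n \<Longrightarrow> (y, x) \<in> cohom_rel M n"
proof -
  assume "(x, y) \<in> cohom_rel M n"
  then obtain u where u: "x \<in> cocycles M n" "y \<in> cocycles M n" "u \<in> gr M (n - 1)" "y - x = df u"
    unfolding cohom_rel_iff by blast
  have "x - y = df (- u)" unfolding df_minus[OF u(3)] u(4)[symmetric] by simp
  with gr_minus[OF u(3)] have "\<exists>u\<in>gr M (n - 1). x - y = df u" by (rule rev_bexI)
  with u(1,2) show ?thesis unfolding cohom_rel_iff by (intro conjI)
qed

lemma cohom_rel_trans: "(x, y) \<in> cohom_rel M n \<Longrightarrow> (y, z) \<in> cohom_rel M n \<Longrightarrow> (x, z) \<in> cohom_rel M n"
proof -
  assume "(x, y) \<in> cohom_rel M n" "(y, z) \<in> cohom_rel M n"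
  then obtain u u' where u: "x \<in> cocycles M n" "z \<in> cocycles M n" "u \<in> gr M (n - 1)" "y - x = df u"
    "u' \<in> gr M (n - 1)" "z - y = df u'"
    unfolding cohom_rel_iff by blast
  have "z - x = df (u + u')" unfolding df_add[OF u(3,5)] u(4)[symmetric] u(6)[symmetric] by simp
  with gr_add[OF u(3,5)] have "\<exists>u\<in>gr M (n - 1). z - x = df u" by (rule rev_bexI)
  with u(1,2) show ?thesis unfolding cohom_rel_iff by (intro conjI)
qed

lemma class_eq_iff:
  assumes "x \<in> cocycles M n"
  shows "cohom_class M n y = cohom_class M n x \<longleftrightarrow> (y, x) \<in> cohom_rel M n"
proof
  assume "cohom_class M n y = cohom_class M n x"
  then have "x \<in> cohom_class M n y" using cohom_rel_refl[OF assms] by (simp add: cohom_class_def)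
  then show "(y, x) \<in> cohom_rel M n" by (simp add: cohom_class_def)
next
  assume yx: "(y, x) \<in> cohom_rel M n"
  show "cohom_class M n y = cohom_class M n x"
    unfolding cohom_class_def
  proof (rule equalityI; rule subsetI)
    fix z assume "z \<in> cohom_rel M n `` {y}"
    then show "z \<in> cohom_rel M n `` {x}" using cohom_rel_trans[OF cohom_rel_sym[OF yx]] by simp
  next
    fix z assume "z \<in> cohom_rel M n `` {x}"
    then show "z \<in> cohom_rel M n `` {y}" using cohom_rel_trans[OF yx] by simp
  qed
qed

lemma cohomology_eq: "cohomology M n = cohom_class M n ` cocycles M n"
  unfolding cohomology_def quotient_def cohom_class_def by (rule UN_singleton_image)

lemma zero_cocycle: "0 \<in> cocycles M n"
  by (simp add: cocycles_iff)

end

locale quasi_isomorphism = C: bimodule A C + D: bimodule A D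
  for A :: "('k::field, 'a::ab_group_add) ainf" and C :: "('k, 'a, 'c::ab_group_add) bimod"
    and D :: "('k, 'a, 'd::ab_group_add) bimod" +
  fixes g :: "'a list \<Rightarrow> 'c \<Rightarrow> 'a list \<Rightarrow> 'd"
  assumes g: "quasi_iso A C D g"
begin

lemma hom: "bimod_hom A C D g"
  using g by (simp add: quasi_iso_def)

abbreviation g0 :: "'c \<Rightarrow> 'd" where "g0 v \<equiv> g [] v []"

lemma g_zero: "as \<in> lists (homog A) \<Longrightarrow> bs \<in> lists (homog A) \<Longrightarrow> g as 0 bs = 0"
  by (rule C.glinear_zero[OF D.vs.vector_space_axioms trilinearD(1)[OF bimod_homD(1)[OF hom]]])

lemma g_gr: "as \<in> lists (homog A) \<Longrightarrow> bs \<in> lists (homog A) \<Longrightarrow> v \<in> gr C n \<Longrightarrow>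
    g as v bs \<in> gr D (degs (susp A) as + n + degs (susp A) bs)"
proof (cases "v = 0")
  case False
  assume a: "as \<in> lists (homog A)" "bs \<in> lists (homog A)" and v: "v \<in> gr C n"
  have "g as v bs \<in> gr D (degs (susp A) as + deg C v + degs (susp A) bs + 0)"
    by (rule bimod_homD(2)[OF hom, unfolded has_degree_def, rule_format]) (use a C.homogI[OF v] in simp_all)
  then show ?thesis using C.deg_eq[OF v False] by simp
qed (simp add: g_zero)

lemma g0_gr: "v \<in> gr C n \<Longrightarrow> g0 v \<in> gr D n"
  using g_gr[of "[]" "[]" v n] by simp

lemma g0_diff: "v \<in> gr C n \<Longrightarrow> w \<in> gr C n \<Longrightarrow> g0 (v - w) = g0 v - g0 w"
proof -
  assume v: "v \<in> gr C n" and w: "w \<in> gr C n"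
  have l: "glinear C (scl D) g0" using trilinearD(1)[OF bimod_homD(1)[OF hom], of "[]" "[]"] by simp
  have "g0 ((v - w) + w) = g0 (v - w) + g0 w" by (rule glinearD(1)[OF l C.gr_diff[OF v w] w])
  then show ?thesis by simp
qed

lemma g0_df: "v \<in> gr C n \<Longrightarrow> g0 (C.df v) = D.df (g0 v)"
  unfolding C.df_def D.df_def by (rule hom_constant_part[OF hom C.homogI])

lemma g0_cocycle: "v \<in> cocycles C n \<Longrightarrow> g0 v \<in> cocycles D n"
proof -
  assume "v \<in> cocycles C n"
  then have v: "v \<in> gr C n" "C.df v = 0" by (simp_all add: C.cocycles_iff)
  have "D.df (g0 v) = 0" unfolding g0_df[OF v(1), symmetric] v(2) by (rule g_zero) simp_all
  with g0_gr[OF v(1)] show ?thesis by (simp add: D.cocycles_iff)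
qed

text \<open>Cohomologous representatives have cohomologous images, so the union is over copies of
  a single class.\<close>

lemma induced_class:
  assumes x: "x \<in> cocycles C n"
  shows "(\<Union>y\<in>cohom_class C n x. cohom_class D n (g0 y)) = cohom_class D n (g0 x)"
proof -
  have "cohom_class D n (g0 y) = cohom_class D n (g0 x)" if "y \<in> cohom_class C n x" for y
  proof -
    have "(x, y) \<in> cohom_rel C n" using that by (simp add: cohom_class_def)
    then obtain u where u: "y \<in> cocycles C n" "u \<in> gr C (n - 1)" "y - x = C.df u"
      unfolding C.cohom_rel_iff by blast
    have "g0 y - g0 x = g0 (y - x)"
      using x u(1) unfolding C.cocycles_iff by (intro g0_diff[symmetric, of _ n]) blast+
    also have "\<dots> = D.df (g0 u)" using g0_df[OF u(2)] u(3) by simp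
    finally have "(g0 x, g0 y) \<in> cohom_rel D n"
      unfolding D.cohom_rel_iff by (intro conjI g0_cocycle x u(1) rev_bexI[OF g0_gr[OF u(2)]])
    then show ?thesis unfolding D.class_eq_iff[OF g0_cocycle[OF x]] by (rule D.cohom_rel_sym)
  qed
  note const = this
  have "x \<in> cohom_class C n x" using C.cohom_rel_refl[OF x] by (simp add: cohom_class_def)
  then have "cohom_class C n x \<noteq> {}" by blast
  then show ?thesis by (rule SUP_eq_const) (rule const)
qed

lemma detects:
  assumes x: "x \<in> cocycles C n" and "u \<in> gr D (n - 1)" "g0 x = D.df u"
  shows "cohom_class C n x = cohom_class C n 0"
proof -
  have inj: "inj_on (\<lambda>X. \<Union>x\<in>X. cohom_class D n (g0 x)) (cohomology C n)"
    using g by (simp add: quasi_iso_def bij_betw_def)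
  have g00: "g0 0 = 0" by (rule g_zero) simp_all
  have "(0, g0 x) \<in> cohom_rel D n"
    unfolding D.cohom_rel_iff
    by (intro conjI D.zero_cocycle g0_cocycle x rev_bexI[OF assms(2)]) (simp add: assms(3))
  then have "cohom_class D n (g0 x) = cohom_class D n (g0 0)"
    unfolding g00 D.class_eq_iff[OF D.zero_cocycle] by (rule D.cohom_rel_sym)
  then have "(\<Union>y\<in>cohom_class C n x. cohom_class D n (g0 y)) = (\<Union>y\<in>cohom_class C n 0. cohom_class D n (g0 y))"
    by (simp only: induced_class[OF x] induced_class[OF C.zero_cocycle])
  then show ?thesis
    by (rule inj_onD[OF inj]) (simp_all add: C.cohomology_eq x C.zero_cocycle)
qed

lemma hits:
  assumes y: "y \<in> cocycles D n"
  obtains x u where "x \<in> cocycles C n" "u \<in> gr D (n - 1)" "y = g0 x + D.df u"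
proof -
  have onto: "(\<lambda>X. \<Union>x\<in>X. cohom_class D n (g0 x)) ` cohomology C n = cohomology D n"
    using g by (simp add: quasi_iso_def bij_betw_def)
  have "cohom_class D n y \<in> (\<lambda>X. \<Union>x\<in>X. cohom_class D n (g0 x)) ` cohomology C n"
    unfolding onto D.cohomology_eq by (rule imageI[OF y])
  then obtain X where X: "cohom_class D n y = (\<Union>x\<in>X. cohom_class D n (g0 x))" "X \<in> cohomology C n"
    by (rule imageE)
  obtain x where x: "X = cohom_class C n x" "x \<in> cocycles C n"
    using X(2) unfolding C.cohomology_eq by (rule imageE)
  have "cohom_class D n (g0 x) = cohom_class D n y"
    using X(1) unfolding x(1) induced_class[OF x(2)] by (rule sym)
  then have "(g0 x, y) \<in> cohom_rel D n" unfolding D.class_eq_iff[OF y] .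
  then obtain u where u: "u \<in> gr D (n - 1)" "y - g0 x = D.df u" unfolding D.cohom_rel_iff by blast
  show thesis by (rule that[OF x(2) u(1)]) (simp add: u(2)[symmetric])
qed

end

locale pulled_back_inner_product = quasi_isomorphism A C D g
  for A :: "('k::field, 'a::ab_group_add) ainf" and C :: "('k, 'a, 'c::ab_group_add) bimod"
    and D :: "('k, 'a, 'd::ab_group_add) bimod" and g +
  fixes d :: int and \<psi> :: "'a list \<Rightarrow> 'd \<Rightarrow> 'a list \<Rightarrow> 'd \<Rightarrow> 'k" and \<phi> :: "'a list \<Rightarrow> 'c \<Rightarrow> 'a list \<Rightarrow> 'c \<Rightarrow> 'k"
  assumes cyc: "cyclic_inner_product d A D \<psi>" and hom\<phi>: "bimod_hom A C (dual d A C) \<phi>"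
    and \<phi>: "\<And>as v bs. as \<in> lists (homog A) \<Longrightarrow> v \<in> homog C \<Longrightarrow> bs \<in> lists (homog A) \<Longrightarrow>
      \<phi> as v bs = hcomp (dual_hom d A C D g) (hcomp \<psi> g) as v bs"
begin

abbreviation "dg \<equiv> degs (susp A)"
abbreviation "H \<equiv> lists (homog A)"
abbreviation B :: "'d \<Rightarrow> 'd \<Rightarrow> 'k" where "B v w \<equiv> \<psi> [] v [] w"

lemmas c = cyc[unfolded cyclic_inner_product_def]
lemmas \<psi>_hom = c[THEN conjunct1]
lemmas \<psi>_zero = c[THEN conjunct2, THEN conjunct1, rule_format]
lemmas \<psi>_bij = c[THEN conjunct2, THEN conjunct2, THEN conjunct1, rule_format]
lemmas \<psi>_skew = c[THEN conjunct2, THEN conjunct2, THEN conjunct2, rule_format]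

lemma B_gr: "v \<in> gr D n \<Longrightarrow> B v \<in> gr (dual d A D) n"
  using \<psi>_bij[of n] by (auto simp: bij_betw_def)

lemma B_linear: "v \<in> gr D n \<Longrightarrow> glinear D (*) (B v)"
  and B_zero_outside: "v \<in> gr D n \<Longrightarrow> w \<notin> gr D (d - n) \<Longrightarrow> B v w = 0"
  using B_gr[of v n] by (auto simp: gr_dual)

lemma B_degree: "v \<in> gr D n \<Longrightarrow> w \<in> gr D m \<Longrightarrow> n + m \<noteq> d \<Longrightarrow> B v w = 0"
proof -
  assume v: "v \<in> gr D n" and w: "w \<in> gr D m" and ne: "n + m \<noteq> d"
  show "B v w = 0"
  proof (cases "w \<in> gr D (d - n)")
    case True
    then have "w = 0" using D.gr_disjoint[OF True w] ne by auto
    then show ?thesis using D.glinear_zero[OF vector_space_field B_linear[OF v]] by simp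
  qed (rule B_zero_outside[OF v])
qed

lemma B_zero [simp]: "v \<in> gr D n \<Longrightarrow> B v 0 = 0"
  by (rule D.glinear_zero[OF vector_space_field B_linear])

lemma B_zero_left [simp]: "B 0 w = 0"
proof -
  have "glinear D (\<lambda>c \<phi> w. c * \<phi> w) (\<lambda>v. \<psi> [] v [])"
    using trilinearD(1)[OF bimod_homD(1)[OF \<psi>_hom], of "[]" "[]"] by simp
  from D.glinear_zero[OF vector_space_functions this] show ?thesis by simp
qed

lemma B_skew: "v \<in> gr D n \<Longrightarrow> w \<in> gr D m \<Longrightarrow> B v w = - ksgn (n * m) (B w v)"
proof (cases "v = 0 \<or> w = 0")
  case True
  assume "v \<in> gr D n" "w \<in> gr D m"
  with True show ?thesis by auto
next
  case False
  assume v: "v \<in> gr D n" and w: "w \<in> gr D m"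
  have "B v w = - ksgn (deg D v * deg D w) (B w v)" by (rule \<psi>_skew) (use v w in auto)
  then show ?thesis using D.deg_eq[OF v] D.deg_eq[OF w] False by simp
qed

lemma dual_degree_D: "\<xi> \<in> gr (dual d A D) n \<Longrightarrow> \<xi> \<noteq> 0 \<Longrightarrow> deg (dual d A D) \<xi> = n"
proof -
  assume \<xi>: "\<xi> \<in> gr (dual d A D) n" and "\<xi> \<noteq> 0"
  then obtain w where w: "\<xi> w \<noteq> 0" by (auto simp: fun_eq_iff)
  have "m = n" if m: "\<xi> \<in> gr (dual d A D) m" for m
  proof (rule ccontr)
    assume "m \<noteq> n"
    moreover have "w \<in> gr D (d - n)" "w \<in> gr D (d - m)" using w \<xi> m unfolding gr_dual by blast+
    ultimately have "w = 0" using D.gr_disjoint[of w "d - n" "d - m"] by simp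
    moreover have "\<xi> 0 = 0" using \<xi> D.glinear_zero[OF vector_space_field, of \<xi>] by (simp add: gr_dual)
    ultimately show False using w by simp
  qed
  with \<xi> show ?thesis unfolding deg_def by (rule the_equality)
qed

text \<open>As \<open>\<psi>\<close> is concentrated in the empty words, each word is shared out between the two
  copies of \<open>g\<close>. The total degree \<open>d\<close> of \<open>\<psi>\<close> reduces the sign of the dual homomorphism to one of
  the right word of the second copy.\<close>

lemma expand:
  assumes H: "as \<in> H" "bs \<in> H" and v: "v \<in> gr C n" and w: "w \<in> gr C m"
  shows "\<phi> as v bs w = spl (\<lambda>x y. spl (\<lambda>u q. ksgn ((d + 1) * dg x) (B (g y v u) (g q w x))) bs) as"
proof -
  have inner: "hcomp \<psi> g y v u = \<psi> [] (g y v u) []" if h: "y \<in> H" "u \<in> H" for y u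
  proof -
    have 0: "\<psi> x (g x2 v u1) q = 0" if "x \<noteq> [] \<or> q \<noteq> []" "x \<in> H" "x2 \<in> H" "u1 \<in> H" "q \<in> H" for x x2 u1 q
      using \<psi>_zero[OF that(2) _ that(5)] D.homogI[OF g_gr[OF that(3,4) v]] that(1) by simp
    have "hcomp \<psi> g y v u = spl (\<lambda>x1 x2. spl (\<lambda>u1 u2. \<psi> x1 (g x2 v u1) u2) u) y"
      by (simp add: hcomp_def spl_def)
    also have "\<dots> = spl (\<lambda>u1 u2. \<psi> [] (g y v u1) u2) u"
    proof (rule spl_eq_first, rule spl_zeroI)
      fix x x2 u1 q assume "x @ x2 = y" "x \<noteq> []" "u1 @ q = u"
      then show "\<psi> x (g x2 v u1) q = 0" using h by (intro 0) auto
    qed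
    also have "\<dots> = \<psi> [] (g y v u) []"
    proof (rule spl_eq_last)
      fix u1 q assume "u1 @ q = u" "q \<noteq> []"
      then show "\<psi> [] (g y v u1) q = 0" using h by (intro 0) auto
    qed
    finally show ?thesis .
  qed
  have summand: "dual_hom d A C D g x (hcomp \<psi> g y v u) q w = ksgn ((d + 1) * dg x) (B (g y v u) (g q w x))"
    if "x \<in> H" "y \<in> H" "u \<in> H" "q \<in> H" for x y u q
  proof -
    let ?a = "g y v u" and ?b = "g q w x"
    have a: "?a \<in> gr D (dg y + n + dg u)" by (rule g_gr[OF that(2,3) v])
    have b: "?b \<in> gr D (dg q + m + dg x)" by (rule g_gr[OF that(4,1) w])
    show ?thesis
    proof (cases "B ?a ?b = 0")
      case True
      then show ?thesis using C.homogI[OF w] by (simp add: dual_hom_def inner[OF that(2,3)])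
    next
      case False
      then have "\<psi> [] ?a [] \<noteq> 0" by auto
      then have d1: "deg (dual d A D) (\<psi> [] ?a []) = dg y + n + dg u"
        by (rule dual_degree_D[OF B_gr[OF a]])
      have "w \<noteq> 0" using False g_zero[OF that(4,1)] B_zero[OF a] by auto
      then have d2: "deg C w = m" by (rule C.deg_eq[OF w])
      have "dg y + n + dg u + (dg q + m + dg x) = d" using B_degree[OF a b] False by blast
      then have d: "d = dg y + n + dg u + dg q + m + dg x" by simp
      have "even (dg x * (dg y + n + dg u + dg q + m) - (d + 1) * dg x)"
        unfolding d by (cases "even (dg x)"; cases "even (dg y)"; cases "even n"; cases "even (dg u)"; cases "even (dg q)"; simp)
      then have "ksgn (dg x * (dg y + n + dg u + dg q + m)) (B ?a ?b) = ksgn ((d + 1) * dg x) (B ?a ?b)"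
        by (rule ksgn_cong) simp
      then show ?thesis
        using C.homogI[OF w] by (simp add: dual_hom_def inner[OF that(2,3)] d1 d2)
    qed
  qed
  have "\<phi> as v bs w = spl (\<lambda>x y. spl (\<lambda>u q. dual_hom d A C D g x (hcomp \<psi> g y v u) q w) bs) as"
    unfolding \<phi>[OF H(1) C.homogI[OF v] H(2)] by (simp add: hcomp_def[of "dual_hom _ _ _ _ _"] sum_fun spl_def)
  also have "\<dots> = spl (\<lambda>x y. spl (\<lambda>u q. ksgn ((d + 1) * dg x) (B (g y v u) (g q w x))) bs) as"
    using H by (intro spl_cong summand) auto
  finally show ?thesis .
qed

text \<open>Interchanging the arguments of \<open>\<phi>\<close> interchanges the two copies of \<open>g\<close> in its expansion.\<close>

lemma skew: "skew_symmetric A C \<phi>"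
  unfolding skew_symmetric_def
proof (intro ballI)
  fix as bs v w assume H: "as \<in> H" "bs \<in> H" and hv: "v \<in> homog C" and hw: "w \<in> homog C"
  obtain n m where v: "v \<in> gr C n" and w: "w \<in> gr C m" using hv hw by (auto simp: homog_def)
  let ?s = "(dg as + n) * (dg bs + m)"
  have "\<phi> as v bs w = spl (\<lambda>x y. spl (\<lambda>u q. - ksgn ?s (ksgn ((d + 1) * dg u) (B (g q w x) (g y v u)))) bs) as"
    unfolding expand[OF H v w]
  proof (intro spl_cong)
    fix x y u q assume xy: "x @ y = as" and uq: "u @ q = bs"
    then have h: "x \<in> H" "y \<in> H" "u \<in> H" "q \<in> H" using H by auto
    let ?a = "g y v u" and ?b = "g q w x"
    have a: "?a \<in> gr D (dg y + n + dg u)" by (rule g_gr[OF h(2,3) v])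
    have b: "?b \<in> gr D (dg q + m + dg x)" by (rule g_gr[OF h(4,1) w])
    show "ksgn ((d + 1) * dg x) (B ?a ?b) = - ksgn ?s (ksgn ((d + 1) * dg u) (B ?b ?a))"
    proof (cases "dg y + n + dg u + (dg q + m + dg x) = d")
      case False
      then show ?thesis using B_degree[OF a b] B_degree[OF b a] by (simp add: add.commute)
    next
      case True
      then have d: "d = dg y + n + dg u + dg q + m + dg x" by simp
      have "even ((d + 1) * dg x + (dg y + n + dg u) * (dg q + m + dg x) - (?s + (d + 1) * dg u))"
        unfolding d xy[symmetric] uq[symmetric] degs_append
        by (cases "even (dg x)"; cases "even (dg y)"; cases "even n"; cases "even (dg u)"; cases "even (dg q)"; simp)
      then have "ksgn ((d + 1) * dg x + (dg y + n + dg u) * (dg q + m + dg x)) (B ?b ?a) = ksgn (?s + (d + 1) * dg u) (B ?b ?a)"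
        by (rule ksgn_cong) simp
      then show ?thesis unfolding B_skew[OF a b] by simp
    qed
  qed
  also have "\<dots> = spl (\<lambda>u q. spl (\<lambda>x y. - ksgn ?s (ksgn ((d + 1) * dg u) (B (g q w x) (g y v u)))) as) bs"
    by (rule spl_swap)
  also have "\<dots> = - ksgn ?s (\<phi> bs w as v)"
    unfolding expand[OF H(2,1) w v] by (simp add: spl_minus spl_ksgn del: ksgn_ksgn)
  finally have *: "\<phi> as v bs w = - ksgn ?s (\<phi> bs w as v)" .
  have "\<phi> bs w as v = 0" if "v = 0 \<or> w = 0"
    unfolding expand[OF H(2,1) w v]
  proof (intro spl_zeroI)
    fix x y u q assume "x @ y = bs" "u @ q = as"
    then have h: "x \<in> H" "y \<in> H" "u \<in> H" "q \<in> H" using H by auto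
    show "ksgn ((d + 1) * dg x) (B (g y w u) (g q v x)) = 0"
      using that g_zero[OF h(2,3)] g_zero[OF h(4,1)] B_zero[OF g_gr[OF h(2,3) w]] by auto
  qed
  then show "\<phi> as v bs w = - ksgn ((dg as + deg C v) * (dg bs + deg C w)) (\<phi> bs w as v)"
    using * C.deg_eq[OF v] C.deg_eq[OF w] by (cases "v = 0 \<or> w = 0") auto
qed

lemma \<phi>0: "v \<in> gr C n \<Longrightarrow> w \<in> gr C m \<Longrightarrow> \<phi> [] v [] w = B (g0 v) (g0 w)"
  using expand[of "[]" "[]" v n w m] by simp

lemma B_df: "v \<in> gr D n \<Longrightarrow> w \<in> gr D m \<Longrightarrow> B (D.df v) w = - ksgn n (B v (D.df w))"
proof -
  assume v: "v \<in> gr D n" and w: "w \<in> gr D m"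
  have "B (D.df v) w = act (dual d A D) [] (\<psi> [] v []) [] w"
    unfolding D.df_def using fun_cong[OF hom_constant_part[OF \<psi>_hom D.homogI[OF v]], of w] .
  also have "\<dots> = ksgn (1 + deg (dual d A D) (\<psi> [] v [])) (B v (D.df w))"
    using D.homogI[OF w] by (simp add: act_dual D.df_def)
  also have "\<dots> = - ksgn n (B v (D.df w))"
  proof (cases "\<psi> [] v [] = 0")
    case False
    then show ?thesis using dual_degree_D[OF B_gr[OF v]] by (simp add: ksgn_def)
  qed simp
  finally show ?thesis .
qed

text \<open>The pairing with a cocycle that is orthogonal to all cocycles factors through the
  differential. Because \<open>\<psi>\<close> maps onto the dual, the resulting functional is represented by an
  element, whose differential is the cocycle up to sign.\<close>

lemma coboundary_if_orthogonal:
  assumes x: "x \<in> cocycles D n" and orth: "\<And>y. y \<in> cocycles D (d - n) \<Longrightarrow> B x y = 0"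
  shows "\<exists>u\<in>gr D (n - 1). x = D.df u"
proof -
  have xg: "x \<in> gr D n" and dx: "D.df x = 0" using x by (auto simp: D.cocycles_iff)
  let ?U = "gr D (d - n)" and ?m = "d - n + 1"
  have W: "D.vs.subspace (D.df ` ?U)"
  proof (rule D.vs.subspaceI)
    show "0 \<in> D.df ` ?U" using D.df_0 by (metis D.gr_zero imageI)
    show "a + b \<in> D.df ` ?U" if "a \<in> D.df ` ?U" "b \<in> D.df ` ?U" for a b
      using that by (auto simp: D.df_add[symmetric] intro!: imageI)
    show "scl D c a \<in> D.df ` ?U" if "a \<in> D.df ` ?U" for c a
      using that by (auto simp: D.df_scale[symmetric] intro!: imageI)
  qed
  obtain \<pi> where \<pi>: "homogeneous_map (scl D) (scl D) \<pi>" "range \<pi> \<subseteq> D.df ` ?U" "\<forall>v\<in>D.df ` ?U. \<pi> v = v"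
    using D.vs.projection_onto[OF W] by blast
  note \<pi>' = homogeneous_mapD[OF \<pi>(1)]
  \<comment> \<open>a preimage, under the differential, of the projection of \<open>y\<close> onto the coboundaries\<close>
  define pick where "pick y = (SOME w. w \<in> ?U \<and> D.df w = \<pi> y)" for y
  have pick: "pick y \<in> ?U" "D.df (pick y) = \<pi> y" for y
  proof -
    have "\<pi> y \<in> D.df ` ?U" using \<pi>(2) by blast
    then have "\<exists>w. w \<in> ?U \<and> D.df w = \<pi> y" by auto
    from someI_ex[OF this] show "pick y \<in> ?U" "D.df (pick y) = \<pi> y" by (simp_all add: pick_def)
  qed
  note Bl = glinearD[OF B_linear[OF xg]]
  have well: "B x w = B x w'" if "w \<in> ?U" "w' \<in> ?U" "D.df w = D.df w'" for w w'
  proof -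
    have "w - w' \<in> cocycles D (d - n)"
      using that D.df_diff[OF that(1,2)] by (auto simp: D.cocycles_iff)
    then have "B x (w - w') = 0" by (rule orth)
    then have "B x ((w - w') + w') = B x w'" using Bl(1)[OF D.gr_diff[OF that(1,2)] that(2)] by simp
    then show ?thesis by simp
  qed
  \<comment> \<open>\<open>\<xi> (D y) = \<langle>x, y\<rangle>\<close>, extended to all of degree \<open>d - n + 1\<close>\<close>
  define \<xi> where "\<xi> y = (if y \<in> gr D ?m then B x (pick y) else 0)" for y
  have \<xi>g: "\<xi> \<in> gr (dual d A D) (n - 1)"
    unfolding gr_dual
  proof (intro CollectI conjI allI impI)
    show "\<xi> w = 0" if "w \<notin> gr D (d - (n - 1))" for w
      using that by (simp add: \<xi>_def algebra_simps)
    have add: "\<xi> (a + b) = \<xi> a + \<xi> b" if "a \<in> gr D ?m" "b \<in> gr D ?m" for a b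
    proof -
      have "B x (pick (a + b)) = B x (pick a + pick b)"
        by (rule well) (auto simp: pick D.df_add[OF pick(1) pick(1)] \<pi>' intro: D.gr_add pick(1))
      also have "\<dots> = B x (pick a) + B x (pick b)" by (rule Bl(1)) (rule pick(1))+
      finally show ?thesis using that D.gr_add[OF that] by (simp add: \<xi>_def)
    qed
    have scale: "\<xi> (scl D c a) = c * \<xi> a" if "a \<in> gr D ?m" for a c
    proof -
      have "B x (pick (scl D c a)) = B x (scl D c (pick a))"
        by (rule well) (auto simp: pick D.df_scale[OF pick(1)] \<pi>' intro: D.gr_scale pick(1))
      also have "\<dots> = c * B x (pick a)" by (rule Bl(2)) (rule pick(1))
      finally show ?thesis using that D.gr_scale[OF that] by (simp add: \<xi>_def)
    qed
    have \<xi>0: "\<xi> 0 = 0" using scale[of 0 0] by simp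
    have other: "\<xi> a = 0" if "a \<in> gr D k" "k \<noteq> ?m" for a k
    proof (cases "a \<in> gr D ?m")
      case True
      then have "a = 0" using D.gr_disjoint[OF that(1) True] that(2) by blast
      then show ?thesis by (simp add: \<xi>0)
    qed (simp add: \<xi>_def)
    show "glinear D (*) \<xi>"
    proof (rule glinearI)
      show "\<xi> (a + b) = \<xi> a + \<xi> b" if "a \<in> gr D k" "b \<in> gr D k" for k a b
        using that add[of a b] other[of a k] other[of b k] other[OF D.gr_add[OF that]] by (cases "k = ?m") auto
      show "\<xi> (scl D c a) = c * \<xi> a" if "a \<in> gr D k" for k c a
        using that scale[of a c] other[of a k] other[OF D.gr_scale[OF that], of c] by (cases "k = ?m") auto
    qed
  qed
  then obtain u where u: "u \<in> gr D (n - 1)" "\<psi> [] u [] = \<xi>"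
    using \<psi>_bij[of "n - 1"] unfolding bij_betw_def by (metis imageE)
  have du: "D.df u \<in> gr D n" using D.df_gr[OF u(1)] by simp
  have "\<psi> [] (ksgn n (D.df u)) [] = \<psi> [] x []"
  proof
    fix w
    show "B (ksgn n (D.df u)) w = B x w"
    proof (cases "w \<in> ?U")
      case False
      then show ?thesis using B_zero_outside[OF xg False] B_zero_outside[OF D.gr_ksgn[OF du] False] by simp
    next
      case True
      have dw: "D.df w \<in> gr D ?m" by (rule D.df_gr[OF True])
      have "\<xi> (D.df w) = B x w"
        using dw \<pi>(3) True by (auto simp: \<xi>_def pick intro!: well)
      moreover have "B (D.df (ksgn n u)) w = - ksgn (n - 1) (B (ksgn n u) (D.df w))"
        by (rule B_df[OF D.gr_ksgn[OF u(1)] True])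
      moreover have "B (ksgn n u) (D.df w) = ksgn n (B u (D.df w))"
      proof -
        have l: "glinear D (\<lambda>c \<phi> w. c * \<phi> w) (\<lambda>v. \<psi> [] v [])"
          using trilinearD(1)[OF bimod_homD(1)[OF \<psi>_hom], of "[]" "[]"] by simp
        have "\<psi> [] (u + - u) [] = \<psi> [] u [] + \<psi> [] (- u) []" by (rule glinearD(1)[OF l u(1) D.gr_minus[OF u(1)]])
        then have "B (- u) (D.df w) = - B u (D.df w)"
          using B_zero_left by (simp add: fun_eq_iff eq_neg_iff_add_eq_0 add.commute)
        then show ?thesis by (simp add: ksgn_def)
      qed
      ultimately show ?thesis using u(2) D.df_ksgn[OF u(1)] by (auto simp: ksgn_def split: if_splits)
    qed
  qed
  moreover have "inj_on (\<lambda>v. \<psi> [] v []) (gr D n)" using \<psi>_bij[of n] by (simp add: bij_betw_def)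
  ultimately have "ksgn n (D.df u) = x" using xg D.gr_ksgn[OF du] by (auto dest: inj_onD)
  then have "x = D.df (ksgn n u)" using D.df_ksgn[OF u(1)] by simp
  then show ?thesis using D.gr_ksgn[OF u(1)] by blast
qed

text \<open>If \<open>a\<close> is not a coboundary then neither is its image, which therefore pairs
  non-trivially with some cocycle of \<open>D\<close>. Up to a coboundary, which pairs to \<open>0\<close> with cocycles,
  this cocycle comes from \<open>C\<close>.\<close>

lemma nondegenerate: "homologically_nondegenerate C \<phi>"
  unfolding homologically_nondegenerate_def
proof (intro allI ballI impI)
  fix n a assume a: "a \<in> cocycles C n" and ne: "cohom_class C n a \<noteq> cohom_class C n 0"
  have ag: "a \<in> gr C n" using a by (simp add: C.cocycles_iff)
  have "\<not> (\<exists>u\<in>gr D (n - 1). g0 a = D.df u)" using detects[OF a] ne by blast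
  then obtain y where y: "y \<in> cocycles D (d - n)" "B (g0 a) y \<noteq> 0"
    using coboundary_if_orthogonal[OF g0_cocycle[OF a]] by blast
  obtain b u where b: "b \<in> cocycles C (d - n)" and u: "u \<in> gr D (d - n - 1)" "y = g0 b + D.df u"
    using hits[OF y(1)] by blast
  have bg: "b \<in> gr C (d - n)" using b by (simp add: C.cocycles_iff)
  have gb: "g0 b \<in> gr D (d - n)" by (rule g0_gr[OF bg])
  have du: "D.df u \<in> gr D (d - n)" using D.df_gr[OF u(1)] by simp
  have "D.df (g0 a) = 0" using g0_cocycle[OF a] by (simp add: D.cocycles_iff)
  then have "B (g0 a) (D.df u) = 0" using B_df[OF g0_gr[OF ag] u(1)] by simp
  moreover have "B (g0 a) y = B (g0 a) (g0 b) + B (g0 a) (D.df u)"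
    unfolding u(2) by (rule glinearD(1)[OF B_linear[OF g0_gr[OF ag]] gb du])
  ultimately have "\<phi> [] a [] b \<noteq> 0" using y(2) \<phi>0[OF ag bg] by simp
  then show "\<exists>m. \<exists>b\<in>cocycles C m. \<phi> [] a [] b \<noteq> 0" using b by blast
qed

end

theorem theorem4p1:
  fixes A :: "('k::field_char_0, 'a::ab_group_add) ainf"
    and C :: "('k, 'a, 'c::ab_group_add) bimod"
    and d :: int
    and scaleU :: "'k \<Rightarrow> 'd::ab_group_add \<Rightarrow> 'd"
    and j :: "'c \<Rightarrow> 'd"
  assumes "ainf_algebra A"
    and "ainf_bimodule A C"
    and "\<forall>n. finite_dim_cohomology C n"
    and "Vector_Spaces.linear (scl C) scaleU j" and "inj j"
  shows "(\<exists>\<phi>'. homotopy_inner_product TYPE('d) d A C \<phi>') \<longleftrightarrow>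
         (\<exists>\<phi>. bimod_hom A C (dual d A C) \<phi> \<and> skew_symmetric A C \<phi> \<and>
              homologically_nondegenerate C \<phi>)"
proof
  assume "\<exists>\<phi>'. homotopy_inner_product TYPE('d) d A C \<phi>'"
  then obtain \<phi> where *: "homotopy_inner_product TYPE('d) d A C \<phi>" ..
  note h = *[unfolded homotopy_inner_product_def]
  have \<phi>: "bimod_hom A C (dual d A C) \<phi>" by (rule conjunct1[OF h])
  obtain D :: "('k, 'a, 'd) bimod" and \<psi> g where Dg: "ainf_bimodule A D \<and> cyclic_inner_product d A D \<psi> \<and> quasi_iso A C D g \<and>
      (\<forall>as\<in>lists (homog A). \<forall>v\<in>homog C. \<forall>bs\<in>lists (homog A).
         \<phi> as v bs = hcomp (dual_hom d A C D g) (hcomp \<psi> g) as v bs)"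
    using conjunct2[OF h] by (elim exE)
  note D = Dg[THEN conjunct1] and cyc = Dg[THEN conjunct2, THEN conjunct1]
    and g = Dg[THEN conjunct2, THEN conjunct2, THEN conjunct1]
    and eq = Dg[THEN conjunct2, THEN conjunct2, THEN conjunct2, rule_format]
  have gC: "graded_space C" and gD: "graded_space D" by (rule bimoduleD(1), rule assms(2) D)+
  interpret pulled_back_inner_product A C D g d \<psi> \<phi>
    by unfold_locales (rule gC gD assms(2) D g cyc \<phi> eq; assumption)+
  show "\<exists>\<phi>. bimod_hom A C (dual d A C) \<phi> \<and> skew_symmetric A C \<phi> \<and> homologically_nondegenerate C \<phi>"
    by (intro exI[of _ \<phi>] conjI hom\<phi> skew nondegenerate)
next
  assume "\<exists>\<phi>. bimod_hom A C (dual d A C) \<phi> \<and> skew_symmetric A C \<phi> \<and> homologically_nondegenerate C \<phi>"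
  then obtain \<phi> where \<phi>: "bimod_hom A C (dual d A C) \<phi>" "skew_symmetric A C \<phi>" "homologically_nondegenerate C \<phi>"
    by (elim exE conjE)
  have C: "graded_space C" by (rule bimoduleD(1)[OF assms(2)])
  \<comment> \<open>linear maps are extended from homogeneous elements, so these have to span\<close>
  obtain V :: "('k, 'c) gspace" and e where V: "spanning V" "scl V = scl C" "homogeneous_map (scl C) (scl C) e"
    "\<forall>n. gr C n \<subseteq> gr V n \<and> (\<forall>v\<in>gr V n. e v \<in> gr C n) \<and> (\<forall>v\<in>gr C n. e v = v)"
    using spanning_enlargement[OF C] by (elim exE conjE)
  interpret V: spanning V by (rule V(1))
  have A: "graded_space A" using assms(1) unfolding ainf_algebra_def by (rule conjunct1)
  interpret words A V by (unfold_locales) (rule A assms(1))+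
  have e: "homogeneous_map (scl V) (scl V) e" unfolding V(2) by (rule V(3))
  interpret sub: submodule A V C e
  proof
    show "graded_space C" "scl C = scl V" "homogeneous_map (scl V) (scl V) e" by (rule C V(2)[symmetric] e)+
    show "gr C n \<subseteq> gr V n" for n using V(4) by blast
    show "v \<in> gr V n \<Longrightarrow> e v \<in> gr C n" for v n using V(4) by blast
    show "v \<in> gr C n \<Longrightarrow> e v = v" for v n using V(4) by blast
  qed
  have tri: "trilinear A C (scl V) (act C)" unfolding V(2) by (rule bimoduleD(2)[OF assms(2)])
  obtain b where b: "mor 1 b" "b \<odot> conc e = b" "conc e \<odot> b = b"
    and act: "\<forall>as\<in>lists (homog A). \<forall>bs\<in>lists (homog A). \<forall>v\<in>homog C. app b as v bs = act C as v bs"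
    using sub.represent_mor[OF tri bimoduleD(3)[OF assms(2)]] by (elim exE conjE)
  interpret rep: represented A V C e b
    by unfold_locales (rule b act[rule_format, symmetric]; assumption)+
  have "(2 :: 'k) \<noteq> 0" by simp
  from rep.homotopy_inner_product_from_skew_form[OF this assms(2) assms(3)[rule_format] \<phi>]
  obtain \<phi>' and N :: "('k, 'a, 'c) bimod" and \<psi> g where N: "scl N = scl C" "bimod_hom A C (dual d A C) \<phi>'"
    "ainf_bimodule A N" "cyclic_inner_product d A N \<psi>" "quasi_iso A C N g"
    "\<forall>as\<in>lists (homog A). \<forall>v\<in>homog C. \<forall>bs\<in>lists (homog A).
       \<phi>' as v bs = hcomp (dual_hom d A C N g) (hcomp \<psi> g) as v bs"
    by (elim exE conjE)
  have vs: "vector_space (scl C)" "vector_space scaleU"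
    using assms(4) by (simp_all add: Vector_Spaces.linear_def)
  \<comment> \<open>the model \<open>N\<close> found on the type of \<open>C\<close> is moved along \<open>j\<close>\<close>
  interpret U: vector_space scaleU by (rule vs(2))
  interpret embedding N A scaleU j
  proof
    show "graded_space N" by (rule bimoduleD(1)[OF N(3)])
    show "homogeneous_map (scl N) scaleU j"
      using assms(4) unfolding N(1) linear_iff_homogeneous_map[OF vs] .
    show "inj j" by (rule assms(5))
  qed
  have "homotopy_inner_product TYPE('d) d A C \<phi>'"
    by (rule homotopy_inner_product_N'[OF N(2-6)])
  then show "\<exists>\<phi>'. homotopy_inner_product TYPE('d) d A C \<phi>'" by - (rule exI[where x = \<phi>'], assumption)
qed

end
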